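(* Let $R$ be a ring and let $A=R[x]/(f(x))$ be a monogenic rank-$4$ $R$-algebra, where $f(x)=x^4-s_1x^3+s_2x^2-s_3x+s_4\in R[x]$. Then $\mathrm{D}_4$-closure data for $A$ over $R$ correspond to roots in $R$ of $f$'s cubic resolvent $$m(y)=y^3-s_2y^2+(s_1s_3-4s_4)y-(s_1^2s_4-4s_2s_4+s_3^2).$$
   Context: All rings and algebras are commutative with 1. $\mathrm{D}_4=\langle(13),(1234)\rangle\subset\mathrm{S}_4$. A monogenic $R$-algebra of rank $4$ is one isomorphic to $R[x]/(f(x))$ with $f$ monic of degree $4$. $A^{\otimes 4}$ is the $4$-fold tensor power over $R$; for $a\in A$, $a^{(i)}\in A^{\otimes 4}$ is the pure tensor with $a$ in position $i$ and $1$ elsewhere. $\mathrm{S}_4$ acts on $A^{\otimes 4}$ by the $R$-algebra automorphisms with $\sigma\cdot a^{(i)}=a^{(\sigma(i))}$; $(A^{\otimes 4})^{\mathrm{D}_4}$ is the subalgebra of $\mathrm{D}_4$-invariants. $e_k(a)\in(A^{\otimes 4})^{\mathrm{S}_4}$ is the $k$-th elementary symmetric polynomial in $a^{(1)},\dots,a^{(4)}$, and $s_k(a)\in R$ is defined by the characteristic polynomial of multiplication by $a$ on $A$: $\lambda^4-s_1(a)\lambda^3+s_2(a)\lambda^2-s_3(a)\lambda+s_4(a)$. A $\mathrm{D}_4$-closure datum for $A$ over $R$ is an $R$-algebra homomorphism $\varphi:(A^{\otimes 4})^{\mathrm{D}_4}\to R$ with $\varphi(e_k(a))=s_k(a)$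 for all $a\in A$, $1\le k\le 4$. *)

theory Defs
  imports "HOL-Algebra.UnivPoly" "HOL-Algebra.QuotRing" "HOL-Algebra.Sym_Groups" "HOL-Algebra.Generated_Groups"
begin

section \<open>Quotients of algebras\<close>

text \<open>
  The quotient ring \<open>M Quot I\<close> of an \<open>R\<close>-algebra by an ideal, together with the induced scalar
  multiplication \<open>r \<odot> (I +> x) = I +> (r \<odot> x)\<close>, written over representatives in the style of
  \<^const>\<open>rcoset_mult\<close>.
\<close>

definition algebra_Quot ::
    "('r, 'a, 'm) module_scheme \<Rightarrow> 'a set \<Rightarrow> ('r, 'a set) module" where
  "algebra_Quot M I =
    \<lparr>carrier = carrier (M Quot I), monoid.mult = monoid.mult (M Quot I), one = one (M Quot I),
     zero = zero (M Quot I), add = add (M Quot I),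
     smult = (\<lambda>r X. \<Union>x\<in>X. I +>\<^bsub>M\<^esub> (r \<odot>\<^bsub>M\<^esub> x))\<rparr>"


section \<open>Tensor powers of an algebra\<close>

text \<open>
  Pure tensors \<open>a\<^sub>1 \<otimes> \<dots> \<otimes> a\<^sub>n\<close> are indexed by families \<open>a \<in> tuples A n\<close>.  The tensor power of
  \<open>A\<close> over \<open>R\<close> is constructed as the free \<open>R\<close>-module on these families modulo the relations of
  multilinearity.  The componentwise product of families makes the free module an \<open>R\<close>-algebra
  (a monoid algebra).  The product of a family with a multilinearity relation is again such a
  relation, so the ideal generated by the relations is also the submodule generated by them.
\<close>

definition tuples :: "('a, 'm) ring_scheme \<Rightarrow> nat \<Rightarrow> (nat \<Rightarrow> 'a) set" where
  "tuples A n = ({1..n} \<rightarrow>\<^sub>E carrier A)"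

definition free_algebra ::
    "('r, 'k) ring_scheme \<Rightarrow> ('a, 'm) ring_scheme \<Rightarrow> nat \<Rightarrow>
      ('r, (nat \<Rightarrow> 'a) \<Rightarrow> 'r) module" where
  "free_algebra R A n =
    \<lparr>carrier = {F. range F \<subseteq> carrier R \<and> finite {a. F a \<noteq> \<zero>\<^bsub>R\<^esub>} \<and>
                   {a. F a \<noteq> \<zero>\<^bsub>R\<^esub>} \<subseteq> tuples A n},
     monoid.mult = (\<lambda>F G c. \<Oplus>\<^bsub>R\<^esub>p \<in> {(a, b). F a \<noteq> \<zero>\<^bsub>R\<^esub> \<and> G b \<noteq> \<zero>\<^bsub>R\<^esub> \<and>
                        (\<lambda>i\<in>{1..n}. a i \<otimes>\<^bsub>A\<^esub> b i) = c}. F (fst p) \<otimes>\<^bsub>R\<^esub> G (snd p)),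
     one = (\<lambda>a. if a = (\<lambda>i\<in>{1..n}. \<one>\<^bsub>A\<^esub>) then \<one>\<^bsub>R\<^esub> else \<zero>\<^bsub>R\<^esub>),
     zero = (\<lambda>a. \<zero>\<^bsub>R\<^esub>),
     add = (\<lambda>F G a. F a \<oplus>\<^bsub>R\<^esub> G a),
     smult = (\<lambda>r F a. r \<otimes>\<^bsub>R\<^esub> F a)\<rparr>"

definition free_gen :: "('r, 'k) ring_scheme \<Rightarrow> (nat \<Rightarrow> 'a) \<Rightarrow> (nat \<Rightarrow> 'a) \<Rightarrow> 'r" where
  "free_gen R a = (\<lambda>b. if b = a then \<one>\<^bsub>R\<^esub> else \<zero>\<^bsub>R\<^esub>)"

definition multilinear_rels ::
    "('r, 'k) ring_scheme \<Rightarrow> ('r, 'a, 'm) module_scheme \<Rightarrow> nat \<Rightarrow>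
      ((nat \<Rightarrow> 'a) \<Rightarrow> 'r) set" where
  "multilinear_rels R A n =
    {free_gen R (a(i := u \<oplus>\<^bsub>A\<^esub> v)) \<ominus>\<^bsub>free_algebra R A n\<^esub>
       (free_gen R (a(i := u)) \<oplus>\<^bsub>free_algebra R A n\<^esub> free_gen R (a(i := v))) | a i u v.
       a \<in> tuples A n \<and> i \<in> {1..n} \<and> u \<in> carrier A \<and> v \<in> carrier A} \<union>
    {free_gen R (a(i := r \<odot>\<^bsub>A\<^esub> u)) \<ominus>\<^bsub>free_algebra R A n\<^esub>
       (r \<odot>\<^bsub>free_algebra R A n\<^esub> free_gen R (a(i := u))) | a i r u.
       a \<in> tuples A n \<and> i \<in> {1..n} \<and> r \<in> carrier R \<and> u \<in> carrier A}"

definition tensor_ideal ::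
    "('r, 'k) ring_scheme \<Rightarrow> ('r, 'a, 'm) module_scheme \<Rightarrow> nat \<Rightarrow>
      ((nat \<Rightarrow> 'a) \<Rightarrow> 'r) set" where
  "tensor_ideal R A n = Idl\<^bsub>free_algebra R A n\<^esub> (multilinear_rels R A n)"

definition tensor_power ::
    "('r, 'k) ring_scheme \<Rightarrow> ('r, 'a, 'm) module_scheme \<Rightarrow> nat \<Rightarrow>
      ('r, ((nat \<Rightarrow> 'a) \<Rightarrow> 'r) set) module" where
  "tensor_power R A n = algebra_Quot (free_algebra R A n) (tensor_ideal R A n)"

definition pure_tensor ::
    "('r, 'k) ring_scheme \<Rightarrow> ('r, 'a, 'm) module_scheme \<Rightarrow> nat \<Rightarrow>
      (nat \<Rightarrow> 'a) \<Rightarrow> ((nat \<Rightarrow> 'a) \<Rightarrow> 'r) set" where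
  "pure_tensor R A n a = tensor_ideal R A n +>\<^bsub>free_algebra R A n\<^esub> free_gen R a"

definition tensor_at ::
    "('r, 'k) ring_scheme \<Rightarrow> ('r, 'a, 'm) module_scheme \<Rightarrow> nat \<Rightarrow>
      nat \<Rightarrow> 'a \<Rightarrow> ((nat \<Rightarrow> 'a) \<Rightarrow> 'r) set" where
  "tensor_at R A n i a = pure_tensor R A n (\<lambda>j\<in>{1..n}. if j = i then a else \<one>\<^bsub>A\<^esub>)"

text \<open>
  A permutation \<open>\<sigma>\<close> of \<open>{1..n}\<close> moves the \<open>i\<close>-th tensor factor to position \<open>\<sigma> i\<close>, i.e. it sends
  the generator of the family \<open>a\<close> to that of \<open>a \<circ> inv \<sigma>\<close>.  On finitely supported functions this
  is \<open>F \<mapsto> (\<lambda>b. F (b \<circ> \<sigma>))\<close>; on the tensor power it is applied to all representatives of a class.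
\<close>

definition perm_tensor ::
    "(nat \<Rightarrow> nat) \<Rightarrow> ((nat \<Rightarrow> 'a) \<Rightarrow> 'r) set \<Rightarrow> ((nat \<Rightarrow> 'a) \<Rightarrow> 'r) set" where
  "perm_tensor \<sigma> t = (\<lambda>F b. F (b \<circ> \<sigma>)) ` t"

definition tensor_invariants ::
    "('r, 'k) ring_scheme \<Rightarrow> ('r, 'a, 'm) module_scheme \<Rightarrow> nat \<Rightarrow> (nat \<Rightarrow> nat) set \<Rightarrow>
      ('r, ((nat \<Rightarrow> 'a) \<Rightarrow> 'r) set) module" where
  "tensor_invariants R A n G = (tensor_power R A n)
    \<lparr>carrier := {t \<in> carrier (tensor_power R A n). \<forall>\<sigma>\<in>G. perm_tensor \<sigma> t = t}\<rparr>"

definition tensor_elem_sym ::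
    "('r, 'k) ring_scheme \<Rightarrow> ('r, 'a, 'm) module_scheme \<Rightarrow> nat \<Rightarrow>
      nat \<Rightarrow> 'a \<Rightarrow> ((nat \<Rightarrow> 'a) \<Rightarrow> 'r) set" where
  "tensor_elem_sym R A n k a =
    (\<Oplus>\<^bsub>tensor_power R A n\<^esub>S \<in> {S. S \<subseteq> {1..n} \<and> card S = k}.
       \<Otimes>\<^bsub>tensor_power R A n\<^esub>i\<in>S. tensor_at R A n i a)"


section \<open>Characteristic polynomials\<close>

definition ring_det :: "('a, 'm) ring_scheme \<Rightarrow> nat \<Rightarrow> (nat \<Rightarrow> nat \<Rightarrow> 'a) \<Rightarrow> 'a" where
  "ring_det R n M =
    (\<Oplus>\<^bsub>R\<^esub>p \<in> {p. p permutes {..<n}}.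
       (if evenperm p then \<one>\<^bsub>R\<^esub> else \<ominus>\<^bsub>R\<^esub> \<one>\<^bsub>R\<^esub>) \<otimes>\<^bsub>R\<^esub> (\<Otimes>\<^bsub>R\<^esub>i\<in>{..<n}. M i (p i)))"

text \<open>
  Below, \<open>b 0, \<dots>, b (n - 1)\<close> is an \<open>R\<close>-basis of \<open>A\<close>.  As usual the characteristic polynomial is
  computed in a basis, and does not depend on it.
\<close>

definition basis_coords ::
    "('r, 'k) ring_scheme \<Rightarrow> ('r, 'a, 'm) module_scheme \<Rightarrow> nat \<Rightarrow> (nat \<Rightarrow> 'a) \<Rightarrow>
      'a \<Rightarrow> nat \<Rightarrow> 'r" where
  "basis_coords R A n b a =
    (THE c. c \<in> {..<n} \<rightarrow>\<^sub>E carrier R \<and> a = (\<Oplus>\<^bsub>A\<^esub>i\<in>{..<n}. c i \<odot>\<^bsub>A\<^esub> b i))"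

definition mult_char_poly ::
    "('r, 'k) ring_scheme \<Rightarrow> ('r, 'a, 'm) module_scheme \<Rightarrow> nat \<Rightarrow> (nat \<Rightarrow> 'a) \<Rightarrow>
      'a \<Rightarrow> nat \<Rightarrow> 'r" where
  "mult_char_poly R A n b a =
    ring_det (UP R) n (\<lambda>i j.
      (if i = j then monom (UP R) \<one>\<^bsub>R\<^esub> 1 else \<zero>\<^bsub>UP R\<^esub>) \<ominus>\<^bsub>UP R\<^esub>
      monom (UP R) (basis_coords R A n b (a \<otimes>\<^bsub>A\<^esub> b j) i) 0)"

text \<open>The characteristic polynomial is \<open>\<Sum>k\<le>n. (-1)\<^sup>k s\<^sub>k(a) \<lambda>\<^sup>n\<^sup>-\<^sup>k\<close>.\<close>

definition char_coeff ::
    "('r, 'k) ring_scheme \<Rightarrow> ('r, 'a, 'm) module_scheme \<Rightarrow> nat \<Rightarrow> (nat \<Rightarrow> 'a) \<Rightarrow>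
      nat \<Rightarrow> 'a \<Rightarrow> 'r" where
  "char_coeff R A n b k a =
    (\<ominus>\<^bsub>R\<^esub> \<one>\<^bsub>R\<^esub>) [^]\<^bsub>R\<^esub> k \<otimes>\<^bsub>R\<^esub> coeff (UP R) (mult_char_poly R A n b a) (n - k)"


section \<open>\<open>D\<^sub>4\<close>-closure data\<close>

definition D4 :: "(nat \<Rightarrow> nat) set" where
  "D4 = generate (sym_group 4) {cycle_of_list [1, 3], cycle_of_list [1, 2, 3, 4]}"

text \<open>
  Homomorphisms are taken to be extensional, so that two of them are equal as HOL functions
  precisely if they agree on the invariants.
\<close>

definition D4_closure_data ::
    "('r, 'k) ring_scheme \<Rightarrow> ('r, 'a, 'm) module_scheme \<Rightarrow> (nat \<Rightarrow> 'a) \<Rightarrow>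
      (((nat \<Rightarrow> 'a) \<Rightarrow> 'r) set \<Rightarrow> 'r) set" where
  "D4_closure_data R A b =
    {\<phi> \<in> ring_hom (tensor_invariants R A 4 D4) R.
       \<phi> \<in> extensional (carrier (tensor_invariants R A 4 D4)) \<and>
       (\<forall>r \<in> carrier R. \<forall>t \<in> carrier (tensor_invariants R A 4 D4).
          \<phi> (r \<odot>\<^bsub>tensor_invariants R A 4 D4\<^esub> t) = r \<otimes>\<^bsub>R\<^esub> \<phi> t) \<and>
       (\<forall>a \<in> carrier A. \<forall>k \<in> {1..4}. \<phi> (tensor_elem_sym R A 4 k a) = char_coeff R A 4 b k a)}"


section \<open>Monogenic algebras of rank 4 and cubic resolvents\<close>

definition monogenic_algebra ::
    "('r, 'k) ring_scheme \<Rightarrow> (nat \<Rightarrow> 'r) \<Rightarrow> ('r, (nat \<Rightarrow> 'r) set) module" where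
  "monogenic_algebra R f = algebra_Quot (UP R) (PIdl\<^bsub>UP R\<^esub> f)"

definition monogenic_gen :: "('r, 'k) ring_scheme \<Rightarrow> (nat \<Rightarrow> 'r) \<Rightarrow> (nat \<Rightarrow> 'r) set" where
  "monogenic_gen R f = PIdl\<^bsub>UP R\<^esub> f +>\<^bsub>UP R\<^esub> monom (UP R) \<one>\<^bsub>R\<^esub> 1"

definition power_basis :: "('r, 'k) ring_scheme \<Rightarrow> (nat \<Rightarrow> 'r) \<Rightarrow> nat \<Rightarrow> (nat \<Rightarrow> 'r) set" where
  "power_basis R f i = monogenic_gen R f [^]\<^bsub>monogenic_algebra R f\<^esub> i"

definition quartic :: "('r, 'k) ring_scheme \<Rightarrow> 'r \<Rightarrow> 'r \<Rightarrow> 'r \<Rightarrow> 'r \<Rightarrow> nat \<Rightarrow> 'r" where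
  "quartic R s1 s2 s3 s4 =
    monom (UP R) \<one>\<^bsub>R\<^esub> 4 \<ominus>\<^bsub>UP R\<^esub> monom (UP R) s1 3 \<oplus>\<^bsub>UP R\<^esub> monom (UP R) s2 2
      \<ominus>\<^bsub>UP R\<^esub> monom (UP R) s3 1 \<oplus>\<^bsub>UP R\<^esub> monom (UP R) s4 0"

definition cubic_resolvent :: "('r, 'k) ring_scheme \<Rightarrow> 'r \<Rightarrow> 'r \<Rightarrow> 'r \<Rightarrow> 'r \<Rightarrow> nat \<Rightarrow> 'r" where
  "cubic_resolvent R s1 s2 s3 s4 =
    monom (UP R) \<one>\<^bsub>R\<^esub> 3 \<ominus>\<^bsub>UP R\<^esub> monom (UP R) s2 2
      \<oplus>\<^bsub>UP R\<^esub> monom (UP R) (s1 \<otimes>\<^bsub>R\<^esub> s3 \<ominus>\<^bsub>R\<^esub> [(4::nat)] \<cdot>\<^bsub>R\<^esub> s4) 1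
      \<ominus>\<^bsub>UP R\<^esub> monom (UP R) (s1 [^]\<^bsub>R\<^esub> (2::nat) \<otimes>\<^bsub>R\<^esub> s4
            \<ominus>\<^bsub>R\<^esub> [(4::nat)] \<cdot>\<^bsub>R\<^esub> (s2 \<otimes>\<^bsub>R\<^esub> s4) \<oplus>\<^bsub>R\<^esub> s3 [^]\<^bsub>R\<^esub> (2::nat)) 0"

text \<open>
  The element \<open>x\<^sup>(\<^sup>1\<^sup>) x\<^sup>(\<^sup>3\<^sup>) + x\<^sup>(\<^sup>2\<^sup>) x\<^sup>(\<^sup>4\<^sup>)\<close> of the tensor power, with \<open>x\<close> the class of the variable:
  it is \<open>D\<^sub>4\<close>-invariant, and its three conjugates under \<open>S\<^sub>4\<close> are the formal roots of the cubic
  resolvent.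
\<close>

definition resolvent_element ::
    "('r, 'k) ring_scheme \<Rightarrow> (nat \<Rightarrow> 'r) \<Rightarrow> ((nat \<Rightarrow> (nat \<Rightarrow> 'r) set) \<Rightarrow> 'r) set" where
  "resolvent_element R f =
    (let A = monogenic_algebra R f; T = tensor_power R A 4;
         x = (\<lambda>i. tensor_at R A 4 i (monogenic_gen R f))
     in x 1 \<otimes>\<^bsub>T\<^esub> x 3 \<oplus>\<^bsub>T\<^esub> x 2 \<otimes>\<^bsub>T\<^esub> x 4)"

end

theory Submission
  imports Defs
begin

text \<open>
  Let \<open>T\<close> be the fourth tensor power of \<open>A\<close>, let \<open>\<xi>\<^sub>i\<close> be the class \<open>x\<close> of the variable in position \<open>i\<close>, and
  put \<open>\<omega> = \<xi>\<^sub>1 \<xi>\<^sub>3 + \<xi>\<^sub>2 \<xi>\<^sub>4\<close>.  The monomials in the \<open>\<xi>\<^sub>i\<close> with exponents below \<open>4\<close> are an \<open>R\<close>-basis of \<open>T\<close>.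
  A closure datum \<open>\<phi>\<close> corresponds to the element \<open>\<phi>(\<omega>)\<close> of \<open>R\<close>.

  \<^emph>\<open>The value is a root.\<close>  In \<open>T\<close> the element \<open>\<omega>\<close> satisfies the cubic resolvent with \<open>e\<^sub>k(x)\<close> in place of
  \<open>s\<^sub>k\<close> (\<open>resolvent_relation\<close>).  A closure datum sends \<open>e\<^sub>k(x)\<close> to the \<open>k\<close>-th coefficient of the
  characteristic polynomial of \<open>x\<close>, which is \<open>s\<^sub>k\<close> (\<open>char_coeff_generator\<close>).

  \<^emph>\<open>The value determines the datum.\<close>  The \<open>D\<^sub>4\<close>-invariants are generated as an algebra by the \<open>e\<^sub>k(x)\<close> and
  \<open>\<omega>\<close> (\<open>invariants_generated\<close>).  Indeed, an invariant is a combination of products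
  \<open>h\<^sub>u(\<xi>\<^sub>1, \<xi>\<^sub>3) h\<^sub>v(\<xi>\<^sub>2, \<xi>\<^sub>4)\<close> of symmetrised monomials, with coefficients symmetric in \<open>u\<close> and \<open>v\<close>.  The two
  elements \<open>h\<^sub>u(\<xi>\<^sub>1, \<xi>\<^sub>3)\<close> and \<open>h\<^sub>u(\<xi>\<^sub>2, \<xi>\<^sub>4)\<close> arise from one polynomial, evaluated at the sum and product of
  the first and of the second pair, and the products needed can be expressed by \<open>e\<^sub>k(x)\<close> and \<open>\<omega>\<close>.

  \<^emph>\<open>Every root occurs.\<close>  The idea is to read off the coordinates of an invariant with respect to
  \<open>1, \<omega>, \<omega>\<^sup>2\<close>, with coordinates that are symmetric tensors evaluated in \<open>R\<close>.  For symmetric tensors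
  themselves there is the determinant functional \<open>alt\<close> on \<open>T\<close>: symmetric tensors act on its values by
  scalars (\<open>alt_symmetric_mult\<close>), and \<open>e\<^sub>k(a)\<close> acts as \<open>s\<^sub>k(a)\<close> for every \<open>a\<close> (\<open>alt_esym_eq_char_coeff\<close>).
  This functional vanishes on tensors fixed by a transposition, so an invariant \<open>t\<close> is first multiplied
  by \<open>\<xi>\<^sub>1 \<xi>\<^sub>4\<close>.  The product is still fixed by the even permutation \<open>(1 4)(2 3)\<close>, hence \<open>alt\<close> takes each of
  its terms twice; as \<open>2\<close> need not be invertible, or even nonzero, one sums over half of the permutations
  instead.  The resulting functional \<open>half\<close> still lets symmetric tensors act by the same scalars
  (\<open>half_symmetric_mult\<close>).  Now \<open>L(t) = half(\<xi>\<^sub>1 \<xi>\<^sub>4 t)\<close> takes the values \<open>0, 0, 1\<close> at \<open>1, \<omega>, \<omega>\<^sup>2\<close>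
  (\<open>half_corner\<close>), so \<open>L(t), L(\<omega> t), L(\<omega>\<^sup>2 t)\<close> determine the three coordinates, and for a root \<open>y\<close> the
  combination \<open>closure_map y\<close> of these three is the element \<open>c\<^sub>0 + c\<^sub>1 y + c\<^sub>2 y\<^sup>2\<close> of \<open>R\<close>.  It
  turns multiplication by \<open>e\<^sub>k(a)\<close> and by \<open>\<omega>\<close> into multiplication by \<open>s\<^sub>k(a)\<close> and by \<open>y\<close>; since these elements
  generate the invariants, it is multiplicative.
\<close>

lemma (in abelian_group) minus_eq_zero_iff:
  assumes "x \<in> carrier G" "y \<in> carrier G"
  shows "x \<ominus> y = \<zero> \<longleftrightarrow> x = y"
proof
  assume zero: "x \<ominus> y = \<zero>"
  have "x = (x \<ominus> y) \<oplus> y" using assms by (simp add: minus_eq a_assoc l_neg)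
  then show "x = y" unfolding zero using assms by simp
qed (simp add: assms minus_eq r_neg)

section \<open>Quotient algebras\<close>

text \<open>
  Carries the ring axioms over to a record that has the same ring operations and an additional scalar
  multiplication.
\<close>

lemma cring_same_operations:
  assumes "cring R" and "carrier S = carrier R" "monoid.mult S = monoid.mult R" "one S = one R"
    "zero S = zero R" "ring.add S = ring.add R"
  shows "cring S"
proof -
  interpret R: cring R by fact
  show ?thesis
  proof (rule cringI)
    show "abelian_group S"
      by (rule abelian_groupI)
        (use R.add.inv_closed R.add.l_inv in
          \<open>auto simp: assms R.a_assoc intro: R.a_comm\<close>)
    show "comm_monoid S"
      by (rule comm_monoidI) (auto simp: assms R.m_assoc intro: R.m_comm)
  qed (auto simp: assms R.l_distr)
qed

context algebra
begin

lemma ideal_smult_closed: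
  assumes "ideal I M" "r \<in> carrier R" "x \<in> I"
  shows "r \<odot>\<^bsub>M\<^esub> x \<in> I"
proof -
  interpret I: ideal I M by fact
  have "r \<odot>\<^bsub>M\<^esub> x = (r \<odot>\<^bsub>M\<^esub> \<one>\<^bsub>M\<^esub>) \<otimes>\<^bsub>M\<^esub> x"
    using assms I.Icarr by (simp add: smult_assoc2)
  then show ?thesis using assms by (simp add: I.I_l_closed)
qed

text \<open>
  Scalar multiplication of a class is defined through its representatives; an ideal is stable under
  scalars because a scalar acts as multiplication by a multiple of \<open>1\<close>.
\<close>

lemma algebra_Quot_smult:
  assumes "ideal I M" "r \<in> carrier R" "x \<in> carrier M"
  shows "r \<odot>\<^bsub>algebra_Quot M I\<^esub> (I +>\<^bsub>M\<^esub> x) = I +>\<^bsub>M\<^esub> (r \<odot>\<^bsub>M\<^esub> x)"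
proof -
  interpret I: ideal I M by fact
  have "I +>\<^bsub>M\<^esub> (r \<odot>\<^bsub>M\<^esub> y) = I +>\<^bsub>M\<^esub> (r \<odot>\<^bsub>M\<^esub> x)" if "y \<in> I +>\<^bsub>M\<^esub> x" for y
  proof -
    obtain i where i: "i \<in> I" "y = i \<oplus>\<^bsub>M\<^esub> x" using \<open>y \<in> I +>\<^bsub>M\<^esub> x\<close>
      by (auto simp: a_r_coset_def' )
    have "r \<odot>\<^bsub>M\<^esub> y \<ominus>\<^bsub>M\<^esub> r \<odot>\<^bsub>M\<^esub> x = r \<odot>\<^bsub>M\<^esub> i"
      using i assms I.Icarr by (simp add: smult_r_distr M.minus_eq M.a_assoc M.r_neg)
    then have "r \<odot>\<^bsub>M\<^esub> y \<ominus>\<^bsub>M\<^esub> r \<odot>\<^bsub>M\<^esub> x \<in> I" using i assms ideal_smult_closed by simp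
    then show ?thesis
      using quotient_eq_iff_same_a_r_cos[OF assms(1), of "r \<odot>\<^bsub>M\<^esub> y" "r \<odot>\<^bsub>M\<^esub> x"]
        i assms I.Icarr by blast
  qed
  moreover have "x \<in> I +>\<^bsub>M\<^esub> x" using assms by (simp add: I.a_rcos_self)
  ultimately have "(\<Union>y\<in>I +>\<^bsub>M\<^esub> x. I +>\<^bsub>M\<^esub> (r \<odot>\<^bsub>M\<^esub> y)) = I +>\<^bsub>M\<^esub> (r \<odot>\<^bsub>M\<^esub> x)"
    by blast
  then show ?thesis by (simp add: algebra_Quot_def)
qed

lemma carrier_algebra_Quot: "carrier (algebra_Quot M I) = {I +>\<^bsub>M\<^esub> x |x. x \<in> carrier M}"
  by (auto simp: algebra_Quot_def FactRing_simps)

lemma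
  assumes "ideal I M" "x \<in> carrier M" "y \<in> carrier M"
  shows algebra_Quot_add:
      "(I +>\<^bsub>M\<^esub> x) \<oplus>\<^bsub>algebra_Quot M I\<^esub> (I +>\<^bsub>M\<^esub> y) = I +>\<^bsub>M\<^esub> (x \<oplus>\<^bsub>M\<^esub> y)"
    and algebra_Quot_mult:
      "(I +>\<^bsub>M\<^esub> x) \<otimes>\<^bsub>algebra_Quot M I\<^esub> (I +>\<^bsub>M\<^esub> y) = I +>\<^bsub>M\<^esub> (x \<otimes>\<^bsub>M\<^esub> y)"
    and algebra_Quot_one: "\<one>\<^bsub>algebra_Quot M I\<^esub> = I +>\<^bsub>M\<^esub> \<one>\<^bsub>M\<^esub>"
proof -
  interpret I: ideal I M by fact
  show "(I +>\<^bsub>M\<^esub> x) \<oplus>\<^bsub>algebra_Quot M I\<^esub> (I +>\<^bsub>M\<^esub> y) = I +>\<^bsub>M\<^esub> (x \<oplus>\<^bsub>M\<^esub> y)"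
    "(I +>\<^bsub>M\<^esub> x) \<otimes>\<^bsub>algebra_Quot M I\<^esub> (I +>\<^bsub>M\<^esub> y) = I +>\<^bsub>M\<^esub> (x \<otimes>\<^bsub>M\<^esub> y)"
    "\<one>\<^bsub>algebra_Quot M I\<^esub> = I +>\<^bsub>M\<^esub> \<one>\<^bsub>M\<^esub>"
    using assms by (auto simp: algebra_Quot_def FactRing_def I.a_rcos_sum I.rcoset_mult_add)
qed

lemma algebra_algebra_Quot:
  assumes "ideal I M"
  shows "algebra R (algebra_Quot M I)"
proof -
  interpret I: ideal I M by fact
  have "cring (algebra_Quot M I)"
    by (rule cring_same_operations[OF I.quotient_is_cring[OF M_cring]]) (simp_all add: algebra_Quot_def)
  then show ?thesis
  proof (rule algebraI[OF R_cring])
    fix a X Y assume "a \<in> carrier R" "X \<in> carrier (algebra_Quot M I)" "Y \<in> carrier (algebra_Quot M I)"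
    then obtain x y where *: "a \<in> carrier R" "x \<in> carrier M" "y \<in> carrier M"
      "X = I +>\<^bsub>M\<^esub> x" "Y = I +>\<^bsub>M\<^esub> y" by (auto simp: carrier_algebra_Quot)
    then show "a \<odot>\<^bsub>algebra_Quot M I\<^esub> (X \<oplus>\<^bsub>algebra_Quot M I\<^esub> Y) =
        a \<odot>\<^bsub>algebra_Quot M I\<^esub> X \<oplus>\<^bsub>algebra_Quot M I\<^esub> a \<odot>\<^bsub>algebra_Quot M I\<^esub> Y"
      "(a \<odot>\<^bsub>algebra_Quot M I\<^esub> X) \<otimes>\<^bsub>algebra_Quot M I\<^esub> Y =
        a \<odot>\<^bsub>algebra_Quot M I\<^esub> (X \<otimes>\<^bsub>algebra_Quot M I\<^esub> Y)"
      by (simp_all add: algebra_Quot_smult[OF assms] algebra_Quot_add[OF assms]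
          algebra_Quot_mult[OF assms] smult_r_distr smult_assoc2)
  next
    fix a b X assume "a \<in> carrier R" "b \<in> carrier R" "X \<in> carrier (algebra_Quot M I)"
    then obtain x where *: "a \<in> carrier R" "b \<in> carrier R" "x \<in> carrier M" "X = I +>\<^bsub>M\<^esub> x"
      by (auto simp: carrier_algebra_Quot)
    then show "(a \<oplus> b) \<odot>\<^bsub>algebra_Quot M I\<^esub> X =
        a \<odot>\<^bsub>algebra_Quot M I\<^esub> X \<oplus>\<^bsub>algebra_Quot M I\<^esub> b \<odot>\<^bsub>algebra_Quot M I\<^esub> X"
      "(a \<otimes> b) \<odot>\<^bsub>algebra_Quot M I\<^esub> X =
        a \<odot>\<^bsub>algebra_Quot M I\<^esub> (b \<odot>\<^bsub>algebra_Quot M I\<^esub> X)"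
      by (simp_all add: algebra_Quot_smult[OF assms] algebra_Quot_add[OF assms]
          smult_l_distr smult_assoc1)
  next
    fix a X assume "a \<in> carrier R" "X \<in> carrier (algebra_Quot M I)"
    then obtain x where *: "a \<in> carrier R" "x \<in> carrier M" "X = I +>\<^bsub>M\<^esub> x"
      by (auto simp: carrier_algebra_Quot)
    then show "a \<odot>\<^bsub>algebra_Quot M I\<^esub> X \<in> carrier (algebra_Quot M I)"
      by (auto simp: algebra_Quot_smult[OF assms] carrier_algebra_Quot)
  next
    fix X assume "X \<in> carrier (algebra_Quot M I)"
    then show "\<one> \<odot>\<^bsub>algebra_Quot M I\<^esub> X = X"
      using algebra_Quot_smult[OF assms, of \<one>] by (auto simp: carrier_algebra_Quot)
  qed
qed

lemma algebra_Quot_eq_iff: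
  assumes "ideal I M" "x \<in> carrier M" "y \<in> carrier M"
  shows "I +>\<^bsub>M\<^esub> x = I +>\<^bsub>M\<^esub> y \<longleftrightarrow> x \<ominus>\<^bsub>M\<^esub> y \<in> I"
  using quotient_eq_iff_same_a_r_cos[OF assms] by blast

end

section \<open>Free algebras on tuples\<close>

lemma (in abelian_monoid) finsum_cartesian:
  assumes "finite X" "finite Y" "\<And>x y. x \<in> X \<Longrightarrow> y \<in> Y \<Longrightarrow> f (x, y) \<in> carrier G"
  shows "(\<Oplus>p\<in>X \<times> Y. f p) = (\<Oplus>x\<in>X. \<Oplus>y\<in>Y. f (x, y))"
proof -
  have "(\<Oplus>p\<in>(\<Union>x\<in>X. {x} \<times> Y). f p) = (\<Oplus>x\<in>X. \<Oplus>p\<in>{x} \<times> Y. f p)"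
    using assms by (intro add.finprod_UN_disjoint) (auto simp: pairwise_def disjnt_def)
  also have "\<dots> = (\<Oplus>x\<in>X. \<Oplus>y\<in>Y. f (x, y))"
  proof (rule finsum_cong')
    fix x assume x: "x \<in> X"
    have "(\<Oplus>p\<in>Pair x ` Y. f p) = (\<Oplus>y\<in>Y. f (x, y))"
      using x assms by (intro finsum_reindex) (auto simp: inj_on_def)
    moreover have "Pair x ` Y = {x} \<times> Y" by auto
    ultimately show "(\<Oplus>p\<in>{x} \<times> Y. f p) = (\<Oplus>y\<in>Y. f (x, y))" by simp
  qed (use assms in auto)
  also have "(\<Union>x\<in>X. {x} \<times> Y) = X \<times> Y" by auto
  finally show ?thesis .
qed

lemma (in abelian_monoid) finsum_swap:
  assumes "finite X" "finite Y" "\<And>x y. x \<in> X \<Longrightarrow> y \<in> Y \<Longrightarrow> f x y \<in> carrier G"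
  shows "(\<Oplus>x\<in>X. \<Oplus>y\<in>Y. f x y) = (\<Oplus>y\<in>Y. \<Oplus>x\<in>X. f x y)"
proof -
  have "(\<Oplus>p\<in>prod.swap ` (Y \<times> X). f (fst p) (snd p)) = (\<Oplus>p\<in>Y \<times> X. f (snd p) (fst p))"
    using assms by (subst finsum_reindex) (auto simp: inj_on_def)
  then show ?thesis
    using finsum_cartesian[of X Y "\<lambda>p. f (fst p) (snd p)"]
      finsum_cartesian[of Y X "\<lambda>p. f (snd p) (fst p)"] assms
    by (simp add: product_swap)
qed

locale algebra_power = algebra R A for R (structure) and A + fixes n :: nat
begin

abbreviation F where "F \<equiv> free_algebra R A n"
abbreviation E where "E \<equiv> tuples A n"

definition tuple_mult :: "(nat \<Rightarrow> 'c) \<Rightarrow> (nat \<Rightarrow> 'c) \<Rightarrow> nat \<Rightarrow> 'c" where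
  "tuple_mult a b = (\<lambda>i\<in>{1..n}. a i \<otimes>\<^bsub>A\<^esub> b i)"

definition tuple_one :: "nat \<Rightarrow> 'c" where
  "tuple_one = (\<lambda>i\<in>{1..n}. \<one>\<^bsub>A\<^esub>)"

text \<open>
  Arbitrary functions \<open>m\<close> on tuples are the linear functionals on the free algebra.  As they separate
  its elements, identities in the free algebra are proved by pairing both sides with every \<open>m\<close>, which
  avoids computing with the convolution product.
\<close>

definition pairing :: "((nat \<Rightarrow> 'c) \<Rightarrow> 'a) \<Rightarrow> ((nat \<Rightarrow> 'c) \<Rightarrow> 'a) \<Rightarrow> 'a" where
  "pairing f m = (\<Oplus>a\<in>{a. f a \<noteq> \<zero>}. f a \<otimes> m a)"

lemma tuple_mult_closed [simp, intro]: "a \<in> E \<Longrightarrow> b \<in> E \<Longrightarrow> tuple_mult a b \<in> E"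
  by (auto simp: tuples_def tuple_mult_def PiE_iff)

lemma tuple_one_closed [simp, intro]: "tuple_one \<in> E"
  by (auto simp: tuples_def tuple_one_def)

lemma tuple_mult_assoc:
  "a \<in> E \<Longrightarrow> b \<in> E \<Longrightarrow> c \<in> E \<Longrightarrow> tuple_mult (tuple_mult a b) c = tuple_mult a (tuple_mult b c)"
  by (auto simp: tuples_def tuple_mult_def PiE_iff m_assoc fun_eq_iff restrict_def)

lemma tuple_mult_comm: "a \<in> E \<Longrightarrow> b \<in> E \<Longrightarrow> tuple_mult a b = tuple_mult b a"
  by (auto simp: tuples_def tuple_mult_def PiE_iff restrict_def fun_eq_iff intro: m_comm)

lemma tuple_mult_one: "a \<in> E \<Longrightarrow> tuple_mult tuple_one a = a"
  by (auto simp: tuples_def tuple_mult_def tuple_one_def PiE_iff extensional_def fun_eq_iff)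

lemma free_carrier_iff:
  "f \<in> carrier F \<longleftrightarrow> (\<forall>a. f a \<in> carrier R) \<and> finite {a. f a \<noteq> \<zero>} \<and> {a. f a \<noteq> \<zero>} \<subseteq> E"
  by (auto simp: free_algebra_def)

lemma free_carrierD:
  assumes "f \<in> carrier F"
  shows "f a \<in> carrier R" "finite {a. f a \<noteq> \<zero>}" "f a \<noteq> \<zero> \<Longrightarrow> a \<in> E"
  using assms by (auto simp: free_carrier_iff)

lemma free_add: "f \<oplus>\<^bsub>F\<^esub> g = (\<lambda>a. f a \<oplus> g a)"
  and free_zero: "\<zero>\<^bsub>F\<^esub> = (\<lambda>a. \<zero>)"
  and free_smult: "r \<odot>\<^bsub>F\<^esub> f = (\<lambda>a. r \<otimes> f a)"
  and free_one: "\<one>\<^bsub>F\<^esub> = free_gen R tuple_one"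
  by (simp_all add: free_algebra_def free_gen_def tuple_one_def)

lemma free_mult:
  "f \<otimes>\<^bsub>F\<^esub> g = (\<lambda>c. \<Oplus>p\<in>{p \<in> {a. f a \<noteq> \<zero>} \<times> {b. g b \<noteq> \<zero>}. tuple_mult (fst p) (snd p) = c}.
      f (fst p) \<otimes> g (snd p))"
  by (auto simp: free_algebra_def tuple_mult_def fun_eq_iff intro!: arg_cong[where f = "finsum R _"])

lemma free_gen_closed [simp, intro]: "a \<in> E \<Longrightarrow> free_gen R a \<in> carrier F"
  by (auto simp: free_carrier_iff free_gen_def)

lemma free_abelian_group: "abelian_group F"
proof (rule abelian_groupI)
  fix f g assume f: "f \<in> carrier F" and g: "g \<in> carrier F"
  have "{a. f a \<oplus> g a \<noteq> \<zero>} \<subseteq> {a. f a \<noteq> \<zero>} \<union> {a. g a \<noteq> \<zero>}" by auto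
  then have "finite {a. f a \<oplus> g a \<noteq> \<zero>}"
    using f g by (auto simp: free_carrier_iff intro: finite_subset)
  then show "f \<oplus>\<^bsub>F\<^esub> g \<in> carrier F"
    using f g \<open>{a. f a \<oplus> g a \<noteq> \<zero>} \<subseteq> _\<close> unfolding free_carrier_iff free_add
    by (intro conjI allI R.a_closed) blast+
  show "f \<oplus>\<^bsub>F\<^esub> g = g \<oplus>\<^bsub>F\<^esub> f"
    using f g by (auto simp: free_carrier_iff free_add fun_eq_iff intro: R.a_comm)
next
  fix f assume f: "f \<in> carrier F"
  then have "(\<lambda>a. \<ominus> f a) \<in> carrier F" "(\<lambda>a. \<ominus> f a) \<oplus>\<^bsub>F\<^esub> f = \<zero>\<^bsub>F\<^esub>"
    by (auto simp: free_carrier_iff free_add free_zero R.l_neg)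
  then show "\<exists>g\<in>carrier F. g \<oplus>\<^bsub>F\<^esub> f = \<zero>\<^bsub>F\<^esub>" by blast
qed (auto simp: free_carrier_iff free_add free_zero R.a_assoc)

lemma supported_dual_closed:
  "f \<in> carrier F \<Longrightarrow> m \<in> E \<rightarrow> carrier R \<Longrightarrow> f a \<noteq> \<zero> \<Longrightarrow> m a \<in> carrier R"
  by (auto simp: free_carrier_iff)

lemma pairing_eq:
  assumes "f \<in> carrier F" "m \<in> E \<rightarrow> carrier R" "finite X" "{a. f a \<noteq> \<zero>} \<subseteq> X" "X \<subseteq> E"
  shows "pairing f m = (\<Oplus>a\<in>X. f a \<otimes> m a)"
proof -
  have "m a \<in> carrier R" if "a \<in> X" for a using that assms by blast
  then show ?thesis
    unfolding pairing_def using assms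
    by (intro R.add.finprod_mono_neutral_cong_left) (auto simp: free_carrierD)
qed

lemma pairing_closed [simp, intro]:
  "f \<in> carrier F \<Longrightarrow> m \<in> E \<rightarrow> carrier R \<Longrightarrow> pairing f m \<in> carrier R"
  unfolding pairing_def
  by (rule R.finsum_closed) (auto simp: free_carrierD supported_dual_closed)

lemma pairing_cong:
  assumes "f \<in> carrier F" "m \<in> E \<rightarrow> carrier R" "\<And>a. a \<in> E \<Longrightarrow> m' a = m a"
  shows "pairing f m' = pairing f m"
  unfolding pairing_def using assms
  by (intro R.finsum_cong') (auto simp: free_carrierD supported_dual_closed)

lemma pairing_add:
  assumes "f \<in> carrier F" "g \<in> carrier F" "m \<in> E \<rightarrow> carrier R"
  shows "pairing (f \<oplus>\<^bsub>F\<^esub> g) m = pairing f m \<oplus> pairing g m"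
proof -
  interpret F: abelian_group F by (rule free_abelian_group)
  let ?X = "{a. f a \<noteq> \<zero>} \<union> {a. g a \<noteq> \<zero>}"
  have X: "finite ?X" "?X \<subseteq> E" using assms by (auto simp: free_carrier_iff)
  have c: "f a \<in> carrier R" "g a \<in> carrier R" for a using assms by (auto simp: free_carrier_iff)
  have m: "m a \<in> carrier R" if "a \<in> ?X" for a using X assms that by blast
  have "pairing (f \<oplus>\<^bsub>F\<^esub> g) m = (\<Oplus>a\<in>?X. (f \<oplus>\<^bsub>F\<^esub> g) a \<otimes> m a)"
    using assms X by (intro pairing_eq F.a_closed) (auto simp: free_add)
  also have "\<dots> = (\<Oplus>a\<in>?X. f a \<otimes> m a \<oplus> g a \<otimes> m a)"
    using c m by (intro R.finsum_cong') (auto simp: free_add R.l_distr)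
  also have "\<dots> = (\<Oplus>a\<in>?X. f a \<otimes> m a) \<oplus> (\<Oplus>a\<in>?X. g a \<otimes> m a)"
    using c m by (intro R.finsum_addf) auto
  also have "\<dots> = pairing f m \<oplus> pairing g m"
    using assms X by (intro arg_cong2[where f = "(\<oplus>)"] pairing_eq[symmetric]) auto
  finally show ?thesis .
qed

lemma free_smult_closed: "r \<in> carrier R \<Longrightarrow> f \<in> carrier F \<Longrightarrow> r \<odot>\<^bsub>F\<^esub> f \<in> carrier F"
  by (auto simp: free_carrier_iff free_smult intro: rev_finite_subset)

lemma pairing_smult:
  assumes "r \<in> carrier R" "f \<in> carrier F" "m \<in> E \<rightarrow> carrier R"
  shows "pairing (r \<odot>\<^bsub>F\<^esub> f) m = r \<otimes> pairing f m"
proof -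
  let ?X = "{a. f a \<noteq> \<zero>}"
  have X: "finite ?X" "?X \<subseteq> E" using assms by (auto simp: free_carrier_iff)
  have m: "f a \<in> carrier R" "a \<in> ?X \<Longrightarrow> m a \<in> carrier R" for a
    using X assms by (auto simp: free_carrier_iff)
  have "pairing (r \<odot>\<^bsub>F\<^esub> f) m = (\<Oplus>a\<in>?X. (r \<odot>\<^bsub>F\<^esub> f) a \<otimes> m a)"
    using assms X by (intro pairing_eq free_smult_closed) (auto simp: free_smult)
  also have "\<dots> = (\<Oplus>a\<in>?X. r \<otimes> (f a \<otimes> m a))"
    using assms m by (intro R.finsum_cong') (auto simp: free_smult R.m_assoc)
  also have "\<dots> = r \<otimes> pairing f m"
    unfolding pairing_def using X m assms by (intro R.finsum_rdistr[symmetric]) auto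
  finally show ?thesis .
qed

lemma pairing_free_gen:
  assumes "a \<in> E" "m \<in> E \<rightarrow> carrier R"
  shows "pairing (free_gen R a) m = m a"
proof -
  have "pairing (free_gen R a) m = (\<Oplus>b\<in>{a}. free_gen R a b \<otimes> m b)"
    using assms by (intro pairing_eq free_gen_closed) (auto simp: free_gen_def)
  also have "\<dots> = free_gen R a a \<otimes> m a"
    using assms by (subst R.finsum_insert) (auto simp: free_gen_def Pi_iff)
  finally show ?thesis using assms by (auto simp: free_gen_def Pi_iff)
qed

lemma pairing_delta:
  assumes "f \<in> carrier F"
  shows "pairing f (\<lambda>a. if a = b then \<one> else \<zero>) = f b"
proof -
  have "pairing f (\<lambda>a. if a = b then \<one> else \<zero>) =
      (\<Oplus>a\<in>{a. f a \<noteq> \<zero>}. if b = a then f a else \<zero>)"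
    unfolding pairing_def using assms by (intro R.finsum_cong') (auto simp: free_carrier_iff)
  also have "\<dots> = f b"
  proof (cases "f b = \<zero>")
    case True
    have "(\<Oplus>a\<in>{a. f a \<noteq> \<zero>}. if b = a then f a else \<zero>) = (\<Oplus>a\<in>{a. f a \<noteq> \<zero>}. \<zero>)"
      using True assms by (intro R.finsum_cong') auto
    then show ?thesis using True by simp
  next
    case False
    then show ?thesis using assms by (intro R.finsum_singleton) (auto simp: free_carrier_iff)
  qed
  finally show ?thesis .
qed

lemma free_eqI:
  assumes "f \<in> carrier F" "g \<in> carrier F"
    "\<And>m. m \<in> E \<rightarrow> carrier R \<Longrightarrow> pairing f m = pairing g m"
  shows "f = g"
proof
  fix b
  show "f b = g b"
    using assms(3)[of "\<lambda>a. if a = b then \<one> else \<zero>"] pairing_delta assms(1,2) by simp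
qed

lemma free_mult_closed [simp, intro]:
  assumes "f \<in> carrier F" "g \<in> carrier F"
  shows "f \<otimes>\<^bsub>F\<^esub> g \<in> carrier F"
proof -
  let ?C = "(\<lambda>p. tuple_mult (fst p) (snd p)) ` ({a. f a \<noteq> \<zero>} \<times> {b. g b \<noteq> \<zero>})"
  have C: "finite ?C" "?C \<subseteq> E" using assms by (auto simp: free_carrierD)
  have "{c. (f \<otimes>\<^bsub>F\<^esub> g) c \<noteq> \<zero>} \<subseteq> ?C"
  proof
    fix c assume c: "c \<in> {c. (f \<otimes>\<^bsub>F\<^esub> g) c \<noteq> \<zero>}"
    show "c \<in> ?C"
    proof (rule ccontr)
      assume "c \<notin> ?C"
      then have "{p \<in> {a. f a \<noteq> \<zero>} \<times> {b. g b \<noteq> \<zero>}. tuple_mult (fst p) (snd p) = c} = {}"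
        by blast
      then have "(f \<otimes>\<^bsub>F\<^esub> g) c = \<zero>" unfolding free_mult by (simp only: R.finsum_empty)
      then show False using c by simp
    qed
  qed
  then have "finite {c. (f \<otimes>\<^bsub>F\<^esub> g) c \<noteq> \<zero>}" "{c. (f \<otimes>\<^bsub>F\<^esub> g) c \<noteq> \<zero>} \<subseteq> E"
    using C finite_subset by (blast, blast)
  moreover have "(f \<otimes>\<^bsub>F\<^esub> g) c \<in> carrier R" for c
    unfolding free_mult using assms by (intro R.finsum_closed) (auto simp: free_carrier_iff)
  ultimately show ?thesis by (simp add: free_carrier_iff)
qed

text \<open>
  Pairing undoes the summation over the fibres of the tuple product: the ring axioms of the free algebra
  become statements about iterated sums.
\<close>

lemma pairing_mult:
  assumes f: "f \<in> carrier F" and g: "g \<in> carrier F" and m: "m \<in> E \<rightarrow> carrier R"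
  shows "pairing (f \<otimes>\<^bsub>F\<^esub> g) m = pairing f (\<lambda>a. pairing g (\<lambda>b. m (tuple_mult a b)))"
proof -
  let ?X = "{a. f a \<noteq> \<zero>}" and ?Y = "{b. g b \<noteq> \<zero>}"
  let ?t = "\<lambda>p. tuple_mult (fst p) (snd p)"
  let ?P = "\<lambda>c. {p \<in> ?X \<times> ?Y. ?t p = c}"
  let ?h = "\<lambda>p. f (fst p) \<otimes> g (snd p) \<otimes> m (?t p)"
  have fin: "finite ?X" "finite ?Y" "?X \<subseteq> E" "?Y \<subseteq> E" using f g by (auto simp: free_carrier_iff)
  have fc: "f a \<in> carrier R" "g a \<in> carrier R" for a using f g by (auto simp: free_carrier_iff)
  have mc: "m (tuple_mult a b) \<in> carrier R" if "a \<in> ?X" "b \<in> ?Y" for a b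
    using that fin by (intro funcset_mem[OF m] tuple_mult_closed) blast+
  have hc: "?h p \<in> carrier R" if "p \<in> ?X \<times> ?Y" for p
    using that mc[of "fst p" "snd p"] fc by (simp add: mem_Times_iff)
  have tc: "?t p \<in> E" if "p \<in> ?X \<times> ?Y" for p
    using that subsetD[OF fin(3), of "fst p"] subsetD[OF fin(4), of "snd p"]
    by (intro tuple_mult_closed) (simp_all add: mem_Times_iff)
  have C: "finite (?t ` (?X \<times> ?Y))" "?t ` (?X \<times> ?Y) \<subseteq> E"
    by (simp add: fin, rule image_subsetI, rule tc)
  have supp: "{c. (f \<otimes>\<^bsub>F\<^esub> g) c \<noteq> \<zero>} \<subseteq> ?t ` (?X \<times> ?Y)"
  proof
    fix c assume c: "c \<in> {c. (f \<otimes>\<^bsub>F\<^esub> g) c \<noteq> \<zero>}"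
    show "c \<in> ?t ` (?X \<times> ?Y)"
    proof (rule ccontr)
      assume "c \<notin> ?t ` (?X \<times> ?Y)"
      then have "?P c = {}" by blast
      then have "(f \<otimes>\<^bsub>F\<^esub> g) c = \<zero>" unfolding free_mult by (simp only: R.finsum_empty)
      then show False using c by simp
    qed
  qed
  have "pairing (f \<otimes>\<^bsub>F\<^esub> g) m = (\<Oplus>c\<in>?t ` (?X \<times> ?Y). (f \<otimes>\<^bsub>F\<^esub> g) c \<otimes> m c)"
    by (rule pairing_eq[OF _ m C(1) supp C(2)]) (use f g in auto)
  also have "\<dots> = (\<Oplus>c\<in>?t ` (?X \<times> ?Y). \<Oplus>p\<in>?P c. ?h p)"
  proof (rule R.finsum_cong')
    fix c assume c: "c \<in> ?t ` (?X \<times> ?Y)"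
    then have "m c \<in> carrier R" using C m by blast
    then have "(f \<otimes>\<^bsub>F\<^esub> g) c \<otimes> m c = (\<Oplus>p\<in>?P c. f (fst p) \<otimes> g (snd p) \<otimes> m c)"
      unfolding free_mult using fin fc by (intro R.finsum_ldistr) auto
    also have "\<dots> = (\<Oplus>p\<in>?P c. ?h p)"
    proof (rule R.finsum_cong'[OF refl])
      show "?h \<in> ?P c \<rightarrow> carrier R" by (rule Pi_I, rule hc) blast
      fix p assume "p \<in> ?P c"
      then have "?t p = c" by blast
      then show "f (fst p) \<otimes> g (snd p) \<otimes> m c = ?h p" by simp
    qed
    finally show "(f \<otimes>\<^bsub>F\<^esub> g) c \<otimes> m c = (\<Oplus>p\<in>?P c. ?h p)" .
  next
    show "(\<lambda>c. \<Oplus>p\<in>?P c. ?h p) \<in> ?t ` (?X \<times> ?Y) \<rightarrow> carrier R"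
      using hc by (intro Pi_I R.finsum_closed) simp
  qed simp
  also have "\<dots> = (\<Oplus>p\<in>(\<Union>c\<in>?t ` (?X \<times> ?Y). ?P c). ?h p)"
  proof (rule R.add.finprod_UN_disjoint[symmetric])
    show "finite (?t ` (?X \<times> ?Y))" by (rule C(1))
    show "finite (?P c)" for c using fin(1,2) by simp
    show "pairwise (\<lambda>c d. disjnt (?P c) (?P d)) (?t ` (?X \<times> ?Y))"
      unfolding pairwise_def disjnt_def by blast
    fix c p assume "p \<in> ?P c"
    then show "?h p \<in> carrier R" by (intro hc) blast
  qed
  also have "(\<Union>c\<in>?t ` (?X \<times> ?Y). ?P c) = ?X \<times> ?Y" by blast
  also have "(\<Oplus>p\<in>?X \<times> ?Y. ?h p) = (\<Oplus>a\<in>?X. \<Oplus>b\<in>?Y. f a \<otimes> g b \<otimes> m (tuple_mult a b))"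
    using fin(1,2) hc by (subst R.finsum_cartesian) auto
  also have "\<dots> = (\<Oplus>a\<in>?X. f a \<otimes> pairing g (\<lambda>b. m (tuple_mult a b)))"
  proof (rule R.finsum_cong')
    fix a assume a: "a \<in> ?X"
    have "f a \<otimes> pairing g (\<lambda>b. m (tuple_mult a b)) =
        (\<Oplus>b\<in>?Y. f a \<otimes> (g b \<otimes> m (tuple_mult a b)))"
      unfolding pairing_def using fin fc mc a by (intro R.finsum_rdistr) auto
    also have "\<dots> = (\<Oplus>b\<in>?Y. f a \<otimes> g b \<otimes> m (tuple_mult a b))"
      using fc mc a by (intro R.finsum_cong') (auto simp: R.m_assoc)
    finally show "(\<Oplus>b\<in>?Y. f a \<otimes> g b \<otimes> m (tuple_mult a b)) =
        f a \<otimes> pairing g (\<lambda>b. m (tuple_mult a b))" by simp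
  next
    have "pairing g (\<lambda>b. m (tuple_mult a b)) \<in> carrier R" if "a \<in> ?X" for a
      unfolding pairing_def using mc fc that by (intro R.finsum_closed) auto
    then show "(\<lambda>a. f a \<otimes> pairing g (\<lambda>b. m (tuple_mult a b))) \<in> ?X \<rightarrow> carrier R"
      using fc by auto
  qed simp
  finally show ?thesis by (simp add: pairing_def)
qed

lemma pairing_translate_closed [simp]:
  "g \<in> carrier F \<Longrightarrow> m \<in> E \<rightarrow> carrier R \<Longrightarrow>
    (\<lambda>a. pairing g (\<lambda>b. m (tuple_mult a b))) \<in> E \<rightarrow> carrier R"
  by (auto intro!: pairing_closed)

lemma free_mult_comm:
  assumes f: "f \<in> carrier F" and g: "g \<in> carrier F"
  shows "f \<otimes>\<^bsub>F\<^esub> g = g \<otimes>\<^bsub>F\<^esub> f"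
proof (rule free_eqI)
  fix m assume m: "m \<in> E \<rightarrow> carrier R"
  let ?X = "{a. f a \<noteq> \<zero>}" and ?Y = "{b. g b \<noteq> \<zero>}"
  have fin: "finite ?X" "finite ?Y" "?X \<subseteq> E" "?Y \<subseteq> E" using f g by (auto simp: free_carrier_iff)
  have fc: "f a \<in> carrier R" "g a \<in> carrier R" for a using f g by (auto simp: free_carrier_iff)
  have mc: "m (tuple_mult a b) \<in> carrier R" if "a \<in> ?X" "b \<in> ?Y" for a b
    using that fin by (intro funcset_mem[OF m] tuple_mult_closed) blast+
  have mc': "m (tuple_mult b a) \<in> carrier R" if "a \<in> ?X" "b \<in> ?Y" for a b
    using that fin by (intro funcset_mem[OF m] tuple_mult_closed) blast+
  have "pairing (f \<otimes>\<^bsub>F\<^esub> g) m = (\<Oplus>a\<in>?X. \<Oplus>b\<in>?Y. f a \<otimes> (g b \<otimes> m (tuple_mult a b)))"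
    unfolding pairing_mult[OF f g m] unfolding pairing_def using fin fc mc
    by (intro R.finsum_cong' R.finsum_rdistr) auto
  also have "\<dots> = (\<Oplus>b\<in>?Y. \<Oplus>a\<in>?X. f a \<otimes> (g b \<otimes> m (tuple_mult a b)))"
    using fin fc mc by (intro R.finsum_swap) auto
  also have "\<dots> = (\<Oplus>b\<in>?Y. \<Oplus>a\<in>?X. g b \<otimes> (f a \<otimes> m (tuple_mult b a)))"
  proof (intro R.finsum_cong' refl)
    fix a b assume ab: "a \<in> ?X" "b \<in> ?Y"
    then have "tuple_mult a b = tuple_mult b a" using fin tuple_mult_comm by blast
    then show "f a \<otimes> (g b \<otimes> m (tuple_mult a b)) = g b \<otimes> (f a \<otimes> m (tuple_mult b a))"
      using fc mc'[OF ab] by (simp add: R.m_lcomm)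
  qed (use fc mc' in auto)
  also have "\<dots> = pairing (g \<otimes>\<^bsub>F\<^esub> f) m"
    unfolding pairing_mult[OF g f m] unfolding pairing_def using fin fc mc'
    by (intro R.finsum_cong' R.finsum_rdistr[symmetric]) auto
  finally show "pairing (f \<otimes>\<^bsub>F\<^esub> g) m = pairing (g \<otimes>\<^bsub>F\<^esub> f) m" .
qed (use assms in auto)

lemma free_cring: "cring F"
proof -
  interpret FG: abelian_group F by (rule free_abelian_group)
  show ?thesis
  proof (rule cringI)
    show "comm_monoid F"
    proof (rule comm_monoidI)
      fix f g h assume fgh: "f \<in> carrier F" "g \<in> carrier F" "h \<in> carrier F"
      show "f \<otimes>\<^bsub>F\<^esub> g \<otimes>\<^bsub>F\<^esub> h = f \<otimes>\<^bsub>F\<^esub> (g \<otimes>\<^bsub>F\<^esub> h)"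
      proof (rule free_eqI)
        fix m assume m: "m \<in> E \<rightarrow> carrier R"
        then have m': "(\<lambda>b. m (tuple_mult a b)) \<in> E \<rightarrow> carrier R" if "a \<in> E" for a
          using that by blast
        have "pairing (f \<otimes>\<^bsub>F\<^esub> g \<otimes>\<^bsub>F\<^esub> h) m =
            pairing f (\<lambda>a. pairing g (\<lambda>b. pairing h (\<lambda>c. m (tuple_mult (tuple_mult a b) c))))"
          using fgh m by (simp add: pairing_mult)
        also have "\<dots> = pairing f (\<lambda>a. pairing (g \<otimes>\<^bsub>F\<^esub> h) (\<lambda>b. m (tuple_mult a b)))"
        proof (rule pairing_cong[OF fgh(1)])
          fix a assume a: "a \<in> E"
          have "pairing g (\<lambda>b. pairing h (\<lambda>c. m (tuple_mult (tuple_mult a b) c))) =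
              pairing g (\<lambda>b. pairing h (\<lambda>c. m (tuple_mult a (tuple_mult b c))))"
          proof (rule pairing_cong[OF fgh(2)])
            show "(\<lambda>b. pairing h (\<lambda>c. m (tuple_mult a (tuple_mult b c)))) \<in> E \<rightarrow> carrier R"
              by (rule pairing_translate_closed[OF fgh(3) m'[OF a]])
            fix b assume b: "b \<in> E"
            show "pairing h (\<lambda>c. m (tuple_mult (tuple_mult a b) c)) =
                pairing h (\<lambda>c. m (tuple_mult a (tuple_mult b c)))"
            proof (rule pairing_cong[OF fgh(3)])
              show "(\<lambda>c. m (tuple_mult a (tuple_mult b c))) \<in> E \<rightarrow> carrier R"
                using m'[OF a] b by blast
            qed (simp add: a b tuple_mult_assoc)
          qed
          then show "pairing g (\<lambda>b. pairing h (\<lambda>c. m (tuple_mult (tuple_mult a b) c))) =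
              pairing (g \<otimes>\<^bsub>F\<^esub> h) (\<lambda>b. m (tuple_mult a b))"
            by (simp add: pairing_mult[OF fgh(2,3) m'[OF a]])
        qed (use fgh m in \<open>simp\<close>)
        also have "\<dots> = pairing (f \<otimes>\<^bsub>F\<^esub> (g \<otimes>\<^bsub>F\<^esub> h)) m"
          using fgh m by (simp add: pairing_mult[of f])
        finally show "pairing (f \<otimes>\<^bsub>F\<^esub> g \<otimes>\<^bsub>F\<^esub> h) m = pairing (f \<otimes>\<^bsub>F\<^esub> (g \<otimes>\<^bsub>F\<^esub> h)) m" .
      qed (use fgh in simp_all)
    next
      fix f assume f: "f \<in> carrier F"
      show "\<one>\<^bsub>F\<^esub> \<otimes>\<^bsub>F\<^esub> f = f"
      proof (rule free_eqI)
        fix m assume m: "m \<in> E \<rightarrow> carrier R"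
        have "pairing (\<one>\<^bsub>F\<^esub> \<otimes>\<^bsub>F\<^esub> f) m = pairing f (\<lambda>b. m (tuple_mult tuple_one b))"
          using f m by (simp add: free_one pairing_mult pairing_free_gen)
        also have "\<dots> = pairing f m"
          by (rule pairing_cong[OF f m]) (simp only: tuple_mult_one)
        finally show "pairing (\<one>\<^bsub>F\<^esub> \<otimes>\<^bsub>F\<^esub> f) m = pairing f m" .
      next
        show "\<one>\<^bsub>F\<^esub> \<otimes>\<^bsub>F\<^esub> f \<in> carrier F"
          unfolding free_one using f by (intro free_mult_closed free_gen_closed tuple_one_closed)
      qed (rule f)
    next
      show "\<one>\<^bsub>F\<^esub> \<in> carrier F" by (simp add: free_one free_gen_closed)
    qed (rule free_mult_closed free_mult_comm; assumption)+
  next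
    fix f g h assume fgh: "f \<in> carrier F" "g \<in> carrier F" "h \<in> carrier F"
    show "(f \<oplus>\<^bsub>F\<^esub> g) \<otimes>\<^bsub>F\<^esub> h = f \<otimes>\<^bsub>F\<^esub> h \<oplus>\<^bsub>F\<^esub> g \<otimes>\<^bsub>F\<^esub> h"
    proof (rule free_eqI)
      interpret FG: abelian_group F by (rule free_abelian_group)
      show "(f \<oplus>\<^bsub>F\<^esub> g) \<otimes>\<^bsub>F\<^esub> h \<in> carrier F" "f \<otimes>\<^bsub>F\<^esub> h \<oplus>\<^bsub>F\<^esub> g \<otimes>\<^bsub>F\<^esub> h \<in> carrier F"
        using fgh by (simp_all add: free_mult_closed)
      fix m assume m: "m \<in> E \<rightarrow> carrier R"
      show "pairing ((f \<oplus>\<^bsub>F\<^esub> g) \<otimes>\<^bsub>F\<^esub> h) m = pairing (f \<otimes>\<^bsub>F\<^esub> h \<oplus>\<^bsub>F\<^esub> g \<otimes>\<^bsub>F\<^esub> h) m"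
        using fgh m by (simp add: pairing_mult pairing_add)
    qed
  qed (rule free_abelian_group)
qed

lemma free_smult_mult:
  assumes "r \<in> carrier R" "f \<in> carrier F" "g \<in> carrier F"
  shows "(r \<odot>\<^bsub>F\<^esub> f) \<otimes>\<^bsub>F\<^esub> g = r \<odot>\<^bsub>F\<^esub> (f \<otimes>\<^bsub>F\<^esub> g)"
proof (rule free_eqI)
  fix m assume m: "m \<in> E \<rightarrow> carrier R"
  show "pairing ((r \<odot>\<^bsub>F\<^esub> f) \<otimes>\<^bsub>F\<^esub> g) m = pairing (r \<odot>\<^bsub>F\<^esub> (f \<otimes>\<^bsub>F\<^esub> g)) m"
    using assms m by (simp add: pairing_mult pairing_smult free_smult_closed)
qed (use assms in \<open>auto intro: free_smult_closed\<close>)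

lemma free_algebra_algebra: "algebra R F"
proof (rule algebraI[OF R_cring free_cring])
  show "r \<odot>\<^bsub>F\<^esub> f \<in> carrier F" if "r \<in> carrier R" "f \<in> carrier F" for r f
    using that by (rule free_smult_closed)
  show "(r \<odot>\<^bsub>F\<^esub> f) \<otimes>\<^bsub>F\<^esub> g = r \<odot>\<^bsub>F\<^esub> (f \<otimes>\<^bsub>F\<^esub> g)"
    if "r \<in> carrier R" "f \<in> carrier F" "g \<in> carrier F" for r f g
    using that by (rule free_smult_mult)
qed (simp_all add: free_add free_smult free_carrier_iff R.l_distr R.r_distr R.m_assoc)

end

section \<open>Tensor powers and multilinear maps\<close>

sublocale algebra_power \<subseteq> FA: algebra R "free_algebra R A n"
  by (rule free_algebra_algebra)

context algebra_power
begin

abbreviation I where "I \<equiv> tensor_ideal R A n"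
abbreviation T where "T \<equiv> tensor_power R A n"
abbreviation pure where "pure \<equiv> pure_tensor R A n"

lemma tuple_upd_closed [simp]:
  "a \<in> E \<Longrightarrow> i \<in> {1..n} \<Longrightarrow> u \<in> carrier A \<Longrightarrow> a(i := u) \<in> E"
  by (auto simp: tuples_def PiE_iff extensional_def)

lemma tuple_nth_closed: "a \<in> E \<Longrightarrow> i \<in> {1..n} \<Longrightarrow> a i \<in> carrier A"
  by (auto simp: tuples_def)

lemma multilinear_rels_closed: "multilinear_rels R A n \<subseteq> carrier F"
  unfolding multilinear_rels_def
  by (auto simp del: fun_upd_apply)

lemma tensor_ideal_ideal: "ideal I F"
  unfolding tensor_ideal_def by (rule FA.genideal_ideal[OF multilinear_rels_closed])

lemma tensor_ideal_rels: "f \<in> multilinear_rels R A n \<Longrightarrow> f \<in> I"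
  unfolding tensor_ideal_def using FA.genideal_self[OF multilinear_rels_closed] by blast

lemma tensor_power_algebra: "algebra R T"
  unfolding tensor_power_def by (rule FA.algebra_algebra_Quot[OF tensor_ideal_ideal])

definition multilinear :: "((nat \<Rightarrow> 'c) \<Rightarrow> 'a) \<Rightarrow> bool" where
  "multilinear m \<longleftrightarrow> m \<in> E \<rightarrow> carrier R \<and>
    (\<forall>a\<in>E. \<forall>i\<in>{1..n}. \<forall>u\<in>carrier A. \<forall>v\<in>carrier A.
       m (a(i := u \<oplus>\<^bsub>A\<^esub> v)) = m (a(i := u)) \<oplus> m (a(i := v))) \<and>
    (\<forall>a\<in>E. \<forall>i\<in>{1..n}. \<forall>r\<in>carrier R. \<forall>u\<in>carrier A.
       m (a(i := r \<odot>\<^bsub>A\<^esub> u)) = r \<otimes> m (a(i := u)))"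

lemma multilinearD:
  assumes "multilinear m"
  shows "m \<in> E \<rightarrow> carrier R"
    and "a \<in> E \<Longrightarrow> i \<in> {1..n} \<Longrightarrow> u \<in> carrier A \<Longrightarrow> v \<in> carrier A \<Longrightarrow>
      m (a(i := u \<oplus>\<^bsub>A\<^esub> v)) = m (a(i := u)) \<oplus> m (a(i := v))"
    and "a \<in> E \<Longrightarrow> i \<in> {1..n} \<Longrightarrow> r \<in> carrier R \<Longrightarrow> u \<in> carrier A \<Longrightarrow>
      m (a(i := r \<odot>\<^bsub>A\<^esub> u)) = r \<otimes> m (a(i := u))"
  using assms unfolding multilinear_def by blast+

lemma multilinearI:
  assumes "m \<in> E \<rightarrow> carrier R"
    and "\<And>a i u v. a \<in> E \<Longrightarrow> i \<in> {1..n} \<Longrightarrow> u \<in> carrier A \<Longrightarrow> v \<in> carrier A \<Longrightarrow>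
      m (a(i := u \<oplus>\<^bsub>A\<^esub> v)) = m (a(i := u)) \<oplus> m (a(i := v))"
    and "\<And>a i r u. a \<in> E \<Longrightarrow> i \<in> {1..n} \<Longrightarrow> r \<in> carrier R \<Longrightarrow> u \<in> carrier A \<Longrightarrow>
      m (a(i := r \<odot>\<^bsub>A\<^esub> u)) = r \<otimes> m (a(i := u))"
  shows "multilinear m"
  using assms unfolding multilinear_def by blast

lemma tuple_mult_upd:
  assumes "i \<in> {1..n}"
  shows "tuple_mult b (a(i := u)) = (tuple_mult b a)(i := b i \<otimes>\<^bsub>A\<^esub> u)"
  using assms by (auto simp: tuple_mult_def restrict_def fun_eq_iff)

text \<open>
  Multilinear functions are stable under translation by a tuple, which is what makes the relations that
  they kill an ideal.
\<close>

lemma multilinear_translate: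
  assumes "multilinear m" "b \<in> E"
  shows "multilinear (\<lambda>a. m (tuple_mult b a))"
proof (rule multilinearI)
  show "(\<lambda>a. m (tuple_mult b a)) \<in> E \<rightarrow> carrier R"
    using multilinearD(1)[OF assms(1)] assms(2) by blast
next
  fix a i u v assume "a \<in> E" "i \<in> {1..n}" "u \<in> carrier A" "v \<in> carrier A"
  then show "m (tuple_mult b (a(i := u \<oplus>\<^bsub>A\<^esub> v))) =
      m (tuple_mult b (a(i := u))) \<oplus> m (tuple_mult b (a(i := v)))"
    using assms(2) tuple_nth_closed[OF assms(2)]
    by (simp add: tuple_mult_upd multilinearD(2)[OF assms(1)] r_distr)
next
  fix a i r u assume "a \<in> E" "i \<in> {1..n}" "r \<in> carrier R" "u \<in> carrier A"
  moreover from this have "b i \<otimes>\<^bsub>A\<^esub> (r \<odot>\<^bsub>A\<^esub> u) = r \<odot>\<^bsub>A\<^esub> (b i \<otimes>\<^bsub>A\<^esub> u)"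
    using tuple_nth_closed[OF assms(2)] by (simp add: m_comm[of "b i"] smult_assoc2)
  ultimately show "m (tuple_mult b (a(i := r \<odot>\<^bsub>A\<^esub> u))) = r \<otimes> m (tuple_mult b (a(i := u)))"
    using assms(2) tuple_nth_closed[OF assms(2)]
    by (simp add: tuple_mult_upd multilinearD(3)[OF assms(1)])
qed

lemma pairing_zero: "pairing \<zero>\<^bsub>F\<^esub> m = \<zero>"
  by (simp add: pairing_def free_zero)

lemma pairing_minus:
  assumes "f \<in> carrier F" "m \<in> E \<rightarrow> carrier R"
  shows "pairing (\<ominus>\<^bsub>F\<^esub> f) m = \<ominus> pairing f m"
proof -
  have "pairing f m \<oplus> pairing (\<ominus>\<^bsub>F\<^esub> f) m = \<zero>"
    using assms by (simp add: pairing_add[symmetric] FA.r_neg pairing_zero)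
  then show ?thesis
    using assms by (metis R.minus_equality R.a_comm pairing_closed FA.a_inv_closed)
qed

text \<open>
  The elements killed by all multilinear functions form an ideal that contains the multilinear relations.
  This is the universal property of the tensor power.
\<close>

lemma pairing_tensor_ideal:
  assumes "multilinear m" "f \<in> I"
  shows "pairing f m = \<zero>"
proof -
  define K where "K = {f \<in> carrier F. \<forall>m. multilinear m \<longrightarrow> pairing f m = \<zero>}"
  have "ideal K F"
  proof (rule idealI[OF FA.ring_axioms])
    show "subgroup K (add_monoid F)"
    proof (rule FA.add.subgroupI)
      show "K \<noteq> {}" using pairing_zero FA.zero_closed unfolding K_def by blast
    qed (auto simp: K_def pairing_minus pairing_add multilinearD(1))
    fix f g assume f: "f \<in> K" and g: "g \<in> carrier F"
    have "pairing (g \<otimes>\<^bsub>F\<^esub> f) m = \<zero>" if m: "multilinear m" for m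
    proof -
      have "pairing (g \<otimes>\<^bsub>F\<^esub> f) m = pairing g (\<lambda>a. pairing f (\<lambda>b. m (tuple_mult a b)))"
        using f g m by (simp add: K_def pairing_mult multilinearD(1))
      also have "\<dots> = pairing g (\<lambda>a. \<zero>)"
        using f g by (intro pairing_cong) (auto simp: K_def multilinear_translate[OF m])
      also have "\<dots> = \<zero>"
        unfolding pairing_def using free_carrierD(1)[OF g] by (intro R.add.finprod_one_eqI) simp
      finally show ?thesis .
    qed
    then show "g \<otimes>\<^bsub>F\<^esub> f \<in> K" using f g by (simp add: K_def)
    then show "f \<otimes>\<^bsub>F\<^esub> g \<in> K" using f g by (simp add: K_def free_mult_comm[of f g])
  qed
  moreover have "multilinear_rels R A n \<subseteq> K"
  proof
    fix f assume f: "f \<in> multilinear_rels R A n"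
    then have fc: "f \<in> carrier F" using multilinear_rels_closed by blast
    have "pairing f m = \<zero>" if m: "multilinear m" for m
    proof -
      note mc = funcset_mem[OF multilinearD(1)[OF m]]
      from f consider
        (add) a i u v where "a \<in> E" "i \<in> {1..n}" "u \<in> carrier A" "v \<in> carrier A"
          "f = free_gen R (a(i := u \<oplus>\<^bsub>A\<^esub> v)) \<ominus>\<^bsub>F\<^esub> (free_gen R (a(i := u)) \<oplus>\<^bsub>F\<^esub> free_gen R (a(i := v)))"
        | (smult) a i r u where "a \<in> E" "i \<in> {1..n}" "r \<in> carrier R" "u \<in> carrier A"
          "f = free_gen R (a(i := r \<odot>\<^bsub>A\<^esub> u)) \<ominus>\<^bsub>F\<^esub> (r \<odot>\<^bsub>F\<^esub> free_gen R (a(i := u)))"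
        unfolding multilinear_rels_def by blast
      then show ?thesis
      proof cases
        case add
        then have "pairing f m = m (a(i := u \<oplus>\<^bsub>A\<^esub> v)) \<ominus> (m (a(i := u)) \<oplus> m (a(i := v)))"
          by (simp add: FA.minus_eq R.minus_eq pairing_add pairing_minus pairing_free_gen
              multilinearD(1)[OF m] del: fun_upd_apply)
        also have "\<dots> = \<zero>"
          unfolding multilinearD(2)[OF m add(1-4)] using add mc tuple_upd_closed
          by (simp add: R.r_neg R.minus_eq del: fun_upd_apply)
        finally show ?thesis .
      next
        case smult
        then have "pairing f m = m (a(i := r \<odot>\<^bsub>A\<^esub> u)) \<ominus> r \<otimes> m (a(i := u))"
          by (simp add: FA.minus_eq R.minus_eq pairing_add pairing_minus pairing_smult
              pairing_free_gen multilinearD(1)[OF m] del: fun_upd_apply)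
        also have "\<dots> = \<zero>"
          unfolding multilinearD(3)[OF m smult(1-4)] using smult mc tuple_upd_closed
          by (simp add: R.r_neg R.minus_eq del: fun_upd_apply)
        finally show ?thesis .
      qed
    qed
    with fc show "f \<in> K" by (simp add: K_def)
  qed
  ultimately have "I \<subseteq> K" unfolding tensor_ideal_def by (rule FA.genideal_minimal)
  then show ?thesis using assms unfolding K_def by blast
qed

lemma carrier_tensor: "carrier T = {I +>\<^bsub>F\<^esub> f |f. f \<in> carrier F}"
  unfolding tensor_power_def by (rule FA.carrier_algebra_Quot)

lemma tensor_cases:
  assumes "t \<in> carrier T"
  obtains f where "f \<in> carrier F" "t = I +>\<^bsub>F\<^esub> f"
  using assms unfolding carrier_tensor by blast

lemma tensor_class_closed: "f \<in> carrier F \<Longrightarrow> I +>\<^bsub>F\<^esub> f \<in> carrier T"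
  unfolding carrier_tensor by blast

lemmas tensor_class_add = FA.algebra_Quot_add[OF tensor_ideal_ideal, folded tensor_power_def]
  and tensor_class_mult = FA.algebra_Quot_mult[OF tensor_ideal_ideal, folded tensor_power_def]
  and tensor_class_smult = FA.algebra_Quot_smult[OF tensor_ideal_ideal, folded tensor_power_def]

lemma tensor_class_one: "\<one>\<^bsub>T\<^esub> = I +>\<^bsub>F\<^esub> \<one>\<^bsub>F\<^esub>"
  unfolding tensor_power_def
  by (rule FA.algebra_Quot_one[OF tensor_ideal_ideal FA.zero_closed FA.zero_closed])

text \<open>
  For multilinear \<open>m\<close> all representatives of a class have the same pairing with \<open>m\<close>, so that the image
  of the class is a singleton.
\<close>

definition tensor_map :: "((nat \<Rightarrow> 'c) \<Rightarrow> 'a) \<Rightarrow> ((nat \<Rightarrow> 'c) \<Rightarrow> 'a) set \<Rightarrow> 'a" where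
  "tensor_map m t = the_elem ((\<lambda>f. pairing f m) ` t)"

lemma tensor_map_class:
  assumes m: "multilinear m" and f: "f \<in> carrier F"
  shows "tensor_map m (I +>\<^bsub>F\<^esub> f) = pairing f m"
proof -
  interpret I: ideal I F by (rule tensor_ideal_ideal)
  have "pairing g m = pairing f m" if g: "g \<in> I +>\<^bsub>F\<^esub> f" for g
  proof -
    obtain i where i: "i \<in> I" "g = i \<oplus>\<^bsub>F\<^esub> f" using g by (auto simp: a_r_coset_def')
    then show ?thesis
      using f I.Icarr[OF i(1)] multilinearD(1)[OF m] pairing_tensor_ideal[OF m i(1)]
      by (simp add: pairing_add)
  qed
  then have "(\<lambda>g. pairing g m) ` (I +>\<^bsub>F\<^esub> f) = (\<lambda>g. pairing f m) ` (I +>\<^bsub>F\<^esub> f)"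
    by (rule image_cong[OF refl])
  also have "\<dots> = {pairing f m}"
    by (rule image_constant[OF I.a_rcos_self[OF f]])
  finally have "(\<lambda>g. pairing g m) ` (I +>\<^bsub>F\<^esub> f) = {pairing f m}" .
  then show ?thesis by (simp add: tensor_map_def)
qed

lemma tensor_map_closed [simp]:
  "multilinear m \<Longrightarrow> t \<in> carrier T \<Longrightarrow> tensor_map m t \<in> carrier R"
  by (elim tensor_cases) (simp add: tensor_map_class multilinearD(1))

lemma tensor_map_add:
  "multilinear m \<Longrightarrow> t \<in> carrier T \<Longrightarrow> u \<in> carrier T \<Longrightarrow>
    tensor_map m (t \<oplus>\<^bsub>T\<^esub> u) = tensor_map m t \<oplus> tensor_map m u"
  by (elim tensor_cases) (simp add: tensor_map_class multilinearD(1) tensor_class_add pairing_add)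

lemma tensor_map_smult:
  "multilinear m \<Longrightarrow> r \<in> carrier R \<Longrightarrow> t \<in> carrier T \<Longrightarrow>
    tensor_map m (r \<odot>\<^bsub>T\<^esub> t) = r \<otimes> tensor_map m t"
  by (elim tensor_cases)
    (simp add: tensor_map_class multilinearD(1) tensor_class_smult pairing_smult)

lemma tensor_map_pure: "multilinear m \<Longrightarrow> a \<in> E \<Longrightarrow> tensor_map m (pure a) = m a"
  by (simp add: pure_tensor_def tensor_map_class multilinearD(1) pairing_free_gen)

lemma pure_closed [simp]: "a \<in> E \<Longrightarrow> pure a \<in> carrier T"
  unfolding pure_tensor_def by (intro tensor_class_closed free_gen_closed)

lemma free_gen_mult:
  assumes "a \<in> E" "b \<in> E"
  shows "free_gen R a \<otimes>\<^bsub>F\<^esub> free_gen R b = free_gen R (tuple_mult a b)"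
proof (rule free_eqI)
  fix m assume m: "m \<in> E \<rightarrow> carrier R"
  then have "(\<lambda>b. m (tuple_mult a b)) \<in> E \<rightarrow> carrier R" using assms by blast
  then show "pairing (free_gen R a \<otimes>\<^bsub>F\<^esub> free_gen R b) m = pairing (free_gen R (tuple_mult a b)) m"
    using assms m by (simp add: pairing_mult pairing_free_gen)
qed (use assms in simp_all)

lemma pure_mult: "a \<in> E \<Longrightarrow> b \<in> E \<Longrightarrow> pure a \<otimes>\<^bsub>T\<^esub> pure b = pure (tuple_mult a b)"
  unfolding pure_tensor_def by (simp add: tensor_class_mult free_gen_mult)

lemma pure_one: "\<one>\<^bsub>T\<^esub> = pure tuple_one"
  unfolding pure_tensor_def by (simp add: tensor_class_one free_one)

lemma pure_upd_add:
  assumes "a \<in> E" "i \<in> {1..n}" "u \<in> carrier A" "v \<in> carrier A"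
  shows "pure (a(i := u \<oplus>\<^bsub>A\<^esub> v)) = pure (a(i := u)) \<oplus>\<^bsub>T\<^esub> pure (a(i := v))"
proof -
  have "free_gen R (a(i := u \<oplus>\<^bsub>A\<^esub> v)) \<ominus>\<^bsub>F\<^esub> (free_gen R (a(i := u)) \<oplus>\<^bsub>F\<^esub> free_gen R (a(i := v))) \<in> I"
    using assms by (intro tensor_ideal_rels) (auto simp: multilinear_rels_def simp del: fun_upd_apply)
  then have "I +>\<^bsub>F\<^esub> free_gen R (a(i := u \<oplus>\<^bsub>A\<^esub> v)) =
      I +>\<^bsub>F\<^esub> (free_gen R (a(i := u)) \<oplus>\<^bsub>F\<^esub> free_gen R (a(i := v)))"
    using assms by (subst FA.algebra_Quot_eq_iff[OF tensor_ideal_ideal]) simp_all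
  then show ?thesis unfolding pure_tensor_def using assms by (simp add: tensor_class_add)
qed

lemma pure_upd_smult:
  assumes "a \<in> E" "i \<in> {1..n}" "r \<in> carrier R" "u \<in> carrier A"
  shows "pure (a(i := r \<odot>\<^bsub>A\<^esub> u)) = r \<odot>\<^bsub>T\<^esub> pure (a(i := u))"
proof -
  have "free_gen R (a(i := r \<odot>\<^bsub>A\<^esub> u)) \<ominus>\<^bsub>F\<^esub> (r \<odot>\<^bsub>F\<^esub> free_gen R (a(i := u))) \<in> I"
    using assms by (intro tensor_ideal_rels) (auto simp: multilinear_rels_def simp del: fun_upd_apply)
  then have "I +>\<^bsub>F\<^esub> free_gen R (a(i := r \<odot>\<^bsub>A\<^esub> u)) = I +>\<^bsub>F\<^esub> (r \<odot>\<^bsub>F\<^esub> free_gen R (a(i := u)))"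
    using assms by (subst FA.algebra_Quot_eq_iff[OF tensor_ideal_ideal]) simp_all
  then show ?thesis unfolding pure_tensor_def using assms by (simp add: tensor_class_smult)
qed

lemma free_induct:
  assumes f: "f \<in> carrier F"
    and zero: "P \<zero>\<^bsub>F\<^esub>"
    and step: "\<And>r a f. r \<in> carrier R \<Longrightarrow> a \<in> E \<Longrightarrow> f \<in> carrier F \<Longrightarrow> P f \<Longrightarrow>
      P (r \<odot>\<^bsub>F\<^esub> free_gen R a \<oplus>\<^bsub>F\<^esub> f)"
  shows "P f"
proof -
  have "P f" if "finite X" "f \<in> carrier F" "{a. f a \<noteq> \<zero>} \<subseteq> X" "X \<subseteq> E" for f X
    using that
  proof (induction X arbitrary: f rule: finite_induct)
    case empty
    then have "f = \<zero>\<^bsub>F\<^esub>" by (auto simp: free_zero)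
    then show ?case using zero by simp
  next
    case (insert a X)
    let ?g = "f(a := \<zero>)"
    have a: "a \<in> E" and fa: "f a \<in> carrier R" using insert free_carrierD(1) by auto
    have "{b. ?g b \<noteq> \<zero>} \<subseteq> X" using insert.prems(2) by auto
    moreover have g: "?g \<in> carrier F"
      unfolding free_carrier_iff
    proof (intro conjI allI)
      show "finite {b. ?g b \<noteq> \<zero>}" "{b. ?g b \<noteq> \<zero>} \<subseteq> E"
        using \<open>{b. ?g b \<noteq> \<zero>} \<subseteq> X\<close> insert.hyps(1) insert.prems(3) finite_subset by (blast, blast)
    qed (use free_carrierD(1)[OF insert.prems(1)] in simp)
    ultimately have "P ?g" using insert by blast
    moreover have "f = f a \<odot>\<^bsub>F\<^esub> free_gen R a \<oplus>\<^bsub>F\<^esub> ?g"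
    proof (rule ext)
      fix b
      show "f b = (f a \<odot>\<^bsub>F\<^esub> free_gen R a \<oplus>\<^bsub>F\<^esub> ?g) b"
        using free_carrierD(1)[OF insert.prems(1)]
        by (cases "b = a") (simp_all add: free_add free_smult free_gen_def)
    qed
    ultimately show ?case using step[OF fa a g] by simp
  qed
  then show ?thesis using f unfolding free_carrier_iff by blast
qed

lemma tensor_induct:
  assumes t: "t \<in> carrier T"
    and pure: "\<And>a. a \<in> E \<Longrightarrow> P (pure a)"
    and add: "\<And>t u. t \<in> carrier T \<Longrightarrow> u \<in> carrier T \<Longrightarrow> P t \<Longrightarrow> P u \<Longrightarrow> P (t \<oplus>\<^bsub>T\<^esub> u)"
    and smult: "\<And>r t. r \<in> carrier R \<Longrightarrow> t \<in> carrier T \<Longrightarrow> P t \<Longrightarrow> P (r \<odot>\<^bsub>T\<^esub> t)"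
  shows "P t"
proof -
  interpret T: algebra R T by (rule tensor_power_algebra)
  have 0: "P (I +>\<^bsub>F\<^esub> \<zero>\<^bsub>F\<^esub>)"
  proof -
    have "P (\<zero> \<odot>\<^bsub>T\<^esub> pure tuple_one)"
      by (intro smult pure pure_closed tuple_one_closed R.zero_closed)
    moreover have "\<zero> \<odot>\<^bsub>T\<^esub> pure tuple_one = I +>\<^bsub>F\<^esub> \<zero>\<^bsub>F\<^esub>"
      unfolding pure_tensor_def
      by (subst tensor_class_smult) (simp_all del: T.smult_l_null)
    ultimately show ?thesis by simp
  qed
  have "P (I +>\<^bsub>F\<^esub> f)" if f: "f \<in> carrier F" for f
    using f
  proof (rule free_induct)
    fix r a g assume g: "r \<in> carrier R" "a \<in> E" "g \<in> carrier F" "P (I +>\<^bsub>F\<^esub> g)"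
    then have "I +>\<^bsub>F\<^esub> (r \<odot>\<^bsub>F\<^esub> free_gen R a \<oplus>\<^bsub>F\<^esub> g) = r \<odot>\<^bsub>T\<^esub> pure a \<oplus>\<^bsub>T\<^esub> (I +>\<^bsub>F\<^esub> g)"
      unfolding pure_tensor_def by (simp add: tensor_class_smult tensor_class_add)
    moreover have "P (r \<odot>\<^bsub>T\<^esub> pure a)" by (rule smult[OF g(1) pure_closed[OF g(2)] pure[OF g(2)]])
    ultimately show "P (I +>\<^bsub>F\<^esub> (r \<odot>\<^bsub>F\<^esub> free_gen R a \<oplus>\<^bsub>F\<^esub> g))"
      using g add[of "r \<odot>\<^bsub>T\<^esub> pure a" "I +>\<^bsub>F\<^esub> g"] by (simp add: tensor_class_closed)
  qed (rule 0)
  with tensor_cases[OF t] show ?thesis by blast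
qed

definition permute_free :: "(nat \<Rightarrow> nat) \<Rightarrow> ((nat \<Rightarrow> 'c) \<Rightarrow> 'a) \<Rightarrow> (nat \<Rightarrow> 'c) \<Rightarrow> 'a" where
  "permute_free \<sigma> f = (\<lambda>b. f (b \<circ> \<sigma>))"

lemma tuple_comp_closed:
  assumes "\<sigma> permutes {1..n}" "a \<in> E"
  shows "a \<circ> \<sigma> \<in> E"
proof -
  have "a (\<sigma> i) = undefined" if "i \<notin> {1..n}" for i
    using assms permutes_not_in[OF assms(1) that] that
    by (auto simp: tuples_def PiE_iff extensional_def)
  moreover have "a (\<sigma> i) \<in> carrier A" if "i \<in> {1..n}" for i
    by (rule tuple_nth_closed[OF assms(2)]) (use assms(1) that permutes_in_image in metis)
  ultimately show ?thesis by (simp add: tuples_def PiE_iff extensional_def)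
qed

lemma comp_inv_eq_iff:
  assumes "\<sigma> permutes S"
  shows "b \<circ> \<sigma> = a \<longleftrightarrow> b = a \<circ> inv' \<sigma>"
  using permutes_inv_o[OF assms] by (metis comp_assoc comp_id)

lemma permute_free_support:
  assumes "\<sigma> permutes {1..n}"
  shows "{b. permute_free \<sigma> f b \<noteq> \<zero>} = (\<lambda>a. a \<circ> inv' \<sigma>) ` {a. f a \<noteq> \<zero>}"
proof (intro equalityI subsetI)
  fix b assume "b \<in> {b. permute_free \<sigma> f b \<noteq> \<zero>}"
  then have "f (b \<circ> \<sigma>) \<noteq> \<zero>" "b = (b \<circ> \<sigma>) \<circ> inv' \<sigma>"
    using comp_inv_eq_iff[OF assms, of b "b \<circ> \<sigma>"] by (simp_all add: permute_free_def)
  then show "b \<in> (\<lambda>a. a \<circ> inv' \<sigma>) ` {a. f a \<noteq> \<zero>}" by blast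
next
  fix b assume "b \<in> (\<lambda>a. a \<circ> inv' \<sigma>) ` {a. f a \<noteq> \<zero>}"
  then obtain a where "f a \<noteq> \<zero>" "b = a \<circ> inv' \<sigma>" by blast
  then show "b \<in> {b. permute_free \<sigma> f b \<noteq> \<zero>}"
    using comp_inv_eq_iff[OF assms, of b a] by (simp add: permute_free_def)
qed

lemma permute_free_closed:
  assumes "\<sigma> permutes {1..n}" "f \<in> carrier F"
  shows "permute_free \<sigma> f \<in> carrier F"
  unfolding free_carrier_iff permute_free_support[OF assms(1)]
proof (intro conjI allI)
  show "(\<lambda>a. a \<circ> inv' \<sigma>) ` {a. f a \<noteq> \<zero>} \<subseteq> E"
    using free_carrierD(3)[OF assms(2)] tuple_comp_closed[OF permutes_inv[OF assms(1)]]
    by (intro image_subsetI) simp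
qed (use free_carrierD(1,2)[OF assms(2)] in \<open>simp_all add: permute_free_def\<close>)

lemma pairing_permute:
  assumes \<sigma>: "\<sigma> permutes {1..n}" and f: "f \<in> carrier F" and m: "m \<in> E \<rightarrow> carrier R"
  shows "pairing (permute_free \<sigma> f) m = pairing f (\<lambda>a. m (a \<circ> inv' \<sigma>))"
proof -
  have inj: "inj_on (\<lambda>a. a \<circ> inv' \<sigma>) {a. f a \<noteq> \<zero>}"
    by (intro inj_onI) (metis comp_assoc comp_id permutes_inv_o(2)[OF \<sigma>])
  have s: "permute_free \<sigma> f (a \<circ> inv' \<sigma>) = f a" for a
    using permutes_inv_o(2)[OF \<sigma>] by (simp add: permute_free_def comp_assoc)
  have "m (a \<circ> inv' \<sigma>) \<in> carrier R" if "f a \<noteq> \<zero>" for a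
    using free_carrierD(3)[OF f that] by (intro funcset_mem[OF m] tuple_comp_closed permutes_inv[OF \<sigma>])
  then show ?thesis
    unfolding pairing_def permute_free_support[OF \<sigma>]
    by (subst R.finsum_reindex) (auto simp: s inj free_carrierD(1)[OF f])
qed

lemma tuple_mult_comp:
  assumes "\<sigma> permutes {1..n}"
  shows "tuple_mult a b \<circ> \<sigma> = tuple_mult (a \<circ> \<sigma>) (b \<circ> \<sigma>)"
  using permutes_in_image[OF assms] by (auto simp: tuple_mult_def fun_eq_iff restrict_def)

lemma permute_free_add: "permute_free \<sigma> (f \<oplus>\<^bsub>F\<^esub> g) = permute_free \<sigma> f \<oplus>\<^bsub>F\<^esub> permute_free \<sigma> g"
  and permute_free_smult: "permute_free \<sigma> (r \<odot>\<^bsub>F\<^esub> f) = r \<odot>\<^bsub>F\<^esub> permute_free \<sigma> f"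
  and permute_free_zero: "permute_free \<sigma> \<zero>\<^bsub>F\<^esub> = \<zero>\<^bsub>F\<^esub>"
  by (simp_all add: permute_free_def free_add free_smult free_zero)

lemma permute_free_gen:
  "\<sigma> permutes {1..n} \<Longrightarrow> permute_free \<sigma> (free_gen R a) = free_gen R (a \<circ> inv' \<sigma>)"
  by (simp add: permute_free_def free_gen_def comp_inv_eq_iff)

lemma permute_free_mult:
  assumes \<sigma>: "\<sigma> permutes {1..n}" and fg: "f \<in> carrier F" "g \<in> carrier F"
  shows "permute_free \<sigma> (f \<otimes>\<^bsub>F\<^esub> g) = permute_free \<sigma> f \<otimes>\<^bsub>F\<^esub> permute_free \<sigma> g"
proof (rule free_eqI)
  fix m assume m: "m \<in> E \<rightarrow> carrier R"
  have m': "(\<lambda>a. m (a \<circ> inv' \<sigma>)) \<in> E \<rightarrow> carrier R"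
    using tuple_comp_closed[OF permutes_inv[OF \<sigma>]] m by blast
  have m'': "(\<lambda>b. m (tuple_mult a b)) \<in> E \<rightarrow> carrier R" if "a \<in> E" for a
    using that m by blast
  have "pairing (permute_free \<sigma> f \<otimes>\<^bsub>F\<^esub> permute_free \<sigma> g) m =
      pairing f (\<lambda>a. pairing (permute_free \<sigma> g) (\<lambda>b. m (tuple_mult (a \<circ> inv' \<sigma>) b)))"
    using fg m by (simp add: pairing_mult pairing_permute[OF \<sigma>] permute_free_closed[OF \<sigma>])
  also have "\<dots> = pairing f (\<lambda>a. pairing g (\<lambda>b. m (tuple_mult a b \<circ> inv' \<sigma>)))"
  proof (rule pairing_cong[OF fg(1)])
    show "(\<lambda>a. pairing g (\<lambda>b. m (tuple_mult a b \<circ> inv' \<sigma>))) \<in> E \<rightarrow> carrier R"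
      by (rule pairing_translate_closed[OF fg(2) m'])
    fix a assume "a \<in> E"
    then have "a \<circ> inv' \<sigma> \<in> E" by (rule tuple_comp_closed[OF permutes_inv[OF \<sigma>]])
    then show "pairing (permute_free \<sigma> g) (\<lambda>b. m (tuple_mult (a \<circ> inv' \<sigma>) b)) =
        pairing g (\<lambda>b. m (tuple_mult a b \<circ> inv' \<sigma>))"
      by (simp add: pairing_permute[OF \<sigma> fg(2) m''] tuple_mult_comp[OF permutes_inv[OF \<sigma>]])
  qed
  also have "\<dots> = pairing (permute_free \<sigma> (f \<otimes>\<^bsub>F\<^esub> g)) m"
    using fg m m' by (simp add: pairing_mult pairing_permute[OF \<sigma>])
  finally show "pairing (permute_free \<sigma> (f \<otimes>\<^bsub>F\<^esub> g)) m =
      pairing (permute_free \<sigma> f \<otimes>\<^bsub>F\<^esub> permute_free \<sigma> g) m" by simp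
qed (use fg in \<open>simp_all add: permute_free_closed[OF \<sigma>]\<close>)

text \<open>
  Permuting positions maps a multilinear relation in position \<open>i\<close> to one in position \<open>\<sigma> i\<close>, and is
  multiplicative.
\<close>

lemma permute_tensor_ideal:
  assumes \<sigma>: "\<sigma> permutes {1..n}" and f: "f \<in> I"
  shows "permute_free \<sigma> f \<in> I"
proof -
  interpret I: ideal I F by (rule tensor_ideal_ideal)
  define K where "K = {f \<in> carrier F. permute_free \<sigma> f \<in> I}"
  have minus: "permute_free \<sigma> (\<ominus>\<^bsub>F\<^esub> f) = \<ominus>\<^bsub>F\<^esub> permute_free \<sigma> f" if "f \<in> carrier F" for f
  proof -
    have "permute_free \<sigma> (\<ominus>\<^bsub>F\<^esub> f) \<oplus>\<^bsub>F\<^esub> permute_free \<sigma> f = \<zero>\<^bsub>F\<^esub>"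
      using that by (simp add: permute_free_add[symmetric] FA.l_neg permute_free_zero)
    then show ?thesis
      using that permute_free_closed[OF \<sigma>] FA.minus_equality FA.a_inv_closed by metis
  qed
  have "ideal K F"
  proof (rule idealI[OF FA.ring_axioms])
    show "subgroup K (add_monoid F)"
    proof (rule FA.add.subgroupI)
      have "\<zero>\<^bsub>F\<^esub> \<in> K" by (simp add: K_def permute_free_zero)
      then show "K \<noteq> {}" by blast
    qed (auto simp: K_def minus permute_free_add)
    fix f g assume f: "f \<in> K" and g: "g \<in> carrier F"
    then show "g \<otimes>\<^bsub>F\<^esub> f \<in> K" "f \<otimes>\<^bsub>F\<^esub> g \<in> K"
      by (simp_all add: K_def permute_free_mult[OF \<sigma>] permute_free_closed[OF \<sigma>] I.I_l_closed I.I_r_closed)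
  qed
  moreover have "multilinear_rels R A n \<subseteq> K"
  proof
    fix f assume f: "f \<in> multilinear_rels R A n"
    then have fc: "f \<in> carrier F" using multilinear_rels_closed by blast
    have upd: "a(i := u) \<circ> inv' \<sigma> = (a \<circ> inv' \<sigma>)(\<sigma> i := u)" for a :: "nat \<Rightarrow> 'c" and i u
      using permutes_inverses[OF \<sigma>] by (auto simp: fun_eq_iff)
    from f consider
      (add) a i u v where "a \<in> E" "i \<in> {1..n}" "u \<in> carrier A" "v \<in> carrier A"
        "f = free_gen R (a(i := u \<oplus>\<^bsub>A\<^esub> v)) \<ominus>\<^bsub>F\<^esub> (free_gen R (a(i := u)) \<oplus>\<^bsub>F\<^esub> free_gen R (a(i := v)))"
      | (smult) a i r u where "a \<in> E" "i \<in> {1..n}" "r \<in> carrier R" "u \<in> carrier A"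
        "f = free_gen R (a(i := r \<odot>\<^bsub>A\<^esub> u)) \<ominus>\<^bsub>F\<^esub> (r \<odot>\<^bsub>F\<^esub> free_gen R (a(i := u)))"
      unfolding multilinear_rels_def by blast
    then have "permute_free \<sigma> f \<in> multilinear_rels R A n"
    proof cases
      case add
      have "permute_free \<sigma> f = free_gen R ((a \<circ> inv' \<sigma>)(\<sigma> i := u \<oplus>\<^bsub>A\<^esub> v)) \<ominus>\<^bsub>F\<^esub>
          (free_gen R ((a \<circ> inv' \<sigma>)(\<sigma> i := u)) \<oplus>\<^bsub>F\<^esub> free_gen R ((a \<circ> inv' \<sigma>)(\<sigma> i := v)))"
        using add by (simp add: FA.minus_eq permute_free_add minus permute_free_gen[OF \<sigma>] upd del: fun_upd_apply)
      moreover have "a \<circ> inv' \<sigma> \<in> E" "\<sigma> i \<in> {1..n}"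
        using add(1,2) permutes_in_image[OF \<sigma>] tuple_comp_closed[OF permutes_inv[OF \<sigma>]] by blast+
      ultimately show ?thesis using add(3,4) unfolding multilinear_rels_def by blast
    next
      case smult
      have "permute_free \<sigma> f = free_gen R ((a \<circ> inv' \<sigma>)(\<sigma> i := r \<odot>\<^bsub>A\<^esub> u)) \<ominus>\<^bsub>F\<^esub>
          (r \<odot>\<^bsub>F\<^esub> free_gen R ((a \<circ> inv' \<sigma>)(\<sigma> i := u)))"
        using smult by (simp add: FA.minus_eq permute_free_add permute_free_smult minus
            permute_free_gen[OF \<sigma>] upd del: fun_upd_apply)
      moreover have "a \<circ> inv' \<sigma> \<in> E" "\<sigma> i \<in> {1..n}"
        using smult(1,2) permutes_in_image[OF \<sigma>] tuple_comp_closed[OF permutes_inv[OF \<sigma>]] by blast+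
      ultimately show ?thesis using smult(3,4) unfolding multilinear_rels_def by blast
    qed
    then show "f \<in> K" using fc tensor_ideal_rels by (simp add: K_def)
  qed
  ultimately have "I \<subseteq> K" unfolding tensor_ideal_def by (rule FA.genideal_minimal)
  then show ?thesis using f unfolding K_def by blast
qed

text \<open>
  The image of a class is a whole class, because the inverse permutation preserves the ideal as well.
\<close>

lemma perm_tensor_class:
  assumes \<sigma>: "\<sigma> permutes {1..n}" and f: "f \<in> carrier F"
  shows "perm_tensor \<sigma> (I +>\<^bsub>F\<^esub> f) = I +>\<^bsub>F\<^esub> permute_free \<sigma> f"
proof -
  have "permute_free \<sigma> ` I = I"
  proof
    show "permute_free \<sigma> ` I \<subseteq> I" using permute_tensor_ideal[OF \<sigma>] by blast
    show "I \<subseteq> permute_free \<sigma> ` I"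
    proof
      fix g assume "g \<in> I"
      then have "permute_free (inv' \<sigma>) g \<in> I" by (rule permute_tensor_ideal[OF permutes_inv[OF \<sigma>]])
      moreover have "g = permute_free \<sigma> (permute_free (inv' \<sigma>) g)"
        by (simp add: permute_free_def comp_assoc permutes_inv_o[OF \<sigma>])
      ultimately show "g \<in> permute_free \<sigma> ` I" by blast
    qed
  qed
  then have "I +>\<^bsub>F\<^esub> permute_free \<sigma> f = (\<Union>g\<in>permute_free \<sigma> ` I. {g \<oplus>\<^bsub>F\<^esub> permute_free \<sigma> f})"
    by (simp add: a_r_coset_def')
  also have "\<dots> = permute_free \<sigma> ` (I +>\<^bsub>F\<^esub> f)"
    by (simp add: a_r_coset_def' image_UN permute_free_add)
  finally show ?thesis by (simp add: perm_tensor_def permute_free_def[abs_def])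
qed

end

section \<open>Permutation of tensor factors\<close>

lemma ring_hom_cringI2: "cring R \<Longrightarrow> cring S \<Longrightarrow> h \<in> ring_hom R S \<Longrightarrow> ring_hom_cring R S h"
  by (simp add: ring_hom_cringI ring_hom_ringI2 cring.axioms(1))

sublocale algebra_power \<subseteq> T: algebra R "tensor_power R A n"
  by (rule tensor_power_algebra)

context algebra_power
begin

abbreviation at where "at \<equiv> tensor_at R A n"

lemma
  assumes \<sigma>: "\<sigma> permutes {1..n}"
  shows perm_tensor_closed: "t \<in> carrier T \<Longrightarrow> perm_tensor \<sigma> t \<in> carrier T"
    and perm_tensor_add: "t \<in> carrier T \<Longrightarrow> u \<in> carrier T \<Longrightarrow>
      perm_tensor \<sigma> (t \<oplus>\<^bsub>T\<^esub> u) = perm_tensor \<sigma> t \<oplus>\<^bsub>T\<^esub> perm_tensor \<sigma> u"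
    and perm_tensor_mult: "t \<in> carrier T \<Longrightarrow> u \<in> carrier T \<Longrightarrow>
      perm_tensor \<sigma> (t \<otimes>\<^bsub>T\<^esub> u) = perm_tensor \<sigma> t \<otimes>\<^bsub>T\<^esub> perm_tensor \<sigma> u"
    and perm_tensor_smult: "r \<in> carrier R \<Longrightarrow> t \<in> carrier T \<Longrightarrow>
      perm_tensor \<sigma> (r \<odot>\<^bsub>T\<^esub> t) = r \<odot>\<^bsub>T\<^esub> perm_tensor \<sigma> t"
    and perm_tensor_pure: "a \<in> E \<Longrightarrow> perm_tensor \<sigma> (pure a) = pure (a \<circ> inv' \<sigma>)"
proof -
  note cl = permute_free_closed[OF \<sigma>] perm_tensor_class[OF \<sigma>]
  show "t \<in> carrier T \<Longrightarrow> perm_tensor \<sigma> t \<in> carrier T"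
    by (elim tensor_cases) (simp add: cl tensor_class_closed)
  show "t \<in> carrier T \<Longrightarrow> u \<in> carrier T \<Longrightarrow>
      perm_tensor \<sigma> (t \<oplus>\<^bsub>T\<^esub> u) = perm_tensor \<sigma> t \<oplus>\<^bsub>T\<^esub> perm_tensor \<sigma> u"
    by (elim tensor_cases) (simp add: cl tensor_class_add permute_free_add)
  show "t \<in> carrier T \<Longrightarrow> u \<in> carrier T \<Longrightarrow>
      perm_tensor \<sigma> (t \<otimes>\<^bsub>T\<^esub> u) = perm_tensor \<sigma> t \<otimes>\<^bsub>T\<^esub> perm_tensor \<sigma> u"
    by (elim tensor_cases) (simp add: cl tensor_class_mult permute_free_mult[OF \<sigma>])
  show "r \<in> carrier R \<Longrightarrow> t \<in> carrier T \<Longrightarrow>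
      perm_tensor \<sigma> (r \<odot>\<^bsub>T\<^esub> t) = r \<odot>\<^bsub>T\<^esub> perm_tensor \<sigma> t"
    by (elim tensor_cases) (simp add: cl tensor_class_smult permute_free_smult free_smult_closed)
  show "a \<in> E \<Longrightarrow> perm_tensor \<sigma> (pure a) = pure (a \<circ> inv' \<sigma>)"
    by (simp add: pure_tensor_def cl permute_free_gen[OF \<sigma>])
qed

lemma perm_tensor_comp: "perm_tensor \<sigma> (perm_tensor \<tau> t) = perm_tensor (\<sigma> \<circ> \<tau>) t"
  by (simp add: perm_tensor_def image_image comp_assoc)

lemma tuple_one_comp: "\<sigma> permutes {1..n} \<Longrightarrow> tuple_one \<circ> \<sigma> = tuple_one"
  using permutes_in_image by (fastforce simp: tuple_one_def fun_eq_iff restrict_def)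

lemma perm_tensor_hom:
  assumes "\<sigma> permutes {1..n}"
  shows "ring_hom_cring T T (perm_tensor \<sigma>)"
proof (rule ring_hom_cringI2[OF T.M_cring T.M_cring])
  show "perm_tensor \<sigma> \<in> ring_hom T T"
    using assms permutes_inv[OF assms]
    by (intro ring_hom_memI)
      (simp_all add: perm_tensor_closed perm_tensor_add perm_tensor_mult perm_tensor_pure pure_one
        tuple_one_comp)
qed

lemma multilinear_permute:
  assumes m: "multilinear m" and \<sigma>: "\<sigma> permutes {1..n}"
  shows "multilinear (\<lambda>a. m (a \<circ> \<sigma>))"
proof (rule multilinearI)
  show "(\<lambda>a. m (a \<circ> \<sigma>)) \<in> E \<rightarrow> carrier R"
    using multilinearD(1)[OF m] tuple_comp_closed[OF \<sigma>] by blast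
  have upd: "a(i := u) \<circ> \<sigma> = (a \<circ> \<sigma>)(inv' \<sigma> i := u)" for a :: "nat \<Rightarrow> 'c" and i u
    using permutes_inverses[OF \<sigma>] by (auto simp: fun_eq_iff)
  have i: "inv' \<sigma> i \<in> {1..n}" if "i \<in> {1..n}" for i
    using that permutes_in_image[OF permutes_inv[OF \<sigma>]] by blast
  show "m (a(i := u \<oplus>\<^bsub>A\<^esub> v) \<circ> \<sigma>) = m (a(i := u) \<circ> \<sigma>) \<oplus> m (a(i := v) \<circ> \<sigma>)"
    if "a \<in> E" "i \<in> {1..n}" "u \<in> carrier A" "v \<in> carrier A" for a i u v
    unfolding upd by (rule multilinearD(2)[OF m tuple_comp_closed[OF \<sigma> that(1)] i[OF that(2)] that(3,4)])
  show "m (a(i := r \<odot>\<^bsub>A\<^esub> u) \<circ> \<sigma>) = r \<otimes> m (a(i := u) \<circ> \<sigma>)"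
    if "a \<in> E" "i \<in> {1..n}" "r \<in> carrier R" "u \<in> carrier A" for a i r u
    unfolding upd by (rule multilinearD(3)[OF m tuple_comp_closed[OF \<sigma> that(1)] i[OF that(2)] that(3,4)])
qed

lemma tensor_map_permute:
  assumes m: "multilinear m" and \<sigma>: "\<sigma> permutes {1..n}" and t: "t \<in> carrier T"
  shows "tensor_map m (perm_tensor \<sigma> t) = tensor_map (\<lambda>a. m (a \<circ> inv' \<sigma>)) t"
proof -
  obtain f where f: "f \<in> carrier F" "t = I +>\<^bsub>F\<^esub> f" using tensor_cases[OF t] .
  then show ?thesis
    using m multilinear_permute[OF m permutes_inv[OF \<sigma>]]
    by (simp add: perm_tensor_class[OF \<sigma>] tensor_map_class permute_free_closed[OF \<sigma>]
        pairing_permute[OF \<sigma>] multilinearD(1))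
qed

lemma tensor_at_eq: "i \<in> {1..n} \<Longrightarrow> at i a = pure (tuple_one(i := a))"
  unfolding tensor_at_def by (intro arg_cong[where f = pure]) (auto simp: tuple_one_def fun_eq_iff)

lemma tensor_at_closed [simp]: "i \<in> {1..n} \<Longrightarrow> a \<in> carrier A \<Longrightarrow> at i a \<in> carrier T"
  unfolding tensor_at_eq by (intro pure_closed tuple_upd_closed tuple_one_closed)

lemma tensor_at_smult:
  "i \<in> {1..n} \<Longrightarrow> r \<in> carrier R \<Longrightarrow> a \<in> carrier A \<Longrightarrow> at i (r \<odot>\<^bsub>A\<^esub> a) = r \<odot>\<^bsub>T\<^esub> at i a"
  by (simp only: tensor_at_eq pure_upd_smult tuple_one_closed)

lemma tensor_at_hom:
  assumes i: "i \<in> {1..n}"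
  shows "ring_hom_cring A T (at i)"
proof (rule ring_hom_cringI2[OF M_cring T.M_cring])
  show "at i \<in> ring_hom A T"
  proof (rule ring_hom_memI)
    fix a b assume ab: "a \<in> carrier A" "b \<in> carrier A"
    show "at i a \<in> carrier T" using i ab by simp
    show "at i (a \<oplus>\<^bsub>A\<^esub> b) = at i a \<oplus>\<^bsub>T\<^esub> at i b"
      using i ab by (simp only: tensor_at_eq pure_upd_add tuple_one_closed)
    have "tuple_mult (tuple_one(i := a)) (tuple_one(i := b)) = tuple_one(i := a \<otimes>\<^bsub>A\<^esub> b)"
      using i by (auto simp: tuple_mult_def tuple_one_def fun_eq_iff restrict_def)
    then show "at i (a \<otimes>\<^bsub>A\<^esub> b) = at i a \<otimes>\<^bsub>T\<^esub> at i b"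
      using i ab by (simp only: tensor_at_eq pure_mult tuple_upd_closed tuple_one_closed)
  next
    have "tuple_one(i := \<one>\<^bsub>A\<^esub>) = tuple_one" using i by (auto simp: tuple_one_def fun_eq_iff)
    then show "at i \<one>\<^bsub>A\<^esub> = \<one>\<^bsub>T\<^esub>" using i by (simp only: tensor_at_eq pure_one)
  qed
qed

lemma perm_tensor_at:
  assumes \<sigma>: "\<sigma> permutes {1..n}" and i: "i \<in> {1..n}" and a: "a \<in> carrier A"
  shows "perm_tensor \<sigma> (at i a) = at (\<sigma> i) a"
proof -
  have "\<sigma> i \<in> {1..n}" using i permutes_in_image[OF \<sigma>] by blast
  moreover have "tuple_one(i := a) \<circ> inv' \<sigma> = tuple_one(\<sigma> i := a)"
    using tuple_one_comp[OF permutes_inv[OF \<sigma>]] permutes_inverses[OF \<sigma>]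
    by (auto simp: fun_eq_iff)
  ultimately show ?thesis
    using i a by (simp only: tensor_at_eq perm_tensor_pure[OF \<sigma>] tuple_upd_closed tuple_one_closed)
qed

lemma pure_eq_finprod:
  assumes S: "S \<subseteq> {1..n}" and a: "\<And>i. i \<in> S \<Longrightarrow> a i \<in> carrier A"
  shows "(\<Otimes>\<^bsub>T\<^esub>i\<in>S. at i (a i)) = pure (\<lambda>j\<in>{1..n}. if j \<in> S then a j else \<one>\<^bsub>A\<^esub>)"
proof -
  have "finite S" using S finite_subset by blast
  then show ?thesis
    using assms
  proof (induction S rule: finite_induct)
    case empty
    then show ?case by (simp add: pure_one tuple_one_def restrict_def)
  next
    case (insert x S)
    let ?b = "\<lambda>j\<in>{1..n}. if j \<in> S then a j else \<one>\<^bsub>A\<^esub>"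
    have x: "x \<in> {1..n}" "a x \<in> carrier A" using insert by auto
    have b: "?b \<in> E" using insert by (auto simp: tuples_def)
    have ih: "(\<Otimes>\<^bsub>T\<^esub>i\<in>S. at i (a i)) = pure ?b" using insert by blast
    have "(\<Otimes>\<^bsub>T\<^esub>i\<in>insert x S. at i (a i)) = at x (a x) \<otimes>\<^bsub>T\<^esub> (\<Otimes>\<^bsub>T\<^esub>i\<in>S. at i (a i))"
      using insert x by (intro T.finprod_insert) auto
    also have "\<dots> = pure (tuple_mult (tuple_one(x := a x)) ?b)"
      by (simp only: ih tensor_at_eq[OF x(1)] pure_mult tuple_upd_closed tuple_one_closed x b)
    also have "tuple_mult (tuple_one(x := a x)) ?b =
        (\<lambda>j\<in>{1..n}. if j \<in> insert x S then a j else \<one>\<^bsub>A\<^esub>)"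
    proof
      fix j
      show "tuple_mult (tuple_one(x := a x)) ?b j =
          (\<lambda>j\<in>{1..n}. if j \<in> insert x S then a j else \<one>\<^bsub>A\<^esub>) j"
        using x insert.hyps insert.prems(2)[of j]
        by (cases "j \<in> {1..n}") (auto simp: tuple_mult_def tuple_one_def)
    qed
    finally show ?case .
  qed
qed

abbreviation esym where "esym \<equiv> tensor_elem_sym R A n"

lemma esym_closed [simp]: "a \<in> carrier A \<Longrightarrow> esym k a \<in> carrier T"
  unfolding tensor_elem_sym_def
  by (intro T.finsum_closed Pi_I T.finprod_closed tensor_at_closed) auto

lemma esym_eq_pure:
  assumes "a \<in> carrier A"
  shows "esym k a = (\<Oplus>\<^bsub>T\<^esub>S\<in>{S. S \<subseteq> {1..n} \<and> card S = k}.
    pure (\<lambda>j\<in>{1..n}. if j \<in> S then a else \<one>\<^bsub>A\<^esub>))"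
  unfolding tensor_elem_sym_def
proof (rule T.finsum_cong'[OF refl])
  show "(\<Otimes>\<^bsub>T\<^esub>i\<in>S. at i a) = pure (\<lambda>j\<in>{1..n}. if j \<in> S then a else \<one>\<^bsub>A\<^esub>)"
    if "S \<in> {S. S \<subseteq> {1..n} \<and> card S = k}" for S
    using that assms by (intro pure_eq_finprod) auto
  show "(\<lambda>S. pure (\<lambda>j\<in>{1..n}. if j \<in> S then a else \<one>\<^bsub>A\<^esub>)) \<in>
      {S. S \<subseteq> {1..n} \<and> card S = k} \<rightarrow> carrier T"
    using assms by (intro Pi_I pure_closed) (simp add: tuples_def)
qed

text \<open>
  A permutation of the positions permutes the summands of an elementary symmetric polynomial.
\<close>

lemma perm_tensor_esym:
  assumes \<sigma>: "\<sigma> permutes {1..n}" and a: "a \<in> carrier A"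
  shows "perm_tensor \<sigma> (esym k a) = esym k a"
proof -
  interpret h: ring_hom_cring T T "perm_tensor \<sigma>" by (rule perm_tensor_hom[OF \<sigma>])
  let ?K = "{S. S \<subseteq> {1..n} \<and> card S = k}"
  let ?p = "\<lambda>S. \<Otimes>\<^bsub>T\<^esub>i\<in>S. at i a"
  have at: "at i a \<in> carrier T" if "i \<in> S" "S \<in> ?K" for i S using that a by auto
  then have pc: "?p S \<in> carrier T" if "S \<in> ?K" for S using that by (intro T.finprod_closed) auto
  have inj: "inj_on \<sigma> X" for X using permutes_inj[OF \<sigma>] inj_on_subset by blast
  have img: "(`) \<sigma> ` ?K = ?K"
  proof
    show sub: "(`) \<sigma> ` ?K \<subseteq> ?K"
      using permutes_in_image[OF \<sigma>] by (auto simp: card_image[OF inj])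
    show "?K \<subseteq> (`) \<sigma> ` ?K"
    proof
      fix S assume S: "S \<in> ?K"
      have "inj (inv' \<sigma>)" using permutes_inj[OF permutes_inv[OF \<sigma>]] .
      then have "inv' \<sigma> ` S \<in> ?K"
        using S permutes_in_image[OF permutes_inv[OF \<sigma>]] by (auto simp: card_image inj_on_subset)
      moreover have "S = \<sigma> ` (inv' \<sigma> ` S)" using permutes_inverses[OF \<sigma>] by (auto simp: image_image)
      ultimately show "S \<in> (`) \<sigma> ` ?K" by blast
    qed
  qed
  have "perm_tensor \<sigma> (esym k a) = (\<Oplus>\<^bsub>T\<^esub>S\<in>?K. perm_tensor \<sigma> (?p S))"
    unfolding tensor_elem_sym_def using pc by (subst h.hom_finsum) (auto simp: comp_def)
  also have "\<dots> = (\<Oplus>\<^bsub>T\<^esub>S\<in>?K. ?p (\<sigma> ` S))"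
  proof (rule T.finsum_cong'[OF refl])
    show "(\<lambda>S. ?p (\<sigma> ` S)) \<in> ?K \<rightarrow> carrier T" using pc img by blast
    fix S assume S: "S \<in> ?K"
    then have "perm_tensor \<sigma> (?p S) = (\<Otimes>\<^bsub>T\<^esub>i\<in>S. perm_tensor \<sigma> (at i a))"
      using at by (subst h.hom_finprod) (auto simp: comp_def)
    also have "\<dots> = (\<Otimes>\<^bsub>T\<^esub>i\<in>S. at (\<sigma> i) a)"
    proof (rule T.finprod_cong'[OF refl])
      show "(\<lambda>i. at (\<sigma> i) a) \<in> S \<rightarrow> carrier T"
        using S a permutes_in_image[OF \<sigma>] by (intro Pi_I tensor_at_closed) auto
      show "perm_tensor \<sigma> (at i a) = at (\<sigma> i) a" if "i \<in> S" for i
        using S that by (intro perm_tensor_at[OF \<sigma> _ a]) auto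
    qed
    also have "\<dots> = ?p (\<sigma> ` S)"
      using S a permutes_in_image[OF \<sigma>] by (intro T.finprod_reindex[symmetric] inj) auto
    finally show "perm_tensor \<sigma> (?p S) = ?p (\<sigma> ` S)" .
  qed
  also have "\<dots> = (\<Oplus>\<^bsub>T\<^esub>S\<in>(`) \<sigma> ` ?K. ?p S)"
  proof (rule T.finsum_reindex[symmetric])
    show "?p \<in> (`) \<sigma> ` ?K \<rightarrow> carrier T" unfolding img using pc by blast
    show "inj_on ((`) \<sigma>) ?K" using permutes_inj[OF \<sigma>] by (simp add: inj_on_def inj_image_eq_iff)
  qed
  finally show ?thesis unfolding img tensor_elem_sym_def .
qed

end

section \<open>Bases, and quotients by monic polynomials\<close>

locale based_algebra = algebra R A for R (structure) and A + fixes b :: "nat \<Rightarrow> 'c" and d :: nat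
  assumes basis_closed [simp]: "i < d \<Longrightarrow> b i \<in> carrier A"
    and basis_unique: "a \<in> carrier A \<Longrightarrow>
      \<exists>!c. c \<in> {..<d} \<rightarrow>\<^sub>E carrier R \<and> a = (\<Oplus>\<^bsub>A\<^esub>i\<in>{..<d}. c i \<odot>\<^bsub>A\<^esub> b i)"
begin

abbreviation crd where "crd \<equiv> basis_coords R A d b"

lemma crd_spec:
  assumes "a \<in> carrier A"
  shows "crd a \<in> {..<d} \<rightarrow>\<^sub>E carrier R \<and> a = (\<Oplus>\<^bsub>A\<^esub>i\<in>{..<d}. crd a i \<odot>\<^bsub>A\<^esub> b i)"
  unfolding basis_coords_def by (rule theI'[OF basis_unique[OF assms]])

lemma crd_closed [simp]: "a \<in> carrier A \<Longrightarrow> i < d \<Longrightarrow> crd a i \<in> carrier R"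
  using crd_spec by blast

lemma crd_sum: "a \<in> carrier A \<Longrightarrow> (\<Oplus>\<^bsub>A\<^esub>i\<in>{..<d}. crd a i \<odot>\<^bsub>A\<^esub> b i) = a"
  using crd_spec by simp

lemma basis_sum_closed:
  "(\<And>i. i < d \<Longrightarrow> c i \<in> carrier R) \<Longrightarrow> (\<Oplus>\<^bsub>A\<^esub>i\<in>{..<d}. c i \<odot>\<^bsub>A\<^esub> b i) \<in> carrier A"
  by (intro M.finsum_closed Pi_I smult_closed) auto

lemma crd_unique:
  assumes c: "\<And>i. i < d \<Longrightarrow> c i \<in> carrier R" and a: "a = (\<Oplus>\<^bsub>A\<^esub>i\<in>{..<d}. c i \<odot>\<^bsub>A\<^esub> b i)"
    and i: "i < d"
  shows "crd a i = c i"
proof -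
  have aA: "a \<in> carrier A" unfolding a by (rule basis_sum_closed[OF c])
  have "a = (\<Oplus>\<^bsub>A\<^esub>i\<in>{..<d}. restrict c {..<d} i \<odot>\<^bsub>A\<^esub> b i)"
    unfolding a using c by (intro M.finsum_cong') auto
  moreover have "restrict c {..<d} \<in> {..<d} \<rightarrow>\<^sub>E carrier R" using c by auto
  ultimately have "crd a = restrict c {..<d}" using basis_unique[OF aA] crd_spec[OF aA] by blast
  then show ?thesis using i by simp
qed

lemma crd_add:
  assumes "u \<in> carrier A" "v \<in> carrier A" "i < d"
  shows "crd (u \<oplus>\<^bsub>A\<^esub> v) i = crd u i \<oplus> crd v i"
proof (rule crd_unique[where c = "\<lambda>i. crd u i \<oplus> crd v i"])
  have "u \<oplus>\<^bsub>A\<^esub> v = (\<Oplus>\<^bsub>A\<^esub>i\<in>{..<d}. crd u i \<odot>\<^bsub>A\<^esub> b i) \<oplus>\<^bsub>A\<^esub> (\<Oplus>\<^bsub>A\<^esub>i\<in>{..<d}. crd v i \<odot>\<^bsub>A\<^esub> b i)"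
    using assms by (simp add: crd_sum)
  also have "\<dots> = (\<Oplus>\<^bsub>A\<^esub>i\<in>{..<d}. crd u i \<odot>\<^bsub>A\<^esub> b i \<oplus>\<^bsub>A\<^esub> crd v i \<odot>\<^bsub>A\<^esub> b i)"
    using assms by (intro M.finsum_addf[symmetric]) auto
  also have "\<dots> = (\<Oplus>\<^bsub>A\<^esub>i\<in>{..<d}. (crd u i \<oplus> crd v i) \<odot>\<^bsub>A\<^esub> b i)"
    using assms by (intro M.finsum_cong') (auto simp: smult_l_distr)
  finally show "u \<oplus>\<^bsub>A\<^esub> v = (\<Oplus>\<^bsub>A\<^esub>i\<in>{..<d}. (crd u i \<oplus> crd v i) \<odot>\<^bsub>A\<^esub> b i)" .
qed (use assms in auto)

lemma crd_smult:
  assumes "r \<in> carrier R" "u \<in> carrier A" "i < d"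
  shows "crd (r \<odot>\<^bsub>A\<^esub> u) i = r \<otimes> crd u i"
proof (rule crd_unique[where c = "\<lambda>i. r \<otimes> crd u i"])
  have "r \<odot>\<^bsub>A\<^esub> u = r \<odot>\<^bsub>A\<^esub> (\<Oplus>\<^bsub>A\<^esub>i\<in>{..<d}. crd u i \<odot>\<^bsub>A\<^esub> b i)"
    using assms by (simp add: crd_sum)
  also have "\<dots> = (\<Oplus>\<^bsub>A\<^esub>i\<in>{..<d}. r \<odot>\<^bsub>A\<^esub> (crd u i \<odot>\<^bsub>A\<^esub> b i))"
    using assms by (intro finsum_smult_ldistr) auto
  also have "\<dots> = (\<Oplus>\<^bsub>A\<^esub>i\<in>{..<d}. (r \<otimes> crd u i) \<odot>\<^bsub>A\<^esub> b i)"
    using assms by (intro M.finsum_cong') (auto simp: smult_assoc1)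
  finally show "r \<odot>\<^bsub>A\<^esub> u = (\<Oplus>\<^bsub>A\<^esub>i\<in>{..<d}. (r \<otimes> crd u i) \<odot>\<^bsub>A\<^esub> b i)" .
qed (use assms in auto)

lemma crd_basis:
  assumes "j < d" "i < d"
  shows "crd (b j) i = (if i = j then \<one> else \<zero>)"
proof (rule crd_unique[where c = "\<lambda>i. if i = j then \<one> else \<zero>"])
  have "(\<Oplus>\<^bsub>A\<^esub>i\<in>{..<d}. (if i = j then \<one> else \<zero>) \<odot>\<^bsub>A\<^esub> b i) =
      (\<Oplus>\<^bsub>A\<^esub>i\<in>{..<d}. if j = i then b i else \<zero>\<^bsub>A\<^esub>)"
    by (intro M.finsum_cong') auto
  also have "\<dots> = b j" using assms by (intro M.finsum_singleton) auto
  finally show "b j = (\<Oplus>\<^bsub>A\<^esub>i\<in>{..<d}. (if i = j then \<one> else \<zero>) \<odot>\<^bsub>A\<^esub> b i)" by simp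
qed (use assms in auto)

end

text \<open>
  The monic polynomial \<open>f\<close> has degree \<open>d\<close>.  The degree is expressed by coefficients, as over the zero ring
  every polynomial vanishes.
\<close>

locale monic_quotient = UP_cring R P for R (structure) and P (structure) + fixes f :: "nat \<Rightarrow> 'a" and d :: nat
  assumes f_closed [simp]: "f \<in> carrier P"
    and f_monic: "coeff P f d = \<one>"
    and f_degree: "d < k \<Longrightarrow> coeff P f k = \<zero>"
begin

abbreviation J where "J \<equiv> PIdl\<^bsub>P\<^esub> f"
abbreviation A where "A \<equiv> monogenic_algebra R f"
abbreviation x where "x \<equiv> monogenic_gen R f"

lemma J_ideal: "ideal J P" by (rule P.cgenideal_ideal[OF f_closed])

lemma monogenic_algebra_algebra: "algebra R A"
  unfolding monogenic_algebra_def P_def[symmetric] by (rule algebra_algebra_Quot[OF J_ideal])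

lemmas class_add = algebra_Quot_add[OF J_ideal, folded monogenic_algebra_def[of R f, folded P_def]]
  and class_mult = algebra_Quot_mult[OF J_ideal, folded monogenic_algebra_def[of R f, folded P_def]]
  and class_smult = algebra_Quot_smult[OF J_ideal, folded monogenic_algebra_def[of R f, folded P_def]]
  and class_eq_iff = algebra_Quot_eq_iff[OF J_ideal]

lemma class_one: "\<one>\<^bsub>A\<^esub> = J +>\<^bsub>P\<^esub> \<one>\<^bsub>P\<^esub>"
  unfolding monogenic_algebra_def P_def[symmetric]
  by (rule algebra_Quot_one[OF J_ideal P.zero_closed P.zero_closed])

lemma carrier_monogenic: "carrier A = {J +>\<^bsub>P\<^esub> p |p. p \<in> carrier P}"
  unfolding monogenic_algebra_def P_def[symmetric] by (rule carrier_algebra_Quot)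

lemma class_hom: "ring_hom_cring P A (\<lambda>p. J +>\<^bsub>P\<^esub> p)"
proof (rule ring_hom_cringI2[OF P.is_cring])
  show "cring A" using algebra.M_cring[OF monogenic_algebra_algebra] .
  show "(\<lambda>p. J +>\<^bsub>P\<^esub> p) \<in> ring_hom P A"
    by (rule ring_hom_memI) (auto simp: class_add class_mult class_one carrier_monogenic)
qed

lemma power_basis_eq: "power_basis R f i = J +>\<^bsub>P\<^esub> monom P \<one> i"
proof -
  interpret h: ring_hom_cring P A "\<lambda>p. J +>\<^bsub>P\<^esub> p" by (rule class_hom)
  have "power_basis R f i = J +>\<^bsub>P\<^esub> (monom P \<one> 1 [^]\<^bsub>P\<^esub> i)"
    by (simp add: power_basis_def monogenic_gen_def P_def[symmetric])
  moreover have "monom P \<one> 1 [^]\<^bsub>P\<^esub> i = monom P \<one> i" using monom_pow[of \<one> 1 i] by simp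
  ultimately show ?thesis by (simp only:)
qed

lemma basis_sum_eq:
  assumes "\<And>i. i < m \<Longrightarrow> c i \<in> carrier R"
  shows "(\<Oplus>\<^bsub>A\<^esub>i\<in>{..<m}. c i \<odot>\<^bsub>A\<^esub> power_basis R f i) = J +>\<^bsub>P\<^esub> (\<Oplus>\<^bsub>P\<^esub>i\<in>{..<m}. monom P (c i) i)"
proof -
  interpret h: ring_hom_cring P A "\<lambda>p. J +>\<^bsub>P\<^esub> p" by (rule class_hom)
  have m: "c i \<odot>\<^bsub>A\<^esub> power_basis R f i = J +>\<^bsub>P\<^esub> monom P (c i) i" if "i < m" for i
    using assms[OF that] monom_mult_smult[of "c i" \<one> i]
    by (simp add: power_basis_eq class_smult)
  have "J +>\<^bsub>P\<^esub> (\<Oplus>\<^bsub>P\<^esub>i\<in>{..<m}. monom P (c i) i) = (\<Oplus>\<^bsub>A\<^esub>i\<in>{..<m}. J +>\<^bsub>P\<^esub> monom P (c i) i)"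
    using assms by (subst h.hom_finsum) (auto simp: comp_def)
  also have "\<dots> = (\<Oplus>\<^bsub>A\<^esub>i\<in>{..<m}. c i \<odot>\<^bsub>A\<^esub> power_basis R f i)"
    using assms m by (intro h.S.finsum_cong') (auto simp: carrier_monogenic)
  finally show ?thesis by simp
qed

lemma coeff_monom_sum:
  assumes "\<And>i. i < m \<Longrightarrow> c i \<in> carrier R"
  shows "coeff P (\<Oplus>\<^bsub>P\<^esub>i\<in>{..<m}. monom P (c i) i) k = (if k < m then c k else \<zero>)"
proof -
  have "coeff P (\<Oplus>\<^bsub>P\<^esub>i\<in>{..<m}. monom P (c i) i) k = (\<Oplus>i\<in>{..<m}. coeff P (monom P (c i) i) k)"
    using assms by (intro coeff_finsum) auto
  also have "\<dots> = (\<Oplus>i\<in>{..<m}. if k = i then c i else \<zero>)"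
    using assms by (intro R.finsum_cong') auto
  also have "\<dots> = (if k < m then c k else \<zero>)"
  proof (cases "k < m")
    case True
    then show ?thesis using assms R.finsum_singleton[of k "{..<m}" c] by auto
  next
    case False
    then have "(\<Oplus>i\<in>{..<m}. if k = i then c i else \<zero>) = (\<Oplus>i\<in>{..<m}. \<zero>)"
      by (intro R.finsum_cong') auto
    then show ?thesis using False by simp
  qed
  finally show ?thesis .
qed

text \<open>
  Division with remainder by a monic polynomial needs no division in \<open>R\<close>: the leading term of a dividend
  is cancelled by a multiple of \<open>f\<close>.
\<close>

lemma division_by_monic:
  assumes "p \<in> carrier P"
  shows "\<exists>r\<in>carrier P. (\<forall>k\<ge>d. coeff P r k = \<zero>) \<and> p \<ominus>\<^bsub>P\<^esub> r \<in> J"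
proof -
  interpret J: ideal J P by (rule J_ideal)
  have "\<exists>r\<in>carrier P. (\<forall>k\<ge>d. coeff P r k = \<zero>) \<and> p \<ominus>\<^bsub>P\<^esub> r \<in> J"
    if "p \<in> carrier P" "\<And>k. e \<le> k \<Longrightarrow> coeff P p k = \<zero>" for e p
    using that
  proof (induction e arbitrary: p)
    case 0
    then show ?case
      by (intro bexI[of _ p]) (auto simp: P.minus_eq P.r_neg J.zero_closed)
  next
    case (Suc e)
    show ?case
    proof (cases "e < d")
      case True
      then show ?thesis using Suc.prems
        by (intro bexI[of _ p]) (auto simp: P.minus_eq P.r_neg J.zero_closed)
    next
      case False
      define c where "c = coeff P p e"
      define q where "q = monom P c (e - d) \<otimes>\<^bsub>P\<^esub> f"
      have c: "c \<in> carrier R" using Suc.prems by (simp add: c_def)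
      have q: "q \<in> carrier P" using c by (simp add: q_def)
      have qJ: "q \<in> J" unfolding q_def using c J.I_l_closed[OF P.cgenideal_self[OF f_closed]] by simp
      have "coeff P (p \<ominus>\<^bsub>P\<^esub> q) k = \<zero>" if k: "e \<le> k" for k
      proof -
        have "coeff P q k = c \<otimes> coeff P f (k - (e - d))"
          using coeff_monom_mult[OF c f_closed, of "e - d" "k - (e - d)"] k False by (simp add: q_def)
        then have "coeff P q k = coeff P p k"
          using k False c Suc.prems f_monic f_degree[of "k - (e - d)"]
          by (cases "k = e") (auto simp: c_def)
        then show ?thesis using Suc.prems q by (simp add: R.minus_eq R.r_neg)
      qed
      then obtain r where r: "r \<in> carrier P" "\<forall>k\<ge>d. coeff P r k = \<zero>" "p \<ominus>\<^bsub>P\<^esub> q \<ominus>\<^bsub>P\<^esub> r \<in> J"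
        using Suc.IH[of "p \<ominus>\<^bsub>P\<^esub> q"] Suc.prems q by auto
      have "p \<ominus>\<^bsub>P\<^esub> r = (p \<ominus>\<^bsub>P\<^esub> q \<ominus>\<^bsub>P\<^esub> r) \<oplus>\<^bsub>P\<^esub> q"
        using Suc.prems q r by (simp add: P.minus_eq P.a_ac P.r_neg P.r_neg1 P.r_neg2)
      then have "p \<ominus>\<^bsub>P\<^esub> r \<in> J" using r qJ by (simp add: J.a_closed)
      then show ?thesis using r by blast
    qed
  qed
  moreover obtain e where "\<And>k. e \<le> k \<Longrightarrow> coeff P p k = \<zero>"
  proof
    show "coeff P p k = \<zero>" if "Suc (deg R p) \<le> k" for k
      using that assms by (intro deg_aboveD) auto
  qed
  ultimately show ?thesis using assms by blast
qed

text \<open>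
  In a multiple \<open>q f\<close>, the coefficient in degree \<open>deg q + d\<close> is the leading coefficient of \<open>q\<close>.
\<close>

lemma degree_less_imp_zero:
  assumes r: "r \<in> J" "\<And>k. d \<le> k \<Longrightarrow> coeff P r k = \<zero>"
  shows "r = \<zero>\<^bsub>P\<^esub>"
proof -
  obtain h where h: "h \<in> carrier P" "r = h \<otimes>\<^bsub>P\<^esub> f" using r(1) by (auto simp: cgenideal_def)
  define e where "e = deg R h"
  have "coeff P r (e + d) = (\<Oplus>i\<in>{..e + d}. coeff P h i \<otimes> coeff P f (e + d - i))"
    using h by simp
  also have "\<dots> = (\<Oplus>i\<in>{..e + d}. if e = i then coeff P h i else \<zero>)"
  proof (rule R.finsum_cong')
    fix i assume "i \<in> {..e + d}"
    consider "i < e" | "i = e" | "e < i" by linarith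
    then show "coeff P h i \<otimes> coeff P f (e + d - i) = (if e = i then coeff P h i else \<zero>)"
    proof cases
      case 1
      then show ?thesis using h f_degree by simp
    next
      case 2
      then show ?thesis using h f_monic by simp
    next
      case 3
      then show ?thesis using h deg_aboveD[of h i] by (simp add: e_def)
    qed
  qed (use h in auto)
  also have "\<dots> = coeff P h e"
    using h by (intro R.finsum_singleton) auto
  finally have "lcoeff h = \<zero>" using r(2) by (simp add: e_def)
  then have "h = \<zero>\<^bsub>P\<^esub>" using lcoeff_nonzero2[OF h(1)] by blast
  then show ?thesis using h by simp
qed

text \<open>
  Existence of coordinates is division with remainder, and uniqueness says that a remainder in the ideal
  vanishes.
\<close>

lemma based_algebra: "based_algebra R A (power_basis R f) d"
proof -
  interpret A: algebra R A by (rule monogenic_algebra_algebra)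
  interpret J: ideal J P by (rule J_ideal)
  show ?thesis
  proof unfold_locales
    fix i show "power_basis R f i \<in> carrier A"
      by (auto simp: power_basis_eq carrier_monogenic)
  next
    fix a assume "a \<in> carrier A"
    then obtain p where p: "p \<in> carrier P" "a = J +>\<^bsub>P\<^esub> p"
      unfolding carrier_monogenic by blast
    let ?s = "\<lambda>c. \<Oplus>\<^bsub>P\<^esub>i\<in>{..<d}. monom P (c i) i"
    have s: "?s c \<in> carrier P" if "c \<in> {..<d} \<rightarrow>\<^sub>E carrier R" for c :: "nat \<Rightarrow> 'a"
      by (rule P.finsum_closed, rule Pi_I, rule monom_closed, rule PiE_mem[OF that])
    have a_iff: "a = (\<Oplus>\<^bsub>A\<^esub>i\<in>{..<d}. c i \<odot>\<^bsub>A\<^esub> power_basis R f i) \<longleftrightarrow> p \<ominus>\<^bsub>P\<^esub> ?s c \<in> J"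
      if "c \<in> {..<d} \<rightarrow>\<^sub>E carrier R" for c
    proof -
      have "(\<Oplus>\<^bsub>A\<^esub>i\<in>{..<d}. c i \<odot>\<^bsub>A\<^esub> power_basis R f i) = J +>\<^bsub>P\<^esub> ?s c"
        by (rule basis_sum_eq) (use PiE_mem[OF that] in simp)
      then show ?thesis unfolding p(2) using class_eq_iff[OF p(1) s[OF that]] by simp
    qed
    show "\<exists>!c. c \<in> {..<d} \<rightarrow>\<^sub>E carrier R \<and> a = (\<Oplus>\<^bsub>A\<^esub>i\<in>{..<d}. c i \<odot>\<^bsub>A\<^esub> power_basis R f i)"
    proof (rule ex_ex1I)
      obtain r where r: "r \<in> carrier P" "\<And>k. d \<le> k \<Longrightarrow> coeff P r k = \<zero>" "p \<ominus>\<^bsub>P\<^esub> r \<in> J"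
        using division_by_monic[OF p(1)] by blast
      define c where "c = restrict (coeff P r) {..<d}"
      have c: "c \<in> {..<d} \<rightarrow>\<^sub>E carrier R" using r(1) by (auto simp: c_def)
      have "?s c = r"
      proof (rule up_eqI)
        show "coeff P (?s c) k = coeff P r k" for k
          using coeff_monom_sum[of d c k] PiE_mem[OF c] r(1,2) by (simp add: c_def)
      qed (use s[OF c] r(1) in auto)
      then show "\<exists>c. c \<in> {..<d} \<rightarrow>\<^sub>E carrier R \<and> a = (\<Oplus>\<^bsub>A\<^esub>i\<in>{..<d}. c i \<odot>\<^bsub>A\<^esub> power_basis R f i)"
        using a_iff[OF c] c r(3) by auto
    next
      fix c c' assume
        "c \<in> {..<d} \<rightarrow>\<^sub>E carrier R \<and> a = (\<Oplus>\<^bsub>A\<^esub>i\<in>{..<d}. c i \<odot>\<^bsub>A\<^esub> power_basis R f i)"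
        "c' \<in> {..<d} \<rightarrow>\<^sub>E carrier R \<and> a = (\<Oplus>\<^bsub>A\<^esub>i\<in>{..<d}. c' i \<odot>\<^bsub>A\<^esub> power_basis R f i)"
      then have c: "c \<in> {..<d} \<rightarrow>\<^sub>E carrier R" "p \<ominus>\<^bsub>P\<^esub> ?s c \<in> J"
        and c': "c' \<in> {..<d} \<rightarrow>\<^sub>E carrier R" "p \<ominus>\<^bsub>P\<^esub> ?s c' \<in> J" using a_iff by blast+
      have "u \<ominus>\<^bsub>P\<^esub> v = (p \<ominus>\<^bsub>P\<^esub> v) \<ominus>\<^bsub>P\<^esub> (p \<ominus>\<^bsub>P\<^esub> u)" if "u \<in> carrier P" "v \<in> carrier P" for u v
        using p(1) that by algebra
      from this[OF s[OF c(1)] s[OF c'(1)]]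
      have "?s c \<ominus>\<^bsub>P\<^esub> ?s c' = (p \<ominus>\<^bsub>P\<^esub> ?s c') \<ominus>\<^bsub>P\<^esub> (p \<ominus>\<^bsub>P\<^esub> ?s c)" .
      then have J: "?s c \<ominus>\<^bsub>P\<^esub> ?s c' \<in> J"
        using c c' by (simp add: P.minus_eq J.a_closed J.a_inv_closed)
      have cf: "coeff P (?s c) k = (if k < d then c k else \<zero>)"
        "coeff P (?s c') k = (if k < d then c' k else \<zero>)" for k
        using coeff_monom_sum[of d c k] coeff_monom_sum[of d c' k] PiE_mem[OF c(1)] PiE_mem[OF c'(1)]
        by simp_all
      have "?s c \<ominus>\<^bsub>P\<^esub> ?s c' = \<zero>\<^bsub>P\<^esub>"
        by (rule degree_less_imp_zero[OF J])
          (use s[OF c(1)] s[OF c'(1)] cf in \<open>simp add: R.minus_eq R.r_neg\<close>)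
      then have "?s c = ?s c'" using P.minus_eq_zero_iff[OF s[OF c(1)] s[OF c'(1)]] by blast
      then have "c k = c' k" if "k < d" for k using cf[of k] that by simp
      then show "c = c'" using c(1) c'(1) by (intro PiE_ext[of c "{..<d}" "\<lambda>_. carrier R" c']) auto
    qed
  qed
qed

end

section \<open>Bases of tensor powers\<close>

locale based_power = based_algebra R A b d for R (structure) and A and b :: "nat \<Rightarrow> 'c" and d +
  fixes n :: nat

sublocale based_power \<subseteq> algebra_power R A n ..

context based_power
begin

abbreviation X where "X \<equiv> {1..n} \<rightarrow>\<^sub>E {..<d}"

definition basis_tensor :: "(nat \<Rightarrow> nat) \<Rightarrow> ((nat \<Rightarrow> 'c) \<Rightarrow> 'a) set" where
  "basis_tensor \<alpha> = pure (\<lambda>i\<in>{1..n}. b (\<alpha> i))"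

definition crd_prod :: "(nat \<Rightarrow> nat) \<Rightarrow> (nat \<Rightarrow> 'c) \<Rightarrow> 'a" where
  "crd_prod \<alpha> a = (\<Otimes>i\<in>{1..n}. crd (a i) (\<alpha> i))"

text \<open>
  The basis dual to the tensors \<open>b\<^bsub>\<alpha> 1\<^esub> \<otimes> \<dots> \<otimes> b\<^bsub>\<alpha> n\<^esub>\<close>: products of coordinate functions are
  multilinear.
\<close>

definition tcrd :: "(nat \<Rightarrow> nat) \<Rightarrow> ((nat \<Rightarrow> 'c) \<Rightarrow> 'a) set \<Rightarrow> 'a" where
  "tcrd \<alpha> = tensor_map (crd_prod \<alpha>)"

lemma finite_X: "finite X" by (simp add: finite_PiE)

lemma X_nth: "\<alpha> \<in> X \<Longrightarrow> i \<in> {1..n} \<Longrightarrow> \<alpha> i < d" by auto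

lemma crd_prod_closed: "\<alpha> \<in> X \<Longrightarrow> a \<in> E \<Longrightarrow> crd_prod \<alpha> a \<in> carrier R"
  unfolding crd_prod_def by (intro R.finprod_closed Pi_I crd_closed tuple_nth_closed X_nth)

lemma crd_prod_upd:
  assumes "\<alpha> \<in> X" "a \<in> E" "i \<in> {1..n}" "u \<in> carrier A"
  shows "crd_prod \<alpha> (a(i := u)) = crd u (\<alpha> i) \<otimes> (\<Otimes>j\<in>{1..n} - {i}. crd (a j) (\<alpha> j))"
proof -
  have c: "crd (a j) (\<alpha> j) \<in> carrier R" if "j \<in> {1..n}" for j
    using assms that by (intro crd_closed tuple_nth_closed X_nth)
  have "crd_prod \<alpha> (a(i := u)) = (\<Otimes>j\<in>insert i ({1..n} - {i}). crd ((a(i := u)) j) (\<alpha> j))"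
    unfolding crd_prod_def using assms(3) by (simp add: insert_absorb)
  also have "\<dots> = crd ((a(i := u)) i) (\<alpha> i) \<otimes> (\<Otimes>j\<in>{1..n} - {i}. crd ((a(i := u)) j) (\<alpha> j))"
    using assms c X_nth[OF assms(1,3)] by (intro R.finprod_insert) auto
  also have "(\<Otimes>j\<in>{1..n} - {i}. crd ((a(i := u)) j) (\<alpha> j)) = (\<Otimes>j\<in>{1..n} - {i}. crd (a j) (\<alpha> j))"
    using c by (intro R.finprod_cong') auto
  finally show ?thesis by (simp only: fun_upd_same)
qed

lemma multilinear_crd_prod:
  assumes \<alpha>: "\<alpha> \<in> X"
  shows "multilinear (crd_prod \<alpha>)"
proof (rule multilinearI)
  show "crd_prod \<alpha> \<in> E \<rightarrow> carrier R" using crd_prod_closed[OF \<alpha>] by blast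
  have p: "(\<Otimes>j\<in>{1..n} - {i}. crd (a j) (\<alpha> j)) \<in> carrier R" if "a \<in> E" for a i
    using that by (intro R.finprod_closed Pi_I crd_closed tuple_nth_closed X_nth[OF \<alpha>]) auto
  show "crd_prod \<alpha> (a(i := u \<oplus>\<^bsub>A\<^esub> v)) = crd_prod \<alpha> (a(i := u)) \<oplus> crd_prod \<alpha> (a(i := v))"
    if "a \<in> E" "i \<in> {1..n}" "u \<in> carrier A" "v \<in> carrier A" for a i u v
    using that p[OF that(1)] X_nth[OF \<alpha> that(2)] by (simp add: crd_prod_upd[OF \<alpha>] crd_add R.l_distr del: fun_upd_apply)
  show "crd_prod \<alpha> (a(i := r \<odot>\<^bsub>A\<^esub> u)) = r \<otimes> crd_prod \<alpha> (a(i := u))"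
    if "a \<in> E" "i \<in> {1..n}" "r \<in> carrier R" "u \<in> carrier A" for a i r u
    using that p[OF that(1)] X_nth[OF \<alpha> that(2)] by (simp add: crd_prod_upd[OF \<alpha>] crd_smult R.m_assoc del: fun_upd_apply)
qed

lemma basis_tuple_closed: "\<alpha> \<in> X \<Longrightarrow> (\<lambda>i\<in>{1..n}. b (\<alpha> i)) \<in> E"
  unfolding tuples_def by (intro restrict_PiE_iff[THEN iffD2] ballI basis_closed X_nth)

lemma basis_tensor_closed [simp]: "\<alpha> \<in> X \<Longrightarrow> basis_tensor \<alpha> \<in> carrier T"
  unfolding basis_tensor_def by (intro pure_closed basis_tuple_closed)

lemma tcrd_closed [simp]: "\<alpha> \<in> X \<Longrightarrow> t \<in> carrier T \<Longrightarrow> tcrd \<alpha> t \<in> carrier R"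
  and tcrd_add: "\<alpha> \<in> X \<Longrightarrow> t \<in> carrier T \<Longrightarrow> u \<in> carrier T \<Longrightarrow> tcrd \<alpha> (t \<oplus>\<^bsub>T\<^esub> u) = tcrd \<alpha> t \<oplus> tcrd \<alpha> u"
  and tcrd_smult: "\<alpha> \<in> X \<Longrightarrow> r \<in> carrier R \<Longrightarrow> t \<in> carrier T \<Longrightarrow> tcrd \<alpha> (r \<odot>\<^bsub>T\<^esub> t) = r \<otimes> tcrd \<alpha> t"
  and tcrd_pure: "\<alpha> \<in> X \<Longrightarrow> a \<in> E \<Longrightarrow> tcrd \<alpha> (pure a) = crd_prod \<alpha> a"
  unfolding tcrd_def
  by (simp_all add: multilinear_crd_prod tensor_map_add tensor_map_smult tensor_map_pure)

lemma tcrd_basis_tensor: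
  assumes "\<alpha> \<in> X" "\<beta> \<in> X"
  shows "tcrd \<alpha> (basis_tensor \<beta>) = (if \<alpha> = \<beta> then \<one> else \<zero>)"
proof -
  have "tcrd \<alpha> (basis_tensor \<beta>) = (\<Otimes>i\<in>{1..n}. if \<alpha> i = \<beta> i then \<one> else \<zero>)"
    unfolding basis_tensor_def tcrd_pure[OF assms(1) basis_tuple_closed[OF assms(2)]] crd_prod_def
    using X_nth[OF assms(1)] X_nth[OF assms(2)] by (intro R.finprod_cong') (auto simp: crd_basis)
  also have "\<dots> = (if \<alpha> = \<beta> then \<one> else \<zero>)"
  proof (cases "\<alpha> = \<beta>")
    case False
    then obtain i where i: "i \<in> {1..n}" "\<alpha> i \<noteq> \<beta> i" using PiE_ext[OF assms] by blast
    let ?h = "\<lambda>i. if \<alpha> i = \<beta> i then \<one> else \<zero>"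
    have "(\<Otimes>i\<in>insert i ({1..n} - {i}). ?h i) = ?h i \<otimes> (\<Otimes>i\<in>{1..n} - {i}. ?h i)"
      by (intro R.finprod_insert) auto
    also have "\<dots> = \<zero>" using i by (simp add: R.finprod_closed)
    also have "insert i ({1..n} - {i}) = {1..n}" using i by blast
    finally show ?thesis using False by simp
  qed simp
  finally show ?thesis .
qed

lemma tcrd_permute:
  assumes \<sigma>: "\<sigma> permutes {1..n}" and \<alpha>: "\<alpha> \<in> X" and t: "t \<in> carrier T"
  shows "tcrd \<alpha> (perm_tensor \<sigma> t) = tcrd (\<alpha> \<circ> \<sigma>) t"
    and "\<alpha> \<circ> \<sigma> \<in> X"
proof -
  have \<sigma>i: "\<sigma> i \<in> {1..n}" if "i \<in> {1..n}" for i using that permutes_in_image[OF \<sigma>] by blast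
  show X: "\<alpha> \<circ> \<sigma> \<in> X"
  proof (rule PiE_I)
    show "(\<alpha> \<circ> \<sigma>) i \<in> {..<d}" if "i \<in> {1..n}" for i using X_nth[OF \<alpha> \<sigma>i[OF that]] by simp
    show "(\<alpha> \<circ> \<sigma>) i = undefined" if "i \<notin> {1..n}" for i
      using that permutes_not_in[OF \<sigma> that] PiE_arb[OF \<alpha> that] by simp
  qed
  have "crd_prod \<alpha> (a \<circ> inv' \<sigma>) = crd_prod (\<alpha> \<circ> \<sigma>) a" if a: "a \<in> E" for a
  proof -
    have c: "crd ((a \<circ> inv' \<sigma>) i) (\<alpha> i) \<in> carrier R" if "i \<in> {1..n}" for i
      using tuple_nth_closed[OF tuple_comp_closed[OF permutes_inv[OF \<sigma>] a] that] X_nth[OF \<alpha> that]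
      by (rule crd_closed)
    have "crd_prod \<alpha> (a \<circ> inv' \<sigma>) = (\<Otimes>i\<in>\<sigma> ` {1..n}. crd ((a \<circ> inv' \<sigma>) i) (\<alpha> i))"
      unfolding crd_prod_def by (simp only: permutes_image[OF \<sigma>])
    also have "\<dots> = (\<Otimes>i\<in>{1..n}. crd ((a \<circ> inv' \<sigma>) (\<sigma> i)) (\<alpha> (\<sigma> i)))"
    proof (rule R.finprod_reindex)
      show "(\<lambda>i. crd ((a \<circ> inv' \<sigma>) i) (\<alpha> i)) \<in> \<sigma> ` {1..n} \<rightarrow> carrier R"
        unfolding permutes_image[OF \<sigma>] using c by blast
    qed (rule inj_on_subset[OF permutes_inj[OF \<sigma>] subset_UNIV])
    also have "\<dots> = crd_prod (\<alpha> \<circ> \<sigma>) a"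
      unfolding crd_prod_def by (simp add: permutes_inverses(2)[OF \<sigma>])
    finally show ?thesis .
  qed
  then have "tensor_map (\<lambda>a. crd_prod \<alpha> (a \<circ> inv' \<sigma>)) t = tensor_map (crd_prod (\<alpha> \<circ> \<sigma>)) t"
  proof -
    assume eq: "\<And>a. a \<in> E \<Longrightarrow> crd_prod \<alpha> (a \<circ> inv' \<sigma>) = crd_prod (\<alpha> \<circ> \<sigma>) a"
    obtain f where f: "f \<in> carrier F" "t = I +>\<^bsub>F\<^esub> f" using tensor_cases[OF t] .
    have "pairing f (\<lambda>a. crd_prod \<alpha> (a \<circ> inv' \<sigma>)) = pairing f (crd_prod (\<alpha> \<circ> \<sigma>))"
      by (rule pairing_cong[OF f(1) multilinearD(1)[OF multilinear_crd_prod[OF X]] eq])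
    then show ?thesis
      unfolding f(2)
        tensor_map_class[OF multilinear_permute[OF multilinear_crd_prod[OF \<alpha>] permutes_inv[OF \<sigma>]] f(1)]
        tensor_map_class[OF multilinear_crd_prod[OF X] f(1)] .
  qed
  then show "tcrd \<alpha> (perm_tensor \<sigma> t) = tcrd (\<alpha> \<circ> \<sigma>) t"
    unfolding tcrd_def tensor_map_permute[OF multilinear_crd_prod[OF \<alpha>] \<sigma> t] .
qed

lemma perm_tensor_basis_tensor:
  assumes \<sigma>: "\<sigma> permutes {1..n}" and \<alpha>: "\<alpha> \<in> X"
  shows "perm_tensor \<sigma> (basis_tensor \<alpha>) = basis_tensor (\<alpha> \<circ> inv' \<sigma>)"
proof -
  have "(\<lambda>i\<in>{1..n}. b (\<alpha> i)) \<circ> inv' \<sigma> = (\<lambda>i\<in>{1..n}. b ((\<alpha> \<circ> inv' \<sigma>) i))"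
    using permutes_in_image[OF permutes_inv[OF \<sigma>]] by (auto simp: fun_eq_iff restrict_def)
  then show ?thesis
    unfolding basis_tensor_def perm_tensor_pure[OF \<sigma> basis_tuple_closed[OF \<alpha>]] by simp
qed

lemma basis_tensor_eq_finprod:
  assumes "\<alpha> \<in> X"
  shows "basis_tensor \<alpha> = (\<Otimes>\<^bsub>T\<^esub>i\<in>{1..n}. at i (b (\<alpha> i)))"
proof -
  have "(\<lambda>j\<in>{1..n}. if j \<in> {1..n} then b (\<alpha> j) else \<one>\<^bsub>A\<^esub>) = (\<lambda>j\<in>{1..n}. b (\<alpha> j))"
    by (auto simp: fun_eq_iff)
  then show ?thesis
    unfolding basis_tensor_def using pure_eq_finprod[of "{1..n}" "\<lambda>i. b (\<alpha> i)"] X_nth[OF assms] by simp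
qed

lemma pure_upd_zero: "a \<in> E \<Longrightarrow> i \<in> {1..n} \<Longrightarrow> pure (a(i := \<zero>\<^bsub>A\<^esub>)) = \<zero>\<^bsub>T\<^esub>"
  using pure_upd_smult[of a i \<zero> "\<zero>\<^bsub>A\<^esub>"] by (simp del: fun_upd_apply)

lemma pure_upd_finsum:
  assumes a: "a \<in> E" and i: "i \<in> {1..n}" and "finite K" "\<And>j. j \<in> K \<Longrightarrow> u j \<in> carrier A"
  shows "pure (a(i := \<Oplus>\<^bsub>A\<^esub>j\<in>K. u j)) = (\<Oplus>\<^bsub>T\<^esub>j\<in>K. pure (a(i := u j)))"
  using assms(3,4)
proof (induction K rule: finite_induct)
  case empty
  then show ?case using pure_upd_zero[OF a i] by (simp only: M.finsum_empty T.M.finsum_empty)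
next
  case (insert k K)
  have u: "u k \<in> carrier A" "\<And>j. j \<in> K \<Longrightarrow> u j \<in> carrier A" using insert by auto
  have "pure (a(i := \<Oplus>\<^bsub>A\<^esub>j\<in>insert k K. u j)) = pure (a(i := u k \<oplus>\<^bsub>A\<^esub> (\<Oplus>\<^bsub>A\<^esub>j\<in>K. u j)))"
    using insert.hyps u by (subst M.finsum_insert) auto
  also have "\<dots> = pure (a(i := u k)) \<oplus>\<^bsub>T\<^esub> pure (a(i := \<Oplus>\<^bsub>A\<^esub>j\<in>K. u j))"
    using u by (intro pure_upd_add[OF a i] M.finsum_closed) auto
  also have "\<dots> = pure (a(i := u k)) \<oplus>\<^bsub>T\<^esub> (\<Oplus>\<^bsub>T\<^esub>j\<in>K. pure (a(i := u j)))"
    by (simp only: insert.IH[OF u(2)])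
  also have "\<dots> = (\<Oplus>\<^bsub>T\<^esub>j\<in>insert k K. pure (a(i := u j)))"
    using insert.hyps u pure_closed[OF tuple_upd_closed[OF a i]]
    by (intro T.M.finsum_insert[symmetric]) auto
  finally show ?case .
qed

text \<open>
  Pure tensors are expanded in one position after the other, until every entry is a basis vector.
\<close>

lemma tensor_expansion:
  assumes "t \<in> carrier T"
  shows "t = (\<Oplus>\<^bsub>T\<^esub>\<alpha>\<in>X. tcrd \<alpha> t \<odot>\<^bsub>T\<^esub> basis_tensor \<alpha>)"
proof -
  define V where "V = {t \<in> carrier T. t = (\<Oplus>\<^bsub>T\<^esub>\<alpha>\<in>X. tcrd \<alpha> t \<odot>\<^bsub>T\<^esub> basis_tensor \<alpha>)}"
  have V_add: "t \<oplus>\<^bsub>T\<^esub> u \<in> V" if "t \<in> V" "u \<in> V" for t u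
  proof -
    have c: "t \<in> carrier T" "u \<in> carrier T" using that by (auto simp: V_def)
    have "(\<Oplus>\<^bsub>T\<^esub>\<alpha>\<in>X. tcrd \<alpha> (t \<oplus>\<^bsub>T\<^esub> u) \<odot>\<^bsub>T\<^esub> basis_tensor \<alpha>) =
        (\<Oplus>\<^bsub>T\<^esub>\<alpha>\<in>X. tcrd \<alpha> t \<odot>\<^bsub>T\<^esub> basis_tensor \<alpha> \<oplus>\<^bsub>T\<^esub> tcrd \<alpha> u \<odot>\<^bsub>T\<^esub> basis_tensor \<alpha>)"
      using c by (intro T.M.finsum_cong') (auto simp: tcrd_add T.smult_l_distr)
    also have "\<dots> = (\<Oplus>\<^bsub>T\<^esub>\<alpha>\<in>X. tcrd \<alpha> t \<odot>\<^bsub>T\<^esub> basis_tensor \<alpha>) \<oplus>\<^bsub>T\<^esub> (\<Oplus>\<^bsub>T\<^esub>\<alpha>\<in>X. tcrd \<alpha> u \<odot>\<^bsub>T\<^esub> basis_tensor \<alpha>)"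
      using c by (intro T.M.finsum_addf) auto
    also have "\<dots> = t \<oplus>\<^bsub>T\<^esub> u" using that by (simp add: V_def)
    finally show ?thesis using c by (simp add: V_def)
  qed
  have V_smult: "r \<odot>\<^bsub>T\<^esub> t \<in> V" if r: "r \<in> carrier R" and "t \<in> V" for r t
  proof -
    have c: "t \<in> carrier T" using that by (auto simp: V_def)
    have "(\<Oplus>\<^bsub>T\<^esub>\<alpha>\<in>X. tcrd \<alpha> (r \<odot>\<^bsub>T\<^esub> t) \<odot>\<^bsub>T\<^esub> basis_tensor \<alpha>) =
        (\<Oplus>\<^bsub>T\<^esub>\<alpha>\<in>X. r \<odot>\<^bsub>T\<^esub> (tcrd \<alpha> t \<odot>\<^bsub>T\<^esub> basis_tensor \<alpha>))"
      using c r by (intro T.M.finsum_cong') (auto simp: tcrd_smult T.smult_assoc1)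
    also have "\<dots> = r \<odot>\<^bsub>T\<^esub> (\<Oplus>\<^bsub>T\<^esub>\<alpha>\<in>X. tcrd \<alpha> t \<odot>\<^bsub>T\<^esub> basis_tensor \<alpha>)"
      using c r finite_X by (intro T.finsum_smult_ldistr[symmetric]) auto
    also have "\<dots> = r \<odot>\<^bsub>T\<^esub> t" using that by (simp add: V_def)
    finally show ?thesis using c r by (simp add: V_def)
  qed
  have V_basis_tensor: "basis_tensor \<beta> \<in> V" if \<beta>: "\<beta> \<in> X" for \<beta>
  proof -
    have "(\<Oplus>\<^bsub>T\<^esub>\<alpha>\<in>X. tcrd \<alpha> (basis_tensor \<beta>) \<odot>\<^bsub>T\<^esub> basis_tensor \<alpha>) = (\<Oplus>\<^bsub>T\<^esub>\<alpha>\<in>X. if \<beta> = \<alpha> then basis_tensor \<alpha> else \<zero>\<^bsub>T\<^esub>)"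
      using \<beta> by (intro T.M.finsum_cong') (auto simp: tcrd_basis_tensor)
    also have "\<dots> = basis_tensor \<beta>" using \<beta> finite_X by (intro T.M.finsum_singleton) auto
    finally show ?thesis using \<beta> by (simp add: V_def)
  qed
  have V_zero: "\<zero>\<^bsub>T\<^esub> \<in> V"
  proof -
    have "(\<Oplus>\<^bsub>T\<^esub>\<alpha>\<in>X. tcrd \<alpha> \<zero>\<^bsub>T\<^esub> \<odot>\<^bsub>T\<^esub> basis_tensor \<alpha>) = \<zero>\<^bsub>T\<^esub>"
      using tcrd_smult[of _ \<zero> "\<zero>\<^bsub>T\<^esub>"] by (intro T.M.add.finprod_one_eqI) simp
    then show ?thesis by (simp add: V_def)
  qed
  have V_sum: "(\<Oplus>\<^bsub>T\<^esub>j\<in>K. u j) \<in> V" if "finite K" "\<And>j. j \<in> K \<Longrightarrow> u j \<in> V" for K :: "nat set" and u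
    using that
  proof (induction K rule: finite_induct)
    case (insert k K)
    have "u \<in> insert k K \<rightarrow> carrier T" using insert.prems by (auto simp: V_def)
    then have "(\<Oplus>\<^bsub>T\<^esub>j\<in>insert k K. u j) = u k \<oplus>\<^bsub>T\<^esub> (\<Oplus>\<^bsub>T\<^esub>j\<in>K. u j)"
      using insert.hyps by (intro T.M.finsum_insert) auto
    then show ?case using insert V_add by simp
  qed (simp add: V_zero)
  \<comment> \<open>Induction on the bound \<open>m\<close>: the entries beyond position \<open>m\<close> are basis vectors already.\<close>
  have V_pure: "pure a \<in> V" if "a \<in> E" "\<And>i. i \<in> {1..n} \<Longrightarrow> m < i \<Longrightarrow> a i \<in> b ` {..<d}" for m a
    using that
  proof (induction m arbitrary: a)
    case 0
    then have "\<forall>i\<in>{1..n}. \<exists>j. j < d \<and> a i = b j" by fastforce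
    then obtain \<beta> where \<beta>: "\<And>i. i \<in> {1..n} \<Longrightarrow> \<beta> i < d \<and> a i = b (\<beta> i)" by metis
    have "a = (\<lambda>i\<in>{1..n}. b (restrict \<beta> {1..n} i))"
      using 0(1) \<beta> by (auto simp: tuples_def PiE_iff extensional_def fun_eq_iff)
    then have "pure a = basis_tensor (restrict \<beta> {1..n})" by (simp add: basis_tensor_def)
    moreover have "restrict \<beta> {1..n} \<in> X" using \<beta> by auto
    ultimately show ?case using V_basis_tensor by simp
  next
    case (Suc m)
    show ?case
    proof (cases "Suc m \<in> {1..n}")
      case False
      then have "a i \<in> b ` {..<d}" if "i \<in> {1..n}" "m < i" for i
        using Suc.prems(2) that by (metis Suc_lessI)
      then show ?thesis using Suc.IH Suc.prems(1) by blast
    next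
      case True
      let ?u = "a (Suc m)"
      have u: "?u \<in> carrier A" by (rule tuple_nth_closed[OF Suc.prems(1) True])
      have "pure a = pure (a(Suc m := \<Oplus>\<^bsub>A\<^esub>j\<in>{..<d}. crd ?u j \<odot>\<^bsub>A\<^esub> b j))"
        by (simp only: crd_sum[OF u] fun_upd_triv)
      also have "\<dots> = (\<Oplus>\<^bsub>T\<^esub>j\<in>{..<d}. pure (a(Suc m := crd ?u j \<odot>\<^bsub>A\<^esub> b j)))"
        using u by (intro pure_upd_finsum[OF Suc.prems(1) True]) auto
      finally have eq: "pure a = (\<Oplus>\<^bsub>T\<^esub>j\<in>{..<d}. pure (a(Suc m := crd ?u j \<odot>\<^bsub>A\<^esub> b j)))" .
      have "pure (a(Suc m := crd ?u j \<odot>\<^bsub>A\<^esub> b j)) \<in> V" if j: "j \<in> {..<d}" for j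
      proof -
        have "pure (a(Suc m := b j)) \<in> V"
          using Suc.prems j by (intro Suc.IH tuple_upd_closed[OF Suc.prems(1) True]) auto
        then show ?thesis
          using u j pure_upd_smult[OF Suc.prems(1) True, of "crd ?u j" "b j"] V_smult
          by (simp del: fun_upd_apply)
      qed
      then show ?thesis unfolding eq by (intro V_sum) auto
    qed
  qed
  have "t \<in> V"
    using assms
  proof (rule tensor_induct)
    show "pure a \<in> V" if "a \<in> E" for a
      by (rule V_pure[OF that, of n]) auto
  qed (blast intro: V_add V_smult)+
  then show ?thesis by (simp add: V_def)
qed

end

section \<open>The determinant functional\<close>

declare One_nat_def [simp del]

context based_power
begin

lemma tensor_basis_induct:
  assumes t: "t \<in> carrier T"
    and basis: "\<And>\<alpha>. \<alpha> \<in> X \<Longrightarrow> P (basis_tensor \<alpha>)"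
    and zero: "P \<zero>\<^bsub>T\<^esub>"
    and add: "\<And>t u. t \<in> carrier T \<Longrightarrow> u \<in> carrier T \<Longrightarrow> P t \<Longrightarrow> P u \<Longrightarrow> P (t \<oplus>\<^bsub>T\<^esub> u)"
    and smult: "\<And>r t. r \<in> carrier R \<Longrightarrow> t \<in> carrier T \<Longrightarrow> P t \<Longrightarrow> P (r \<odot>\<^bsub>T\<^esub> t)"
  shows "P t"
proof -
  have "P (\<Oplus>\<^bsub>T\<^esub>\<alpha>\<in>K. tcrd \<alpha> t \<odot>\<^bsub>T\<^esub> basis_tensor \<alpha>)" if "finite K" "K \<subseteq> X" for K
    using that
  proof (induction K rule: finite_induct)
    case (insert \<beta> K)
    have c: "tcrd \<alpha> t \<odot>\<^bsub>T\<^esub> basis_tensor \<alpha> \<in> carrier T" if "\<alpha> \<in> insert \<beta> K" for \<alpha>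
      using that insert.prems t by (intro T.smult_closed tcrd_closed basis_tensor_closed) blast+
    then have eq: "(\<Oplus>\<^bsub>T\<^esub>\<alpha>\<in>insert \<beta> K. tcrd \<alpha> t \<odot>\<^bsub>T\<^esub> basis_tensor \<alpha>) =
        tcrd \<beta> t \<odot>\<^bsub>T\<^esub> basis_tensor \<beta> \<oplus>\<^bsub>T\<^esub> (\<Oplus>\<^bsub>T\<^esub>\<alpha>\<in>K. tcrd \<alpha> t \<odot>\<^bsub>T\<^esub> basis_tensor \<alpha>)"
      using insert.hyps by (intro T.M.finsum_insert) auto
    show ?case
      unfolding eq
    proof (rule add)
      show "(\<Oplus>\<^bsub>T\<^esub>\<alpha>\<in>K. tcrd \<alpha> t \<odot>\<^bsub>T\<^esub> basis_tensor \<alpha>) \<in> carrier T"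
        using c by (intro T.M.finsum_closed Pi_I) blast
    qed (use insert t c basis smult in auto)
  qed (simp add: zero)
  from this[OF finite_X subset_refl] show ?thesis using tensor_expansion[OF t] by simp
qed

end

text \<open>
  The number of tensor factors equals the rank of the algebra.
\<close>

locale tensor_alternation = based_power R A b n n for R (structure) and A and b :: "nat \<Rightarrow> 'c" and n
begin

abbreviation Perm where "Perm \<equiv> {p. p permutes {1..n}}"

text \<open>
  The exponents of the basis tensor with \<open>b\<^bsub>p i - 1\<^esub>\<close> in position \<open>i\<close>: positions start with \<open>1\<close> and
  basis vectors with \<open>0\<close>.
\<close>

definition exps :: "(nat \<Rightarrow> nat) \<Rightarrow> nat \<Rightarrow> nat" where
  "exps p = (\<lambda>i\<in>{1..n}. p i - 1)"

definition sgnR :: "(nat \<Rightarrow> nat) \<Rightarrow> 'a" where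
  "sgnR p = (if evenperm p then \<one> else \<ominus> \<one>)"

text \<open>
  For the set of all permutations this is the determinant functional: on a pure tensor it is the
  determinant of the coordinates of its entries.  Partial sums serve to halve it.
\<close>

definition psum :: "(nat \<Rightarrow> nat) set \<Rightarrow> ((nat \<Rightarrow> 'c) \<Rightarrow> 'a) set \<Rightarrow> 'a" where
  "psum Q t = (\<Oplus>p\<in>Q. sgnR p \<otimes> tcrd (exps p) t)"

abbreviation alt where "alt \<equiv> psum Perm"

lemma finite_Perm: "finite Perm" by (simp add: finite_permutations)

lemma sgnR_closed [simp]: "sgnR p \<in> carrier R" by (simp add: sgnR_def)

lemma sgnR_square: "sgnR p \<otimes> sgnR p = \<one>"
  by (simp add: sgnR_def R.l_minus R.r_minus)

lemma permutation_Perm: "p permutes {1..n} \<Longrightarrow> permutation p"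
  by (rule permutes_imp_permutation[of "{1..n}"]) simp_all

lemma sgnR_comp: "p permutes {1..n} \<Longrightarrow> q permutes {1..n} \<Longrightarrow> sgnR (p \<circ> q) = sgnR p \<otimes> sgnR q"
  by (simp add: sgnR_def evenperm_comp permutation_Perm R.l_minus R.r_minus)

lemma sgnR_inv: "p permutes {1..n} \<Longrightarrow> sgnR (inv' p) = sgnR p"
  by (simp add: sgnR_def evenperm_inv permutation_Perm)

lemma exps_closed [simp]:
  assumes "p permutes {1..n}"
  shows "exps p \<in> X"
proof -
  have "p i - 1 < n" if "i \<in> {1..n}" for i
  proof -
    have "p i \<in> {1..n}" using that permutes_in_image[OF assms] by blast
    then show ?thesis by auto
  qed
  then show ?thesis by (auto simp: exps_def)
qed

lemma exps_inj:
  assumes p: "p permutes {1..n}" and q: "q permutes {1..n}" and eq: "exps p = exps q"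
  shows "p = q"
proof
  fix i
  show "p i = q i"
  proof (cases "i \<in> {1..n}")
    case True
    then have "p i \<in> {1..n}" "q i \<in> {1..n}" using permutes_in_image[OF p] permutes_in_image[OF q] by blast+
    moreover have "p i - 1 = q i - 1" using fun_cong[OF eq, of i] True by (simp add: exps_def)
    ultimately show ?thesis by auto
  qed (simp add: permutes_not_in[OF p] permutes_not_in[OF q])
qed

lemma exps_comp:
  assumes "\<sigma> permutes {1..n}"
  shows "exps p \<circ> \<sigma> = exps (p \<circ> \<sigma>)"
proof
  fix i
  show "(exps p \<circ> \<sigma>) i = exps (p \<circ> \<sigma>) i"
    using permutes_in_image[OF assms, of i] by (simp add: exps_def restrict_def)
qed

lemma term_closed: "p permutes {1..n} \<Longrightarrow> t \<in> carrier T \<Longrightarrow> sgnR p \<otimes> tcrd (exps p) t \<in> carrier R"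
  by (intro R.m_closed sgnR_closed tcrd_closed exps_closed)

lemma psum_closed [simp]: "Q \<subseteq> Perm \<Longrightarrow> t \<in> carrier T \<Longrightarrow> psum Q t \<in> carrier R"
  unfolding psum_def by (intro R.finsum_closed Pi_I term_closed) blast+

lemma psum_add:
  assumes "Q \<subseteq> Perm" "t \<in> carrier T" "u \<in> carrier T"
  shows "psum Q (t \<oplus>\<^bsub>T\<^esub> u) = psum Q t \<oplus> psum Q u"
proof -
  have c: "p permutes {1..n}" if "p \<in> Q" for p using that assms(1) by blast
  have "psum Q (t \<oplus>\<^bsub>T\<^esub> u) = (\<Oplus>p\<in>Q. sgnR p \<otimes> tcrd (exps p) t \<oplus> sgnR p \<otimes> tcrd (exps p) u)"
    unfolding psum_def using assms(2,3) c
    by (intro R.finsum_cong') (auto simp: tcrd_add R.r_distr)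
  also have "\<dots> = psum Q t \<oplus> psum Q u"
    unfolding psum_def using assms(2,3) c by (intro R.finsum_addf) auto
  finally show ?thesis .
qed

lemma psum_smult:
  assumes "Q \<subseteq> Perm" "r \<in> carrier R" "t \<in> carrier T"
  shows "psum Q (r \<odot>\<^bsub>T\<^esub> t) = r \<otimes> psum Q t"
proof -
  have c: "p permutes {1..n}" if "p \<in> Q" for p using that assms(1) by blast
  have "psum Q (r \<odot>\<^bsub>T\<^esub> t) = (\<Oplus>p\<in>Q. r \<otimes> (sgnR p \<otimes> tcrd (exps p) t))"
    unfolding psum_def using assms(2,3) c
    by (intro R.finsum_cong') (auto simp: tcrd_smult R.m_lcomm)
  also have "\<dots> = r \<otimes> psum Q t"
    unfolding psum_def using assms c finite_subset[OF assms(1) finite_Perm]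
    by (intro R.finsum_rdistr[symmetric]) auto
  finally show ?thesis .
qed

lemma psum_zero: "Q \<subseteq> Perm \<Longrightarrow> psum Q \<zero>\<^bsub>T\<^esub> = \<zero>"
  using psum_smult[of Q \<zero> "\<zero>\<^bsub>T\<^esub>"] by simp

lemma psum_Un:
  assumes "Q \<subseteq> Perm" "Q' \<subseteq> Perm" "Q \<inter> Q' = {}" "t \<in> carrier T"
  shows "psum (Q \<union> Q') t = psum Q t \<oplus> psum Q' t"
proof -
  have fin: "finite Q" "finite Q'" using assms(1,2) finite_Perm finite_subset by blast+
  have c: "p permutes {1..n}" if "p \<in> Q \<union> Q'" for p using that assms(1,2) by blast
  show ?thesis
    unfolding psum_def using fin assms(3,4) c by (intro R.finsum_Un_disjoint) auto
qed

lemma psum_permute: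
  assumes Q: "Q \<subseteq> Perm" and \<sigma>: "\<sigma> permutes {1..n}" and t: "t \<in> carrier T"
  shows "psum Q (perm_tensor \<sigma> t) = sgnR \<sigma> \<otimes> psum ((\<lambda>p. p \<circ> \<sigma>) ` Q) t"
proof -
  have c: "p permutes {1..n}" if "p \<in> Q" for p using that Q by blast
  have c': "p \<circ> \<sigma> permutes {1..n}" if "p \<in> Q" for p by (rule permutes_compose[OF \<sigma> c[OF that]])
  have inj: "inj_on (\<lambda>p. p \<circ> \<sigma>) Q"
    by (intro inj_onI) (metis comp_assoc comp_id permutes_inv_o(1)[OF \<sigma>])
  have "psum ((\<lambda>p. p \<circ> \<sigma>) ` Q) t = (\<Oplus>p\<in>Q. sgnR (p \<circ> \<sigma>) \<otimes> tcrd (exps (p \<circ> \<sigma>)) t)"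
    unfolding psum_def using t c' inj by (intro R.finsum_reindex) auto
  then have "sgnR \<sigma> \<otimes> psum ((\<lambda>p. p \<circ> \<sigma>) ` Q) t =
      (\<Oplus>p\<in>Q. sgnR \<sigma> \<otimes> (sgnR (p \<circ> \<sigma>) \<otimes> tcrd (exps (p \<circ> \<sigma>)) t))"
    using t c' finite_subset[OF Q finite_Perm] by (simp, intro R.finsum_rdistr) auto
  also have "\<dots> = psum Q (perm_tensor \<sigma> t)"
    unfolding psum_def
  proof (rule R.finsum_cong'[OF refl])
    show "(\<lambda>p. sgnR p \<otimes> tcrd (exps p) (perm_tensor \<sigma> t)) \<in> Q \<rightarrow> carrier R"
      using t c by (intro Pi_I term_closed perm_tensor_closed[OF \<sigma>])
    fix p assume p: "p \<in> Q"
    have "sgnR \<sigma> \<otimes> (sgnR (p \<circ> \<sigma>) \<otimes> tcrd (exps (p \<circ> \<sigma>)) t) =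
        (sgnR \<sigma> \<otimes> sgnR \<sigma>) \<otimes> (sgnR p \<otimes> tcrd (exps (p \<circ> \<sigma>)) t)"
      using t c'[OF p] by (simp add: sgnR_comp[OF c[OF p] \<sigma>] R.m_ac)
    also have "\<dots> = sgnR p \<otimes> tcrd (exps p) (perm_tensor \<sigma> t)"
      using t c[OF p] c'[OF p]
      by (simp add: sgnR_square tcrd_permute(1)[OF \<sigma>] exps_comp[OF \<sigma>])
    finally show "sgnR \<sigma> \<otimes> (sgnR (p \<circ> \<sigma>) \<otimes> tcrd (exps (p \<circ> \<sigma>)) t) =
        sgnR p \<otimes> tcrd (exps p) (perm_tensor \<sigma> t)" .
  qed
  finally show ?thesis by simp
qed

text \<open>
  The terms of \<open>p\<close> and \<open>p \<circ> (i j)\<close> cancel in pairs.  Being a cancellation, and not a consequence of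
  \<open>x = - x\<close>, this also holds where \<open>2\<close> is a zero divisor.
\<close>

lemma psum_transposition_invariant:
  assumes Q: "Q \<subseteq> Perm" and ij: "i \<in> {1..n}" "j \<in> {1..n}" "i \<noteq> j"
    and closed: "\<And>p. p \<in> Q \<Longrightarrow> p \<circ> transpose i j \<in> Q"
    and t: "t \<in> carrier T" and inv: "perm_tensor (transpose i j) t = t"
  shows "psum Q t = \<zero>"
proof -
  let ?\<sigma> = "transpose i j"
  have \<sigma>: "?\<sigma> permutes {1..n}" using ij by (intro permutes_swap_id) auto
  define Q1 where "Q1 = {p \<in> Q. p i < p j}"
  define Q2 where "Q2 = {p \<in> Q. p j < p i}"
  have ne: "p i \<noteq> p j" if "p \<in> Q" for p
    using that Q ij(3) permutes_inj by (metis injD mem_Collect_eq subsetD)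
  have "Q2 = (\<lambda>p. p \<circ> ?\<sigma>) ` Q1"
  proof (intro equalityI subsetI)
    fix p assume p: "p \<in> Q2"
    then have "p \<circ> ?\<sigma> \<in> Q1" using closed by (simp add: Q1_def Q2_def)
    moreover have "p = (p \<circ> ?\<sigma>) \<circ> ?\<sigma>" by (simp add: comp_assoc)
    ultimately show "p \<in> (\<lambda>p. p \<circ> ?\<sigma>) ` Q1" by blast
  qed (use closed in \<open>auto simp: Q1_def Q2_def\<close>)
  then have "psum Q1 t = sgnR ?\<sigma> \<otimes> psum Q2 t"
    using psum_permute[OF _ \<sigma> t, of Q1] Q inv by (auto simp: Q1_def)
  also have "sgnR ?\<sigma> = \<ominus> \<one>" using ij(3) by (simp add: sgnR_def evenperm_swap)
  finally have "psum Q1 t = \<ominus> psum Q2 t" using Q t by (simp add: R.l_minus Q2_def subset_iff)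
  moreover have "Q = Q1 \<union> Q2" using ne by (auto simp: Q1_def Q2_def neq_iff)
  moreover have "psum (Q1 \<union> Q2) t = psum Q1 t \<oplus> psum Q2 t"
    using Q t by (intro psum_Un) (auto simp: Q1_def Q2_def)
  moreover have "psum Q2 t \<in> carrier R" using Q t by (intro psum_closed) (auto simp: Q2_def)
  ultimately show ?thesis by (simp add: R.l_neg)
qed

lemma tcrd_exps_basis:
  assumes "p permutes {1..n}" "\<alpha> \<in> X"
  shows "tcrd (exps p) (basis_tensor \<alpha>) = (if exps p = \<alpha> then \<one> else \<zero>)"
  by (rule tcrd_basis_tensor[OF exps_closed[OF assms(1)] assms(2)])

lemma psum_basis:
  assumes Q: "Q \<subseteq> Perm" and q: "q permutes {1..n}"
  shows "psum Q (basis_tensor (exps q)) = (if q \<in> Q then sgnR q else \<zero>)"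
proof -
  have c: "p permutes {1..n}" if "p \<in> Q" for p using that Q by blast
  have "psum Q (basis_tensor (exps q)) = (\<Oplus>p\<in>Q. if q = p then sgnR p else \<zero>)"
    unfolding psum_def
  proof (rule R.finsum_cong'[OF refl])
    fix p assume "p \<in> Q"
    then show "sgnR p \<otimes> tcrd (exps p) (basis_tensor (exps q)) = (if q = p then sgnR p else \<zero>)"
      using exps_inj[OF c q, of p] by (auto simp: tcrd_exps_basis c q)
  qed auto
  also have "\<dots> = (if q \<in> Q then sgnR q else \<zero>)"
  proof (cases "q \<in> Q")
    case True
    then show ?thesis using finite_subset[OF Q finite_Perm] by (simp, intro R.finsum_singleton) auto
  next
    case False
    then have "(\<Oplus>p\<in>Q. if q = p then sgnR p else \<zero>) = (\<Oplus>p\<in>Q. \<zero>)" by (intro R.finsum_cong') auto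
    then show ?thesis using False by simp
  qed
  finally show ?thesis .
qed

lemma psum_basis_repeated:
  assumes Q: "Q \<subseteq> Perm" and \<alpha>: "\<alpha> \<in> X" "i \<in> {1..n}" "j \<in> {1..n}" "i \<noteq> j" "\<alpha> i = \<alpha> j"
  shows "psum Q (basis_tensor \<alpha>) = \<zero>"
proof -
  have "sgnR p \<otimes> tcrd (exps p) (basis_tensor \<alpha>) = \<zero>" if "p \<in> Q" for p
  proof -
    have p: "p permutes {1..n}" using that Q by blast
    have "exps p \<noteq> \<alpha>"
    proof
      assume eq: "exps p = \<alpha>"
      have "p i \<in> {1..n}" "p j \<in> {1..n}" using \<alpha> permutes_in_image[OF p] by blast+
      moreover have "p i - 1 = p j - 1" using \<alpha> eq by (auto simp: exps_def)
      ultimately have "p i = p j" by auto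
      then show False using permutes_inj[OF p] \<alpha>(4) by (auto dest: injD)
    qed
    then show ?thesis by (simp add: tcrd_exps_basis p \<alpha>(1))
  qed
  then show ?thesis unfolding psum_def by (rule R.add.finprod_one_eqI)
qed

text \<open>
  An injective exponent function takes all values below \<open>n\<close>, as it has \<open>n\<close> arguments.
\<close>

lemma exps_surj:
  assumes \<alpha>: "\<alpha> \<in> X" and inj: "inj_on \<alpha> {1..n}"
  obtains p where "p permutes {1..n}" "\<alpha> = exps p"
proof -
  define p where "p i = (if i \<in> {1..n} then Suc (\<alpha> i) else i)" for i
  have "p permutes {1..n}"
  proof (rule bij_imp_permutes)
    have "inj_on p {1..n}"
    proof (rule inj_onI)
      fix i j assume ij: "i \<in> {1..n}" "j \<in> {1..n}" "p i = p j"
      then have "\<alpha> i = \<alpha> j" by (simp only: p_def if_True nat.inject)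
      then show "i = j" using ij inj by (simp only: inj_on_eq_iff)
    qed
    moreover have "p ` {1..n} \<subseteq> {1..n}"
    proof (rule image_subsetI)
      fix i assume i: "i \<in> {1..n}"
      then have "p i = Suc (\<alpha> i)" by (simp only: p_def if_True)
      then show "p i \<in> {1..n}" using X_nth[OF \<alpha> i] by simp
    qed
    ultimately show "bij_betw p {1..n} {1..n}" by (simp add: bij_betw_def endo_inj_surj)
  qed (simp only: p_def if_False)
  moreover have "\<alpha> = exps p" using PiE_arb[OF \<alpha>] by (auto simp: exps_def p_def fun_eq_iff)
  ultimately show thesis by (rule that)
qed

abbreviation e0 where "e0 \<equiv> basis_tensor (exps id)"

lemma e0_closed: "e0 \<in> carrier T"
  by (intro basis_tensor_closed exps_closed permutes_id)

text \<open>
  The determinant functional is the projection to the top exterior power, a free module of rank one,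
  on which symmetric tensors act by scalars; the scalar is read off at \<open>e0\<close>, the tensor of all basis
  vectors in their order.  On the basis: if two exponents agree, then \<open>z\<close> times the basis tensor is fixed
  by a transposition, and otherwise the basis tensor is a permutation of \<open>e0\<close>.
\<close>

lemma alt_symmetric_mult:
  assumes z: "z \<in> carrier T" and sym: "\<And>\<sigma>. \<sigma> permutes {1..n} \<Longrightarrow> perm_tensor \<sigma> z = z"
    and t: "t \<in> carrier T"
  shows "alt (z \<otimes>\<^bsub>T\<^esub> t) = alt (z \<otimes>\<^bsub>T\<^esub> e0) \<otimes> alt t"
  using t
proof (rule tensor_basis_induct)
  have ze: "alt (z \<otimes>\<^bsub>T\<^esub> e0) \<in> carrier R" using z e0_closed by (intro psum_closed) auto
  show "alt (z \<otimes>\<^bsub>T\<^esub> \<zero>\<^bsub>T\<^esub>) = alt (z \<otimes>\<^bsub>T\<^esub> e0) \<otimes> alt \<zero>\<^bsub>T\<^esub>"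
    using z ze by (simp add: psum_zero)
  show "alt (z \<otimes>\<^bsub>T\<^esub> (t \<oplus>\<^bsub>T\<^esub> u)) = alt (z \<otimes>\<^bsub>T\<^esub> e0) \<otimes> alt (t \<oplus>\<^bsub>T\<^esub> u)"
    if "t \<in> carrier T" "u \<in> carrier T" "alt (z \<otimes>\<^bsub>T\<^esub> t) = alt (z \<otimes>\<^bsub>T\<^esub> e0) \<otimes> alt t"
      "alt (z \<otimes>\<^bsub>T\<^esub> u) = alt (z \<otimes>\<^bsub>T\<^esub> e0) \<otimes> alt u" for t u
    using that z ze by (simp add: T.r_distr psum_add R.r_distr)
  show "alt (z \<otimes>\<^bsub>T\<^esub> (r \<odot>\<^bsub>T\<^esub> t)) = alt (z \<otimes>\<^bsub>T\<^esub> e0) \<otimes> alt (r \<odot>\<^bsub>T\<^esub> t)"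
    if "r \<in> carrier R" "t \<in> carrier T" "alt (z \<otimes>\<^bsub>T\<^esub> t) = alt (z \<otimes>\<^bsub>T\<^esub> e0) \<otimes> alt t" for r t
  proof -
    have "z \<otimes>\<^bsub>T\<^esub> (r \<odot>\<^bsub>T\<^esub> t) = r \<odot>\<^bsub>T\<^esub> (z \<otimes>\<^bsub>T\<^esub> t)"
      using that z by (simp add: T.m_comm[of z] T.smult_assoc2)
    then show ?thesis using that z ze by (simp add: psum_smult R.m_lcomm)
  qed
  show "alt (z \<otimes>\<^bsub>T\<^esub> basis_tensor \<alpha>) = alt (z \<otimes>\<^bsub>T\<^esub> e0) \<otimes> alt (basis_tensor \<alpha>)" if \<alpha>: "\<alpha> \<in> X" for \<alpha>
  proof (cases "inj_on \<alpha> {1..n}")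
    case True
    obtain p where p: "p permutes {1..n}" "\<alpha> = exps p" by (rule exps_surj[OF \<alpha> True])
    note \<alpha>_eq = p(2)
    note p = p(1)
    have "exps id \<circ> inv' (inv' p) = exps p"
      using p by (simp add: exps_comp permutes_inv_inv)
    then have "perm_tensor (inv' p) e0 = basis_tensor (exps p)"
      using perm_tensor_basis_tensor[OF permutes_inv[OF p] exps_closed[OF permutes_id]] by simp
    then have "z \<otimes>\<^bsub>T\<^esub> basis_tensor \<alpha> = perm_tensor (inv' p) (z \<otimes>\<^bsub>T\<^esub> e0)"
      using z \<alpha>_eq sym[OF permutes_inv[OF p]] e0_closed
      by (simp add: perm_tensor_mult[OF permutes_inv[OF p]])
    moreover have "(\<lambda>q. q \<circ> inv' p) ` Perm = Perm"
    proof (intro equalityI subsetI)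
      fix q assume "q \<in> Perm"
      then have "q \<circ> p \<in> Perm" using permutes_compose[OF p] by blast
      moreover have "q = (q \<circ> p) \<circ> inv' p" using permutes_inv_o(1)[OF p] by (simp add: comp_assoc)
      ultimately show "q \<in> (\<lambda>q. q \<circ> inv' p) ` Perm" by blast
    qed (use permutes_compose[OF permutes_inv[OF p]] in blast)
    ultimately have "alt (z \<otimes>\<^bsub>T\<^esub> basis_tensor \<alpha>) = sgnR (inv' p) \<otimes> alt (z \<otimes>\<^bsub>T\<^esub> e0)"
      using psum_permute[OF subset_refl permutes_inv[OF p], of "z \<otimes>\<^bsub>T\<^esub> e0"] z e0_closed by simp
    then show ?thesis
      using p ze by (simp add: \<alpha>_eq psum_basis sgnR_inv R.m_comm)
  next
    case False
    then obtain i j where ij: "i \<in> {1..n}" "j \<in> {1..n}" "i \<noteq> j" "\<alpha> i = \<alpha> j"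
      by (auto simp: inj_on_def)
    let ?\<sigma> = "transpose i j"
    have \<sigma>: "?\<sigma> permutes {1..n}" using ij by (intro permutes_swap_id) auto
    have "\<alpha> \<circ> inv' ?\<sigma> = \<alpha>" using ij(4) by (auto simp: fun_eq_iff transpose_def)
    then have "perm_tensor ?\<sigma> (z \<otimes>\<^bsub>T\<^esub> basis_tensor \<alpha>) = z \<otimes>\<^bsub>T\<^esub> basis_tensor \<alpha>"
      using z \<alpha> by (simp add: perm_tensor_mult[OF \<sigma>] sym[OF \<sigma>] perm_tensor_basis_tensor[OF \<sigma>])
    then have "alt (z \<otimes>\<^bsub>T\<^esub> basis_tensor \<alpha>) = \<zero>"
      using ij z \<alpha> permutes_compose[OF \<sigma>]
      by (intro psum_transposition_invariant[of Perm i j]) auto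
    moreover have "alt (basis_tensor \<alpha>) = \<zero>"
      using ij \<alpha> by (intro psum_basis_repeated[of Perm \<alpha> i j]) auto
    ultimately show ?thesis using ze by simp
  qed
qed

end

section \<open>Half of the determinant functional\<close>

locale quartic_tensor = tensor_alternation R A b 4 for R (structure) and A and b :: "nat \<Rightarrow> 'c"
begin

text \<open>
  Composition with the reflection exchanges the values at \<open>1\<close> and \<open>4\<close>, so that one permutation of each pair
  \<open>p\<close>, \<open>p \<circ> (1 4)(2 3)\<close> is selected.
\<close>

definition Half :: "(nat \<Rightarrow> nat) set" where "Half = {p \<in> Perm. p 1 < p 4}"

abbreviation half where "half \<equiv> psum Half"

definition reflection :: "nat \<Rightarrow> nat" where "reflection = transpose 1 4 \<circ> transpose 2 3"

lemma Half_subset: "Half \<subseteq> Perm" by (auto simp: Half_def)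

lemma reflection_permutes: "reflection permutes {1..4}"
  unfolding reflection_def by (intro permutes_compose permutes_swap_id) auto

lemma reflection_simps [simp]:
  "reflection 1 = 4" "reflection 2 = 3" "reflection 3 = 2" "reflection 4 = 1"
  by (simp_all add: reflection_def transpose_def)

lemma reflection_involution: "reflection \<circ> reflection = id"
  by (auto simp: reflection_def transpose_def fun_eq_iff)

lemma sgnR_reflection: "sgnR reflection = \<one>"
  by (simp add: sgnR_def reflection_def evenperm_comp evenperm_swap permutation_swap_id)

text \<open>
  Since the reflection is even, the terms of \<open>half\<close> at \<open>perm_tensor reflection v\<close> are those of \<open>alt v\<close> for
  the other half of the permutations.
\<close>

lemma half_add_reflection:
  assumes v: "v \<in> carrier T"
  shows "half v \<oplus> half (perm_tensor reflection v) = alt v"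
proof -
  let ?Half' = "(\<lambda>p. p \<circ> reflection) ` Half"
  have eq: "?Half' = {p \<in> Perm. p 4 < p 1}"
  proof (intro equalityI subsetI)
    fix p assume "p \<in> {p \<in> Perm. p 4 < p 1}"
    then have "p \<circ> reflection \<in> Half"
      using permutes_compose[OF reflection_permutes] by (auto simp: Half_def)
    moreover have "p = (p \<circ> reflection) \<circ> reflection" by (simp add: comp_assoc reflection_involution)
    ultimately show "p \<in> ?Half'" by blast
  qed (use permutes_compose[OF reflection_permutes] in \<open>auto simp: Half_def\<close>)
  have "p 1 \<noteq> p 4" if "p permutes {1..4}" for p :: "nat \<Rightarrow> nat"
    using injD[OF permutes_inj[OF that], of 1 4] by auto
  then have "Half \<union> ?Half' = Perm" "Half \<inter> ?Half' = {}"
    unfolding eq by (auto simp: Half_def neq_iff)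
  moreover have "half (perm_tensor reflection v) = psum ?Half' v"
    using psum_permute[OF Half_subset reflection_permutes v] v
    by (simp add: sgnR_reflection eq subset_iff)
  moreover have "?Half' \<subseteq> Perm" unfolding eq by blast
  ultimately show ?thesis using psum_Un[OF Half_subset _ _ v, of ?Half'] by simp
qed

text \<open>
  The reflection permutes the basis tensors.  Orbits of two elements contribute to \<open>u\<close>.  A basis tensor that
  is fixed has equal exponents at \<open>2\<close> and \<open>3\<close>, and is therefore fixed by \<open>(2 3)\<close> alone.
\<close>

lemma reflection_decomposition:
  assumes t: "t \<in> carrier T" and inv: "perm_tensor reflection t = t"
  obtains u w where "u \<in> carrier T" "w \<in> carrier T" "t = u \<oplus>\<^bsub>T\<^esub> perm_tensor reflection u \<oplus>\<^bsub>T\<^esub> w"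
    "perm_tensor (transpose 2 3) w = w"
proof -
  let ?c = "\<lambda>\<alpha>. tcrd \<alpha> t \<odot>\<^bsub>T\<^esub> basis_tensor \<alpha>"
  define X1 where "X1 = {\<alpha> \<in> X. \<alpha> 1 < \<alpha> 4 \<or> \<alpha> 1 = \<alpha> 4 \<and> \<alpha> 2 < \<alpha> 3}"
  define X2 where "X2 = {\<alpha> \<in> X. \<alpha> 4 < \<alpha> 1 \<or> \<alpha> 1 = \<alpha> 4 \<and> \<alpha> 3 < \<alpha> 2}"
  define X3 where "X3 = {\<alpha> \<in> X. \<alpha> 1 = \<alpha> 4 \<and> \<alpha> 2 = \<alpha> 3}"
  have sub: "X1 \<subseteq> X" "X2 \<subseteq> X" "X3 \<subseteq> X" by (auto simp: X1_def X2_def X3_def)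
  have fin: "finite X1" "finite X2" "finite X3" using sub finite_X finite_subset by blast+
  have c: "?c \<alpha> \<in> carrier T" if "\<alpha> \<in> X" for \<alpha> using that t by simp
  define u where "u = (\<Oplus>\<^bsub>T\<^esub>\<alpha>\<in>X1. ?c \<alpha>)"
  define w where "w = (\<Oplus>\<^bsub>T\<^esub>\<alpha>\<in>X3. ?c \<alpha>)"
  have u: "u \<in> carrier T" and w: "w \<in> carrier T"
    unfolding u_def w_def using c sub by (intro T.M.finsum_closed Pi_I; blast)+
  have \<rho>X: "\<alpha> \<circ> reflection \<in> X" if "\<alpha> \<in> X" for \<alpha>
    by (rule tcrd_permute(2)[OF reflection_permutes that t])
  have \<rho>\<rho>: "\<alpha> = (\<alpha> \<circ> reflection) \<circ> reflection" for \<alpha> :: "nat \<Rightarrow> nat"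
    by (simp add: comp_assoc reflection_involution)
  have inv_\<rho>: "inv' reflection = reflection"
    by (rule inv_unique_comp[OF reflection_involution reflection_involution])
  have refl_c: "perm_tensor reflection (?c \<alpha>) = ?c (\<alpha> \<circ> reflection)" if \<alpha>: "\<alpha> \<in> X" for \<alpha>
  proof -
    have "tcrd (\<alpha> \<circ> reflection) t = tcrd \<alpha> t"
      using tcrd_permute(1)[OF reflection_permutes \<alpha> t] inv by simp
    then show ?thesis
      using \<alpha> t by (simp add: perm_tensor_smult[OF reflection_permutes]
          perm_tensor_basis_tensor[OF reflection_permutes] inv_\<rho>)
  qed
  have X2_eq: "X2 = (\<lambda>\<alpha>. \<alpha> \<circ> reflection) ` X1"
  proof (intro equalityI subsetI)
    fix \<alpha> assume "\<alpha> \<in> X2"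
    then have "\<alpha> \<circ> reflection \<in> X1" using \<rho>X by (auto simp: X1_def X2_def)
    then show "\<alpha> \<in> (\<lambda>\<alpha>. \<alpha> \<circ> reflection) ` X1" using \<rho>\<rho> by blast
  qed (use \<rho>X in \<open>auto simp: X1_def X2_def\<close>)
  interpret h: ring_hom_cring T T "perm_tensor reflection" by (rule perm_tensor_hom[OF reflection_permutes])
  have "perm_tensor reflection u = (\<Oplus>\<^bsub>T\<^esub>\<alpha>\<in>X1. perm_tensor reflection (?c \<alpha>))"
    unfolding u_def using c sub by (subst h.hom_finsum) (auto simp: comp_def)
  also have "\<dots> = (\<Oplus>\<^bsub>T\<^esub>\<alpha>\<in>X1. ?c (\<alpha> \<circ> reflection))"
  proof (rule T.M.finsum_cong'[OF refl])
    show "(\<lambda>\<alpha>. ?c (\<alpha> \<circ> reflection)) \<in> X1 \<rightarrow> carrier T" using c \<rho>X sub by blast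
    show "perm_tensor reflection (?c \<alpha>) = ?c (\<alpha> \<circ> reflection)" if "\<alpha> \<in> X1" for \<alpha>
      using that sub refl_c by blast
  qed
  also have "\<dots> = (\<Oplus>\<^bsub>T\<^esub>\<alpha>\<in>X2. ?c \<alpha>)"
    unfolding X2_eq
  proof (rule T.M.finsum_reindex[symmetric])
    show "?c \<in> (\<lambda>\<alpha>. \<alpha> \<circ> reflection) ` X1 \<rightarrow> carrier T" using c \<rho>X sub by blast
    show "inj_on (\<lambda>\<alpha>. \<alpha> \<circ> reflection) X1" using \<rho>\<rho> by (intro inj_onI) metis
  qed
  finally have \<rho>u: "perm_tensor reflection u = (\<Oplus>\<^bsub>T\<^esub>\<alpha>\<in>X2. ?c \<alpha>)" .
  have cX: "?c \<in> X1 \<rightarrow> carrier T" "?c \<in> X2 \<rightarrow> carrier T" "?c \<in> X3 \<rightarrow> carrier T"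
    "?c \<in> X1 \<union> X2 \<rightarrow> carrier T" using c sub by blast+
  have "X = (X1 \<union> X2) \<union> X3" using sub by (auto simp: X1_def X2_def X3_def neq_iff)
  then have "t = (\<Oplus>\<^bsub>T\<^esub>\<alpha>\<in>(X1 \<union> X2) \<union> X3. ?c \<alpha>)" using tensor_expansion[OF t] by simp
  also have "\<dots> = (\<Oplus>\<^bsub>T\<^esub>\<alpha>\<in>X1 \<union> X2. ?c \<alpha>) \<oplus>\<^bsub>T\<^esub> w"
    unfolding w_def using fin cX by (intro T.M.finsum_Un_disjoint) (auto simp: X1_def X2_def X3_def)
  also have "(\<Oplus>\<^bsub>T\<^esub>\<alpha>\<in>X1 \<union> X2. ?c \<alpha>) = u \<oplus>\<^bsub>T\<^esub> perm_tensor reflection u"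
    unfolding u_def \<rho>u[unfolded u_def] using fin cX
    by (intro T.M.finsum_Un_disjoint) (auto simp: X1_def X2_def)
  finally have dec: "t = u \<oplus>\<^bsub>T\<^esub> perm_tensor reflection u \<oplus>\<^bsub>T\<^esub> w" .
  have \<kappa>: "transpose 2 3 permutes {1..4::nat}" by (intro permutes_swap_id) auto
  interpret k: ring_hom_cring T T "perm_tensor (transpose 2 3)" by (rule perm_tensor_hom[OF \<kappa>])
  have "perm_tensor (transpose 2 3) w = (\<Oplus>\<^bsub>T\<^esub>\<alpha>\<in>X3. perm_tensor (transpose 2 3) (?c \<alpha>))"
    unfolding w_def using c sub by (subst k.hom_finsum) (auto simp: comp_def)
  also have "\<dots> = w"
    unfolding w_def
  proof (rule T.M.finsum_cong'[OF refl cX(3)])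
    fix \<alpha> assume \<alpha>: "\<alpha> \<in> X3"
    then have "\<alpha> \<circ> inv' (transpose 2 3) = \<alpha>" by (auto simp: X3_def fun_eq_iff transpose_def)
    moreover have "\<alpha> \<in> X" using \<alpha> sub by blast
    ultimately show "perm_tensor (transpose 2 3) (?c \<alpha>) = ?c \<alpha>"
      using t by (simp add: perm_tensor_smult[OF \<kappa>] perm_tensor_basis_tensor[OF \<kappa>])
  qed
  finally show ?thesis using that[OF u w dec] by blast
qed

text \<open>
  The functional \<open>half\<close> kills the part fixed by \<open>(2 3)\<close>, as \<open>Half\<close> is stable under that transposition, and
  on \<open>u + (1 4)(2 3) u\<close> it equals \<open>alt u\<close>.  Both facts persist after multiplication by a symmetric tensor,
  so that the rule for \<open>alt\<close> carries over to \<open>half\<close>.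
\<close>

lemma half_symmetric_mult:
  assumes z: "z \<in> carrier T" and sym: "\<And>\<sigma>. \<sigma> permutes {1..4} \<Longrightarrow> perm_tensor \<sigma> z = z"
    and t: "t \<in> carrier T" and inv: "perm_tensor reflection t = t"
  shows "half (z \<otimes>\<^bsub>T\<^esub> t) = alt (z \<otimes>\<^bsub>T\<^esub> e0) \<otimes> half t"
proof -
  obtain u w where uw: "u \<in> carrier T" "w \<in> carrier T" and
    dec: "t = u \<oplus>\<^bsub>T\<^esub> perm_tensor reflection u \<oplus>\<^bsub>T\<^esub> w" and w: "perm_tensor (transpose 2 3) w = w"
    by (rule reflection_decomposition[OF t inv])
  note \<rho> = reflection_permutes
  have \<rho>u: "perm_tensor reflection u \<in> carrier T" by (rule perm_tensor_closed[OF \<rho> uw(1)])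
  have \<kappa>: "transpose 2 3 permutes {1..4::nat}" by (intro permutes_swap_id) auto
  have zero: "half v = \<zero>" if "v \<in> carrier T" "perm_tensor (transpose 2 3) v = v" for v
  proof (rule psum_transposition_invariant[OF Half_subset _ _ _ _ that])
    show "p \<circ> transpose 2 3 \<in> Half" if "p \<in> Half" for p
      using that permutes_compose[OF \<kappa>] by (auto simp: Half_def transpose_def)
  qed auto
  have "z \<otimes>\<^bsub>T\<^esub> t = (z \<otimes>\<^bsub>T\<^esub> u \<oplus>\<^bsub>T\<^esub> perm_tensor reflection (z \<otimes>\<^bsub>T\<^esub> u)) \<oplus>\<^bsub>T\<^esub> z \<otimes>\<^bsub>T\<^esub> w"
    unfolding dec using z uw \<rho>u by (simp add: perm_tensor_mult[OF \<rho>] sym[OF \<rho>] T.r_distr)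
  moreover have "half (z \<otimes>\<^bsub>T\<^esub> w) = \<zero>"
    using z uw w by (intro zero) (simp_all add: perm_tensor_mult[OF \<kappa>] sym[OF \<kappa>])
  ultimately have "half (z \<otimes>\<^bsub>T\<^esub> t) =
      half (z \<otimes>\<^bsub>T\<^esub> u) \<oplus> half (perm_tensor reflection (z \<otimes>\<^bsub>T\<^esub> u))"
    using z uw \<rho>u by (simp add: psum_add[OF Half_subset] perm_tensor_closed[OF \<rho>] psum_closed[OF Half_subset])
  also have "\<dots> = alt (z \<otimes>\<^bsub>T\<^esub> u)" using z uw by (intro half_add_reflection) simp
  also have "\<dots> = alt (z \<otimes>\<^bsub>T\<^esub> e0) \<otimes> alt u" by (rule alt_symmetric_mult[OF z sym uw(1)])
  also have "alt u = half t"
    unfolding dec using uw \<rho>u zero[OF uw(2) w]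
    by (simp add: psum_add[OF Half_subset] half_add_reflection[symmetric] psum_closed[OF Half_subset])
  finally show ?thesis .
qed

end

section \<open>Characteristic polynomials and elementary symmetric tensors\<close>

text \<open>
  Expanding the product, \<open>S\<close> is the set of factors from which the constant term is taken.
\<close>

lemma (in UP_cring) coeff_prod_linear:
  assumes I: "finite I" and c: "\<And>i. i \<in> I \<Longrightarrow> c i \<in> carrier R" and m: "\<And>i. i \<in> I \<Longrightarrow> m i \<in> carrier R"
  shows "coeff P (\<Otimes>\<^bsub>P\<^esub>i\<in>I. monom P (c i) 1 \<ominus>\<^bsub>P\<^esub> monom P (m i) 0) j =
    (\<Oplus>S\<in>{S. S \<subseteq> I \<and> card S + j = card I}. (\<ominus> \<one>) [^] card S \<otimes> (\<Otimes>i\<in>I. if i \<in> S then m i else c i))"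
  using assms
proof (induction I arbitrary: j rule: finite_induct)
  case empty
  have "{S :: 'c set. S = {} \<and> card S + j = 0} = (if j = 0 then {{}} else {})" by auto
  then show ?case by (simp add: R.finsum_insert)
next
  case (insert x I)
  let ?l = "\<lambda>i. monom P (c i) 1 \<ominus>\<^bsub>P\<^esub> monom P (m i) 0"
  let ?f = "\<Otimes>\<^bsub>P\<^esub>i\<in>I. ?l i"
  let ?K = "\<lambda>j. {S. S \<subseteq> I \<and> card S + j = card I}"
  let ?A = "{S. S \<subseteq> I \<and> card S + j = Suc (card I)}"
  let ?B = "insert x ` ?K j"
  let ?w = "\<lambda>S. (\<ominus> \<one>) [^] card S \<otimes> (\<Otimes>i\<in>I. if i \<in> S then m i else c i)"
  let ?w' = "\<lambda>S. (\<ominus> \<one>) [^] card S \<otimes> (\<Otimes>i\<in>insert x I. if i \<in> S then m i else c i)"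
  have cx: "c x \<in> carrier R" "m x \<in> carrier R" and cI: "\<And>i. i \<in> I \<Longrightarrow> c i \<in> carrier R"
    and mI: "\<And>i. i \<in> I \<Longrightarrow> m i \<in> carrier R" using insert.prems by auto
  have l: "?l i \<in> carrier P" if "i \<in> insert x I" for i using that insert.prems by simp
  then have f: "?f \<in> carrier P" by (intro P.finprod_closed) auto
  have pr: "(\<Otimes>i\<in>I. if i \<in> S then m i else c i) \<in> carrier R" for S
    using cI mI by (intro R.finprod_closed) auto
  have fin: "finite ?A" "\<And>j. finite (?K j)" using insert.hyps(1) by simp_all
  have IH: "coeff P ?f j = (\<Oplus>S\<in>?K j. ?w S)" for j using insert.IH[OF cI mI] .
  have split: "(\<Otimes>i\<in>insert x I. if i \<in> S then m i else c i) =
      (if x \<in> S then m x else c x) \<otimes> (\<Otimes>i\<in>I. if i \<in> S then m i else c i)" for S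
    using insert.hyps cx cI mI by (intro R.finprod_insert) auto
  have wc: "?w' S \<in> carrier R" for S
    unfolding split using cx pr by (cases "x \<in> S") simp_all
  have "(\<Otimes>\<^bsub>P\<^esub>i\<in>insert x I. ?l i) = ?l x \<otimes>\<^bsub>P\<^esub> ?f"
    using insert.hyps l by (intro P.finprod_insert) auto
  then have "coeff P (\<Otimes>\<^bsub>P\<^esub>i\<in>insert x I. ?l i) j =
      coeff P (monom P (c x) 1 \<otimes>\<^bsub>P\<^esub> ?f) j \<ominus> coeff P (monom P (m x) 0 \<otimes>\<^bsub>P\<^esub> ?f) j"
    using f cx by (simp add: P.minus_eq P.l_distr P.l_minus R.minus_eq)
  also have "coeff P (monom P (m x) 0 \<otimes>\<^bsub>P\<^esub> ?f) j = m x \<otimes> coeff P ?f j"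
    using coeff_monom_mult[OF cx(2) f, of 0 j] by simp
  also have "coeff P (monom P (c x) 1 \<otimes>\<^bsub>P\<^esub> ?f) j = (\<Oplus>S\<in>?A. ?w' S)"
  proof -
    have w': "?w' S = c x \<otimes> ?w S" if "S \<in> ?A" for S
    proof -
      have "x \<notin> S" using that insert.hyps(2) by blast
      then show ?thesis using cx pr by (simp add: split R.m_lcomm)
    qed
    show ?thesis
    proof (cases j)
      case 0
      have "coeff P (monom P (c x) 1 \<otimes>\<^bsub>P\<^esub> ?f) 0 = \<zero>" using f cx by simp
      moreover have "S \<notin> ?A" for S using 0 card_mono[OF insert.hyps(1), of S] by auto
      then have "?A = {}" by blast
      ultimately show ?thesis unfolding \<open>?A = {}\<close> 0 by (simp only: R.finsum_empty)
    next
      case (Suc j')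
      have "coeff P (monom P (c x) 1 \<otimes>\<^bsub>P\<^esub> ?f) j = c x \<otimes> coeff P ?f j'"
        using coeff_monom_mult[OF cx(1) f, of 1 j'] by (simp only: Suc Suc_eq_plus1)
      also have "\<dots> = (\<Oplus>S\<in>?K j'. c x \<otimes> ?w S)"
        unfolding IH using cx pr fin by (intro R.finsum_rdistr) auto
      also have "?K j' = ?A" using Suc by auto
      also have "(\<Oplus>S\<in>?A. c x \<otimes> ?w S) = (\<Oplus>S\<in>?A. ?w' S)"
        using w' cx pr by (intro R.finsum_cong') (auto simp: split)
      finally show ?thesis .
    qed
  qed
  also have "m x \<otimes> coeff P ?f j = \<ominus> (\<Oplus>S\<in>?B. ?w' S)"
  proof -
    have inj: "inj_on (insert x) (?K j)" using insert.hyps(2) by (auto simp: inj_on_def insert_eq_iff subset_iff)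
    have "(\<Oplus>S\<in>?B. ?w' S) = (\<Oplus>S\<in>?K j. ?w' (insert x S))"
      by (rule R.finsum_reindex[OF Pi_I inj], rule wc)
    also have "\<dots> = (\<Oplus>S\<in>?K j. (\<ominus> m x) \<otimes> ?w S)"
    proof (rule R.finsum_cong'[OF refl])
      fix S assume S: "S \<in> ?K j"
      then have x: "x \<notin> S" and "finite S" using insert.hyps finite_subset by blast+
      have "(\<Otimes>i\<in>I. if i \<in> insert x S then m i else c i) = (\<Otimes>i\<in>I. if i \<in> S then m i else c i)"
        using insert.hyps(2) cI mI by (intro R.finprod_cong') auto
      then have "(\<Otimes>i\<in>insert x I. if i \<in> insert x S then m i else c i) =
          m x \<otimes> (\<Otimes>i\<in>I. if i \<in> S then m i else c i)"
        using split[of "insert x S"] by (simp only: insertI1 if_True)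
      then show "?w' (insert x S) = (\<ominus> m x) \<otimes> ?w S"
        using x \<open>finite S\<close> cx pr by (simp add: R.l_minus R.r_minus R.m_ac del: insert_iff)
    qed (use cx pr in auto)
    also have "\<dots> = (\<ominus> m x) \<otimes> coeff P ?f j"
      unfolding IH using cx pr fin by (intro R.finsum_rdistr[symmetric]) auto
    finally show ?thesis using cx f by (simp add: R.l_minus)
  qed
  also have "(\<Oplus>S\<in>?A. ?w' S) \<ominus> \<ominus> (\<Oplus>S\<in>?B. ?w' S) = (\<Oplus>S\<in>?A. ?w' S) \<oplus> (\<Oplus>S\<in>?B. ?w' S)"
  proof -
    have "(\<Oplus>S\<in>?B. ?w' S) \<in> carrier R" by (rule R.finsum_closed[OF Pi_I], rule wc)
    then show ?thesis by (simp only: R.minus_eq R.minus_minus)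
  qed
  also have "\<dots> = (\<Oplus>S\<in>?A \<union> ?B. ?w' S)"
  proof (rule R.finsum_Un_disjoint[symmetric, OF fin(1) finite_imageI[OF fin(2)]])
    show "?A \<inter> ?B = {}" using insert.hyps(2) by blast
  qed (rule Pi_I, rule wc)+
  also have "?A \<union> ?B = {S. S \<subseteq> insert x I \<and> card S + j = card (insert x I)}"
  proof (intro equalityI subsetI)
    fix S assume S: "S \<in> {S. S \<subseteq> insert x I \<and> card S + j = card (insert x I)}"
    then have "finite S" using insert.hyps(1) finite_subset by blast
    show "S \<in> ?A \<union> ?B"
    proof (cases "x \<in> S")
      case True
      then have "S = insert x (S - {x})" "S - {x} \<in> ?K j"
        using S insert.hyps \<open>finite S\<close> card_Suc_Diff1[OF \<open>finite S\<close> True] by auto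
      then show ?thesis by blast
    next
      case False
      then show ?thesis using S insert.hyps by auto
    qed
  next
    fix S assume "S \<in> ?A \<union> ?B"
    then consider "S \<in> ?A" | S' where "S = insert x S'" "S' \<subseteq> I" "card S' + j = card I" by blast
    then show "S \<in> {S. S \<subseteq> insert x I \<and> card S + j = card (insert x I)}"
    proof cases
      case 1
      then show ?thesis using insert.hyps by auto
    next
      case 2
      then have "x \<notin> S'" "finite S'" using insert.hyps finite_subset by blast+
      then show ?thesis using 2 insert.hyps by auto
    qed
  qed
  finally show ?case .
qed

lemma (in cring) subset_sum_reindex:
  assumes g: "bij_betw g I J" and I: "finite I" and f: "\<And>b j. j \<in> J \<Longrightarrow> f b j \<in> carrier R"
  shows "(\<Oplus>S\<in>{S. S \<subseteq> I \<and> card S = k}. \<Otimes>i\<in>I. f (i \<in> S) (g i)) =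
    (\<Oplus>S\<in>{S. S \<subseteq> J \<and> card S = k}. \<Otimes>j\<in>J. f (j \<in> S) j)"
proof -
  have inj: "inj_on g I" and J: "J = g ` I" using g by (auto simp: bij_betw_def)
  have K: "{S. S \<subseteq> J \<and> card S = k} = (`) g ` {S. S \<subseteq> I \<and> card S = k}"
  proof (intro equalityI subsetI)
    fix S assume S: "S \<in> {S. S \<subseteq> J \<and> card S = k}"
    then obtain S' where S': "S' \<subseteq> I" "S = g ` S'" unfolding J by (auto simp: subset_image_iff)
    then have "card S' = k" using S card_image[OF inj_on_subset[OF inj S'(1)]] by simp
    then show "S \<in> (`) g ` {S. S \<subseteq> I \<and> card S = k}" using S' by blast
  next
    fix S assume "S \<in> (`) g ` {S. S \<subseteq> I \<and> card S = k}"
    then obtain S' where "S' \<subseteq> I" "card S' = k" "S = g ` S'" by blast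
    then show "S \<in> {S. S \<subseteq> J \<and> card S = k}"
      using card_image[OF inj_on_subset[OF inj]] unfolding J by blast
  qed
  have "(\<Oplus>S\<in>{S. S \<subseteq> J \<and> card S = k}. \<Otimes>j\<in>J. f (j \<in> S) j) =
      (\<Oplus>S\<in>{S. S \<subseteq> I \<and> card S = k}. \<Otimes>j\<in>J. f (j \<in> g ` S) j)"
    unfolding K
  proof (rule finsum_reindex)
    show "inj_on ((`) g) {S. S \<subseteq> I \<and> card S = k}"
      by (rule inj_on_subset[OF inj_on_image_Pow[OF inj]]) blast
    show "(\<lambda>S. \<Otimes>j\<in>J. f (j \<in> S) j) \<in> (`) g ` {S. S \<subseteq> I \<and> card S = k} \<rightarrow> carrier R"
      using f by (intro Pi_I finprod_closed) auto
  qed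
  also have "\<dots> = (\<Oplus>S\<in>{S. S \<subseteq> I \<and> card S = k}. \<Otimes>i\<in>I. f (i \<in> S) (g i))"
  proof (rule finsum_cong'[OF refl])
    show "(\<lambda>S. \<Otimes>i\<in>I. f (i \<in> S) (g i)) \<in> {S. S \<subseteq> I \<and> card S = k} \<rightarrow> carrier R"
      using f unfolding J by (intro Pi_I finprod_closed) auto
    fix S assume S: "S \<in> {S. S \<subseteq> I \<and> card S = k}"
    have "(\<Otimes>j\<in>J. f (j \<in> g ` S) j) = (\<Otimes>i\<in>I. f (g i \<in> g ` S) (g i))"
      unfolding J using f inj by (intro finprod_reindex) (auto simp: J)
    also have "\<dots> = (\<Otimes>i\<in>I. f (i \<in> S) (g i))"
      using f S inj_on_image_mem_iff[OF inj] unfolding J by (intro finprod_cong') auto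
    finally show "(\<Otimes>j\<in>J. f (j \<in> g ` S) j) = (\<Otimes>i\<in>I. f (i \<in> S) (g i))" .
  qed
  finally show ?thesis by simp
qed

context tensor_alternation
begin

lemma psum_finsum:
  assumes Q: "Q \<subseteq> Perm" and K: "finite K" and u: "\<And>k. k \<in> K \<Longrightarrow> u k \<in> carrier T"
  shows "psum Q (\<Oplus>\<^bsub>T\<^esub>k\<in>K. u k) = (\<Oplus>k\<in>K. psum Q (u k))"
  using K u
proof (induction K rule: finite_induct)
  case empty
  then show ?case using psum_zero[OF Q] by simp
next
  case (insert k K)
  have "u k \<in> carrier T" "u \<in> K \<rightarrow> carrier T" "(\<lambda>k. psum Q (u k)) \<in> K \<rightarrow> carrier R"
    using insert.prems Q by auto
  then show ?case using insert Q
    by (simp add: T.M.finsum_insert R.finsum_insert psum_add T.M.finsum_closed)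
qed

lemma alt_pure:
  assumes "a \<in> E"
  shows "alt (pure a) = (\<Oplus>p\<in>Perm. sgnR p \<otimes> (\<Otimes>i\<in>{1..n}. crd (a i) (p i - 1)))"
  unfolding psum_def
proof (rule R.finsum_cong'[OF refl])
  have nth: "p i - 1 < n" if "p \<in> Perm" "i \<in> {1..n}" for p i
    using X_nth[OF exps_closed, of p i] that by (simp add: exps_def)
  show "(\<lambda>p. sgnR p \<otimes> (\<Otimes>i\<in>{1..n}. crd (a i) (p i - 1))) \<in> Perm \<rightarrow> carrier R"
    using nth by (intro Pi_I R.m_closed sgnR_closed R.finprod_closed crd_closed tuple_nth_closed[OF assms])
  fix p assume p: "p \<in> Perm"
  then have "tcrd (exps p) (pure a) = (\<Otimes>i\<in>{1..n}. crd (a i) (exps p i))"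
    using tcrd_pure[OF exps_closed assms] by (simp add: crd_prod_def)
  also have "\<dots> = (\<Otimes>i\<in>{1..n}. crd (a i) (p i - 1))"
    using nth[OF p] by (intro R.finprod_cong' Pi_I crd_closed tuple_nth_closed[OF assms]) (simp_all add: exps_def)
  finally show "sgnR p \<otimes> tcrd (exps p) (pure a) = sgnR p \<otimes> (\<Otimes>i\<in>{1..n}. crd (a i) (p i - 1))"
    by simp
qed

text \<open>
  The \<open>j\<close>-th column in a mixed determinant: the column of multiplication by \<open>a\<close> if \<open>B\<close> holds, and that of the
  identity otherwise.
\<close>

definition minor_entry :: "'c \<Rightarrow> bool \<Rightarrow> nat \<Rightarrow> 'c" where
  "minor_entry a B j = (if B then a \<otimes>\<^bsub>A\<^esub> b j else b j)"

lemma minor_entry_closed [simp]: "a \<in> carrier A \<Longrightarrow> j < n \<Longrightarrow> minor_entry a B j \<in> carrier A"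
  by (simp add: minor_entry_def)

lemma minor_crd_closed:
  assumes "a \<in> carrier A" "p permutes {1..n}" "i \<in> {1..n}"
  shows "crd (minor_entry a B (i - 1)) (p i - 1) \<in> carrier R"
proof -
  have "i - 1 < n" "p i - 1 < n"
    using assms(3) X_nth[OF exps_closed[OF assms(2)] assms(3)] by (auto simp: exps_def)
  then show ?thesis using assms(1) by simp
qed

text \<open>
  The product of \<open>e\<^sub>k(a)\<close> and \<open>b\<^sub>0 \<otimes> \<dots> \<otimes> b\<^bsub>n-1\<^esub>\<close> is a sum of pure tensors, one for each \<open>k\<close>-set \<open>S\<close>, with
  \<open>a\<close> multiplied to the entries in \<open>S\<close>.
\<close>

lemma alt_esym:
  assumes a: "a \<in> carrier A"
  shows "alt (esym k a \<otimes>\<^bsub>T\<^esub> e0) = (\<Oplus>p\<in>Perm. sgnR p \<otimes>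
    (\<Oplus>S\<in>{S. S \<subseteq> {1..n} \<and> card S = k}. \<Otimes>i\<in>{1..n}. crd (minor_entry a (i \<in> S) (i - 1)) (p i - 1)))"
proof -
  let ?K = "{S. S \<subseteq> {1..n} \<and> card S = k}"
  let ?v = "\<lambda>S. \<lambda>i\<in>{1..n}. minor_entry a (i \<in> S) (i - 1)"
  let ?w = "\<lambda>S. \<lambda>j\<in>{1..n}. if j \<in> S then a else \<one>\<^bsub>A\<^esub>"
  let ?e = "\<lambda>i\<in>{1..n}. b (exps id i)"
  have K: "finite ?K" by simp
  have e: "?e \<in> E" by (rule basis_tuple_closed[OF exps_closed[OF permutes_id]])
  have w: "?w S \<in> E" for S using a by (auto simp: tuples_def)
  have v: "?v S \<in> E" for S using a by (auto simp: tuples_def)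
  have m: "tuple_mult (?w S) ?e = ?v S" for S
  proof
    fix i
    show "tuple_mult (?w S) ?e i = ?v S i"
    proof (cases "i \<in> {1..n}")
      case True
      then have "b (i - 1) \<in> carrier A" by (intro basis_closed) auto
      then show ?thesis using True by (simp add: tuple_mult_def minor_entry_def exps_def)
    next
      case False
      then show ?thesis by (simp only: tuple_mult_def restrict_def if_False)
    qed
  qed
  have pr: "(\<Otimes>i\<in>{1..n}. crd (minor_entry a (i \<in> S) (i - 1)) (p i - 1)) \<in> carrier R" if "p \<in> Perm" for S p
    using minor_crd_closed[OF a] that by (intro R.finprod_closed) auto
  have "esym k a \<otimes>\<^bsub>T\<^esub> e0 = (\<Oplus>\<^bsub>T\<^esub>S\<in>?K. pure (?w S) \<otimes>\<^bsub>T\<^esub> e0)"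
    unfolding esym_eq_pure[OF a] using w K e0_closed by (intro T.finsum_ldistr) auto
  also have "\<dots> = (\<Oplus>\<^bsub>T\<^esub>S\<in>?K. pure (?v S))"
    using v by (intro T.M.finsum_cong') (simp_all only: basis_tensor_def pure_mult[OF w e] m, auto)
  finally have "alt (esym k a \<otimes>\<^bsub>T\<^esub> e0) = (\<Oplus>S\<in>?K. alt (pure (?v S)))"
    using psum_finsum[OF subset_refl K, of "\<lambda>S. pure (?v S)"] v by simp
  also have "\<dots> = (\<Oplus>S\<in>?K. \<Oplus>p\<in>Perm. sgnR p \<otimes>
      (\<Otimes>i\<in>{1..n}. crd (minor_entry a (i \<in> S) (i - 1)) (p i - 1)))"
  proof (rule R.finsum_cong'[OF refl])
    fix S
    have eq: "(\<Otimes>i\<in>{1..n}. crd (?v S i) (p i - 1)) =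
        (\<Otimes>i\<in>{1..n}. crd (minor_entry a (i \<in> S) (i - 1)) (p i - 1))" if "p \<in> Perm" for p
      using minor_crd_closed[OF a] that by (intro R.finprod_cong') auto
    show "alt (pure (?v S)) = (\<Oplus>p\<in>Perm. sgnR p \<otimes>
        (\<Otimes>i\<in>{1..n}. crd (minor_entry a (i \<in> S) (i - 1)) (p i - 1)))"
      unfolding alt_pure[OF v] using eq pr by (intro R.finsum_cong') auto
  qed (use pr in \<open>auto intro!: R.finsum_closed\<close>)
  also have "\<dots> = (\<Oplus>p\<in>Perm. \<Oplus>S\<in>?K. sgnR p \<otimes>
      (\<Otimes>i\<in>{1..n}. crd (minor_entry a (i \<in> S) (i - 1)) (p i - 1)))"
    using pr by (intro R.finsum_swap K finite_Perm) auto
  also have "\<dots> = (\<Oplus>p\<in>Perm. sgnR p \<otimes>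
      (\<Oplus>S\<in>?K. \<Otimes>i\<in>{1..n}. crd (minor_entry a (i \<in> S) (i - 1)) (p i - 1)))"
    using pr K by (intro R.finsum_cong' R.finsum_rdistr[symmetric]) (auto intro!: R.finsum_closed)
  finally show ?thesis .
qed

text \<open>
  Expansion of \<open>det(\<lambda> - a)\<close>; the sign \<open>(-1)\<^sup>k\<close> in the definition of the coefficient cancels that of the
  \<open>k\<close> entries of \<open>-a\<close>.
\<close>

lemma char_coeff_eq:
  assumes a: "a \<in> carrier A" and k: "k \<le> n"
  shows "char_coeff R A n b k a = (\<Oplus>q\<in>{q. q permutes {..<n}}. sgnR q \<otimes>
    (\<Oplus>S\<in>{S. S \<subseteq> {..<n} \<and> card S = k}. \<Otimes>i\<in>{..<n}. crd (minor_entry a (i \<in> S) (q i)) i))"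
proof -
  interpret P: UP_cring R "UP R" by (unfold_locales) simp
  let ?P = "UP R"
  let ?Q = "{q. q permutes {..<n}}"
  let ?K = "{S. S \<subseteq> {..<n} \<and> card S = k}"
  let ?M = "\<lambda>i j. crd (a \<otimes>\<^bsub>A\<^esub> b j) i"
  let ?B = "\<lambda>i j. (if i = j then monom ?P \<one> 1 else \<zero>\<^bsub>?P\<^esub>) \<ominus>\<^bsub>?P\<^esub> monom ?P (?M i j) 0"
  let ?w = "\<lambda>q. \<Oplus>S\<in>?K. \<Otimes>i\<in>{..<n}. crd (minor_entry a (i \<in> S) (q i)) i"
  have Q: "finite ?Q" by (simp add: finite_permutations)
  have qi: "q i < n" if "q \<in> ?Q" "i < n" for q i
    using that permutes_in_image[of q "{..<n}" i] by simp
  have B: "?B i j = monom ?P (crd (b j) i) 1 \<ominus>\<^bsub>?P\<^esub> monom ?P (?M i j) 0" if "i < n" "j < n" for i j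
    using that by (simp add: crd_basis)
  have pr: "(\<Otimes>i\<in>{..<n}. crd (minor_entry a (i \<in> S) (q i)) i) \<in> carrier R" if "q \<in> ?Q" for S q
    using a qi[OF that] by (intro R.finprod_closed) auto
  then have w: "?w q \<in> carrier R" if "q \<in> ?Q" for q using that by (intro R.finsum_closed) auto
  have BP: "(\<Otimes>\<^bsub>?P\<^esub>i\<in>{..<n}. ?B i (q i)) \<in> carrier ?P" if "q \<in> ?Q" for q
    using a qi[OF that] by (intro P.P.finprod_closed) auto
  have sq: "(\<ominus> \<one>) [^] k \<otimes> (\<ominus> \<one>) [^] k = \<one>"
    by (simp add: R.nat_pow_distrib[symmetric] R.l_minus R.r_minus)
  have prod: "(\<ominus> \<one>) [^] k \<otimes> coeff ?P (\<Otimes>\<^bsub>?P\<^esub>i\<in>{..<n}. ?B i (q i)) (n - k) = ?w q" if q: "q \<in> ?Q" for q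
  proof -
    have "(\<Otimes>\<^bsub>?P\<^esub>i\<in>{..<n}. ?B i (q i)) =
        (\<Otimes>\<^bsub>?P\<^esub>i\<in>{..<n}. monom ?P (crd (b (q i)) i) 1 \<ominus>\<^bsub>?P\<^esub> monom ?P (?M i (q i)) 0)"
      using a qi[OF q] B by (intro P.P.finprod_cong') auto
    then have "coeff ?P (\<Otimes>\<^bsub>?P\<^esub>i\<in>{..<n}. ?B i (q i)) (n - k) =
        (\<Oplus>S\<in>{S. S \<subseteq> {..<n} \<and> card S + (n - k) = card {..<n}}.
          (\<ominus> \<one>) [^] card S \<otimes> (\<Otimes>i\<in>{..<n}. if i \<in> S then ?M i (q i) else crd (b (q i)) i))"
      using P.coeff_prod_linear[of "{..<n}" "\<lambda>i. crd (b (q i)) i" "\<lambda>i. ?M i (q i)" "n - k"] a qi[OF q] by simp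
    also have "{S. S \<subseteq> {..<n} \<and> card S + (n - k) = card {..<n}} = ?K" using k by auto
    also have "(\<Oplus>S\<in>?K. (\<ominus> \<one>) [^] card S \<otimes> (\<Otimes>i\<in>{..<n}. if i \<in> S then ?M i (q i) else crd (b (q i)) i)) =
        (\<Oplus>S\<in>?K. (\<ominus> \<one>) [^] k \<otimes> (\<Otimes>i\<in>{..<n}. crd (minor_entry a (i \<in> S) (q i)) i))"
    proof (rule R.finsum_cong'[OF refl])
      fix S assume "S \<in> ?K"
      moreover have "(\<Otimes>i\<in>{..<n}. if i \<in> S then ?M i (q i) else crd (b (q i)) i) =
          (\<Otimes>i\<in>{..<n}. crd (minor_entry a (i \<in> S) (q i)) i)"
        using a qi[OF q] by (intro R.finprod_cong') (auto simp: minor_entry_def)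
      ultimately show "(\<ominus> \<one>) [^] card S \<otimes> (\<Otimes>i\<in>{..<n}. if i \<in> S then ?M i (q i) else crd (b (q i)) i) =
          (\<ominus> \<one>) [^] k \<otimes> (\<Otimes>i\<in>{..<n}. crd (minor_entry a (i \<in> S) (q i)) i)" by simp
    qed (use pr[OF q] in auto)
    also have "\<dots> = (\<ominus> \<one>) [^] k \<otimes> ?w q"
      using pr[OF q] by (intro R.finsum_rdistr[symmetric]) auto
    finally show ?thesis using sq w[OF q] by (simp add: R.m_assoc[symmetric])
  qed
  let ?s = "\<lambda>q. if evenperm q then \<one>\<^bsub>?P\<^esub> else \<ominus>\<^bsub>?P\<^esub> \<one>\<^bsub>?P\<^esub>"
  let ?D = "\<lambda>q. \<Otimes>\<^bsub>?P\<^esub>i\<in>{..<n}. ?B i (q i)"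
  have s: "coeff ?P (?s q \<otimes>\<^bsub>?P\<^esub> ?D q) j = sgnR q \<otimes> coeff ?P (?D q) j" if "q \<in> ?Q" for q j
  proof -
    have "coeff ?P (?s q \<otimes>\<^bsub>?P\<^esub> d) j = sgnR q \<otimes> coeff ?P d j" if d: "d \<in> carrier ?P" for d
    proof (cases "evenperm q")
      case True
      then have "?s q \<otimes>\<^bsub>?P\<^esub> d = d" using d by (simp only: if_True P.P.l_one)
      then show ?thesis using True d by (simp only:) (simp add: sgnR_def)
    next
      case False
      then have "?s q \<otimes>\<^bsub>?P\<^esub> d = \<ominus>\<^bsub>?P\<^esub> d"
        using d by (simp only: if_False P.P.l_minus P.P.l_one P.P.one_closed)
      then show ?thesis using False d by (simp only:) (simp add: sgnR_def R.l_minus)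
    qed
    then show ?thesis using BP[OF that] by blast
  qed
  have "char_coeff R A n b k a = (\<ominus> \<one>) [^] k \<otimes> coeff ?P (\<Oplus>\<^bsub>?P\<^esub>q\<in>?Q. ?s q \<otimes>\<^bsub>?P\<^esub> ?D q) (n - k)"
    by (simp only: char_coeff_def mult_char_poly_def ring_det_def)
  also have "coeff ?P (\<Oplus>\<^bsub>?P\<^esub>q\<in>?Q. ?s q \<otimes>\<^bsub>?P\<^esub> ?D q) (n - k) =
      (\<Oplus>q\<in>?Q. coeff ?P (?s q \<otimes>\<^bsub>?P\<^esub> ?D q) (n - k))"
    using Q BP by (intro P.coeff_finsum) auto
  also have "\<dots> = (\<Oplus>q\<in>?Q. sgnR q \<otimes> coeff ?P (?D q) (n - k))"
    by (rule R.finsum_cong'[OF refl]) (intro Pi_I R.m_closed sgnR_closed P.coeff_closed BP, assumption, rule s)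
  also have "(\<ominus> \<one>) [^] k \<otimes> \<dots> = (\<Oplus>q\<in>?Q. (\<ominus> \<one>) [^] k \<otimes> (sgnR q \<otimes> coeff ?P (?D q) (n - k)))"
    using Q BP by (intro R.finsum_rdistr) auto
  also have "\<dots> = (\<Oplus>q\<in>?Q. sgnR q \<otimes> ?w q)"
  proof (rule R.finsum_cong'[OF refl])
    fix q assume q: "q \<in> ?Q"
    show "(\<ominus> \<one>) [^] k \<otimes> (sgnR q \<otimes> coeff ?P (?D q) (n - k)) = sgnR q \<otimes> ?w q"
      unfolding prod[OF q, symmetric] using BP[OF q] by (intro R.m_lcomm) auto
  qed (use w in auto)
  finally show ?thesis .
qed

text \<open>
  Both sides are the sum, over all \<open>k\<close>-sets \<open>S\<close>, of the determinant with columns of \<open>a\<close> in \<open>S\<close> and of the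
  identity elsewhere.  The two determinants are expanded along columns and along rows, so that the
  permutations correspond by inversion.
\<close>

theorem alt_esym_eq_char_coeff:
  assumes a: "a \<in> carrier A" and k: "k \<le> n"
  shows "alt (esym k a \<otimes>\<^bsub>T\<^esub> e0) = char_coeff R A n b k a"
proof -
  let ?Q = "{q. q permutes {..<n}}"
  \<comment> \<open>Besides the inversion, \<open>Suc\<close> translates the indices \<open>0, \<dots>, n - 1\<close> of the matrix into positions.\<close>
  let ?\<mu> = "\<lambda>q. map_permutation {..<n} Suc (inv' q)"
  let ?\<nu> = "\<lambda>p. inv' (map_permutation {1..n} (\<lambda>x. x - 1) p)"
  let ?V = "\<lambda>p. \<Oplus>S\<in>{S. S \<subseteq> {1..n} \<and> card S = k}.
    \<Otimes>i\<in>{1..n}. crd (minor_entry a (i \<in> S) (i - 1)) (p i - 1)"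
  have S: "bij_betw Suc {..<n} {1..n}"
    by (rule bij_betw_byWitness[of _ "\<lambda>x. x - 1"]) auto
  have S': "bij_betw (\<lambda>x. x - 1) {1..n} {..<n}"
    by (rule bij_betw_byWitness[of _ Suc]) auto
  have \<mu>: "?\<mu> q permutes {1..n}" if "q permutes {..<n}" for q
    by (rule map_permutation_permutes[OF S permutes_inv[OF that]])
  have \<nu>: "?\<nu> p permutes {..<n}" if "p permutes {1..n}" for p
    by (rule permutes_inv[OF map_permutation_permutes[OF S' that]])
  have bij: "bij_betw ?\<mu> ?Q Perm"
  proof (rule bij_betw_byWitness[of _ ?\<nu>])
    show "\<forall>q\<in>?Q. ?\<nu> (?\<mu> q) = q"
    proof
      fix q assume "q \<in> ?Q"
      then have q: "q permutes {..<n}" by simp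
      have "map_permutation {1..n} (\<lambda>x. x - 1) (?\<mu> q) = inv' q"
        by (rule map_permutation_compose_inv[OF S permutes_inv[OF q]]) simp
      then show "?\<nu> (?\<mu> q) = q" by (simp only: permutes_inv_inv[OF q])
    qed
    show "\<forall>p\<in>Perm. ?\<mu> (?\<nu> p) = p"
    proof
      fix p assume "p \<in> Perm"
      then have p: "p permutes {1..n}" by simp
      have "map_permutation {..<n} Suc (map_permutation {1..n} (\<lambda>x. x - 1) p) = p"
        by (rule map_permutation_compose_inv[OF S' p]) simp
      then show "?\<mu> (?\<nu> p) = p"
        by (simp only: permutes_inv_inv[OF map_permutation_permutes[OF S' p]])
    qed
  qed (use \<mu> \<nu> in blast)+
  have V: "?V p \<in> carrier R" if "p \<in> Perm" for p
    using minor_crd_closed[OF a] that by (intro R.finsum_closed Pi_I R.finprod_closed) auto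
  have "alt (esym k a \<otimes>\<^bsub>T\<^esub> e0) = (\<Oplus>p\<in>?\<mu> ` ?Q. sgnR p \<otimes> ?V p)"
    unfolding alt_esym[OF a] bij_betw_imp_surj_on[OF bij] ..
  also have "\<dots> = (\<Oplus>q\<in>?Q. sgnR (?\<mu> q) \<otimes> ?V (?\<mu> q))"
  proof (rule R.finsum_reindex[OF _ bij_betw_imp_inj_on[OF bij]])
    show "(\<lambda>p. sgnR p \<otimes> ?V p) \<in> ?\<mu> ` ?Q \<rightarrow> carrier R"
      unfolding bij_betw_imp_surj_on[OF bij] using V by (intro Pi_I R.m_closed sgnR_closed)
  qed
  also have "\<dots> = char_coeff R A n b k a"
    unfolding char_coeff_eq[OF a k]
  proof (rule R.finsum_cong'[OF refl])
    fix q assume "q \<in> ?Q"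
    then have q: "q permutes {..<n}" by simp
    have qi: "q i < n" "inv' q i < n" if "i < n" for i
      using that permutes_in_image[OF q, of i] permutes_in_image[OF permutes_inv[OF q], of i] by simp_all
    have "permutation q" by (rule permutes_imp_permutation[OF _ q]) simp
    then have "evenperm (?\<mu> q) = evenperm q"
      using evenperm_map_permutation[of Suc "{..<n}", OF _ permutes_inv[OF q]] by (simp add: evenperm_inv)
    then have sg: "sgnR (?\<mu> q) = sgnR q" by (simp add: sgnR_def)
    have \<mu>i: "?\<mu> q i - 1 = inv' q (i - 1)" if "i \<in> {1..n}" for i
    proof -
      have "?\<mu> q (Suc (i - 1)) = Suc (inv' q (i - 1))"
        by (rule map_permutation_apply) (use that in auto)
      then show ?thesis using that by simp
    qed
    let ?f = "\<lambda>B j. crd (minor_entry a B (j - 1)) (inv' q (j - 1))"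
    have f: "?f B j \<in> carrier R" if "j \<in> {1..n}" for B j
      using a that qi(2)[of "j - 1"] by (intro crd_closed minor_entry_closed) auto
    have "?V (?\<mu> q) = (\<Oplus>S\<in>{S. S \<subseteq> {1..n} \<and> card S = k}. \<Otimes>i\<in>{1..n}. ?f (i \<in> S) i)"
    proof (rule R.finsum_cong'[OF refl])
      fix S
      show "(\<Otimes>i\<in>{1..n}. crd (minor_entry a (i \<in> S) (i - 1)) (?\<mu> q i - 1)) = (\<Otimes>i\<in>{1..n}. ?f (i \<in> S) i)"
        using f by (intro R.finprod_cong' refl Pi_I) (simp_all only: \<mu>i)
    qed (use f in \<open>auto intro!: R.finprod_closed\<close>)
    also have "\<dots> = (\<Oplus>S\<in>{S. S \<subseteq> {..<n} \<and> card S = k}. \<Otimes>i\<in>{..<n}. ?f (i \<in> S) (Suc (q i)))"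
    proof (rule R.subset_sum_reindex[symmetric])
      show "bij_betw (\<lambda>i. Suc (q i)) {..<n} {1..n}"
        using bij_betw_trans[OF permutes_imp_bij[OF q] S] by (simp add: comp_def)
    qed (use f in auto)
    also have "\<dots> = (\<Oplus>S\<in>{S. S \<subseteq> {..<n} \<and> card S = k}. \<Otimes>i\<in>{..<n}. crd (minor_entry a (i \<in> S) (q i)) i)"
      by (simp add: permutes_inverses(2)[OF q])
    finally show "sgnR (?\<mu> q) \<otimes> ?V (?\<mu> q) = sgnR q \<otimes>
        (\<Oplus>S\<in>{S. S \<subseteq> {..<n} \<and> card S = k}. \<Otimes>i\<in>{..<n}. crd (minor_entry a (i \<in> S) (q i)) i)"
      by (simp only: sg)
  next
    show "(\<lambda>q. sgnR q \<otimes> (\<Oplus>S\<in>{S. S \<subseteq> {..<n} \<and> card S = k}. \<Otimes>i\<in>{..<n}.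
        crd (minor_entry a (i \<in> S) (q i)) i)) \<in> ?Q \<rightarrow> carrier R"
    proof (intro Pi_I R.m_closed sgnR_closed R.finsum_closed R.finprod_closed crd_closed minor_entry_closed a)
      fix q i assume "q \<in> ?Q" "i \<in> {..<n}"
      then show "q i < n" "i < n" using permutes_in_image[of q "{..<n}" i] by simp_all
    qed
  qed
  finally show ?thesis .
qed

end

section \<open>Identities for sums and products\<close>

context cring
begin

lemma elementary_sum_zero: "finite I \<Longrightarrow> (\<Oplus>S\<in>{S. S \<subseteq> I \<and> card S = 0}. \<Otimes>i\<in>S. u i) = \<one>"
proof -
  assume I: "finite I"
  then have "{S. S \<subseteq> I \<and> card S = 0} = {{}}" by (auto dest: finite_subset)
  then show ?thesis by (simp add: finsum_insert)
qed

lemma elementary_sum_empty: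
  fixes u :: "'i \<Rightarrow> 'a"
  shows "(\<Oplus>S\<in>{S. S \<subseteq> {} \<and> card S = Suc k}. \<Otimes>i\<in>S. u i) = \<zero>"
proof -
  have "{S. S \<subseteq> ({} :: 'i set) \<and> card S = Suc k} = {}" by auto
  then show ?thesis by (simp only: finsum_empty)
qed

lemma elementary_sum_insert:
  assumes I: "finite I" "x \<notin> I" and u: "\<And>i. i \<in> insert x I \<Longrightarrow> u i \<in> carrier R"
  shows "(\<Oplus>S\<in>{S. S \<subseteq> insert x I \<and> card S = Suc k}. \<Otimes>i\<in>S. u i) =
    (\<Oplus>S\<in>{S. S \<subseteq> I \<and> card S = Suc k}. \<Otimes>i\<in>S. u i) \<oplus>
    u x \<otimes> (\<Oplus>S\<in>{S. S \<subseteq> I \<and> card S = k}. \<Otimes>i\<in>S. u i)"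
proof -
  let ?A = "{S. S \<subseteq> I \<and> card S = Suc k}" and ?K = "{S. S \<subseteq> I \<and> card S = k}"
  have fin: "finite ?A" "finite ?K" using I by simp_all
  have pr: "(\<Otimes>i\<in>S. u i) \<in> carrier R" if "S \<subseteq> insert x I" for S
    using that u by (intro finprod_closed) auto
  have set: "{S. S \<subseteq> insert x I \<and> card S = Suc k} = ?A \<union> insert x ` ?K"
  proof (intro equalityI subsetI)
    fix S assume S: "S \<in> {S. S \<subseteq> insert x I \<and> card S = Suc k}"
    then have "finite S" using I finite_subset by blast
    show "S \<in> ?A \<union> insert x ` ?K"
    proof (cases "x \<in> S")
      case True
      then have "S = insert x (S - {x})" "S - {x} \<in> ?K"
        using S card_Suc_Diff1[OF \<open>finite S\<close> True] by auto
      then show ?thesis by blast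
    qed (use S in auto)
  next
    fix S assume "S \<in> ?A \<union> insert x ` ?K"
    then consider "S \<in> ?A" | S' where "S = insert x S'" "S' \<subseteq> I" "card S' = k" by blast
    then show "S \<in> {S. S \<subseteq> insert x I \<and> card S = Suc k}"
    proof cases
      case 2
      then have "x \<notin> S'" "finite S'" using I finite_subset by blast+
      then show ?thesis using 2 by auto
    qed auto
  qed
  have inj: "inj_on (insert x) ?K" using I(2) by (auto simp: inj_on_def insert_eq_iff subset_iff)
  have "(\<Oplus>S\<in>insert x ` ?K. \<Otimes>i\<in>S. u i) = (\<Oplus>S\<in>?K. \<Otimes>i\<in>insert x S. u i)"
    by (rule finsum_reindex[OF Pi_I inj], rule pr) auto
  also have "\<dots> = (\<Oplus>S\<in>?K. u x \<otimes> (\<Otimes>i\<in>S. u i))"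
  proof (rule finsum_cong'[OF refl])
    fix S assume "S \<in> ?K"
    then have "finite S" "x \<notin> S" "u \<in> S \<rightarrow> carrier R" using I u finite_subset by blast+
    then show "(\<Otimes>i\<in>insert x S. u i) = u x \<otimes> (\<Otimes>i\<in>S. u i)" using u by simp
  qed (use pr u in auto)
  also have "\<dots> = u x \<otimes> (\<Oplus>S\<in>?K. \<Otimes>i\<in>S. u i)"
    using fin pr u by (intro finsum_rdistr[symmetric]) auto
  finally have "(\<Oplus>S\<in>insert x ` ?K. \<Otimes>i\<in>S. u i) = u x \<otimes> (\<Oplus>S\<in>?K. \<Otimes>i\<in>S. u i)" .
  moreover have "(\<Oplus>S\<in>?A \<union> insert x ` ?K. \<Otimes>i\<in>S. u i) =
      (\<Oplus>S\<in>?A. \<Otimes>i\<in>S. u i) \<oplus> (\<Oplus>S\<in>insert x ` ?K. \<Otimes>i\<in>S. u i)"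
  proof (rule finsum_Un_disjoint[OF fin(1) finite_imageI[OF fin(2)]])
    show "?A \<inter> insert x ` ?K = {}" using I(2) by blast
  qed (rule Pi_I, rule pr, blast)+
  ultimately show ?thesis unfolding set by simp
qed

lemma elementary_sums_four:
  assumes u: "\<And>i. i \<in> {1..4::nat} \<Longrightarrow> u i \<in> carrier R"
  defines "e \<equiv> \<lambda>k. \<Oplus>S\<in>{S. S \<subseteq> {1..4::nat} \<and> card S = k}. \<Otimes>i\<in>S. u i"
  shows "e 1 = (u 1 \<oplus> u 3) \<oplus> (u 2 \<oplus> u 4)"
    and "e 2 = (u 1 \<otimes> u 3 \<oplus> u 2 \<otimes> u 4) \<oplus> (u 1 \<oplus> u 3) \<otimes> (u 2 \<oplus> u 4)"
    and "e 3 = (u 1 \<oplus> u 3) \<otimes> (u 2 \<otimes> u 4) \<oplus> (u 2 \<oplus> u 4) \<otimes> (u 1 \<otimes> u 3)"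
    and "e 4 = (u 1 \<otimes> u 3) \<otimes> (u 2 \<otimes> u 4)"
proof -
  have I: "{1..4::nat} = insert 1 (insert 2 (insert 3 (insert 4 {})))" by auto
  have c: "u 1 \<in> carrier R" "u 2 \<in> carrier R" "u 3 \<in> carrier R" "u 4 \<in> carrier R" using u by auto
  have k: "2 = Suc 1" "3 = Suc 2" "4 = Suc 3" "1 = Suc 0" by simp_all
  have n: "1 \<notin> {2, 3, 4::nat}" "2 \<notin> {3, 4::nat}" "3 \<notin> {4::nat}" "4 \<notin> ({}::nat set)" by simp_all
  let ?E = "\<lambda>I k. \<Oplus>S\<in>{S. S \<subseteq> I \<and> card S = k}. \<Otimes>i\<in>S. u i"
  have e: "e = ?E {1..4}" by (simp add: e_def)
  have step: "?E (insert x I) (Suc k) = ?E I (Suc k) \<oplus> u x \<otimes> ?E I k"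
    if "x \<notin> I" "insert x I \<subseteq> {1..4}" for x I k
    using that u by (intro elementary_sum_insert) (auto intro: finite_subset)
  have E0: "?E I 0 = \<one>" if "I \<subseteq> {1..4}" for I
    by (rule elementary_sum_zero[OF finite_subset[OF that]]) simp
  have s4: "?E {4} (Suc 0) = u 4" "?E {4} (Suc (Suc k)) = \<zero>" for k
    using step[of 4 "{}" 0] step[of 4 "{}" "Suc k"] E0[of "{}"] elementary_sum_empty[where u = u] c
    by (simp_all del: subset_empty)
  have s3: "?E {3, 4} (Suc 0) = u 4 \<oplus> u 3" "?E {3, 4} (Suc (Suc 0)) = u 3 \<otimes> u 4"
    "?E {3, 4} (Suc (Suc (Suc k))) = \<zero>" for k
    using step[of 3 "{4}" 0] step[of 3 "{4}" "Suc 0"] step[of 3 "{4}" "Suc (Suc k)"] E0[of "{4}"] c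
    unfolding s4 by simp_all
  have s2: "?E {2, 3, 4} (Suc 0) = u 4 \<oplus> u 3 \<oplus> u 2"
    "?E {2, 3, 4} (Suc (Suc 0)) = u 3 \<otimes> u 4 \<oplus> u 2 \<otimes> (u 4 \<oplus> u 3)"
    "?E {2, 3, 4} (Suc (Suc (Suc 0))) = u 2 \<otimes> (u 3 \<otimes> u 4)"
    "?E {2, 3, 4} (Suc (Suc (Suc (Suc k)))) = \<zero>" for k
    using step[of 2 "{3, 4}" 0] step[of 2 "{3, 4}" "Suc 0"] step[of 2 "{3, 4}" "Suc (Suc 0)"]
      step[of 2 "{3, 4}" "Suc (Suc (Suc k))"] E0[of "{3, 4}"] c
    unfolding s3 by simp_all
  have s1: "e (Suc 0) = u 4 \<oplus> u 3 \<oplus> u 2 \<oplus> u 1"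
    "e (Suc (Suc 0)) = u 3 \<otimes> u 4 \<oplus> u 2 \<otimes> (u 4 \<oplus> u 3) \<oplus> u 1 \<otimes> (u 4 \<oplus> u 3 \<oplus> u 2)"
    "e (Suc (Suc (Suc 0))) = u 2 \<otimes> (u 3 \<otimes> u 4) \<oplus> u 1 \<otimes> (u 3 \<otimes> u 4 \<oplus> u 2 \<otimes> (u 4 \<oplus> u 3))"
    "e (Suc (Suc (Suc (Suc 0)))) = u 1 \<otimes> (u 2 \<otimes> (u 3 \<otimes> u 4))"
    using step[of 1 "{2, 3, 4}" 0] step[of 1 "{2, 3, 4}" "Suc 0"] step[of 1 "{2, 3, 4}" "Suc (Suc 0)"]
      step[of 1 "{2, 3, 4}" "Suc (Suc (Suc 0))"] E0[of "{2, 3, 4}"] c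
    unfolding s2 e I by simp_all
  have S: "Suc 0 = 1" "Suc (Suc 0) = 2" "Suc (Suc (Suc 0)) = 3" "Suc (Suc (Suc (Suc 0))) = 4"
    by simp_all
  have e1: "e 1 = u 4 \<oplus> u 3 \<oplus> u 2 \<oplus> u 1"
    and e2: "e 2 = u 3 \<otimes> u 4 \<oplus> u 2 \<otimes> (u 4 \<oplus> u 3) \<oplus> u 1 \<otimes> (u 4 \<oplus> u 3 \<oplus> u 2)"
    and e3: "e 3 = u 2 \<otimes> (u 3 \<otimes> u 4) \<oplus> u 1 \<otimes> (u 3 \<otimes> u 4 \<oplus> u 2 \<otimes> (u 4 \<oplus> u 3))"
    and e4: "e 4 = u 1 \<otimes> (u 2 \<otimes> (u 3 \<otimes> u 4))"
    using s1(1)[unfolded S(1)] s1(2)[unfolded S(2)] s1(3)[unfolded S(3)] s1(4)[unfolded S(4)] by blast+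
  show "e 1 = (u 1 \<oplus> u 3) \<oplus> (u 2 \<oplus> u 4)" unfolding e1 using c by (simp add: a_ac)
  show "e 2 = (u 1 \<otimes> u 3 \<oplus> u 2 \<otimes> u 4) \<oplus> (u 1 \<oplus> u 3) \<otimes> (u 2 \<oplus> u 4)"
    unfolding e2 using c by (simp add: a_ac m_ac l_distr r_distr)
  show "e 3 = (u 1 \<oplus> u 3) \<otimes> (u 2 \<otimes> u 4) \<oplus> (u 2 \<oplus> u 4) \<otimes> (u 1 \<otimes> u 3)"
    unfolding e3 using c by (simp add: a_ac m_ac l_distr r_distr)
  show "e 4 = (u 1 \<otimes> u 3) \<otimes> (u 2 \<otimes> u 4)" unfolding e4 using c by (simp add: m_ac)
qed

text \<open>
  The product of the values of one polynomial at \<open>(p, q)\<close> and at \<open>(p', q')\<close> does not change when the two points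
  are exchanged; it is written here by such expressions only.  The term \<open>p q + p' q'\<close> is replaced by
  products of sums minus \<open>p q' + p' q\<close>, which is an elementary symmetric polynomial in the application.
\<close>

lemma pair_norm_expansion:
  assumes [simp]: "s0 \<in> carrier R" "s1 \<in> carrier R" "s2 \<in> carrier R" "s3 \<in> carrier R"
    "p \<in> carrier R" "p' \<in> carrier R" "q \<in> carrier R" "q' \<in> carrier R"
  shows "(s0 \<oplus> s1 \<otimes> p \<oplus> s2 \<otimes> q \<oplus> s3 \<otimes> (p \<otimes> q)) \<otimes> (s0 \<oplus> s1 \<otimes> p' \<oplus> s2 \<otimes> q' \<oplus> s3 \<otimes> (p' \<otimes> q')) =
    s0 \<otimes> s0 \<oplus> s1 \<otimes> s1 \<otimes> (p \<otimes> p') \<oplus> s2 \<otimes> s2 \<otimes> (q \<otimes> q') \<oplus> s3 \<otimes> s3 \<otimes> (p \<otimes> p') \<otimes> (q \<otimes> q')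
    \<oplus> s0 \<otimes> s1 \<otimes> (p \<oplus> p') \<oplus> s0 \<otimes> s2 \<otimes> (q \<oplus> q')
    \<oplus> s0 \<otimes> s3 \<otimes> ((p \<oplus> p') \<otimes> (q \<oplus> q') \<ominus> (p \<otimes> q' \<oplus> p' \<otimes> q))
    \<oplus> s1 \<otimes> s2 \<otimes> (p \<otimes> q' \<oplus> p' \<otimes> q)
    \<oplus> s1 \<otimes> s3 \<otimes> (p \<otimes> p') \<otimes> (q \<oplus> q') \<oplus> s2 \<otimes> s3 \<otimes> (q \<otimes> q') \<otimes> (p \<oplus> p')" (is "_ = ?r")
proof -
  have lin: "(x \<oplus> y \<otimes> p) \<otimes> (x' \<oplus> y' \<otimes> p') = x \<otimes> x' \<oplus> x' \<otimes> y \<otimes> p \<oplus> x \<otimes> y' \<otimes> p' \<oplus> y \<otimes> y' \<otimes> (p \<otimes> p')"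
    if "x \<in> carrier R" "y \<in> carrier R" "x' \<in> carrier R" "y' \<in> carrier R" for x y x' y'
    using that assms by algebra
  have prd: "(x \<oplus> y \<otimes> q) \<otimes> (x' \<oplus> y' \<otimes> q') = x \<otimes> x' \<oplus> (x \<otimes> y') \<otimes> q' \<oplus> (y \<otimes> x') \<otimes> q \<oplus> (y \<otimes> y') \<otimes> (q \<otimes> q')"
    if "x \<in> carrier R" "y \<in> carrier R" "x' \<in> carrier R" "y' \<in> carrier R" for x y x' y'
    using that assms by algebra
  let ?a = "s0 \<oplus> s1 \<otimes> p" and ?a' = "s0 \<oplus> s1 \<otimes> p'" and ?b = "s2 \<oplus> s3 \<otimes> p" and ?b' = "s2 \<oplus> s3 \<otimes> p'"
  have "(s0 \<oplus> s1 \<otimes> p \<oplus> s2 \<otimes> q \<oplus> s3 \<otimes> (p \<otimes> q)) \<otimes> (s0 \<oplus> s1 \<otimes> p' \<oplus> s2 \<otimes> q' \<oplus> s3 \<otimes> (p' \<otimes> q')) =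
    (?a \<oplus> ?b \<otimes> q) \<otimes> (?a' \<oplus> ?b' \<otimes> q')"
    by (simp add: l_distr a_assoc m_assoc)
  also have "\<dots> = ?a \<otimes> ?a' \<oplus> (?a \<otimes> ?b') \<otimes> q' \<oplus> (?b \<otimes> ?a') \<otimes> q \<oplus> (?b \<otimes> ?b') \<otimes> (q \<otimes> q')"
    by (rule prd) simp_all
  also have "\<dots> = s0 \<otimes> s0 \<oplus> s1 \<otimes> s1 \<otimes> (p \<otimes> p') \<oplus> s2 \<otimes> s2 \<otimes> (q \<otimes> q') \<oplus> s3 \<otimes> s3 \<otimes> (p \<otimes> p') \<otimes> (q \<otimes> q')
    \<oplus> s0 \<otimes> s1 \<otimes> (p \<oplus> p') \<oplus> s0 \<otimes> s2 \<otimes> (q \<oplus> q')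
    \<oplus> s0 \<otimes> s3 \<otimes> (p \<otimes> q \<oplus> p' \<otimes> q')
    \<oplus> s1 \<otimes> s2 \<otimes> (p \<otimes> q' \<oplus> p' \<otimes> q)
    \<oplus> s1 \<otimes> s3 \<otimes> (p \<otimes> p') \<otimes> (q \<oplus> q') \<oplus> s2 \<otimes> s3 \<otimes> (q \<otimes> q') \<otimes> (p \<oplus> p')"
    unfolding lin[OF assms(1,2,1,2)] lin[OF assms(1,2,3,4)] lin[OF assms(3,4,1,2)] lin[OF assms(3,4,3,4)]
    by (simp add: l_distr r_distr a_ac m_ac)
  also have "p \<otimes> q \<oplus> p' \<otimes> q' = (p \<oplus> p') \<otimes> (q \<oplus> q') \<ominus> (p \<otimes> q' \<oplus> p' \<otimes> q)"
    using assms by algebra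
  finally show ?thesis .
qed

end

lemma (in abelian_monoid) finsum_square_upper:
  fixes I :: "nat set"
  assumes I: "finite I" and G: "\<And>i j. i \<in> I \<Longrightarrow> j \<in> I \<Longrightarrow> h i j \<in> carrier G"
  shows "(\<Oplus>u\<in>I \<times> I. h (fst u) (snd u)) =
    (\<Oplus>u\<in>{u \<in> I \<times> I. fst u \<le> snd u}. if fst u = snd u then h (fst u) (snd u)
      else h (fst u) (snd u) \<oplus> h (snd u) (fst u))"
proof -
  let ?D = "{u \<in> I \<times> I. fst u = snd u}" and ?U = "{u \<in> I \<times> I. fst u < snd u}"
    and ?L = "{u \<in> I \<times> I. snd u < fst u}"
  let ?h = "\<lambda>u. h (fst u) (snd u)" and ?h' = "\<lambda>u. h (snd u) (fst u)"
  let ?g = "\<lambda>u. if fst u = snd u then ?h u else ?h u \<oplus> ?h' u"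
  have fin: "finite ?D" "finite ?U" "finite ?L"
    using I by (auto intro: finite_subset[of _ "I \<times> I"])
  have hc: "?h u \<in> carrier G" "?h' u \<in> carrier G" if "u \<in> I \<times> I" for u
    using that G[of "fst u" "snd u"] G[of "snd u" "fst u"] by (auto simp: mem_Times_iff)
  have "I \<times> I = (?D \<union> ?U) \<union> ?L" by auto
  then have "(\<Oplus>u\<in>I \<times> I. ?h u) = (\<Oplus>u\<in>(?D \<union> ?U) \<union> ?L. ?h u)" by simp
  also have "\<dots> = (\<Oplus>u\<in>?D \<union> ?U. ?h u) \<oplus> (\<Oplus>u\<in>?L. ?h u)"
    using fin hc by (intro finsum_Un_disjoint finite_UnI) auto
  also have "(\<Oplus>u\<in>?D \<union> ?U. ?h u) = (\<Oplus>u\<in>?D. ?h u) \<oplus> (\<Oplus>u\<in>?U. ?h u)"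
    using fin hc by (intro finsum_Un_disjoint) auto
  also have "(\<Oplus>u\<in>?L. ?h u) = (\<Oplus>u\<in>prod.swap ` ?U. ?h u)"
  proof -
    have "?L = prod.swap ` ?U"
    proof (intro equalityI subsetI)
      fix u assume "u \<in> ?L"
      then have *: "prod.swap u \<in> ?U" "u = prod.swap (prod.swap u)" by (auto simp: mem_Times_iff)
      show "u \<in> prod.swap ` ?U" by (rule image_eqI[where f = prod.swap and x = "prod.swap u", OF *(2) *(1)])
    qed (auto simp: mem_Times_iff)
    then show ?thesis by simp
  qed
  also have "\<dots> = (\<Oplus>u\<in>?U. ?h' u)"
    using hc by (subst finsum_reindex) (auto simp: inj_on_def)
  also have "(\<Oplus>u\<in>?D. ?h u) \<oplus> (\<Oplus>u\<in>?U. ?h u) \<oplus> (\<Oplus>u\<in>?U. ?h' u) =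
      (\<Oplus>u\<in>?D. ?h u) \<oplus> (\<Oplus>u\<in>?U. ?h u \<oplus> ?h' u)"
  proof -
    have "(\<Oplus>u\<in>?U. ?h u \<oplus> ?h' u) = (\<Oplus>u\<in>?U. ?h u) \<oplus> (\<Oplus>u\<in>?U. ?h' u)"
      using hc by (intro finsum_addf) auto
    moreover have "(\<Oplus>u\<in>?D. ?h u) \<in> carrier G" "(\<Oplus>u\<in>?U. ?h u) \<in> carrier G" "(\<Oplus>u\<in>?U. ?h' u) \<in> carrier G"
      using hc by (auto intro!: finsum_closed)
    ultimately show ?thesis by (simp add: a_assoc)
  qed
  also have "(\<Oplus>u\<in>?D. ?h u) = (\<Oplus>u\<in>?D. ?g u)"
    using hc by (intro finsum_cong') auto
  also have "(\<Oplus>u\<in>?U. ?h u \<oplus> ?h' u) = (\<Oplus>u\<in>?U. ?g u)"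
    using hc by (intro finsum_cong') auto
  also have "(\<Oplus>u\<in>?D. ?g u) \<oplus> (\<Oplus>u\<in>?U. ?g u) = (\<Oplus>u\<in>?D \<union> ?U. ?g u)"
    using fin hc by (intro finsum_Un_disjoint[symmetric]) auto
  also have "?D \<union> ?U = {u \<in> I \<times> I. fst u \<le> snd u}" by auto
  finally show ?thesis .
qed

lemma (in abelian_monoid) symmetric_double_sum_mem:
  assumes J: "finite J" and F: "\<And>i j. i \<in> J \<Longrightarrow> j \<in> J \<Longrightarrow> F i j \<in> carrier G"
    and S: "\<zero> \<in> S" "\<And>a b. a \<in> S \<Longrightarrow> b \<in> S \<Longrightarrow> a \<oplus> b \<in> S"
    and diag: "\<And>i. i \<in> J \<Longrightarrow> F i i \<in> S"
    and off: "\<And>i j. i \<in> J \<Longrightarrow> j \<in> J \<Longrightarrow> i \<noteq> j \<Longrightarrow> F i j \<oplus> F j i \<in> S"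
  shows "(\<Oplus>i\<in>J. \<Oplus>j\<in>J. F i j) \<in> S"
  using J F diag off
proof (induction J rule: finite_induct)
  case empty
  then show ?case using S by simp
next
  case (insert x J)
  have Fc: "F i j \<in> carrier G" if "i \<in> insert x J" "j \<in> insert x J" for i j using insert.prems(1) that .
  have row: "(\<Oplus>j\<in>insert x J. F i j) = F i x \<oplus> (\<Oplus>j\<in>J. F i j)" if "i \<in> insert x J" for i
    using insert.hyps Fc that by (intro finsum_insert) auto
  have c: "(\<Oplus>j\<in>J. F i j) \<in> carrier G" "(\<Oplus>j\<in>J. F j i) \<in> carrier G" if "i \<in> insert x J" for i
    using Fc that by (auto intro!: finsum_closed)
  have IH: "(\<Oplus>i\<in>J. \<Oplus>j\<in>J. F i j) \<in> S"
    using insert.prems by (intro insert.IH) auto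
  have cross: "(\<Oplus>j\<in>J. F x j \<oplus> F j x) \<in> S"
  proof -
    have "(\<Oplus>j\<in>K. F x j \<oplus> F j x) \<in> S" if "K \<subseteq> J" for K
      using finite_subset[OF that insert.hyps(1)] that
    proof (induction K rule: finite_induct)
      case (insert k K)
      have "(\<Oplus>j\<in>insert k K. F x j \<oplus> F j x) = (F x k \<oplus> F k x) \<oplus> (\<Oplus>j\<in>K. F x j \<oplus> F j x)"
        using insert Fc by (intro finsum_insert) auto
      moreover have "F x k \<oplus> F k x \<in> S"
        using insert.prems \<open>x \<notin> J\<close> by (intro \<open>\<And>i j. i \<in> insert x J \<Longrightarrow> j \<in> insert x J \<Longrightarrow> i \<noteq> j \<Longrightarrow> F i j \<oplus> F j i \<in> S\<close>) auto
      ultimately show ?case using insert.IH insert.prems S by auto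
    qed (simp add: S)
    then show ?thesis by blast
  qed
  have "(\<Oplus>i\<in>insert x J. \<Oplus>j\<in>insert x J. F i j) = (\<Oplus>i\<in>insert x J. F i x \<oplus> (\<Oplus>j\<in>J. F i j))"
    using row c Fc by (intro finsum_cong') auto
  also have "\<dots> = (F x x \<oplus> (\<Oplus>j\<in>J. F x j)) \<oplus> (\<Oplus>i\<in>J. F i x \<oplus> (\<Oplus>j\<in>J. F i j))"
    using insert.hyps c Fc by (intro finsum_insert) auto
  also have "(\<Oplus>i\<in>J. F i x \<oplus> (\<Oplus>j\<in>J. F i j)) = (\<Oplus>i\<in>J. F i x) \<oplus> (\<Oplus>i\<in>J. \<Oplus>j\<in>J. F i j)"
    using c Fc by (intro finsum_addf) auto
  also have "(F x x \<oplus> (\<Oplus>j\<in>J. F x j)) \<oplus> ((\<Oplus>i\<in>J. F i x) \<oplus> (\<Oplus>i\<in>J. \<Oplus>j\<in>J. F i j)) =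
      F x x \<oplus> ((\<Oplus>j\<in>J. F x j) \<oplus> (\<Oplus>j\<in>J. F j x)) \<oplus> (\<Oplus>i\<in>J. \<Oplus>j\<in>J. F i j)"
  proof -
    have "(\<Oplus>i\<in>J. \<Oplus>j\<in>J. F i j) \<in> carrier G" using c by (intro finsum_closed) auto
    then show ?thesis using c[of x] Fc[of x x] by (simp add: a_assoc)
  qed
  also have "(\<Oplus>j\<in>J. F x j) \<oplus> (\<Oplus>j\<in>J. F j x) = (\<Oplus>j\<in>J. F x j \<oplus> F j x)"
    using Fc by (intro finsum_addf[symmetric]) auto
  finally show ?case using S IH cross insert.prems(2) by auto
qed

section \<open>Tensor powers of a quartic algebra\<close>

text \<open>
  The algebra generated by a root \<open>x\<close> of the quartic, with the powers of \<open>x\<close> as basis.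
\<close>

locale quartic_closure = quartic_tensor R A b for R (structure) and A and b :: "nat \<Rightarrow> 'c" +
  fixes x :: 'c and s1 s2 s3 s4 :: 'a
  assumes x_closed [simp]: "x \<in> carrier A"
    and basis_power: "b i = x [^]\<^bsub>A\<^esub> i"
    and s_closed [simp]: "s1 \<in> carrier R" "s2 \<in> carrier R" "s3 \<in> carrier R" "s4 \<in> carrier R"
    and x_quartic: "x [^]\<^bsub>A\<^esub> (4::nat) = s1 \<odot>\<^bsub>A\<^esub> (x [^]\<^bsub>A\<^esub> (3::nat)) \<ominus>\<^bsub>A\<^esub> s2 \<odot>\<^bsub>A\<^esub> (x [^]\<^bsub>A\<^esub> (2::nat))
      \<oplus>\<^bsub>A\<^esub> s3 \<odot>\<^bsub>A\<^esub> x \<ominus>\<^bsub>A\<^esub> s4 \<odot>\<^bsub>A\<^esub> \<one>\<^bsub>A\<^esub>"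
begin

definition \<xi> where "\<xi> i = at i x"
definition sum13 where "sum13 = \<xi> 1 \<oplus>\<^bsub>T\<^esub> \<xi> 3"
definition sum24 where "sum24 = \<xi> 2 \<oplus>\<^bsub>T\<^esub> \<xi> 4"
definition prod13 where "prod13 = \<xi> 1 \<otimes>\<^bsub>T\<^esub> \<xi> 3"
definition prod24 where "prod24 = \<xi> 2 \<otimes>\<^bsub>T\<^esub> \<xi> 4"
definition \<omega> where "\<omega> = prod13 \<oplus>\<^bsub>T\<^esub> prod24"

lemma \<xi>_closed [simp]: "i \<in> {1..4} \<Longrightarrow> \<xi> i \<in> carrier T"
  by (simp add: \<xi>_def)

lemma \<xi>_closed' [simp]:
  "\<xi> 1 \<in> carrier T" "\<xi> 2 \<in> carrier T" "\<xi> 3 \<in> carrier T" "\<xi> 4 \<in> carrier T"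
  by (rule \<xi>_closed; simp)+

lemma gens_closed [simp]:
  "sum13 \<in> carrier T" "sum24 \<in> carrier T" "prod13 \<in> carrier T" "prod24 \<in> carrier T" "\<omega> \<in> carrier T"
  by (simp_all add: sum13_def sum24_def prod13_def prod24_def \<omega>_def)

lemma esym_x:
  "esym 1 x = sum13 \<oplus>\<^bsub>T\<^esub> sum24"
  "esym 2 x = \<omega> \<oplus>\<^bsub>T\<^esub> sum13 \<otimes>\<^bsub>T\<^esub> sum24"
  "esym 3 x = sum13 \<otimes>\<^bsub>T\<^esub> prod24 \<oplus>\<^bsub>T\<^esub> sum24 \<otimes>\<^bsub>T\<^esub> prod13"
  "esym 4 x = prod13 \<otimes>\<^bsub>T\<^esub> prod24"
  using T.elementary_sums_four[of \<xi>, OF \<xi>_closed]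
  unfolding \<omega>_def sum13_def sum24_def prod13_def prod24_def
  by (simp_all only: tensor_elem_sym_def \<xi>_def)

lemma basis_tensor_eq:
  assumes \<alpha>: "\<alpha> \<in> X"
  shows "basis_tensor \<alpha> = (\<xi> 1 [^]\<^bsub>T\<^esub> \<alpha> 1 \<otimes>\<^bsub>T\<^esub> \<xi> 3 [^]\<^bsub>T\<^esub> \<alpha> 3) \<otimes>\<^bsub>T\<^esub> (\<xi> 2 [^]\<^bsub>T\<^esub> \<alpha> 2 \<otimes>\<^bsub>T\<^esub> \<xi> 4 [^]\<^bsub>T\<^esub> \<alpha> 4)"
proof -
  have I: "{1..4::nat} = insert 1 (insert 2 (insert 3 (insert 4 {})))" by auto
  have pow: "at i (b k) = \<xi> i [^]\<^bsub>T\<^esub> k" if "i \<in> {1..4}" for i k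
  proof -
    interpret h: ring_hom_cring A T "at i" by (rule tensor_at_hom[OF that])
    show ?thesis unfolding basis_power \<xi>_def using h.hom_pow[OF x_closed, of k] .
  qed
  have "basis_tensor \<alpha> = (\<Otimes>\<^bsub>T\<^esub>i\<in>{1..4}. \<xi> i [^]\<^bsub>T\<^esub> \<alpha> i)"
    unfolding basis_tensor_eq_finprod[OF \<alpha>] using pow by (intro T.finprod_cong') auto
  also have "\<dots> = \<xi> 1 [^]\<^bsub>T\<^esub> \<alpha> 1 \<otimes>\<^bsub>T\<^esub> (\<xi> 2 [^]\<^bsub>T\<^esub> \<alpha> 2 \<otimes>\<^bsub>T\<^esub> (\<xi> 3 [^]\<^bsub>T\<^esub> \<alpha> 3 \<otimes>\<^bsub>T\<^esub> \<xi> 4 [^]\<^bsub>T\<^esub> \<alpha> 4))"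
    unfolding I by simp
  finally show ?thesis by (simp add: T.m_ac)
qed

text \<open>
  Exponents are grouped by the blocks \<open>{1, 3}\<close> and \<open>{2, 4}\<close> on which \<open>D\<^sub>4\<close> acts.
\<close>

definition idx :: "nat \<times> nat \<Rightarrow> nat \<times> nat \<Rightarrow> nat \<Rightarrow> nat" where
  "idx u v = (\<lambda>i\<in>{1..4}. if i = 1 then fst u else if i = 2 then fst v else if i = 3 then snd u else snd v)"

lemma idx_simps [simp]:
  "idx u v 1 = fst u" "idx u v 2 = fst v" "idx u v 3 = snd u" "idx u v 4 = snd v"
  by (simp_all add: idx_def)

abbreviation I2 where "I2 \<equiv> {..<4::nat} \<times> {..<4::nat}"

lemma four_cases: "i \<in> {1..4::nat} \<Longrightarrow> i = 1 \<or> i = 2 \<or> i = 3 \<or> i = 4"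
  by auto

lemma idx_closed: "u \<in> I2 \<Longrightarrow> v \<in> I2 \<Longrightarrow> idx u v \<in> X"
  by (auto simp: idx_def)

lemma idx_bij: "bij_betw (\<lambda>w. idx (fst w) (snd w)) (I2 \<times> I2) X"
proof (rule bij_betw_byWitness[of _ "\<lambda>\<alpha>. ((\<alpha> 1, \<alpha> 3), (\<alpha> 2, \<alpha> 4))"])
  show "\<forall>\<alpha>\<in>X. idx (fst ((\<alpha> 1, \<alpha> 3), (\<alpha> 2, \<alpha> 4))) (snd ((\<alpha> 1, \<alpha> 3), (\<alpha> 2, \<alpha> 4))) = \<alpha>"
  proof (rule ballI, rule ext)
    fix \<alpha> i assume \<alpha>: "\<alpha> \<in> X"
    show "idx (fst ((\<alpha> 1, \<alpha> 3), (\<alpha> 2, \<alpha> 4))) (snd ((\<alpha> 1, \<alpha> 3), (\<alpha> 2, \<alpha> 4))) i = \<alpha> i"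
    proof (cases "i \<in> {1..4}")
      case True
      then show ?thesis using four_cases by fastforce
    next
      case False
      then show ?thesis using PiE_arb[OF \<alpha> False] by (simp only: idx_def restrict_def if_False)
    qed
  qed
  show "(\<lambda>w. idx (fst w) (snd w)) ` (I2 \<times> I2) \<subseteq> X"
    by (rule image_subsetI, rule idx_closed) auto
  show "(\<lambda>\<alpha>. ((\<alpha> 1, \<alpha> 3), (\<alpha> 2, \<alpha> 4))) ` X \<subseteq> I2 \<times> I2"
  proof (rule image_subsetI)
    fix \<alpha> assume "\<alpha> \<in> X"
    then have "\<alpha> i < 4" if "i \<in> {1..4}" for i using X_nth that by blast
    then show "((\<alpha> 1, \<alpha> 3), (\<alpha> 2, \<alpha> 4)) \<in> I2 \<times> I2" by simp
  qed
qed (auto simp: idx_def)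

definition mon13 where "mon13 u = \<xi> 1 [^]\<^bsub>T\<^esub> fst u \<otimes>\<^bsub>T\<^esub> \<xi> 3 [^]\<^bsub>T\<^esub> snd u" for u :: "nat \<times> nat"
definition mon24 where "mon24 u = \<xi> 2 [^]\<^bsub>T\<^esub> fst u \<otimes>\<^bsub>T\<^esub> \<xi> 4 [^]\<^bsub>T\<^esub> snd u" for u :: "nat \<times> nat"

definition sym13 where
  "sym13 u = (if fst u = snd u then mon13 u else mon13 u \<oplus>\<^bsub>T\<^esub> mon13 (prod.swap u))"
definition sym24 where
  "sym24 u = (if fst u = snd u then mon24 u else mon24 u \<oplus>\<^bsub>T\<^esub> mon24 (prod.swap u))"

lemma mon_closed [simp]: "mon13 u \<in> carrier T" "mon24 u \<in> carrier T"
  "sym13 u \<in> carrier T" "sym24 u \<in> carrier T"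
  by (simp_all add: mon13_def mon24_def sym13_def sym24_def)

abbreviation J2 where "J2 \<equiv> {u \<in> I2. fst u \<le> snd u}"

lemma tcrd_idx_permute:
  assumes t: "t \<in> carrier T" and \<sigma>: "\<sigma> permutes {1..4}" and inv: "perm_tensor \<sigma> t = t"
    and uv: "u \<in> I2" "v \<in> I2"
  shows "tcrd (idx u v \<circ> \<sigma>) t = tcrd (idx u v) t"
  using tcrd_permute(1)[OF \<sigma> idx_closed[OF uv] t] inv by simp

text \<open>
  The coordinates of \<open>t\<close> are constant on the orbits of \<open>(1 3)\<close> and \<open>(2 4)\<close>, so the basis tensors of an orbit can
  be collected.
\<close>

lemma symmetric_expansion:
  assumes t: "t \<in> carrier T"
    and inv13: "perm_tensor (transpose 1 3) t = t" and inv24: "perm_tensor (transpose 2 4) t = t"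
  shows "t = (\<Oplus>\<^bsub>T\<^esub>u\<in>J2. \<Oplus>\<^bsub>T\<^esub>v\<in>J2. tcrd (idx u v) t \<odot>\<^bsub>T\<^esub> (sym13 u \<otimes>\<^bsub>T\<^esub> sym24 v))"
proof -
  let ?c = "\<lambda>u v. tcrd (idx u v) t"
  have c [simp]: "?c u v \<in> carrier R" if "u \<in> I2" "v \<in> I2" for u v
    using tcrd_closed[OF idx_closed[OF that] t] .
  have p13: "transpose 1 3 permutes {1..4::nat}" and p24: "transpose 2 4 permutes {1..4::nat}"
    by (intro permutes_swap_id; simp)+
  have c13: "?c (prod.swap u) v = ?c u v" if "u \<in> I2" "v \<in> I2" for u v
  proof -
    have "idx u v \<circ> transpose 1 3 = idx (prod.swap u) v"
      by (auto simp: fun_eq_iff idx_def transpose_def restrict_def)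
    then show ?thesis using tcrd_idx_permute[OF t p13 inv13 that] by simp
  qed
  have c24: "?c u (prod.swap v) = ?c u v" if "u \<in> I2" "v \<in> I2" for u v
  proof -
    have "idx u v \<circ> transpose 2 4 = idx u (prod.swap v)"
      by (auto simp: fun_eq_iff idx_def transpose_def restrict_def)
    then show ?thesis using tcrd_idx_permute[OF t p24 inv24 that] by simp
  qed
  have fin: "finite I2" "finite J2" by (auto intro: finite_subset[of _ I2])
  have J: "u \<in> I2" if "u \<in> J2" for u using that by blast
  have smult_add: "r \<odot>\<^bsub>T\<^esub> (y \<otimes>\<^bsub>T\<^esub> z) \<oplus>\<^bsub>T\<^esub> r \<odot>\<^bsub>T\<^esub> (y \<otimes>\<^bsub>T\<^esub> z') = r \<odot>\<^bsub>T\<^esub> (y \<otimes>\<^bsub>T\<^esub> (z \<oplus>\<^bsub>T\<^esub> z'))"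
    "r \<odot>\<^bsub>T\<^esub> (z \<otimes>\<^bsub>T\<^esub> y) \<oplus>\<^bsub>T\<^esub> r \<odot>\<^bsub>T\<^esub> (z' \<otimes>\<^bsub>T\<^esub> y) = r \<odot>\<^bsub>T\<^esub> ((z \<oplus>\<^bsub>T\<^esub> z') \<otimes>\<^bsub>T\<^esub> y)"
    if "r \<in> carrier R" "y \<in> carrier T" "z \<in> carrier T" "z' \<in> carrier T" for r y z z'
    using that by (simp_all add: T.r_distr T.l_distr T.smult_r_distr)
  have "t = (\<Oplus>\<^bsub>T\<^esub>\<alpha>\<in>(\<lambda>w. idx (fst w) (snd w)) ` (I2 \<times> I2). tcrd \<alpha> t \<odot>\<^bsub>T\<^esub> basis_tensor \<alpha>)"
    unfolding bij_betw_imp_surj_on[OF idx_bij] by (rule tensor_expansion[OF t])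
  also have "\<dots> = (\<Oplus>\<^bsub>T\<^esub>w\<in>I2 \<times> I2. ?c (fst w) (snd w) \<odot>\<^bsub>T\<^esub> basis_tensor (idx (fst w) (snd w)))"
  proof (rule T.M.finsum_reindex[OF _ bij_betw_imp_inj_on[OF idx_bij]])
    show "(\<lambda>\<alpha>. tcrd \<alpha> t \<odot>\<^bsub>T\<^esub> basis_tensor \<alpha>) \<in> (\<lambda>w. idx (fst w) (snd w)) ` (I2 \<times> I2) \<rightarrow> carrier T"
      unfolding bij_betw_imp_surj_on[OF idx_bij]
      using t by (intro Pi_I T.smult_closed tcrd_closed basis_tensor_closed)
  qed
  also have "\<dots> = (\<Oplus>\<^bsub>T\<^esub>w\<in>I2 \<times> I2. ?c (fst w) (snd w) \<odot>\<^bsub>T\<^esub> (mon13 (fst w) \<otimes>\<^bsub>T\<^esub> mon24 (snd w)))"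
  proof (rule T.M.finsum_cong'[OF refl])
    fix w assume "w \<in> I2 \<times> I2"
    then have "idx (fst w) (snd w) \<in> X" by (intro idx_closed) auto
    then show "?c (fst w) (snd w) \<odot>\<^bsub>T\<^esub> basis_tensor (idx (fst w) (snd w)) =
        ?c (fst w) (snd w) \<odot>\<^bsub>T\<^esub> (mon13 (fst w) \<otimes>\<^bsub>T\<^esub> mon24 (snd w))"
      by (simp add: basis_tensor_eq mon13_def mon24_def)
  next
    show "(\<lambda>w. ?c (fst w) (snd w) \<odot>\<^bsub>T\<^esub> (mon13 (fst w) \<otimes>\<^bsub>T\<^esub> mon24 (snd w))) \<in> I2 \<times> I2 \<rightarrow> carrier T"
      by (intro Pi_I T.smult_closed c T.m_closed mon_closed) auto
  qed
  also have "\<dots> = (\<Oplus>\<^bsub>T\<^esub>u\<in>I2. \<Oplus>\<^bsub>T\<^esub>v\<in>I2. ?c u v \<odot>\<^bsub>T\<^esub> (mon13 u \<otimes>\<^bsub>T\<^esub> mon24 v))"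
    using fin c by (subst T.M.finsum_cartesian) auto
  also have "\<dots> = (\<Oplus>\<^bsub>T\<^esub>u\<in>I2. \<Oplus>\<^bsub>T\<^esub>v\<in>J2. ?c u v \<odot>\<^bsub>T\<^esub> (mon13 u \<otimes>\<^bsub>T\<^esub> sym24 v))"
  proof (rule T.M.finsum_cong'[OF refl])
    fix u assume u: "u \<in> I2"
    have "(\<Oplus>\<^bsub>T\<^esub>v\<in>I2. ?c u v \<odot>\<^bsub>T\<^esub> (mon13 u \<otimes>\<^bsub>T\<^esub> mon24 v)) =
        (\<Oplus>\<^bsub>T\<^esub>v\<in>I2. ?c u (fst v, snd v) \<odot>\<^bsub>T\<^esub> (mon13 u \<otimes>\<^bsub>T\<^esub> mon24 (fst v, snd v)))" by simp
    also have "\<dots> = (\<Oplus>\<^bsub>T\<^esub>v\<in>J2. if fst v = snd v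
        then ?c u (fst v, snd v) \<odot>\<^bsub>T\<^esub> (mon13 u \<otimes>\<^bsub>T\<^esub> mon24 (fst v, snd v))
        else ?c u (fst v, snd v) \<odot>\<^bsub>T\<^esub> (mon13 u \<otimes>\<^bsub>T\<^esub> mon24 (fst v, snd v)) \<oplus>\<^bsub>T\<^esub>
          ?c u (snd v, fst v) \<odot>\<^bsub>T\<^esub> (mon13 u \<otimes>\<^bsub>T\<^esub> mon24 (snd v, fst v)))"
      using u c
      by (intro T.M.finsum_square_upper[where h = "\<lambda>i j. ?c u (i, j) \<odot>\<^bsub>T\<^esub> (mon13 u \<otimes>\<^bsub>T\<^esub> mon24 (i, j))"]) auto
    also have "\<dots> = (\<Oplus>\<^bsub>T\<^esub>v\<in>J2. ?c u v \<odot>\<^bsub>T\<^esub> (mon13 u \<otimes>\<^bsub>T\<^esub> sym24 v))"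
    proof (rule T.M.finsum_cong'[OF refl])
      fix v assume "v \<in> J2"
      then have v: "v \<in> I2" by blast
      then have "?c u (snd v, fst v) = ?c u v" using c24[OF u v] by (simp add: prod.swap_def)
      then show "(if fst v = snd v
        then ?c u (fst v, snd v) \<odot>\<^bsub>T\<^esub> (mon13 u \<otimes>\<^bsub>T\<^esub> mon24 (fst v, snd v))
        else ?c u (fst v, snd v) \<odot>\<^bsub>T\<^esub> (mon13 u \<otimes>\<^bsub>T\<^esub> mon24 (fst v, snd v)) \<oplus>\<^bsub>T\<^esub>
          ?c u (snd v, fst v) \<odot>\<^bsub>T\<^esub> (mon13 u \<otimes>\<^bsub>T\<^esub> mon24 (snd v, fst v))) =
        ?c u v \<odot>\<^bsub>T\<^esub> (mon13 u \<otimes>\<^bsub>T\<^esub> sym24 v)"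
        using c[OF u v] by (cases v) (simp add: sym24_def smult_add)
    qed (use u J c in \<open>intro Pi_I T.smult_closed T.m_closed mon_closed, blast\<close>)
    finally show "(\<Oplus>\<^bsub>T\<^esub>v\<in>I2. ?c u v \<odot>\<^bsub>T\<^esub> (mon13 u \<otimes>\<^bsub>T\<^esub> mon24 v)) =
        (\<Oplus>\<^bsub>T\<^esub>v\<in>J2. ?c u v \<odot>\<^bsub>T\<^esub> (mon13 u \<otimes>\<^bsub>T\<^esub> sym24 v))" .
  qed (use J c in \<open>intro Pi_I T.M.finsum_closed T.smult_closed T.m_closed mon_closed, blast\<close>)
  also have "\<dots> = (\<Oplus>\<^bsub>T\<^esub>v\<in>J2. \<Oplus>\<^bsub>T\<^esub>u\<in>I2. ?c u v \<odot>\<^bsub>T\<^esub> (mon13 u \<otimes>\<^bsub>T\<^esub> sym24 v))"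
    using J c by (intro T.M.finsum_swap fin T.smult_closed T.m_closed mon_closed) blast
  also have "\<dots> = (\<Oplus>\<^bsub>T\<^esub>v\<in>J2. \<Oplus>\<^bsub>T\<^esub>u\<in>J2. ?c u v \<odot>\<^bsub>T\<^esub> (sym13 u \<otimes>\<^bsub>T\<^esub> sym24 v))"
  proof (rule T.M.finsum_cong'[OF refl])
    fix v assume "v \<in> J2"
    then have v: "v \<in> I2" by blast
    have "(\<Oplus>\<^bsub>T\<^esub>u\<in>I2. ?c u v \<odot>\<^bsub>T\<^esub> (mon13 u \<otimes>\<^bsub>T\<^esub> sym24 v)) =
        (\<Oplus>\<^bsub>T\<^esub>u\<in>I2. ?c (fst u, snd u) v \<odot>\<^bsub>T\<^esub> (mon13 (fst u, snd u) \<otimes>\<^bsub>T\<^esub> sym24 v))" by simp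
    also have "\<dots> = (\<Oplus>\<^bsub>T\<^esub>u\<in>J2. if fst u = snd u
        then ?c (fst u, snd u) v \<odot>\<^bsub>T\<^esub> (mon13 (fst u, snd u) \<otimes>\<^bsub>T\<^esub> sym24 v)
        else ?c (fst u, snd u) v \<odot>\<^bsub>T\<^esub> (mon13 (fst u, snd u) \<otimes>\<^bsub>T\<^esub> sym24 v) \<oplus>\<^bsub>T\<^esub>
          ?c (snd u, fst u) v \<odot>\<^bsub>T\<^esub> (mon13 (snd u, fst u) \<otimes>\<^bsub>T\<^esub> sym24 v))"
      using v c
      by (intro T.M.finsum_square_upper[where h = "\<lambda>i j. ?c (i, j) v \<odot>\<^bsub>T\<^esub> (mon13 (i, j) \<otimes>\<^bsub>T\<^esub> sym24 v)"]) auto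
    also have "\<dots> = (\<Oplus>\<^bsub>T\<^esub>u\<in>J2. ?c u v \<odot>\<^bsub>T\<^esub> (sym13 u \<otimes>\<^bsub>T\<^esub> sym24 v))"
    proof (rule T.M.finsum_cong'[OF refl])
      fix u assume "u \<in> J2"
      then have u: "u \<in> I2" by blast
      then have "?c (snd u, fst u) v = ?c u v" using c13[OF u v] by (simp add: prod.swap_def)
      then show "(if fst u = snd u
        then ?c (fst u, snd u) v \<odot>\<^bsub>T\<^esub> (mon13 (fst u, snd u) \<otimes>\<^bsub>T\<^esub> sym24 v)
        else ?c (fst u, snd u) v \<odot>\<^bsub>T\<^esub> (mon13 (fst u, snd u) \<otimes>\<^bsub>T\<^esub> sym24 v) \<oplus>\<^bsub>T\<^esub>
          ?c (snd u, fst u) v \<odot>\<^bsub>T\<^esub> (mon13 (snd u, fst u) \<otimes>\<^bsub>T\<^esub> sym24 v)) =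
        ?c u v \<odot>\<^bsub>T\<^esub> (sym13 u \<otimes>\<^bsub>T\<^esub> sym24 v)"
        using c[OF u v] by (cases u) (simp add: sym13_def smult_add)
    qed (use v J c in \<open>intro Pi_I T.smult_closed T.m_closed mon_closed, blast\<close>)
    finally show "(\<Oplus>\<^bsub>T\<^esub>u\<in>I2. ?c u v \<odot>\<^bsub>T\<^esub> (mon13 u \<otimes>\<^bsub>T\<^esub> sym24 v)) =
        (\<Oplus>\<^bsub>T\<^esub>u\<in>J2. ?c u v \<odot>\<^bsub>T\<^esub> (sym13 u \<otimes>\<^bsub>T\<^esub> sym24 v))" .
  qed (use J c in \<open>intro Pi_I T.M.finsum_closed T.smult_closed T.m_closed mon_closed, blast\<close>)
  also have "\<dots> = (\<Oplus>\<^bsub>T\<^esub>u\<in>J2. \<Oplus>\<^bsub>T\<^esub>v\<in>J2. ?c u v \<odot>\<^bsub>T\<^esub> (sym13 u \<otimes>\<^bsub>T\<^esub> sym24 v))"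
    using J c by (intro T.M.finsum_swap fin T.smult_closed T.m_closed mon_closed) blast
  finally show ?thesis .
qed

end

section \<open>Generators of the dihedral invariants\<close>

context cring
begin

lemma pair_add_expansion:
  assumes [simp]: "a0 \<in> carrier R" "a1 \<in> carrier R" "a2 \<in> carrier R" "a3 \<in> carrier R"
    "b0 \<in> carrier R" "b1 \<in> carrier R" "b2 \<in> carrier R" "b3 \<in> carrier R"
    "p \<in> carrier R" "q \<in> carrier R"
  shows "(a0 \<oplus> a1 \<otimes> p \<oplus> a2 \<otimes> q \<oplus> a3 \<otimes> (p \<otimes> q)) \<oplus> (b0 \<oplus> b1 \<otimes> p \<oplus> b2 \<otimes> q \<oplus> b3 \<otimes> (p \<otimes> q)) =
    (a0 \<oplus> b0) \<oplus> (a1 \<oplus> b1) \<otimes> p \<oplus> (a2 \<oplus> b2) \<otimes> q \<oplus> (a3 \<oplus> b3) \<otimes> (p \<otimes> q)"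
  using assms by algebra

lemma pair_minus_expansion:
  assumes [simp]: "a0 \<in> carrier R" "a1 \<in> carrier R" "a2 \<in> carrier R" "a3 \<in> carrier R"
    "p \<in> carrier R" "q \<in> carrier R"
  shows "\<ominus> (a0 \<oplus> a1 \<otimes> p \<oplus> a2 \<otimes> q \<oplus> a3 \<otimes> (p \<otimes> q)) =
    (\<ominus> a0) \<oplus> (\<ominus> a1) \<otimes> p \<oplus> (\<ominus> a2) \<otimes> q \<oplus> (\<ominus> a3) \<otimes> (p \<otimes> q)"
  using assms by algebra

lemma pair_sum_expansion:
  assumes [simp]: "a0 \<in> carrier R" "a1 \<in> carrier R" "a2 \<in> carrier R" "a3 \<in> carrier R"
    "p \<in> carrier R" "p' \<in> carrier R" "q \<in> carrier R"
  shows "(a0 \<oplus> a1 \<otimes> p \<oplus> a2 \<otimes> q \<oplus> a3 \<otimes> (p \<otimes> q)) \<otimes> p =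
    (\<ominus> (a1 \<otimes> (p \<otimes> p'))) \<oplus> (a0 \<oplus> a1 \<otimes> (p \<oplus> p')) \<otimes> p \<oplus> (\<ominus> (a3 \<otimes> (p \<otimes> p'))) \<otimes> q
    \<oplus> (a2 \<oplus> a3 \<otimes> (p \<oplus> p')) \<otimes> (p \<otimes> q)" (is "?l = ?r")
  using assms by algebra

lemma pair_prod_expansion:
  assumes [simp]: "a0 \<in> carrier R" "a1 \<in> carrier R" "a2 \<in> carrier R" "a3 \<in> carrier R"
    "p \<in> carrier R" "q \<in> carrier R" "q' \<in> carrier R"
  shows "(a0 \<oplus> a1 \<otimes> p \<oplus> a2 \<otimes> q \<oplus> a3 \<otimes> (p \<otimes> q)) \<otimes> q =
    (\<ominus> (a2 \<otimes> (q \<otimes> q'))) \<oplus> (\<ominus> (a3 \<otimes> (q \<otimes> q'))) \<otimes> p \<oplus> (a0 \<oplus> a2 \<otimes> (q \<oplus> q')) \<otimes> q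
    \<oplus> (a1 \<oplus> a3 \<otimes> (q \<oplus> q')) \<otimes> (p \<otimes> q)"
  using assms by algebra

lemma power_sum_recursion:
  assumes [simp]: "a \<in> carrier R" "b \<in> carrier R"
  shows "a [^] Suc (Suc k) \<oplus> b [^] Suc (Suc k) =
    (a [^] Suc k \<oplus> b [^] Suc k) \<otimes> (a \<oplus> b) \<ominus> (a [^] k \<oplus> b [^] k) \<otimes> (a \<otimes> b)"
proof -
  have "y \<otimes> a \<otimes> a \<oplus> z \<otimes> b \<otimes> b = (y \<otimes> a \<oplus> z \<otimes> b) \<otimes> (a \<oplus> b) \<ominus> (y \<oplus> z) \<otimes> (a \<otimes> b)"
    if "y \<in> carrier R" "z \<in> carrier R" for y z
    using that assms by algebra
  then show ?thesis by simp
qed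

lemma cross_term:
  assumes [simp]: "u \<in> carrier R" "u' \<in> carrier R" "v \<in> carrier R" "v' \<in> carrier R"
  shows "u \<otimes> v' \<oplus> v \<otimes> u' = (u \<oplus> v) \<otimes> (u' \<oplus> v') \<oplus> (\<ominus> (u \<otimes> u') \<oplus> \<ominus> (v \<otimes> v'))"
  using assms by algebra

end

text \<open>
  A set that contains the algebra generated by \<open>\<omega>\<close> and the elementary symmetric polynomials in the \<open>\<xi>\<^sub>i\<close>.
\<close>

locale generated_subalgebra = quartic_closure R A b x s1 s2 s3 s4
  for R (structure) and A and b :: "nat \<Rightarrow> 'c" and x :: 'c and s1 s2 s3 s4 :: 'a +
  fixes S :: "((nat \<Rightarrow> 'c) \<Rightarrow> 'a) set set"
  assumes S_sub: "S \<subseteq> carrier T"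
    and S_scalar: "r \<in> carrier R \<Longrightarrow> r \<odot>\<^bsub>T\<^esub> \<one>\<^bsub>T\<^esub> \<in> S"
    and S_add: "u \<in> S \<Longrightarrow> v \<in> S \<Longrightarrow> u \<oplus>\<^bsub>T\<^esub> v \<in> S"
    and S_mult: "u \<in> S \<Longrightarrow> v \<in> S \<Longrightarrow> u \<otimes>\<^bsub>T\<^esub> v \<in> S"
    and S_esym: "k \<in> {1..4} \<Longrightarrow> esym k x \<in> S"
    and S_\<omega>: "\<omega> \<in> S"
begin

lemma S_carrier: "u \<in> S \<Longrightarrow> u \<in> carrier T"
  using S_sub by blast

lemma S_smult: "r \<in> carrier R \<Longrightarrow> u \<in> S \<Longrightarrow> r \<odot>\<^bsub>T\<^esub> u \<in> S"
  using S_mult[OF S_scalar, of r u] S_carrier[of u] by (simp add: T.smult_assoc2)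

lemma S_minus: "u \<in> S \<Longrightarrow> \<ominus>\<^bsub>T\<^esub> u \<in> S"
  using S_smult[of "\<ominus> \<one>" u] S_carrier[of u] by (simp add: T.smult_l_minus)

lemma S_one: "\<one>\<^bsub>T\<^esub> \<in> S"
  using S_scalar[of \<one>] by simp

lemma S_zero: "\<zero>\<^bsub>T\<^esub> \<in> S"
  using S_scalar[of \<zero>] by simp

lemma S_gens:
  "sum13 \<oplus>\<^bsub>T\<^esub> sum24 \<in> S" "prod13 \<oplus>\<^bsub>T\<^esub> prod24 \<in> S" "sum13 \<otimes>\<^bsub>T\<^esub> sum24 \<in> S" "prod13 \<otimes>\<^bsub>T\<^esub> prod24 \<in> S"
  "sum13 \<otimes>\<^bsub>T\<^esub> prod24 \<oplus>\<^bsub>T\<^esub> sum24 \<otimes>\<^bsub>T\<^esub> prod13 \<in> S"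
proof -
  show "sum13 \<oplus>\<^bsub>T\<^esub> sum24 \<in> S" "prod13 \<otimes>\<^bsub>T\<^esub> prod24 \<in> S"
    "sum13 \<otimes>\<^bsub>T\<^esub> prod24 \<oplus>\<^bsub>T\<^esub> sum24 \<otimes>\<^bsub>T\<^esub> prod13 \<in> S"
    using S_esym[of 1] S_esym[of 4] S_esym[of 3] by (simp_all add: esym_x)
  show "prod13 \<oplus>\<^bsub>T\<^esub> prod24 \<in> S" using S_\<omega> by (simp add: \<omega>_def)
  have "(\<ominus>\<^bsub>T\<^esub> \<omega>) \<oplus>\<^bsub>T\<^esub> esym 2 x \<in> S" by (intro S_add S_minus S_\<omega> S_esym) simp
  then show "sum13 \<otimes>\<^bsub>T\<^esub> sum24 \<in> S" by (simp add: esym_x T.r_neg1)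
qed

text \<open>
  The pairs of values of one polynomial \<open>a\<^sub>0 + a\<^sub>1 p + a\<^sub>2 q + a\<^sub>3 p q\<close> over \<open>S\<close> at the sum and product of the
  two blocks.  Higher powers are not needed, since \<open>p + p'\<close>, \<open>p p'\<close>, \<open>q + q'\<close> and \<open>q q'\<close> belong to \<open>S\<close>, so
  that sums and products of the blocks are quadratic over \<open>S\<close>.
\<close>

definition pair_span where
  "pair_span = {(u, u'). \<exists>a0\<in>S. \<exists>a1\<in>S. \<exists>a2\<in>S. \<exists>a3\<in>S.
    u = a0 \<oplus>\<^bsub>T\<^esub> a1 \<otimes>\<^bsub>T\<^esub> sum13 \<oplus>\<^bsub>T\<^esub> a2 \<otimes>\<^bsub>T\<^esub> prod13 \<oplus>\<^bsub>T\<^esub> a3 \<otimes>\<^bsub>T\<^esub> (sum13 \<otimes>\<^bsub>T\<^esub> prod13) \<and>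
    u' = a0 \<oplus>\<^bsub>T\<^esub> a1 \<otimes>\<^bsub>T\<^esub> sum24 \<oplus>\<^bsub>T\<^esub> a2 \<otimes>\<^bsub>T\<^esub> prod24 \<oplus>\<^bsub>T\<^esub> a3 \<otimes>\<^bsub>T\<^esub> (sum24 \<otimes>\<^bsub>T\<^esub> prod24)}"

lemma pair_spanI:
  assumes "a0 \<in> S" "a1 \<in> S" "a2 \<in> S" "a3 \<in> S"
    "u = a0 \<oplus>\<^bsub>T\<^esub> a1 \<otimes>\<^bsub>T\<^esub> sum13 \<oplus>\<^bsub>T\<^esub> a2 \<otimes>\<^bsub>T\<^esub> prod13 \<oplus>\<^bsub>T\<^esub> a3 \<otimes>\<^bsub>T\<^esub> (sum13 \<otimes>\<^bsub>T\<^esub> prod13)"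
    "u' = a0 \<oplus>\<^bsub>T\<^esub> a1 \<otimes>\<^bsub>T\<^esub> sum24 \<oplus>\<^bsub>T\<^esub> a2 \<otimes>\<^bsub>T\<^esub> prod24 \<oplus>\<^bsub>T\<^esub> a3 \<otimes>\<^bsub>T\<^esub> (sum24 \<otimes>\<^bsub>T\<^esub> prod24)"
  shows "(u, u') \<in> pair_span"
  using assms unfolding pair_span_def by blast

lemma pair_spanE:
  assumes "(u, u') \<in> pair_span"
  obtains a0 a1 a2 a3 where "a0 \<in> S" "a1 \<in> S" "a2 \<in> S" "a3 \<in> S"
    "u = a0 \<oplus>\<^bsub>T\<^esub> a1 \<otimes>\<^bsub>T\<^esub> sum13 \<oplus>\<^bsub>T\<^esub> a2 \<otimes>\<^bsub>T\<^esub> prod13 \<oplus>\<^bsub>T\<^esub> a3 \<otimes>\<^bsub>T\<^esub> (sum13 \<otimes>\<^bsub>T\<^esub> prod13)"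
    "u' = a0 \<oplus>\<^bsub>T\<^esub> a1 \<otimes>\<^bsub>T\<^esub> sum24 \<oplus>\<^bsub>T\<^esub> a2 \<otimes>\<^bsub>T\<^esub> prod24 \<oplus>\<^bsub>T\<^esub> a3 \<otimes>\<^bsub>T\<^esub> (sum24 \<otimes>\<^bsub>T\<^esub> prod24)"
  using assms unfolding pair_span_def by blast

lemma pair_span_closed:
  assumes "(u, u') \<in> pair_span"
  shows "u \<in> carrier T" "u' \<in> carrier T"
  using assms by (auto elim!: pair_spanE dest!: S_carrier)

lemma pair_span_base:
  "(\<one>\<^bsub>T\<^esub>, \<one>\<^bsub>T\<^esub>) \<in> pair_span" "(sum13, sum24) \<in> pair_span"
proof -
  show "(\<one>\<^bsub>T\<^esub>, \<one>\<^bsub>T\<^esub>) \<in> pair_span"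
    by (rule pair_spanI[of "\<one>\<^bsub>T\<^esub>" "\<zero>\<^bsub>T\<^esub>" "\<zero>\<^bsub>T\<^esub>" "\<zero>\<^bsub>T\<^esub>"]) (simp_all add: S_one S_zero)
  show "(sum13, sum24) \<in> pair_span"
    by (rule pair_spanI[of "\<zero>\<^bsub>T\<^esub>" "\<one>\<^bsub>T\<^esub>" "\<zero>\<^bsub>T\<^esub>" "\<zero>\<^bsub>T\<^esub>"]) (simp_all add: S_one S_zero)
qed

lemma pair_span_add:
  assumes "(u, u') \<in> pair_span" "(v, v') \<in> pair_span"
  shows "(u \<oplus>\<^bsub>T\<^esub> v, u' \<oplus>\<^bsub>T\<^esub> v') \<in> pair_span"
proof -
  obtain a0 a1 a2 a3 where a: "a0 \<in> S" "a1 \<in> S" "a2 \<in> S" "a3 \<in> S"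
    "u = a0 \<oplus>\<^bsub>T\<^esub> a1 \<otimes>\<^bsub>T\<^esub> sum13 \<oplus>\<^bsub>T\<^esub> a2 \<otimes>\<^bsub>T\<^esub> prod13 \<oplus>\<^bsub>T\<^esub> a3 \<otimes>\<^bsub>T\<^esub> (sum13 \<otimes>\<^bsub>T\<^esub> prod13)"
    "u' = a0 \<oplus>\<^bsub>T\<^esub> a1 \<otimes>\<^bsub>T\<^esub> sum24 \<oplus>\<^bsub>T\<^esub> a2 \<otimes>\<^bsub>T\<^esub> prod24 \<oplus>\<^bsub>T\<^esub> a3 \<otimes>\<^bsub>T\<^esub> (sum24 \<otimes>\<^bsub>T\<^esub> prod24)"
    by (rule pair_spanE[OF assms(1)])
  obtain c0 c1 c2 c3 where c: "c0 \<in> S" "c1 \<in> S" "c2 \<in> S" "c3 \<in> S"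
    "v = c0 \<oplus>\<^bsub>T\<^esub> c1 \<otimes>\<^bsub>T\<^esub> sum13 \<oplus>\<^bsub>T\<^esub> c2 \<otimes>\<^bsub>T\<^esub> prod13 \<oplus>\<^bsub>T\<^esub> c3 \<otimes>\<^bsub>T\<^esub> (sum13 \<otimes>\<^bsub>T\<^esub> prod13)"
    "v' = c0 \<oplus>\<^bsub>T\<^esub> c1 \<otimes>\<^bsub>T\<^esub> sum24 \<oplus>\<^bsub>T\<^esub> c2 \<otimes>\<^bsub>T\<^esub> prod24 \<oplus>\<^bsub>T\<^esub> c3 \<otimes>\<^bsub>T\<^esub> (sum24 \<otimes>\<^bsub>T\<^esub> prod24)"
    by (rule pair_spanE[OF assms(2)])
  note cl = S_carrier[OF a(1)] S_carrier[OF a(2)] S_carrier[OF a(3)] S_carrier[OF a(4)]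
    S_carrier[OF c(1)] S_carrier[OF c(2)] S_carrier[OF c(3)] S_carrier[OF c(4)]
  show ?thesis
    by (rule pair_spanI[OF S_add[OF a(1) c(1)] S_add[OF a(2) c(2)] S_add[OF a(3) c(3)] S_add[OF a(4) c(4)]])
      (simp_all only: a(5,6) c(5,6) T.pair_add_expansion cl gens_closed)
qed

lemma pair_span_minus:
  assumes "(u, u') \<in> pair_span"
  shows "(\<ominus>\<^bsub>T\<^esub> u, \<ominus>\<^bsub>T\<^esub> u') \<in> pair_span"
proof -
  obtain a0 a1 a2 a3 where a: "a0 \<in> S" "a1 \<in> S" "a2 \<in> S" "a3 \<in> S"
    "u = a0 \<oplus>\<^bsub>T\<^esub> a1 \<otimes>\<^bsub>T\<^esub> sum13 \<oplus>\<^bsub>T\<^esub> a2 \<otimes>\<^bsub>T\<^esub> prod13 \<oplus>\<^bsub>T\<^esub> a3 \<otimes>\<^bsub>T\<^esub> (sum13 \<otimes>\<^bsub>T\<^esub> prod13)"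
    "u' = a0 \<oplus>\<^bsub>T\<^esub> a1 \<otimes>\<^bsub>T\<^esub> sum24 \<oplus>\<^bsub>T\<^esub> a2 \<otimes>\<^bsub>T\<^esub> prod24 \<oplus>\<^bsub>T\<^esub> a3 \<otimes>\<^bsub>T\<^esub> (sum24 \<otimes>\<^bsub>T\<^esub> prod24)"
    by (rule pair_spanE[OF assms])
  note cl = S_carrier[OF a(1)] S_carrier[OF a(2)] S_carrier[OF a(3)] S_carrier[OF a(4)]
  show ?thesis
    by (rule pair_spanI[OF S_minus[OF a(1)] S_minus[OF a(2)] S_minus[OF a(3)] S_minus[OF a(4)]])
      (simp_all only: a(5,6) T.pair_minus_expansion cl gens_closed)
qed

text \<open>
  Reduction by \<open>p\<^sup>2 = (p + p') p - p p'\<close>, where \<open>p + p'\<close> is \<open>e\<^sub>1(x)\<close> and \<open>p p'\<close> is \<open>e\<^sub>2(x) - \<omega>\<close>.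
\<close>

lemma pair_span_sum:
  assumes "(u, u') \<in> pair_span"
  shows "(u \<otimes>\<^bsub>T\<^esub> sum13, u' \<otimes>\<^bsub>T\<^esub> sum24) \<in> pair_span"
proof -
  obtain a0 a1 a2 a3 where a: "a0 \<in> S" "a1 \<in> S" "a2 \<in> S" "a3 \<in> S"
    "u = a0 \<oplus>\<^bsub>T\<^esub> a1 \<otimes>\<^bsub>T\<^esub> sum13 \<oplus>\<^bsub>T\<^esub> a2 \<otimes>\<^bsub>T\<^esub> prod13 \<oplus>\<^bsub>T\<^esub> a3 \<otimes>\<^bsub>T\<^esub> (sum13 \<otimes>\<^bsub>T\<^esub> prod13)"
    "u' = a0 \<oplus>\<^bsub>T\<^esub> a1 \<otimes>\<^bsub>T\<^esub> sum24 \<oplus>\<^bsub>T\<^esub> a2 \<otimes>\<^bsub>T\<^esub> prod24 \<oplus>\<^bsub>T\<^esub> a3 \<otimes>\<^bsub>T\<^esub> (sum24 \<otimes>\<^bsub>T\<^esub> prod24)"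
    by (rule pair_spanE[OF assms])
  note cl = S_carrier[OF a(1)] S_carrier[OF a(2)] S_carrier[OF a(3)] S_carrier[OF a(4)] gens_closed
  note comm = T.m_comm[of sum24 sum13] T.a_comm[of sum24 sum13]
  show ?thesis
  proof (rule pair_spanI)
    show "u \<otimes>\<^bsub>T\<^esub> sum13 = (\<ominus>\<^bsub>T\<^esub> (a1 \<otimes>\<^bsub>T\<^esub> (sum13 \<otimes>\<^bsub>T\<^esub> sum24)))
      \<oplus>\<^bsub>T\<^esub> (a0 \<oplus>\<^bsub>T\<^esub> a1 \<otimes>\<^bsub>T\<^esub> (sum13 \<oplus>\<^bsub>T\<^esub> sum24)) \<otimes>\<^bsub>T\<^esub> sum13
      \<oplus>\<^bsub>T\<^esub> (\<ominus>\<^bsub>T\<^esub> (a3 \<otimes>\<^bsub>T\<^esub> (sum13 \<otimes>\<^bsub>T\<^esub> sum24))) \<otimes>\<^bsub>T\<^esub> prod13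
      \<oplus>\<^bsub>T\<^esub> (a2 \<oplus>\<^bsub>T\<^esub> a3 \<otimes>\<^bsub>T\<^esub> (sum13 \<oplus>\<^bsub>T\<^esub> sum24)) \<otimes>\<^bsub>T\<^esub> (sum13 \<otimes>\<^bsub>T\<^esub> prod13)"
      unfolding a(5) by (rule T.pair_sum_expansion) (rule cl)+
    show "u' \<otimes>\<^bsub>T\<^esub> sum24 = (\<ominus>\<^bsub>T\<^esub> (a1 \<otimes>\<^bsub>T\<^esub> (sum13 \<otimes>\<^bsub>T\<^esub> sum24)))
      \<oplus>\<^bsub>T\<^esub> (a0 \<oplus>\<^bsub>T\<^esub> a1 \<otimes>\<^bsub>T\<^esub> (sum13 \<oplus>\<^bsub>T\<^esub> sum24)) \<otimes>\<^bsub>T\<^esub> sum24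
      \<oplus>\<^bsub>T\<^esub> (\<ominus>\<^bsub>T\<^esub> (a3 \<otimes>\<^bsub>T\<^esub> (sum13 \<otimes>\<^bsub>T\<^esub> sum24))) \<otimes>\<^bsub>T\<^esub> prod24
      \<oplus>\<^bsub>T\<^esub> (a2 \<oplus>\<^bsub>T\<^esub> a3 \<otimes>\<^bsub>T\<^esub> (sum13 \<oplus>\<^bsub>T\<^esub> sum24)) \<otimes>\<^bsub>T\<^esub> (sum24 \<otimes>\<^bsub>T\<^esub> prod24)"
      unfolding a(6) T.m_comm[OF cl(5,6)] T.a_comm[OF cl(5,6)]
      by (rule T.pair_sum_expansion) (rule cl)+
  qed (intro S_add S_mult S_minus S_gens a(1-4))+
qed

text \<open>
  Reduction by \<open>q\<^sup>2 = (q + q') q - q q'\<close>, where \<open>q + q'\<close> is \<open>\<omega>\<close> and \<open>q q'\<close> is \<open>e\<^sub>4(x)\<close>.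
\<close>

lemma pair_span_prod:
  assumes "(u, u') \<in> pair_span"
  shows "(u \<otimes>\<^bsub>T\<^esub> prod13, u' \<otimes>\<^bsub>T\<^esub> prod24) \<in> pair_span"
proof -
  obtain a0 a1 a2 a3 where a: "a0 \<in> S" "a1 \<in> S" "a2 \<in> S" "a3 \<in> S"
    "u = a0 \<oplus>\<^bsub>T\<^esub> a1 \<otimes>\<^bsub>T\<^esub> sum13 \<oplus>\<^bsub>T\<^esub> a2 \<otimes>\<^bsub>T\<^esub> prod13 \<oplus>\<^bsub>T\<^esub> a3 \<otimes>\<^bsub>T\<^esub> (sum13 \<otimes>\<^bsub>T\<^esub> prod13)"
    "u' = a0 \<oplus>\<^bsub>T\<^esub> a1 \<otimes>\<^bsub>T\<^esub> sum24 \<oplus>\<^bsub>T\<^esub> a2 \<otimes>\<^bsub>T\<^esub> prod24 \<oplus>\<^bsub>T\<^esub> a3 \<otimes>\<^bsub>T\<^esub> (sum24 \<otimes>\<^bsub>T\<^esub> prod24)"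
    by (rule pair_spanE[OF assms])
  note cl = S_carrier[OF a(1)] S_carrier[OF a(2)] S_carrier[OF a(3)] S_carrier[OF a(4)] gens_closed
  show ?thesis
  proof (rule pair_spanI)
    show "u \<otimes>\<^bsub>T\<^esub> prod13 = (\<ominus>\<^bsub>T\<^esub> (a2 \<otimes>\<^bsub>T\<^esub> (prod13 \<otimes>\<^bsub>T\<^esub> prod24)))
      \<oplus>\<^bsub>T\<^esub> (\<ominus>\<^bsub>T\<^esub> (a3 \<otimes>\<^bsub>T\<^esub> (prod13 \<otimes>\<^bsub>T\<^esub> prod24))) \<otimes>\<^bsub>T\<^esub> sum13
      \<oplus>\<^bsub>T\<^esub> (a0 \<oplus>\<^bsub>T\<^esub> a2 \<otimes>\<^bsub>T\<^esub> (prod13 \<oplus>\<^bsub>T\<^esub> prod24)) \<otimes>\<^bsub>T\<^esub> prod13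
      \<oplus>\<^bsub>T\<^esub> (a1 \<oplus>\<^bsub>T\<^esub> a3 \<otimes>\<^bsub>T\<^esub> (prod13 \<oplus>\<^bsub>T\<^esub> prod24)) \<otimes>\<^bsub>T\<^esub> (sum13 \<otimes>\<^bsub>T\<^esub> prod13)"
      unfolding a(5) by (rule T.pair_prod_expansion) (rule cl)+
    show "u' \<otimes>\<^bsub>T\<^esub> prod24 = (\<ominus>\<^bsub>T\<^esub> (a2 \<otimes>\<^bsub>T\<^esub> (prod13 \<otimes>\<^bsub>T\<^esub> prod24)))
      \<oplus>\<^bsub>T\<^esub> (\<ominus>\<^bsub>T\<^esub> (a3 \<otimes>\<^bsub>T\<^esub> (prod13 \<otimes>\<^bsub>T\<^esub> prod24))) \<otimes>\<^bsub>T\<^esub> sum24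
      \<oplus>\<^bsub>T\<^esub> (a0 \<oplus>\<^bsub>T\<^esub> a2 \<otimes>\<^bsub>T\<^esub> (prod13 \<oplus>\<^bsub>T\<^esub> prod24)) \<otimes>\<^bsub>T\<^esub> prod24
      \<oplus>\<^bsub>T\<^esub> (a1 \<oplus>\<^bsub>T\<^esub> a3 \<otimes>\<^bsub>T\<^esub> (prod13 \<oplus>\<^bsub>T\<^esub> prod24)) \<otimes>\<^bsub>T\<^esub> (sum24 \<otimes>\<^bsub>T\<^esub> prod24)"
      unfolding a(6) T.m_comm[OF cl(7,8)] T.a_comm[OF cl(7,8)]
      by (rule T.pair_prod_expansion) (rule cl)+
  qed (intro S_add S_mult S_minus S_gens a(1-4))+
qed

text \<open>
  All expressions on the right-hand side of \<open>pair_norm_expansion\<close> are polynomials in \<open>e\<^sub>k(x)\<close> and \<open>\<omega>\<close>; the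
  mixed one \<open>p q' + p' q\<close> is \<open>e\<^sub>3(x)\<close>.
\<close>

lemma pair_norm_mem:
  assumes "(u, u') \<in> pair_span"
  shows "u \<otimes>\<^bsub>T\<^esub> u' \<in> S"
proof -
  obtain a0 a1 a2 a3 where a: "a0 \<in> S" "a1 \<in> S" "a2 \<in> S" "a3 \<in> S"
    "u = a0 \<oplus>\<^bsub>T\<^esub> a1 \<otimes>\<^bsub>T\<^esub> sum13 \<oplus>\<^bsub>T\<^esub> a2 \<otimes>\<^bsub>T\<^esub> prod13 \<oplus>\<^bsub>T\<^esub> a3 \<otimes>\<^bsub>T\<^esub> (sum13 \<otimes>\<^bsub>T\<^esub> prod13)"
    "u' = a0 \<oplus>\<^bsub>T\<^esub> a1 \<otimes>\<^bsub>T\<^esub> sum24 \<oplus>\<^bsub>T\<^esub> a2 \<otimes>\<^bsub>T\<^esub> prod24 \<oplus>\<^bsub>T\<^esub> a3 \<otimes>\<^bsub>T\<^esub> (sum24 \<otimes>\<^bsub>T\<^esub> prod24)"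
    by (rule pair_spanE[OF assms])
  show ?thesis
    unfolding a(5,6)
      T.pair_norm_expansion[OF S_carrier[OF a(1)] S_carrier[OF a(2)] S_carrier[OF a(3)] S_carrier[OF a(4)]
        gens_closed(1,2,3,4)] T.minus_eq
    by (intro S_add S_mult S_minus S_gens a(1-4))
qed

text \<open>
  Polarisation of the preceding membership.
\<close>

lemma pair_cross_mem:
  assumes u: "(u, u') \<in> pair_span" and v: "(v, v') \<in> pair_span"
  shows "u \<otimes>\<^bsub>T\<^esub> v' \<oplus>\<^bsub>T\<^esub> v \<otimes>\<^bsub>T\<^esub> u' \<in> S"
  unfolding T.cross_term[OF pair_span_closed[OF u] pair_span_closed[OF v]]
  by (intro S_add S_minus pair_norm_mem pair_span_add u v)

text \<open>
  Recursion for the power sums of two elements.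
\<close>

lemma power_sum_pair:
  fixes k :: nat
  shows "(\<xi> 1 [^]\<^bsub>T\<^esub> k \<oplus>\<^bsub>T\<^esub> \<xi> 3 [^]\<^bsub>T\<^esub> k, \<xi> 2 [^]\<^bsub>T\<^esub> k \<oplus>\<^bsub>T\<^esub> \<xi> 4 [^]\<^bsub>T\<^esub> k) \<in> pair_span"
proof (induction k rule: less_induct)
  case (less k)
  consider "k = 0" | "k = 1" | j where "k = Suc (Suc j)"
    by (metis One_nat_def not0_implies_Suc)
  then show ?case
  proof cases
    case 1
    then show ?thesis using pair_span_add[OF pair_span_base(1) pair_span_base(1)] by simp
  next
    case 2
    then show ?thesis using pair_span_base(2) by (simp add: sum13_def sum24_def)
  next
    case 3
    then have "Suc j < k" "j < k" by simp_all
    note IH = this[THEN less.IH]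
    show ?thesis
      using pair_span_add[OF pair_span_sum[OF IH(1)] pair_span_minus[OF pair_span_prod[OF IH(2)]]]
      unfolding 3 T.power_sum_recursion[OF \<xi>_closed'(1,3)] T.power_sum_recursion[OF \<xi>_closed'(2,4)]
        T.minus_eq sum13_def sum24_def prod13_def prod24_def .
  qed
qed

text \<open>
  A symmetrised monomial is a power of the product times a power sum.
\<close>

lemma sym_pair:
  assumes u: "u \<in> J2"
  shows "(sym13 u, sym24 u) \<in> pair_span"
proof -
  \<comment> \<open>For \<open>u = (a, a + k)\<close> the symmetrised monomial is \<open>q\<^sup>a\<close> times the \<open>k\<close>-th power sum, or \<open>q\<^sup>a\<close> if \<open>k = 0\<close>.\<close>
  obtain a k where ak: "u = (a, a + k)" using u by (cases u) (auto simp: le_iff_add)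
  have prod_power: "(y \<otimes>\<^bsub>T\<^esub> prod13 [^]\<^bsub>T\<^esub> a, y' \<otimes>\<^bsub>T\<^esub> prod24 [^]\<^bsub>T\<^esub> a) \<in> pair_span"
    if y: "(y, y') \<in> pair_span" for y y' and a :: nat
  proof (induction a)
    case 0
    then show ?case using y pair_span_closed[OF y] by simp
  next
    case (Suc a)
    then show ?case
      using pair_span_prod[OF Suc] pair_span_closed[OF y] by (simp add: T.m_assoc)
  qed
  have mon: "mon13 (a, a + k) = \<xi> 3 [^]\<^bsub>T\<^esub> k \<otimes>\<^bsub>T\<^esub> prod13 [^]\<^bsub>T\<^esub> a" "mon13 (a + k, a) = \<xi> 1 [^]\<^bsub>T\<^esub> k \<otimes>\<^bsub>T\<^esub> prod13 [^]\<^bsub>T\<^esub> a"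
    "mon24 (a, a + k) = \<xi> 4 [^]\<^bsub>T\<^esub> k \<otimes>\<^bsub>T\<^esub> prod24 [^]\<^bsub>T\<^esub> a" "mon24 (a + k, a) = \<xi> 2 [^]\<^bsub>T\<^esub> k \<otimes>\<^bsub>T\<^esub> prod24 [^]\<^bsub>T\<^esub> a"
    by (simp_all add: mon13_def mon24_def prod13_def prod24_def T.nat_pow_distrib T.nat_pow_mult[symmetric] T.m_ac)
  show ?thesis
  proof (cases "k = 0")
    case True
    then show ?thesis
      using prod_power[OF pair_span_base(1), of a] mon(1,3) by (simp add: ak sym13_def sym24_def)
  next
    case False
    then have "sym13 u = (\<xi> 1 [^]\<^bsub>T\<^esub> k \<oplus>\<^bsub>T\<^esub> \<xi> 3 [^]\<^bsub>T\<^esub> k) \<otimes>\<^bsub>T\<^esub> prod13 [^]\<^bsub>T\<^esub> a"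
      "sym24 u = (\<xi> 2 [^]\<^bsub>T\<^esub> k \<oplus>\<^bsub>T\<^esub> \<xi> 4 [^]\<^bsub>T\<^esub> k) \<otimes>\<^bsub>T\<^esub> prod24 [^]\<^bsub>T\<^esub> a"
      by (simp_all add: ak sym13_def sym24_def mon T.l_distr T.a_comm)
    then show ?thesis using prod_power[OF power_sum_pair] by simp
  qed
qed

text \<open>
  In the expansion by symmetrised monomials, the remaining generator \<open>(1 2)(3 4)\<close> of \<open>D\<^sub>4\<close> exchanges the two
  blocks and makes the coefficients symmetric.  Off the diagonal, the terms at \<open>(u, v)\<close> and \<open>(v, u)\<close> combine to
  a polarised product of two pairs in \<open>pair_span\<close>.
\<close>

theorem invariants_generated:
  assumes t: "t \<in> carrier T"
    and inv13: "perm_tensor (transpose 1 3) t = t" and inv24: "perm_tensor (transpose 2 4) t = t"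
    and swap: "perm_tensor (transpose 1 2 \<circ> transpose 3 4) t = t"
  shows "t \<in> S"
proof -
  let ?\<sigma> = "transpose 1 2 \<circ> transpose 3 4 :: nat \<Rightarrow> nat"
  have \<sigma>: "?\<sigma> permutes {1..4}" by (intro permutes_compose permutes_swap_id) auto
  let ?c = "\<lambda>u v. tcrd (idx u v) t"
  have c: "?c u v \<in> carrier R" if "u \<in> J2" "v \<in> J2" for u v
    using that by (intro tcrd_closed idx_closed t) auto
  have csym: "?c v u = ?c u v" if "u \<in> J2" "v \<in> J2" for u v
  proof -
    have "idx u v \<circ> ?\<sigma> = idx v u"
      by (auto simp: fun_eq_iff idx_def transpose_def restrict_def)
    moreover have "u \<in> I2" "v \<in> I2" using that by auto
    ultimately show ?thesis using tcrd_idx_permute[OF t \<sigma> swap, of u v] by simp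
  qed
  have "finite J2" by (auto intro: finite_subset[of _ I2])
  then have "(\<Oplus>\<^bsub>T\<^esub>u\<in>J2. \<Oplus>\<^bsub>T\<^esub>v\<in>J2. ?c u v \<odot>\<^bsub>T\<^esub> (sym13 u \<otimes>\<^bsub>T\<^esub> sym24 v)) \<in> S"
  proof (rule T.M.symmetric_double_sum_mem)
    show "?c u v \<odot>\<^bsub>T\<^esub> (sym13 u \<otimes>\<^bsub>T\<^esub> sym24 v) \<in> carrier T" if "u \<in> J2" "v \<in> J2" for u v
      using c[OF that] by simp
    show "?c u u \<odot>\<^bsub>T\<^esub> (sym13 u \<otimes>\<^bsub>T\<^esub> sym24 u) \<in> S" if "u \<in> J2" for u
      by (intro S_smult c that pair_norm_mem sym_pair)
    show "?c u v \<odot>\<^bsub>T\<^esub> (sym13 u \<otimes>\<^bsub>T\<^esub> sym24 v) \<oplus>\<^bsub>T\<^esub> ?c v u \<odot>\<^bsub>T\<^esub> (sym13 v \<otimes>\<^bsub>T\<^esub> sym24 u) \<in> S"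
      if "u \<in> J2" "v \<in> J2" for u v
    proof -
      have "?c u v \<odot>\<^bsub>T\<^esub> (sym13 u \<otimes>\<^bsub>T\<^esub> sym24 v) \<oplus>\<^bsub>T\<^esub> ?c v u \<odot>\<^bsub>T\<^esub> (sym13 v \<otimes>\<^bsub>T\<^esub> sym24 u) =
          ?c u v \<odot>\<^bsub>T\<^esub> (sym13 u \<otimes>\<^bsub>T\<^esub> sym24 v \<oplus>\<^bsub>T\<^esub> sym13 v \<otimes>\<^bsub>T\<^esub> sym24 u)"
        unfolding csym[OF that] using c[OF that] by (simp add: T.smult_r_distr)
      also have "\<dots> \<in> S" by (intro S_smult c that pair_cross_mem sym_pair)
      finally show ?thesis .
    qed
  qed (rule S_zero, rule S_add)
  then show ?thesis using symmetric_expansion[OF t inv13 inv24] by simp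
qed

end

section \<open>Relations for the generator\<close>

context cring
begin

text \<open>
  The monic polynomial with roots \<open>a, b, c, d\<close> in terms of the sums \<open>p, p'\<close> and products \<open>q, q'\<close> of the pairs
  \<open>a, c\<close> and \<open>b, d\<close>: its resolvent has the root \<open>q + q'\<close>.  Written without subtraction, so that both
  sides expand into the same monomials.
\<close>

lemma resolvent_identity:
  assumes [simp]: "p \<in> carrier R" "q \<in> carrier R" "p' \<in> carrier R" "q' \<in> carrier R"
  defines "w \<equiv> q \<oplus> q'" and "e1 \<equiv> p \<oplus> p'" and "e2 \<equiv> (q \<oplus> q') \<oplus> p \<otimes> p'"
    and "e3 \<equiv> p \<otimes> q' \<oplus> p' \<otimes> q" and "e4 \<equiv> q \<otimes> q'"
  shows "w \<otimes> w \<otimes> w \<oplus> e1 \<otimes> e3 \<otimes> w \<oplus> (e2 \<otimes> e4 \<oplus> e2 \<otimes> e4 \<oplus> e2 \<otimes> e4 \<oplus> e2 \<otimes> e4) =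
    e2 \<otimes> (w \<otimes> w) \<oplus> (e4 \<otimes> w \<oplus> e4 \<otimes> w \<oplus> e4 \<otimes> w \<oplus> e4 \<otimes> w) \<oplus> e1 \<otimes> e1 \<otimes> e4 \<oplus> e3 \<otimes> e3"
proof -
  let ?v = "p \<otimes> p'"
  have c: "w \<in> carrier R" "e1 \<in> carrier R" "e3 \<in> carrier R" "e4 \<in> carrier R" "?v \<in> carrier R"
    by (simp_all add: w_def e1_def e3_def e4_def)
  have core: "e1 \<otimes> e3 \<otimes> w \<oplus> (?v \<otimes> e4 \<oplus> ?v \<otimes> e4 \<oplus> ?v \<otimes> e4 \<oplus> ?v \<otimes> e4) =
    ?v \<otimes> (w \<otimes> w) \<oplus> e1 \<otimes> e1 \<otimes> e4 \<oplus> e3 \<otimes> e3"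
    unfolding w_def e1_def e3_def e4_def by (simp add: l_distr r_distr a_ac m_ac)
  have e2: "e2 = w \<oplus> ?v" by (simp only: e2_def w_def)
  have "(w \<otimes> w \<otimes> w \<oplus> u \<oplus> ((w \<oplus> v) \<otimes> e4 \<oplus> (w \<oplus> v) \<otimes> e4 \<oplus> (w \<oplus> v) \<otimes> e4 \<oplus> (w \<oplus> v) \<otimes> e4)) =
    (w \<otimes> w \<otimes> w \<oplus> (e4 \<otimes> w \<oplus> e4 \<otimes> w \<oplus> e4 \<otimes> w \<oplus> e4 \<otimes> w)) \<oplus> (u \<oplus> (v \<otimes> e4 \<oplus> v \<otimes> e4 \<oplus> v \<otimes> e4 \<oplus> v \<otimes> e4))"
    if "u \<in> carrier R" "v \<in> carrier R" for u v
    using that c by (simp add: l_distr a_ac m_comm[of e4])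
  from this[of "e1 \<otimes> e3 \<otimes> w" ?v] show ?thesis
    unfolding e2 using c by (simp add: core) (simp add: l_distr a_ac m_assoc)
qed

lemma transfer_minus:
  assumes [simp]: "z \<in> carrier R" "a \<in> carrier R" "b \<in> carrier R" "c \<in> carrier R" "d \<in> carrier R"
    and eq: "z \<oplus> b \<oplus> d = a \<oplus> c"
  shows "z = a \<ominus> b \<oplus> c \<ominus> d"
proof -
  have "a \<ominus> b \<oplus> c \<ominus> d = (a \<oplus> c) \<ominus> b \<ominus> d" using assms(1-5) by algebra
  also have "\<dots> = z" unfolding eq[symmetric] using assms(1-5) by algebra
  finally show ?thesis by simp
qed

text \<open>
  A root \<open>z\<close> of the quartic with roots \<open>a, b, c, z\<close>; the coefficients are grouped by the quadratic factors with
  roots \<open>a, c\<close> and \<open>b, z\<close>, as they arise for the \<open>\<xi>\<^sub>i\<close>.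
\<close>

lemma vieta_identity:
  assumes [simp]: "a \<in> carrier R" "b \<in> carrier R" "c \<in> carrier R" "z \<in> carrier R"
  defines "e1 \<equiv> (a \<oplus> c) \<oplus> (b \<oplus> z)" and "e2 \<equiv> (a \<otimes> c \<oplus> b \<otimes> z) \<oplus> (a \<oplus> c) \<otimes> (b \<oplus> z)"
    and "e3 \<equiv> (a \<oplus> c) \<otimes> (b \<otimes> z) \<oplus> (b \<oplus> z) \<otimes> (a \<otimes> c)" and "e4 \<equiv> (a \<otimes> c) \<otimes> (b \<otimes> z)"
  shows "z [^] (4::nat) = e1 \<otimes> z [^] (3::nat) \<ominus> e2 \<otimes> z [^] (2::nat) \<oplus> e3 \<otimes> z \<ominus> e4"
proof -
  have pow: "z [^] (4::nat) = z \<otimes> (z \<otimes> (z \<otimes> z))" "z [^] (3::nat) = z \<otimes> (z \<otimes> z)" "z [^] (2::nat) = z \<otimes> z"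
    by (simp_all add: numeral_eq_Suc m_assoc)
  have c: "e1 \<in> carrier R" "e2 \<in> carrier R" "e3 \<in> carrier R" "e4 \<in> carrier R"
    by (simp_all add: e1_def e2_def e3_def e4_def)
  have "z \<otimes> (z \<otimes> (z \<otimes> z)) \<oplus> ((v \<oplus> b \<otimes> z) \<oplus> u \<otimes> (b \<oplus> z)) \<otimes> (z \<otimes> z) \<oplus> v \<otimes> (b \<otimes> z) =
    (u \<oplus> (b \<oplus> z)) \<otimes> (z \<otimes> (z \<otimes> z)) \<oplus> (u \<otimes> (b \<otimes> z) \<oplus> (b \<oplus> z) \<otimes> v) \<otimes> z"
    if "u \<in> carrier R" "v \<in> carrier R" for u v
    using that by (simp add: l_distr r_distr a_ac m_ac)
  from this[of "a \<oplus> c" "a \<otimes> c"] show ?thesis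
    unfolding pow using c by (intro transfer_minus) (simp_all only: e1_def e2_def e3_def e4_def m_closed a_closed assms)
qed

end

context tensor_alternation
begin

lemma alt_basis_unit:
  assumes "\<alpha> \<in> X" "inj_on \<alpha> {1..n}"
  shows "alt (basis_tensor \<alpha>) \<otimes> alt (basis_tensor \<alpha>) = \<one>"
proof -
  obtain p where p: "p permutes {1..n}" "\<alpha> = exps p" by (rule exps_surj[OF assms])
  then show ?thesis by (simp add: psum_basis sgnR_square)
qed

lemma alt_esym_mult:
  assumes "a \<in> carrier A" "k \<le> n" "t \<in> carrier T"
  shows "alt (esym k a \<otimes>\<^bsub>T\<^esub> t) = char_coeff R A n b k a \<otimes> alt t"
proof -
  have "alt (esym k a \<otimes>\<^bsub>T\<^esub> t) = alt (esym k a \<otimes>\<^bsub>T\<^esub> e0) \<otimes> alt t"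
    using assms by (intro alt_symmetric_mult esym_closed perm_tensor_esym) assumption+
  then show ?thesis using assms by (simp only: alt_esym_eq_char_coeff)
qed

end

context quartic_closure
begin

lemma \<xi>_quartic:
  "\<xi> 4 [^]\<^bsub>T\<^esub> (4::nat) = s1 \<odot>\<^bsub>T\<^esub> (\<xi> 4 [^]\<^bsub>T\<^esub> (3::nat)) \<ominus>\<^bsub>T\<^esub> s2 \<odot>\<^bsub>T\<^esub> (\<xi> 4 [^]\<^bsub>T\<^esub> (2::nat))
    \<oplus>\<^bsub>T\<^esub> s3 \<odot>\<^bsub>T\<^esub> \<xi> 4 \<ominus>\<^bsub>T\<^esub> s4 \<odot>\<^bsub>T\<^esub> \<one>\<^bsub>T\<^esub>"
proof -
  have i: "4 \<in> {1..4::nat}" by simp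
  interpret h: ring_hom_cring A T "at 4" by (rule tensor_at_hom[OF i])
  have "\<xi> 4 [^]\<^bsub>T\<^esub> (4::nat) = at 4 (x [^]\<^bsub>A\<^esub> (4::nat))" by (simp only: \<xi>_def h.hom_pow x_closed)
  then show ?thesis
    unfolding x_quartic
    by (simp add: \<xi>_def tensor_at_smult[OF i] M.minus_eq T.minus_eq h.hom_a_inv)
qed

lemma basis_tensor_idx: "u \<in> I2 \<Longrightarrow> v \<in> I2 \<Longrightarrow> basis_tensor (idx u v) = mon13 u \<otimes>\<^bsub>T\<^esub> mon24 v"
  using basis_tensor_eq[OF idx_closed] by (simp add: mon13_def mon24_def)

lemma alt_idx_repeated:
  assumes "u \<in> I2" "v \<in> I2" "i \<in> {1..4}" "j \<in> {1..4}" "i \<noteq> j" "idx u v i = idx u v j" "Q \<subseteq> Perm"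
  shows "psum Q (mon13 u \<otimes>\<^bsub>T\<^esub> mon24 v) = \<zero>"
  using psum_basis_repeated[OF assms(7) idx_closed[OF assms(1,2)] assms(3-6)] basis_tensor_idx[OF assms(1,2)]
  by simp

lemma alt_idx_unit:
  assumes uv: "u \<in> I2" "v \<in> I2" and d: "distinct [fst u, fst v, snd u, snd v]"
  shows "alt (mon13 u \<otimes>\<^bsub>T\<^esub> mon24 v) \<otimes> alt (mon13 u \<otimes>\<^bsub>T\<^esub> mon24 v) = \<one>"
proof -
  have "inj_on (idx u v) {1..4}"
  proof (rule inj_onI)
    fix i j assume "i \<in> {1..4::nat}" "j \<in> {1..4::nat}" "idx u v i = idx u v j"
    then show "i = j" using d four_cases[of i] four_cases[of j] by auto
  qed
  then show ?thesis
    using alt_basis_unit[OF idx_closed[OF uv]] basis_tensor_idx[OF uv] by simp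
qed

abbreviation \<sigma> where "\<sigma> k \<equiv> char_coeff R A 4 b k x"

lemma \<sigma>_closed: "k \<le> 4 \<Longrightarrow> \<sigma> k \<in> carrier R"
  using alt_esym_eq_char_coeff[OF x_closed, of k] e0_closed
  by (metis T.m_closed esym_closed psum_closed subset_refl x_closed)

text \<open>
  The power \<open>\<xi>\<^sub>4\<^sup>4\<close> can be reduced in two ways: by the given quartic, with coefficients \<open>s\<^sub>k\<close>, and as a
  root of the polynomial with roots \<open>\<xi>\<^sub>1, \<dots>, \<xi>\<^sub>4\<close>, whose coefficients \<open>e\<^sub>k(x)\<close> act as \<open>\<sigma> k\<close>.
\<close>

lemma newton_relation:
  assumes v: "v \<in> carrier T"
  defines "a \<equiv> \<lambda>j::nat. alt (v \<otimes>\<^bsub>T\<^esub> \<xi> 4 [^]\<^bsub>T\<^esub> j)"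
  shows "s1 \<otimes> a 3 \<ominus> s2 \<otimes> a 2 \<oplus> s3 \<otimes> a 1 \<ominus> s4 \<otimes> a 0 =
    \<sigma> 1 \<otimes> a 3 \<ominus> \<sigma> 2 \<otimes> a 2 \<oplus> \<sigma> 3 \<otimes> a 1 \<ominus> \<sigma> 4 \<otimes> a 0"
proof -
  have [simp]: "v \<in> carrier T" by (rule v)
  have minus: "alt (\<ominus>\<^bsub>T\<^esub> t) = \<ominus> alt t" if "t \<in> carrier T" for t
    using psum_smult[OF subset_refl, of "\<ominus> \<one>" t] that by (simp add: T.smult_l_minus R.l_minus)
  have pull: "alt (v \<otimes>\<^bsub>T\<^esub> (r \<odot>\<^bsub>T\<^esub> t)) = r \<otimes> alt (v \<otimes>\<^bsub>T\<^esub> t)" if "r \<in> carrier R" "t \<in> carrier T" for r t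
  proof -
    have "v \<otimes>\<^bsub>T\<^esub> (r \<odot>\<^bsub>T\<^esub> t) = r \<odot>\<^bsub>T\<^esub> (v \<otimes>\<^bsub>T\<^esub> t)"
      using that v by (simp add: T.m_comm[of v] T.smult_assoc2)
    then show ?thesis using that v by (simp add: psum_smult)
  qed
  have pull': "alt (v \<otimes>\<^bsub>T\<^esub> (esym k x \<otimes>\<^bsub>T\<^esub> t)) = \<sigma> k \<otimes> alt (v \<otimes>\<^bsub>T\<^esub> t)" if "k \<le> 4" "t \<in> carrier T" for k t
    using that v by (simp add: alt_esym_mult[symmetric] T.m_lcomm)
  have c: "alt (v \<otimes>\<^bsub>T\<^esub> t) \<in> carrier R" if "t \<in> carrier T" for t using that by simp
  have p1: "\<xi> 4 [^]\<^bsub>T\<^esub> (1::nat) = \<xi> 4" "\<xi> 4 [^]\<^bsub>T\<^esub> (0::nat) = \<one>\<^bsub>T\<^esub>" by simp_all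
  have "alt (v \<otimes>\<^bsub>T\<^esub> \<xi> 4 [^]\<^bsub>T\<^esub> (4::nat)) = s1 \<otimes> a 3 \<ominus> s2 \<otimes> a 2 \<oplus> s3 \<otimes> a 1 \<ominus> s4 \<otimes> a 0"
    unfolding \<xi>_quartic a_def p1
    by (simp add: T.minus_eq R.minus_eq T.r_distr T.r_minus psum_add minus pull c del: T.r_one)
  moreover have "alt (v \<otimes>\<^bsub>T\<^esub> \<xi> 4 [^]\<^bsub>T\<^esub> (4::nat)) =
      \<sigma> 1 \<otimes> a 3 \<ominus> \<sigma> 2 \<otimes> a 2 \<oplus> \<sigma> 3 \<otimes> a 1 \<ominus> \<sigma> 4 \<otimes> a 0"
  proof -
    have "\<xi> 4 [^]\<^bsub>T\<^esub> (4::nat) = esym 1 x \<otimes>\<^bsub>T\<^esub> \<xi> 4 [^]\<^bsub>T\<^esub> (3::nat) \<ominus>\<^bsub>T\<^esub> esym 2 x \<otimes>\<^bsub>T\<^esub> \<xi> 4 [^]\<^bsub>T\<^esub> (2::nat)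
        \<oplus>\<^bsub>T\<^esub> esym 3 x \<otimes>\<^bsub>T\<^esub> \<xi> 4 \<ominus>\<^bsub>T\<^esub> esym 4 x \<otimes>\<^bsub>T\<^esub> \<one>\<^bsub>T\<^esub>"
      using T.vieta_identity[OF \<xi>_closed'(1,2,3,4)]
      by (simp add: esym_x \<omega>_def sum13_def sum24_def prod13_def prod24_def)
    then show ?thesis
      unfolding a_def p1
      by (simp add: T.minus_eq R.minus_eq T.r_distr T.r_minus psum_add minus pull' c del: T.r_one)
  qed
  ultimately show ?thesis by simp
qed

text \<open>
  The characteristic polynomial of \<open>x\<close> is the given quartic.  For a monomial \<open>v\<close> in \<open>\<xi>\<^sub>1, \<xi>\<^sub>2, \<xi>\<^sub>3\<close> whose exponents
  are three of \<open>0, 1, 2, 3\<close>, the functional \<open>alt\<close> kills \<open>v \<xi>\<^sub>4\<^sup>j\<close> unless \<open>j\<close> is the fourth number, so that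
  \<open>newton_relation\<close> compares a single coefficient.
\<close>

lemma char_coeff_generator: "\<sigma> 1 = s1" "\<sigma> 2 = s2" "\<sigma> 3 = s3" "\<sigma> 4 = s4"
proof -
  have [simp]: "\<sigma> 1 \<in> carrier R" "\<sigma> 2 \<in> carrier R" "\<sigma> 3 \<in> carrier R" "\<sigma> 4 \<in> carrier R"
    by (rule \<sigma>_closed; simp)+
  define a where "a u b j = alt (mon13 u \<otimes>\<^bsub>T\<^esub> mon24 (b, j))" for u b and j :: nat
  have ac [simp]: "a u b j \<in> carrier R" for u b j by (simp add: a_def)
  have rel: "s1 \<otimes> a u b 3 \<ominus> s2 \<otimes> a u b 2 \<oplus> s3 \<otimes> a u b 1 \<ominus> s4 \<otimes> a u b 0 =
    \<sigma> 1 \<otimes> a u b 3 \<ominus> \<sigma> 2 \<otimes> a u b 2 \<oplus> \<sigma> 3 \<otimes> a u b 1 \<ominus> \<sigma> 4 \<otimes> a u b 0" for u b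
  proof -
    have "mon13 u \<otimes>\<^bsub>T\<^esub> mon24 (b, j) = (mon13 u \<otimes>\<^bsub>T\<^esub> \<xi> 2 [^]\<^bsub>T\<^esub> b) \<otimes>\<^bsub>T\<^esub> \<xi> 4 [^]\<^bsub>T\<^esub> j" for j
      by (simp add: mon24_def T.m_assoc)
    then show ?thesis
      unfolding a_def using newton_relation[of "mon13 u \<otimes>\<^bsub>T\<^esub> \<xi> 2 [^]\<^bsub>T\<^esub> b"] by simp
  qed
  have zero: "a u b j = \<zero>" if "u \<in> I2" "b < 4" "j < 4" "j = fst u \<or> j = b \<or> j = snd u" for u b j
  proof -
    have bj: "(b, j) \<in> I2" using that by simp
    from that(4) consider "j = fst u" | "j = b" | "j = snd u" by blast
    then show ?thesis
    proof cases
      case 1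
      then show ?thesis unfolding a_def
        by (intro alt_idx_repeated[OF that(1) bj, of 1 4]) simp_all
    next
      case 2
      then show ?thesis unfolding a_def
        by (intro alt_idx_repeated[OF that(1) bj, of 2 4]) simp_all
    next
      case 3
      then show ?thesis unfolding a_def
        by (intro alt_idx_repeated[OF that(1) bj, of 3 4]) simp_all
    qed
  qed
  have unit: "a u b j \<otimes> a u b j = \<one>" if "u \<in> I2" "b < 4" "j < 4" "distinct [fst u, b, snd u, j]" for u b j
    unfolding a_def using that by (intro alt_idx_unit) simp_all
  have cancel: "r = s" if "r \<otimes> z = s \<otimes> z" "z \<otimes> z = \<one>" "r \<in> carrier R" "s \<in> carrier R" "z \<in> carrier R" for r s z
    using that by (metis R.m_assoc R.r_one)
  have neg: "r = s" if "\<ominus> r = \<ominus> s" "r \<in> carrier R" "s \<in> carrier R" for r s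
    using that by (metis R.minus_minus)
  \<comment> \<open>The exponents of \<open>\<xi>\<^sub>1, \<xi>\<^sub>3\<close> and of \<open>\<xi>\<^sub>2\<close> omit \<open>3\<close>; in the following cases they omit \<open>2\<close>, \<open>1\<close> and \<open>0\<close>.\<close>
  have ns1: "s1 \<otimes> a (0, 2) 1 3 = \<sigma> 1 \<otimes> a (0, 2) 1 3"
    using rel[of "(0, 2)" 1] by (simp add: zero R.minus_eq)
  show "\<sigma> 1 = s1"
    by (rule cancel[OF ns1 unit[of "(0, 2)" 1 3], symmetric]) simp_all
  have ns2: "s2 \<otimes> a (0, 3) 1 2 = \<sigma> 2 \<otimes> a (0, 3) 1 2"
    by (rule neg) (use rel[of "(0, 3)" 1] in \<open>simp_all add: zero R.minus_eq\<close>)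
  show "\<sigma> 2 = s2"
    by (rule cancel[OF ns2 unit[of "(0, 3)" 1 2], symmetric]) simp_all
  have ns3: "s3 \<otimes> a (0, 3) 2 1 = \<sigma> 3 \<otimes> a (0, 3) 2 1"
    using rel[of "(0, 3)" 2] by (simp add: zero R.minus_eq)
  show "\<sigma> 3 = s3"
    by (rule cancel[OF ns3 unit[of "(0, 3)" 2 1], symmetric]) simp_all
  have ns4: "s4 \<otimes> a (1, 3) 2 0 = \<sigma> 4 \<otimes> a (1, 3) 2 0"
    by (rule neg) (use rel[of "(1, 3)" 2] in \<open>simp_all add: zero R.minus_eq\<close>)
  show "\<sigma> 4 = s4"
    by (rule cancel[OF ns4 unit[of "(1, 3)" 2 0], symmetric]) simp_all
qed

lemma resolvent_relation:
  "\<omega> \<otimes>\<^bsub>T\<^esub> \<omega> \<otimes>\<^bsub>T\<^esub> \<omega> \<oplus>\<^bsub>T\<^esub> esym 1 x \<otimes>\<^bsub>T\<^esub> esym 3 x \<otimes>\<^bsub>T\<^esub> \<omega>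
    \<oplus>\<^bsub>T\<^esub> (esym 2 x \<otimes>\<^bsub>T\<^esub> esym 4 x \<oplus>\<^bsub>T\<^esub> esym 2 x \<otimes>\<^bsub>T\<^esub> esym 4 x \<oplus>\<^bsub>T\<^esub> esym 2 x \<otimes>\<^bsub>T\<^esub> esym 4 x \<oplus>\<^bsub>T\<^esub> esym 2 x \<otimes>\<^bsub>T\<^esub> esym 4 x) =
   esym 2 x \<otimes>\<^bsub>T\<^esub> (\<omega> \<otimes>\<^bsub>T\<^esub> \<omega>)
    \<oplus>\<^bsub>T\<^esub> (esym 4 x \<otimes>\<^bsub>T\<^esub> \<omega> \<oplus>\<^bsub>T\<^esub> esym 4 x \<otimes>\<^bsub>T\<^esub> \<omega> \<oplus>\<^bsub>T\<^esub> esym 4 x \<otimes>\<^bsub>T\<^esub> \<omega> \<oplus>\<^bsub>T\<^esub> esym 4 x \<otimes>\<^bsub>T\<^esub> \<omega>)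
    \<oplus>\<^bsub>T\<^esub> esym 1 x \<otimes>\<^bsub>T\<^esub> esym 1 x \<otimes>\<^bsub>T\<^esub> esym 4 x \<oplus>\<^bsub>T\<^esub> esym 3 x \<otimes>\<^bsub>T\<^esub> esym 3 x"
  using T.resolvent_identity[OF gens_closed(1,3,2,4)] unfolding esym_x \<omega>_def .

end

section \<open>The dihedral group\<close>

lemma D4_permutes:
  assumes "p \<in> D4"
  shows "p permutes {1..4}"
proof -
  interpret group "sym_group 4" by (rule sym_group_is_group)
  have g: "transpose 1 3 permutes {1..4::nat}" "transpose 1 2 permutes {1..4::nat}"
    "transpose 2 3 permutes {1..4::nat}" "transpose 3 4 permutes {1..4::nat}"
    by (intro permutes_swap_id; simp)+
  have "{cycle_of_list [1, 3], cycle_of_list [1, 2, 3, 4]} \<subseteq> carrier (sym_group 4)"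
    using g permutes_compose[OF permutes_compose[OF g(4,3)] g(2)] by (simp add: sym_group_carrier comp_assoc)
  then have "D4 \<subseteq> carrier (sym_group 4)" unfolding D4_def by (rule generate_incl)
  then have "p \<in> carrier (sym_group 4)" using assms by (rule subsetD)
  then show ?thesis by (simp only: sym_group_carrier)
qed

lemma D4_comp: "p \<in> D4 \<Longrightarrow> q \<in> D4 \<Longrightarrow> p \<circ> q \<in> D4"
  using generate.eng[of p "sym_group 4" _ q] unfolding D4_def by (simp add: sym_group_mult)

text \<open>
  The elements of \<open>D\<^sub>4\<close> through which invariance is used: the transpositions within the two blocks, the
  exchange of the blocks, and the reflection that defines \<open>half\<close>.
\<close>

lemma D4_elements:
  "transpose 1 3 \<in> D4" "transpose 2 4 \<in> D4" "transpose 1 2 \<circ> transpose 3 4 \<in> D4"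
  "transpose 1 4 \<circ> transpose 2 3 \<in> D4"
proof -
  have c: "cycle_of_list [1, 3] \<in> D4" "cycle_of_list [1, 2, 3, 4] \<in> D4"
    unfolding D4_def by (rule generate.incl; simp only: insert_iff simp_thms)+
  let ?r = "transpose 1 2 \<circ> (transpose 2 3 \<circ> transpose 3 (4::nat))"
  have s: "transpose 1 3 \<in> D4" and r: "?r \<in> D4" using c by simp_all
  have e: "?r \<circ> (transpose 1 3 \<circ> (?r \<circ> (?r \<circ> ?r))) = transpose 2 4"
    "transpose 1 3 \<circ> ?r = transpose 1 2 \<circ> transpose 3 4"
    "?r \<circ> transpose 1 3 = transpose 1 4 \<circ> transpose 2 3"
    by (rule ext; rename_tac j; case_tac "j = 1"; case_tac "j = 2"; case_tac "j = 3"; case_tac "j = 4";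
        simp add: transpose_def)+
  show "transpose 1 3 \<in> D4" by (rule s)
  show "transpose 2 4 \<in> D4" by (subst e(1)[symmetric]) (intro D4_comp r s)
  show "transpose 1 2 \<circ> transpose 3 4 \<in> D4" by (subst e(2)[symmetric]) (intro D4_comp r s)
  show "transpose 1 4 \<circ> transpose 2 3 \<in> D4" by (subst e(3)[symmetric]) (intro D4_comp r s)
qed

context quartic_closure
begin

lemma D4_fixed:
  assumes t: "t \<in> carrier T" and s: "perm_tensor (transpose 1 3) t = t"
    and r: "perm_tensor (transpose 1 2) (perm_tensor (transpose 2 3) (perm_tensor (transpose 3 4) t)) = t"
    and p: "p \<in> D4"
  shows "perm_tensor p t = t"
proof -
  have pid: "perm_tensor id t = t" by (simp only: perm_tensor_def comp_id image_ident)
  have gen: "perm_tensor h t = t" if "h \<in> {cycle_of_list [1, 3], cycle_of_list [1, 2, 3, 4]}" for h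
    using that s r by (auto simp: perm_tensor_comp)
  show ?thesis
    using p unfolding D4_def
  proof (induction rule: generate.induct)
    case one
    show ?case by (simp only: sym_group_one pid)
  next
    case (incl h)
    then show ?case by (rule gen)
  next
    case (inv h)
    then have "perm_tensor h t = t" by (rule gen)
    moreover have "h \<in> D4" using inv unfolding D4_def by (rule generate.incl)
    then have h: "h permutes {1..4}" by (rule D4_permutes)
    moreover have "inv' h \<circ> h = id" by (rule inv_o_cancel[OF permutes_inj[OF h]])
    moreover note pid
    ultimately have "perm_tensor (inv' h) t = t" by (metis perm_tensor_comp)
    then show ?case using h by (simp add: sym_group_inv_equality sym_group_carrier)
  next
    case (eng h1 h2)
    then show ?case by (simp only: sym_group_mult perm_tensor_comp[symmetric])
  qed
qed

abbreviation Inv where "Inv \<equiv> carrier (tensor_invariants R A 4 D4)"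

lemma Inv_iff: "t \<in> Inv \<longleftrightarrow> t \<in> carrier T \<and> (\<forall>p\<in>D4. perm_tensor p t = t)"
  by (simp add: tensor_invariants_def)

lemma Inv_carrier: "t \<in> Inv \<Longrightarrow> t \<in> carrier T" by (simp add: Inv_iff)

lemma Inv_reflection: "t \<in> Inv \<Longrightarrow> perm_tensor reflection t = t"
  using D4_elements(4) by (simp add: Inv_iff reflection_def)

lemma Inv_ops:
  "t \<in> Inv \<Longrightarrow> u \<in> Inv \<Longrightarrow> t \<oplus>\<^bsub>T\<^esub> u \<in> Inv"
  "t \<in> Inv \<Longrightarrow> u \<in> Inv \<Longrightarrow> t \<otimes>\<^bsub>T\<^esub> u \<in> Inv"
  "r \<in> carrier R \<Longrightarrow> t \<in> Inv \<Longrightarrow> r \<odot>\<^bsub>T\<^esub> t \<in> Inv"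
  by (simp_all add: Inv_iff D4_permutes perm_tensor_add perm_tensor_mult perm_tensor_smult)

lemma Inv_one: "\<one>\<^bsub>T\<^esub> \<in> Inv"
  using ring_hom_one[OF ring_hom_cring.homh[OF perm_tensor_hom[OF D4_permutes]]] by (simp add: Inv_iff)

lemma Inv_esym: "a \<in> carrier A \<Longrightarrow> esym k a \<in> Inv"
  by (simp add: Inv_iff D4_permutes perm_tensor_esym)

lemma perm_\<xi>: "p permutes {1..4} \<Longrightarrow> i \<in> {1..4} \<Longrightarrow> perm_tensor p (\<xi> i) = \<xi> (p i)"
  by (simp add: \<xi>_def perm_tensor_at)

lemma perm_\<omega>:
  assumes p: "p permutes {1..4}"
  shows "perm_tensor p \<omega> = \<xi> (p 1) \<otimes>\<^bsub>T\<^esub> \<xi> (p 3) \<oplus>\<^bsub>T\<^esub> \<xi> (p 2) \<otimes>\<^bsub>T\<^esub> \<xi> (p 4)"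
  by (simp add: \<omega>_def prod13_def prod24_def perm_tensor_add[OF p] perm_tensor_mult[OF p] perm_\<xi>[OF p])

lemma Inv_\<omega>: "\<omega> \<in> Inv"
proof -
  have g: "transpose 1 3 permutes {1..4::nat}" "transpose 1 2 permutes {1..4::nat}"
    "transpose 2 3 permutes {1..4::nat}" "transpose 3 4 permutes {1..4::nat}"
    by (intro permutes_swap_id; simp)+
  note r = permutes_compose[OF permutes_compose[OF g(4,3)] g(2)]
  have s: "perm_tensor (transpose 1 3) \<omega> = \<omega>"
    unfolding perm_\<omega>[OF g(1)]
    by (simp add: \<omega>_def prod13_def prod24_def transpose_def T.m_comm)
  have r: "perm_tensor (transpose 1 2 \<circ> (transpose 2 3 \<circ> transpose 3 4)) \<omega> = \<omega>"
    unfolding perm_\<omega>[OF r]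
    by (simp add: \<omega>_def prod13_def prod24_def transpose_def T.m_comm T.a_comm)
  show ?thesis
    unfolding Inv_iff using D4_fixed[OF gens_closed(5) s] r by (simp add: perm_tensor_comp)
qed

lemma perm_corner: "perm_tensor reflection (\<xi> 1 \<otimes>\<^bsub>T\<^esub> \<xi> 4) = \<xi> 1 \<otimes>\<^bsub>T\<^esub> \<xi> 4"
  by (simp add: perm_tensor_mult[OF reflection_permutes] perm_\<xi>[OF reflection_permutes] T.m_comm)

end

section \<open>The half functional on invariants\<close>

context cring
begin

lemma corner_monomials:
  assumes [simp]: "a \<in> carrier R" "b \<in> carrier R" "c \<in> carrier R" "d \<in> carrier R"
  defines "m \<equiv> \<lambda>(i::nat) (k::nat) (j::nat) (l::nat). (a [^] i \<otimes> c [^] k) \<otimes> (b [^] j \<otimes> d [^] l)"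
    and "w \<equiv> a \<otimes> c \<oplus> b \<otimes> d"
  shows "a \<otimes> d = m 1 0 0 1"
    and "(a \<otimes> d) \<otimes> w = m 2 1 0 1 \<oplus> m 1 0 1 2"
    and "(a \<otimes> d) \<otimes> (w \<otimes> w) = m 3 2 0 1 \<oplus> m 1 0 2 3 \<oplus> (m 2 1 1 2 \<oplus> m 2 1 1 2)"
  unfolding m_def w_def by (simp_all add: numeral_eq_Suc l_distr r_distr a_ac m_ac)

text \<open>
  If \<open>h\<^sub>0, h\<^sub>1, h\<^sub>2, \<dots>\<close> is a linear recursive sequence with a cubic characteristic polynomial and \<open>y\<close> is a root
  of that polynomial, then the quotient of the polynomial by \<open>X - y\<close>, applied to the sequence, yields a geometric
  sequence with ratio \<open>y\<close>.
\<close>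

lemma cubic_recursion:
  assumes [simp]: "h0 \<in> carrier R" "h1 \<in> carrier R" "h2 \<in> carrier R" "h3 \<in> carrier R" "y \<in> carrier R"
    "s2 \<in> carrier R" "p \<in> carrier R" "q \<in> carrier R" "d \<in> carrier R" "d' \<in> carrier R"
    and h: "h3 \<oplus> p \<otimes> h1 \<oplus> d' \<otimes> h0 = s2 \<otimes> h2 \<oplus> q \<otimes> h1 \<oplus> d \<otimes> h0"
    and y: "y \<otimes> y \<otimes> y \<oplus> p \<otimes> y \<oplus> d' = s2 \<otimes> (y \<otimes> y) \<oplus> q \<otimes> y \<oplus> d"
  shows "h3 \<oplus> (y \<ominus> s2) \<otimes> h2 \<oplus> (y \<otimes> y \<ominus> s2 \<otimes> y \<oplus> (p \<ominus> q)) \<otimes> h1 =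
    y \<otimes> (h2 \<oplus> (y \<ominus> s2) \<otimes> h1 \<oplus> (y \<otimes> y \<ominus> s2 \<otimes> y \<oplus> (p \<ominus> q)) \<otimes> h0)" (is "?l = ?r")
proof -
  let ?u = "y \<otimes> h2 \<oplus> (y \<otimes> y \<ominus> s2 \<otimes> y) \<otimes> h1"
  have "?l = ?u \<oplus> ((h3 \<oplus> p \<otimes> h1 \<oplus> d' \<otimes> h0) \<ominus> (s2 \<otimes> h2 \<oplus> q \<otimes> h1) \<ominus> d' \<otimes> h0)"
    using assms(1-10) by algebra
  also have "(h3 \<oplus> p \<otimes> h1 \<oplus> d' \<otimes> h0) \<ominus> (s2 \<otimes> h2 \<oplus> q \<otimes> h1) \<ominus> d' \<otimes> h0 = (d \<ominus> d') \<otimes> h0"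
    unfolding h using assms(1-10) by algebra
  also have "d \<ominus> d' = (y \<otimes> y \<otimes> y \<oplus> p \<otimes> y \<oplus> d') \<ominus> (s2 \<otimes> (y \<otimes> y) \<oplus> q \<otimes> y) \<ominus> d'"
    unfolding y using assms(1-10) by algebra
  also have "\<dots> = y \<otimes> (y \<otimes> y \<ominus> s2 \<otimes> y \<oplus> (p \<ominus> q))"
    using assms(1-10) by algebra
  also have "?u \<oplus> y \<otimes> (y \<otimes> y \<ominus> s2 \<otimes> y \<oplus> (p \<ominus> q)) \<otimes> h0 = ?r"
    using assms(1-10) by (simp add: r_distr minus_eq m_assoc l_distr l_minus r_minus m_lcomm[of y s2] a_assoc)
  finally show ?thesis .
qed

end

context quartic_closure
begin

text \<open>
  The product over the two outer positions.  Only the identity and the reflection preserve the pair \<open>1, 4\<close>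
  within \<open>D\<^sub>4\<close>, and multiplication by \<open>\<omega>\<^sup>2\<close> produces monomials with four distinct exponents.
\<close>

definition corner where "corner = \<xi> 1 \<otimes>\<^bsub>T\<^esub> \<xi> 4"

lemma corner_closed [simp]: "corner \<in> carrier T" by (simp add: corner_def)

text \<open>
  Monomials with a repeated exponent are killed.  In \<open>corner \<omega>\<^sup>2\<close> two monomials have distinct exponents, namely
  \<open>(3, 0, 2, 1)\<close> and \<open>(1, 2, 0, 3)\<close>.  They are exchanged by the reflection, and only the permutation of the second,
  which is even, lies in \<open>Half\<close>.
\<close>

lemma half_corner:
  "half corner = \<zero>" "half (corner \<otimes>\<^bsub>T\<^esub> \<omega>) = \<zero>" "half (corner \<otimes>\<^bsub>T\<^esub> (\<omega> \<otimes>\<^bsub>T\<^esub> \<omega>)) = \<one>"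
proof -
  let ?m = "\<lambda>i k j l. mon13 (i, k) \<otimes>\<^bsub>T\<^esub> mon24 (j, l)"
  have c [simp]: "?m i k j l \<in> carrier T" for i k j l by (simp add: mon13_def mon24_def)
  have eqs: "corner = ?m 1 0 0 1" "corner \<otimes>\<^bsub>T\<^esub> \<omega> = ?m 2 1 0 1 \<oplus>\<^bsub>T\<^esub> ?m 1 0 1 2"
    "corner \<otimes>\<^bsub>T\<^esub> (\<omega> \<otimes>\<^bsub>T\<^esub> \<omega>) = ?m 3 2 0 1 \<oplus>\<^bsub>T\<^esub> ?m 1 0 2 3 \<oplus>\<^bsub>T\<^esub> (?m 2 1 1 2 \<oplus>\<^bsub>T\<^esub> ?m 2 1 1 2)"
    using T.corner_monomials[OF \<xi>_closed']
    by (simp_all only: corner_def \<omega>_def prod13_def prod24_def mon13_def mon24_def fst_conv snd_conv)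
  have rep1: "half (?m 1 0 0 1) = \<zero>"
    by (rule alt_idx_repeated[where i = 1 and j = 4, OF _ _ _ _ _ _ Half_subset]) simp_all
  have rep2: "half (?m 2 1 0 1) = \<zero>"
    by (rule alt_idx_repeated[where i = 3 and j = 4, OF _ _ _ _ _ _ Half_subset]) simp_all
  have rep3: "half (?m 1 0 1 2) = \<zero>"
    by (rule alt_idx_repeated[where i = 1 and j = 2, OF _ _ _ _ _ _ Half_subset]) simp_all
  have rep4: "half (?m 2 1 1 2) = \<zero>"
    by (rule alt_idx_repeated[where i = 2 and j = 3, OF _ _ _ _ _ _ Half_subset]) simp_all
  have ext4: "f = g" if "f 1 = g 1" "f 2 = g 2" "f 3 = g 3" "f 4 = g 4"
    "f \<in> extensional {1..4}" "g \<in> extensional {1..4}" for f g :: "nat \<Rightarrow> nat"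
  proof (rule extensionalityI[OF that(5,6)])
    show "f i = g i" if "i \<in> {1..4}" for i using four_cases[OF that] \<open>f 1 = g 1\<close> \<open>f 2 = g 2\<close> \<open>f 3 = g 3\<close> \<open>f 4 = g 4\<close> by blast
  qed
  have ex: "idx (3, 2) (0, 1) = exps (transpose 1 4 \<circ> transpose 2 4)"
    "idx (1, 0) (2, 3) = exps (transpose 1 2 \<circ> transpose 2 3)"
    by (rule ext4; simp add: idx_def exps_def transpose_def)+
  have pm: "transpose 1 4 \<circ> transpose 2 4 permutes {1..4::nat}" "transpose 1 2 \<circ> transpose 2 3 permutes {1..4::nat}"
    by (intro permutes_compose permutes_swap_id; simp)+
  have m1: "half (?m 3 2 0 1) = \<zero>"
    using psum_basis[OF Half_subset pm(1)]
    by (simp add: ex[symmetric] basis_tensor_idx Half_def transpose_def)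
  have m2: "half (?m 1 0 2 3) = \<one>"
    using psum_basis[OF Half_subset pm(2)] pm(2)
    by (simp add: ex[symmetric] basis_tensor_idx Half_def transpose_def sgnR_def evenperm_comp evenperm_swap permutation_swap_id)
  show "half corner = \<zero>" using rep1 by (subst eqs(1))
  show "half (corner \<otimes>\<^bsub>T\<^esub> \<omega>) = \<zero>"
    using rep2 rep3 by (subst eqs(2)) (simp add: psum_add[OF Half_subset])
  show "half (corner \<otimes>\<^bsub>T\<^esub> (\<omega> \<otimes>\<^bsub>T\<^esub> \<omega>)) = \<one>"
    using m1 m2 rep4 by (subst eqs(3)) (simp add: psum_add[OF Half_subset])
qed

definition corner_half where "corner_half t = half (corner \<otimes>\<^bsub>T\<^esub> t)"

lemma corner_half_closed [simp]: "t \<in> carrier T \<Longrightarrow> corner_half t \<in> carrier R"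
  by (simp add: corner_half_def psum_closed[OF Half_subset])

lemma corner_half_add:
  "t \<in> carrier T \<Longrightarrow> u \<in> carrier T \<Longrightarrow> corner_half (t \<oplus>\<^bsub>T\<^esub> u) = corner_half t \<oplus> corner_half u"
  by (simp add: corner_half_def psum_add[OF Half_subset] T.r_distr)

lemma corner_half_smult:
  assumes "r \<in> carrier R" "t \<in> carrier T"
  shows "corner_half (r \<odot>\<^bsub>T\<^esub> t) = r \<otimes> corner_half t"
proof -
  have "corner \<otimes>\<^bsub>T\<^esub> (r \<odot>\<^bsub>T\<^esub> t) = r \<odot>\<^bsub>T\<^esub> (corner \<otimes>\<^bsub>T\<^esub> t)"
    using assms by (simp add: T.m_comm[of corner] T.smult_assoc2)
  then show ?thesis using assms by (simp add: corner_half_def psum_smult[OF Half_subset])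
qed

lemma corner_half_esym:
  assumes a: "a \<in> carrier A" and k: "k \<le> 4" and t: "t \<in> Inv"
  shows "corner_half (esym k a \<otimes>\<^bsub>T\<^esub> t) = char_coeff R A 4 b k a \<otimes> corner_half t"
proof -
  have tT: "t \<in> carrier T" by (rule Inv_carrier[OF t])
  have inv: "perm_tensor reflection (corner \<otimes>\<^bsub>T\<^esub> t) = corner \<otimes>\<^bsub>T\<^esub> t"
    using perm_corner Inv_reflection[OF t] tT by (simp add: perm_tensor_mult[OF reflection_permutes] corner_def)
  have "half (esym k a \<otimes>\<^bsub>T\<^esub> (corner \<otimes>\<^bsub>T\<^esub> t)) = alt (esym k a \<otimes>\<^bsub>T\<^esub> e0) \<otimes> half (corner \<otimes>\<^bsub>T\<^esub> t)"
    using a tT inv by (intro half_symmetric_mult perm_tensor_esym esym_closed) simp_all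
  moreover have "corner \<otimes>\<^bsub>T\<^esub> (esym k a \<otimes>\<^bsub>T\<^esub> t) = esym k a \<otimes>\<^bsub>T\<^esub> (corner \<otimes>\<^bsub>T\<^esub> t)"
    using a tT by (intro T.m_lcomm) simp_all
  ultimately show ?thesis by (simp only: corner_half_def alt_esym_eq_char_coeff[OF a k])
qed

text \<open>
  The relation for \<open>\<omega>\<close>, multiplied by \<open>t\<close>, with its symmetric coefficients pulled out of the functional.
\<close>

lemma corner_half_cubic:
  assumes t: "t \<in> Inv"
  shows "corner_half (\<omega> \<otimes>\<^bsub>T\<^esub> (\<omega> \<otimes>\<^bsub>T\<^esub> (\<omega> \<otimes>\<^bsub>T\<^esub> t))) \<oplus> s1 \<otimes> s3 \<otimes> corner_half (\<omega> \<otimes>\<^bsub>T\<^esub> t)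
      \<oplus> (s2 \<otimes> s4 \<oplus> s2 \<otimes> s4 \<oplus> s2 \<otimes> s4 \<oplus> s2 \<otimes> s4) \<otimes> corner_half t =
    s2 \<otimes> corner_half (\<omega> \<otimes>\<^bsub>T\<^esub> (\<omega> \<otimes>\<^bsub>T\<^esub> t)) \<oplus> (s4 \<oplus> s4 \<oplus> s4 \<oplus> s4) \<otimes> corner_half (\<omega> \<otimes>\<^bsub>T\<^esub> t)
      \<oplus> (s1 \<otimes> s1 \<otimes> s4 \<oplus> s3 \<otimes> s3) \<otimes> corner_half t"
proof -
  have m [simp]: "t \<in> Inv" "\<omega> \<otimes>\<^bsub>T\<^esub> t \<in> Inv" "\<omega> \<otimes>\<^bsub>T\<^esub> (\<omega> \<otimes>\<^bsub>T\<^esub> t) \<in> Inv" "\<omega> \<otimes>\<^bsub>T\<^esub> (\<omega> \<otimes>\<^bsub>T\<^esub> (\<omega> \<otimes>\<^bsub>T\<^esub> t)) \<in> Inv"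
    using t Inv_\<omega> by (simp_all only: Inv_ops)
  have e: "esym k x \<otimes>\<^bsub>T\<^esub> u \<in> Inv" if "u \<in> Inv" for k u
    by (rule Inv_ops(2)[OF Inv_esym[OF x_closed] that])
  have p: "corner_half (esym 1 x \<otimes>\<^bsub>T\<^esub> u) = s1 \<otimes> corner_half u" "corner_half (esym 2 x \<otimes>\<^bsub>T\<^esub> u) = s2 \<otimes> corner_half u"
    "corner_half (esym 3 x \<otimes>\<^bsub>T\<^esub> u) = s3 \<otimes> corner_half u" "corner_half (esym 4 x \<otimes>\<^bsub>T\<^esub> u) = s4 \<otimes> corner_half u"
    if "u \<in> Inv" for u
    using that corner_half_esym[OF x_closed] by (simp_all add: char_coeff_generator)
  have tT [simp]: "t \<in> carrier T" by (rule Inv_carrier[OF t])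
  show ?thesis
    using arg_cong[OF resolvent_relation, of "\<lambda>u. corner_half (u \<otimes>\<^bsub>T\<^esub> t)"]
    by (simp add: T.l_distr T.m_assoc corner_half_add p e R.l_distr R.m_assoc R.a_assoc)
qed

end

section \<open>Closure data and roots\<close>

context quartic_closure
begin

text \<open>
  The form in which generation is used: to establish a property of all invariants that defines a
  subalgebra, it suffices to check the generators.
\<close>

lemma invariant_subalgebra_generated:
  assumes S: "S \<subseteq> carrier T" and scalar: "\<And>r. r \<in> carrier R \<Longrightarrow> r \<odot>\<^bsub>T\<^esub> \<one>\<^bsub>T\<^esub> \<in> S"
    and add: "\<And>u v. u \<in> S \<Longrightarrow> v \<in> S \<Longrightarrow> u \<oplus>\<^bsub>T\<^esub> v \<in> S" and mult: "\<And>u v. u \<in> S \<Longrightarrow> v \<in> S \<Longrightarrow> u \<otimes>\<^bsub>T\<^esub> v \<in> S"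
    and esym: "\<And>k. k \<in> {1..4} \<Longrightarrow> esym k x \<in> S" and \<omega>: "\<omega> \<in> S"
  shows "Inv \<subseteq> S"
proof
  interpret generated_subalgebra R A b x s1 s2 s3 s4 S
    by (unfold_locales) (use assms in simp_all)
  fix t assume "t \<in> Inv"
  then show "t \<in> S" using D4_elements(1-3) by (intro invariants_generated) (simp_all only: Inv_iff)
qed

text \<open>
  The cubic resolvent at \<open>y\<close>, with negative terms moved to the other side.
\<close>

definition resolvent_root where
  "resolvent_root y \<longleftrightarrow> y \<in> carrier R \<and>
    y \<otimes> y \<otimes> y \<oplus> s1 \<otimes> s3 \<otimes> y \<oplus> (s2 \<otimes> s4 \<oplus> s2 \<otimes> s4 \<oplus> s2 \<otimes> s4 \<oplus> s2 \<otimes> s4) =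
    s2 \<otimes> (y \<otimes> y) \<oplus> (s4 \<oplus> s4 \<oplus> s4 \<oplus> s4) \<otimes> y \<oplus> (s1 \<otimes> s1 \<otimes> s4 \<oplus> s3 \<otimes> s3)"

text \<open>
  The coefficients \<open>1\<close>, \<open>y - s\<^sub>2\<close>, \<open>y\<^sup>2 - s\<^sub>2 y + (s\<^sub>1 s\<^sub>3 - 4 s\<^sub>4)\<close> are those of the quotient of the cubic resolvent by
  \<open>X - y\<close>.  If \<open>t = c\<^sub>0 + c\<^sub>1 \<omega> + c\<^sub>2 \<omega>\<^sup>2\<close> with \<open>c\<^sub>i\<close> in \<open>R\<close>, the value is \<open>c\<^sub>0 + c\<^sub>1 y + c\<^sub>2 y\<^sup>2\<close> for each root \<open>y\<close>.
\<close>

definition closure_map where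
  "closure_map y t = corner_half (\<omega> \<otimes>\<^bsub>T\<^esub> (\<omega> \<otimes>\<^bsub>T\<^esub> t)) \<oplus> (y \<ominus> s2) \<otimes> corner_half (\<omega> \<otimes>\<^bsub>T\<^esub> t)
    \<oplus> (y \<otimes> y \<ominus> s2 \<otimes> y \<oplus> (s1 \<otimes> s3 \<ominus> (s4 \<oplus> s4 \<oplus> s4 \<oplus> s4))) \<otimes> corner_half t"

context
  fixes y
  assumes y_closed [simp]: "y \<in> carrier R"
begin

lemma closure_map_closed [simp]: "t \<in> carrier T \<Longrightarrow> closure_map y t \<in> carrier R"
  by (simp add: closure_map_def)

lemma closure_map_add:
  assumes [simp]: "t \<in> carrier T" "u \<in> carrier T"
  shows "closure_map y (t \<oplus>\<^bsub>T\<^esub> u) = closure_map y t \<oplus> closure_map y u"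
  by (simp add: closure_map_def T.r_distr corner_half_add R.r_distr R.a_ac del: R.r_distr)
    (simp add: R.r_distr R.a_ac)

lemma closure_map_smult:
  assumes [simp]: "r \<in> carrier R" "t \<in> carrier T"
  shows "closure_map y (r \<odot>\<^bsub>T\<^esub> t) = r \<otimes> closure_map y t"
proof -
  have w: "\<omega> \<otimes>\<^bsub>T\<^esub> (r \<odot>\<^bsub>T\<^esub> u) = r \<odot>\<^bsub>T\<^esub> (\<omega> \<otimes>\<^bsub>T\<^esub> u)" if "u \<in> carrier T" for u
    using that by (simp add: T.m_comm[of \<omega>] T.smult_assoc2)
  have l: "c \<otimes> (r \<otimes> h) = r \<otimes> (c \<otimes> h)" if "c \<in> carrier R" "h \<in> carrier R" for c h
    using that by (simp add: R.m_lcomm)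
  show ?thesis by (simp add: closure_map_def w corner_half_smult l R.r_distr)
qed

lemma closure_map_esym:
  assumes a: "a \<in> carrier A" and k: "k \<le> 4" and t: "t \<in> Inv"
  shows "closure_map y (esym k a \<otimes>\<^bsub>T\<^esub> t) = char_coeff R A 4 b k a \<otimes> closure_map y t"
proof -
  let ?c = "char_coeff R A 4 b k a"
  have c: "?c \<in> carrier R"
    using a e0_closed alt_esym_eq_char_coeff[OF a k] psum_closed[OF subset_refl, of "esym k a \<otimes>\<^bsub>T\<^esub> e0"]
    by simp
  have tT [simp]: "t \<in> carrier T" by (rule Inv_carrier[OF t])
  have w: "\<omega> \<otimes>\<^bsub>T\<^esub> (esym k a \<otimes>\<^bsub>T\<^esub> u) = esym k a \<otimes>\<^bsub>T\<^esub> (\<omega> \<otimes>\<^bsub>T\<^esub> u)" if "u \<in> carrier T" for u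
    using that a by (intro T.m_lcomm) simp_all
  have l: "r \<otimes> (?c \<otimes> h) = ?c \<otimes> (r \<otimes> h)" if "r \<in> carrier R" "h \<in> carrier R" for r h
    using that c by (simp add: R.m_lcomm)
  have m: "\<omega> \<otimes>\<^bsub>T\<^esub> t \<in> Inv" "\<omega> \<otimes>\<^bsub>T\<^esub> (\<omega> \<otimes>\<^bsub>T\<^esub> t) \<in> Inv"
    using t Inv_\<omega> by (simp_all only: Inv_ops)
  show ?thesis
    using c by (simp add: closure_map_def w m t corner_half_esym[OF a k] l R.r_distr)
qed

lemma closure_map_one: "closure_map y \<one>\<^bsub>T\<^esub> = \<one>"
  using half_corner by (simp add: closure_map_def corner_half_def)

lemma closure_map_\<omega>:
  assumes y: "resolvent_root y" and t: "t \<in> Inv"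
  shows "closure_map y (\<omega> \<otimes>\<^bsub>T\<^esub> t) = y \<otimes> closure_map y t"
proof -
  have tT [simp]: "t \<in> carrier T" by (rule Inv_carrier[OF t])
  show ?thesis
    unfolding closure_map_def
    by (rule R.cubic_recursion[OF _ _ _ _ _ _ _ _ _ _ corner_half_cubic[OF t] conjunct2[OF y[unfolded resolvent_root_def]]]) simp_all
qed

text \<open>
  The elements \<open>g\<close> for which the rule holds with every \<open>t\<close> form a subalgebra.  The generators belong to it, since
  multiplication by each of them becomes multiplication by a scalar, which is the value of the generator
  because \<open>closure_map y\<close> is \<open>1\<close> at \<open>1\<close>.
\<close>

lemma closure_map_mult:
  assumes y: "resolvent_root y" and t: "t \<in> Inv" and u: "u \<in> Inv"
  shows "closure_map y (t \<otimes>\<^bsub>T\<^esub> u) = closure_map y t \<otimes> closure_map y u"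
proof -
  define S where "S = {g \<in> Inv. \<forall>t\<in>Inv. closure_map y (g \<otimes>\<^bsub>T\<^esub> t) = closure_map y g \<otimes> closure_map y t}"
  have pull: "g \<in> S" if g: "g \<in> Inv" and r: "r \<in> carrier R"
    and m: "\<And>t. t \<in> Inv \<Longrightarrow> closure_map y (g \<otimes>\<^bsub>T\<^esub> t) = r \<otimes> closure_map y t" for g r
  proof -
    have "closure_map y g = r"
      using m[OF Inv_one] r Inv_carrier[OF g] by (simp add: closure_map_one)
    then show ?thesis using g m by (simp add: S_def)
  qed
  have "Inv \<subseteq> S"
  proof (rule invariant_subalgebra_generated)
    show "S \<subseteq> carrier T" using Inv_carrier by (auto simp: S_def)
    show "r \<odot>\<^bsub>T\<^esub> \<one>\<^bsub>T\<^esub> \<in> S" if r: "r \<in> carrier R" for r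
    proof (rule pull[OF Inv_ops(3)[OF r Inv_one] r])
      fix t assume "t \<in> Inv"
      then have "t \<in> carrier T" by (rule Inv_carrier)
      then show "closure_map y ((r \<odot>\<^bsub>T\<^esub> \<one>\<^bsub>T\<^esub>) \<otimes>\<^bsub>T\<^esub> t) = r \<otimes> closure_map y t"
        using r by (simp add: T.smult_assoc2 closure_map_smult)
    qed
    show "g \<oplus>\<^bsub>T\<^esub> h \<in> S" if "g \<in> S" "h \<in> S" for g h
      using that Inv_carrier by (simp add: S_def Inv_ops T.l_distr closure_map_add R.l_distr)
    show "g \<otimes>\<^bsub>T\<^esub> h \<in> S" if "g \<in> S" "h \<in> S" for g h
      using that Inv_carrier by (simp add: S_def Inv_ops T.m_assoc R.m_assoc)
    show "esym k x \<in> S" if "k \<in> {1..4}" for k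
    proof (rule pull[OF Inv_esym[OF x_closed]])
      show "\<sigma> k \<in> carrier R" using that by (intro \<sigma>_closed) simp
      show "closure_map y (esym k x \<otimes>\<^bsub>T\<^esub> t) = \<sigma> k \<otimes> closure_map y t" if "t \<in> Inv" for t
        using that \<open>k \<in> {1..4}\<close> by (intro closure_map_esym) simp_all
    qed
    show "\<omega> \<in> S" by (rule pull[OF Inv_\<omega> y_closed closure_map_\<omega>[OF y]])
  qed
  then show ?thesis using t u by (auto simp: S_def)
qed

end

lemma tensor_invariants_ops [simp]:
  "monoid.mult (tensor_invariants R A 4 D4) = monoid.mult T" "monoid.one (tensor_invariants R A 4 D4) = \<one>\<^bsub>T\<^esub>"
  "ring.add (tensor_invariants R A 4 D4) = ring.add T" "module.smult (tensor_invariants R A 4 D4) = module.smult T"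
  by (simp_all add: tensor_invariants_def)

lemma closure_map_data:
  assumes y: "resolvent_root y"
  shows "restrict (closure_map y) Inv \<in> D4_closure_data R A b"
    and "closure_map y \<omega> = y"
proof -
  have yR: "y \<in> carrier R" using y by (simp add: resolvent_root_def)
  have one: "restrict (closure_map y) Inv \<in> ring_hom (tensor_invariants R A 4 D4) R"
    using closure_map_mult[OF yR y] Inv_carrier
    by (intro ring_hom_memI)
      (simp_all add: yR Inv_ops Inv_one closure_map_add[OF yR] closure_map_closed[OF yR] closure_map_one[OF yR])
  have "closure_map y (esym k a) = char_coeff R A 4 b k a" if "a \<in> carrier A" "k \<in> {1..4}" for a k
  proof -
    have "k \<le> 4" using that by simp
    then have "char_coeff R A 4 b k a \<in> carrier R"
      using that(1) e0_closed alt_esym_eq_char_coeff[of a k] psum_closed[OF subset_refl, of "esym k a \<otimes>\<^bsub>T\<^esub> e0"]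
      by simp
    then show ?thesis
      using closure_map_esym[OF yR that(1) \<open>k \<le> 4\<close> Inv_one] that by (simp add: closure_map_one[OF yR])
  qed
  then show "restrict (closure_map y) Inv \<in> D4_closure_data R A b"
    using one Inv_carrier
    by (simp add: D4_closure_data_def Inv_ops Inv_esym closure_map_smult[OF yR])
  show "closure_map y \<omega> = y"
    using closure_map_\<omega>[OF yR y Inv_one] yR by (simp add: closure_map_one[OF yR])
qed

lemma closure_data_root:
  assumes \<phi>: "\<phi> \<in> D4_closure_data R A b"
  shows "resolvent_root (\<phi> \<omega>)"
proof -
  have hom: "\<phi> \<in> ring_hom (tensor_invariants R A 4 D4) R" using \<phi> by (simp add: D4_closure_data_def)
  note mult = ring_hom_mult[OF hom, simplified] and add = ring_hom_add[OF hom, simplified]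
  have c: "\<phi> t \<in> carrier R" if "t \<in> Inv" for t by (rule ring_hom_closed[OF hom that])
  have e: "\<phi> (esym 1 x) = s1" "\<phi> (esym 2 x) = s2" "\<phi> (esym 3 x) = s3" "\<phi> (esym 4 x) = s4"
    using \<phi> x_closed by (simp_all add: D4_closure_data_def char_coeff_generator)
  have "\<phi> \<omega> \<in> carrier R" by (rule c[OF Inv_\<omega>])
  then show ?thesis
    unfolding resolvent_root_def
    using arg_cong[OF resolvent_relation, of \<phi>]
    by (simp add: mult add e Inv_ops Inv_\<omega> Inv_esym R.l_distr R.a_assoc)
qed

lemma closure_data_eqI:
  assumes \<phi>: "\<phi> \<in> D4_closure_data R A b" and \<psi>: "\<psi> \<in> D4_closure_data R A b" and eq: "\<phi> \<omega> = \<psi> \<omega>"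
  shows "\<phi> = \<psi>"
proof -
  have hom: "\<phi> \<in> ring_hom (tensor_invariants R A 4 D4) R" "\<psi> \<in> ring_hom (tensor_invariants R A 4 D4) R"
    using \<phi> \<psi> by (simp_all add: D4_closure_data_def)
  have "Inv \<subseteq> {t \<in> Inv. \<phi> t = \<psi> t}"
  proof (rule invariant_subalgebra_generated)
    show "r \<odot>\<^bsub>T\<^esub> \<one>\<^bsub>T\<^esub> \<in> {t \<in> Inv. \<phi> t = \<psi> t}" if "r \<in> carrier R" for r
      using \<phi> \<psi> that Inv_one ring_hom_one[OF hom(1)] ring_hom_one[OF hom(2)]
      by (simp add: D4_closure_data_def Inv_ops)
    show "esym k x \<in> {t \<in> Inv. \<phi> t = \<psi> t}" if "k \<in> {1..4}" for k
      using \<phi> \<psi> that by (simp add: D4_closure_data_def Inv_esym)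
  qed (use Inv_carrier Inv_\<omega> eq ring_hom_add[OF hom(1)] ring_hom_add[OF hom(2)]
      ring_hom_mult[OF hom(1)] ring_hom_mult[OF hom(2)] in \<open>auto simp: Inv_ops\<close>)
  moreover have "\<phi> \<in> extensional Inv" "\<psi> \<in> extensional Inv"
    using \<phi> \<psi> by (simp_all add: D4_closure_data_def)
  ultimately show ?thesis by (intro extensionalityI) auto
qed

theorem closure_data_bij:
  "bij_betw (\<lambda>\<phi>. \<phi> \<omega>) (D4_closure_data R A b) {y. resolvent_root y}"
proof (rule bij_betwI')
  show "(\<phi> \<omega> = \<psi> \<omega>) = (\<phi> = \<psi>)" if "\<phi> \<in> D4_closure_data R A b" "\<psi> \<in> D4_closure_data R A b" for \<phi> \<psi>
    using closure_data_eqI[OF that] by blast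
  show "\<phi> \<omega> \<in> {y. resolvent_root y}" if "\<phi> \<in> D4_closure_data R A b" for \<phi>
    using closure_data_root[OF that] by blast
  show "\<exists>\<phi>\<in>D4_closure_data R A b. y = \<phi> \<omega>" if "y \<in> {y. resolvent_root y}" for y
    using closure_map_data[of y] that Inv_\<omega> by (intro bexI[of _ "restrict (closure_map y) Inv"]) simp_all
qed

end

section \<open>The cubic resolvent as a polynomial\<close>

lemma (in cring) four_times:
  assumes [simp]: "a \<in> carrier R"
  shows "[(4::nat)] \<cdot> a = a \<oplus> a \<oplus> a \<oplus> a"
proof -
  have "(4::nat) = Suc (Suc (Suc (Suc 0)))" by simp
  then show ?thesis by (simp only: add.nat_pow_Suc add.nat_pow_0 l_zero assms)
qed

lemma (in cring) quartic_transpose: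
  assumes [simp]: "z \<in> carrier R" "a \<in> carrier R" "b \<in> carrier R" "c \<in> carrier R" "d \<in> carrier R"
    and zero: "z \<ominus> a \<oplus> b \<ominus> c \<oplus> d = \<zero>"
  shows "z = a \<ominus> b \<oplus> c \<ominus> d"
proof (rule transfer_minus)
  have "z \<oplus> b \<oplus> d = (z \<ominus> a \<oplus> b \<ominus> c \<oplus> d) \<oplus> (a \<oplus> c)" using assms(1-5) by algebra
  then show "z \<oplus> b \<oplus> d = a \<oplus> c" unfolding zero by simp
qed simp_all

lemma (in cring) cubic_transpose:
  assumes [simp]: "y \<in> carrier R" "s2 \<in> carrier R" "p \<in> carrier R" "q \<in> carrier R"
    "d \<in> carrier R" "d' \<in> carrier R" "d'' \<in> carrier R"
  shows "y [^] (3::nat) \<ominus> s2 \<otimes> y [^] (2::nat) \<oplus> (p \<ominus> q) \<otimes> y \<ominus> (d \<ominus> d' \<oplus> d'') = \<zero> \<longleftrightarrow>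
    y \<otimes> y \<otimes> y \<oplus> p \<otimes> y \<oplus> d' = s2 \<otimes> (y \<otimes> y) \<oplus> q \<otimes> y \<oplus> (d \<oplus> d'')" (is "?m = \<zero> \<longleftrightarrow> ?l = ?r")
proof -
  have pow: "y [^] (3::nat) = y \<otimes> y \<otimes> y" "y [^] (2::nat) = y \<otimes> y"
    by (simp_all add: numeral_eq_Suc)
  have "?m = ?l \<ominus> ?r" unfolding pow using assms by algebra
  then show ?thesis by (simp only:) (rule minus_eq_zero_iff; simp)
qed

lemma (in cring) eval_cubic_resolvent:
  assumes [simp]: "s1 \<in> carrier R" "s2 \<in> carrier R" "s3 \<in> carrier R" "s4 \<in> carrier R" "y \<in> carrier R"
  shows "eval R R id y (cubic_resolvent R s1 s2 s3 s4) =
    y [^] (3::nat) \<ominus> s2 \<otimes> y [^] (2::nat) \<oplus> (s1 \<otimes> s3 \<ominus> (s4 \<oplus> s4 \<oplus> s4 \<oplus> s4)) \<otimes> y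
      \<ominus> (s1 \<otimes> s1 \<otimes> s4 \<ominus> (s2 \<otimes> s4 \<oplus> s2 \<otimes> s4 \<oplus> s2 \<otimes> s4 \<oplus> s2 \<otimes> s4) \<oplus> s3 \<otimes> s3)"
proof -
  interpret U: UP_pre_univ_prop R R id "UP R"
    by (unfold_locales) (simp_all add: ring_hom_def)
  interpret h: ring_hom_cring "UP R" R "eval R R id y"
    by (rule ring_hom_cringI2[OF U.P.is_cring is_cring U.eval_ring_hom]) simp
  have sq: "a [^] (2::nat) = a \<otimes> a" if "a \<in> carrier R" for a
    using that by (simp add: numeral_2_eq_2)
  have minus: "eval R R id y (p \<ominus>\<^bsub>UP R\<^esub> q) = eval R R id y p \<ominus> eval R R id y q"
    if "p \<in> carrier (UP R)" "q \<in> carrier (UP R)" for p q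
    using that by (simp add: U.P.minus_eq minus_eq)
  show ?thesis
    unfolding cubic_resolvent_def
    by (simp add: minus U.eval_monom four_times sq)
qed

lemma (in cring) quartic_monic_quotient:
  assumes [simp]: "s1 \<in> carrier R" "s2 \<in> carrier R" "s3 \<in> carrier R" "s4 \<in> carrier R"
  shows "monic_quotient R (quartic R s1 s2 s3 s4) 4"
proof -
  interpret U: UP_cring R "UP R" by (unfold_locales) simp
  show ?thesis
  proof (unfold_locales)
    show "quartic R s1 s2 s3 s4 \<in> carrier (UP R)" by (simp add: quartic_def)
    show "coeff (UP R) (quartic R s1 s2 s3 s4) 4 = \<one>" by (simp add: quartic_def minus_eq)
    show "coeff (UP R) (quartic R s1 s2 s3 s4) k = \<zero>" if "4 < k" for k
      using that by (simp add: quartic_def minus_eq)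
  qed
qed

lemma (in cring) monogenic_quartic_closure:
  assumes s [simp]: "s1 \<in> carrier R" "s2 \<in> carrier R" "s3 \<in> carrier R" "s4 \<in> carrier R"
  defines "f \<equiv> quartic R s1 s2 s3 s4"
  shows "quartic_closure R (monogenic_algebra R f) (power_basis R f) (monogenic_gen R f) s1 s2 s3 s4"
proof -
  interpret Q: monic_quotient R "UP R" f 4 unfolding f_def by (rule quartic_monic_quotient[OF s]) (rule reflexive)
  interpret Al: algebra R Q.A by (rule Q.monogenic_algebra_algebra)
  interpret h: ring_hom_cring "UP R" Q.A "\<lambda>p. Q.J +>\<^bsub>UP R\<^esub> p" by (rule Q.class_hom)
  have b: "power_basis R f i = Q.x [^]\<^bsub>Q.A\<^esub> i" for i by (simp only: power_basis_def)
  have x [simp]: "Q.x \<in> carrier Q.A"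
    unfolding monogenic_gen_def by (intro h.hom_closed) simp
  have mon: "Q.J +>\<^bsub>UP R\<^esub> monom (UP R) c i = c \<odot>\<^bsub>Q.A\<^esub> (Q.x [^]\<^bsub>Q.A\<^esub> i)" if c: "c \<in> carrier R" for c i
  proof -
    have "monom (UP R) c i = c \<odot>\<^bsub>UP R\<^esub> monom (UP R) \<one> i"
      using Q.monom_mult_smult[OF c one_closed, of i] c by simp
    then show ?thesis using c by (simp only: Q.class_smult Q.monom_closed one_closed b[symmetric] Q.power_basis_eq)
  qed
  have minus: "Q.J +>\<^bsub>UP R\<^esub> (p \<ominus>\<^bsub>UP R\<^esub> q) = (Q.J +>\<^bsub>UP R\<^esub> p) \<ominus>\<^bsub>Q.A\<^esub> (Q.J +>\<^bsub>UP R\<^esub> q)"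
    if "p \<in> carrier (UP R)" "q \<in> carrier (UP R)" for p q
    using that by (simp add: Q.P.minus_eq Al.M.minus_eq)
  have "f \<ominus>\<^bsub>UP R\<^esub> \<zero>\<^bsub>UP R\<^esub> \<in> Q.J" using Q.P.cgenideal_self[OF Q.f_closed] by (simp add: Q.P.minus_eq)
  then have "Q.J +>\<^bsub>UP R\<^esub> f = Q.J +>\<^bsub>UP R\<^esub> \<zero>\<^bsub>UP R\<^esub>" by (subst Q.class_eq_iff) simp_all
  also have "\<dots> = \<zero>\<^bsub>Q.A\<^esub>" by (rule h.hom_zero)
  also have "Q.J +>\<^bsub>UP R\<^esub> f = \<one> \<odot>\<^bsub>Q.A\<^esub> (Q.x [^]\<^bsub>Q.A\<^esub> (4::nat)) \<ominus>\<^bsub>Q.A\<^esub> s1 \<odot>\<^bsub>Q.A\<^esub> (Q.x [^]\<^bsub>Q.A\<^esub> (3::nat))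
      \<oplus>\<^bsub>Q.A\<^esub> s2 \<odot>\<^bsub>Q.A\<^esub> (Q.x [^]\<^bsub>Q.A\<^esub> (2::nat)) \<ominus>\<^bsub>Q.A\<^esub> s3 \<odot>\<^bsub>Q.A\<^esub> (Q.x [^]\<^bsub>Q.A\<^esub> (1::nat))
      \<oplus>\<^bsub>Q.A\<^esub> s4 \<odot>\<^bsub>Q.A\<^esub> (Q.x [^]\<^bsub>Q.A\<^esub> (0::nat))"
    by (subst f_def, unfold quartic_def)
      (simp only: minus h.hom_add mon Q.monom_closed Q.P.minus_closed Q.P.a_closed s one_closed)
  finally have "Q.x [^]\<^bsub>Q.A\<^esub> (4::nat) = s1 \<odot>\<^bsub>Q.A\<^esub> (Q.x [^]\<^bsub>Q.A\<^esub> (3::nat)) \<ominus>\<^bsub>Q.A\<^esub> s2 \<odot>\<^bsub>Q.A\<^esub> (Q.x [^]\<^bsub>Q.A\<^esub> (2::nat))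
      \<oplus>\<^bsub>Q.A\<^esub> s3 \<odot>\<^bsub>Q.A\<^esub> Q.x \<ominus>\<^bsub>Q.A\<^esub> s4 \<odot>\<^bsub>Q.A\<^esub> \<one>\<^bsub>Q.A\<^esub>"
    by (intro cring.quartic_transpose[OF Al.M_cring]) simp_all
  then show ?thesis
    by (intro quartic_closure.intro quartic_tensor.intro tensor_alternation.intro based_power.intro
        Q.based_algebra quartic_closure_axioms.intro x b s)
qed

theorem theorem7p14:
  fixes R :: "('r, 'k) ring_scheme" (structure) and s1 s2 s3 s4 :: 'r
  assumes "cring R"
    and "s1 \<in> carrier R" and "s2 \<in> carrier R" and "s3 \<in> carrier R" and "s4 \<in> carrier R"
  shows "let f = quartic R s1 s2 s3 s4; m = cubic_resolvent R s1 s2 s3 s4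
         in bij_betw (\<lambda>\<phi>. \<phi> (resolvent_element R f))
              (D4_closure_data R (monogenic_algebra R f) (power_basis R f))
              {y \<in> carrier R. eval R R id y m = \<zero>}"
proof -
  define f where "f = quartic R s1 s2 s3 s4"
  interpret quartic_closure R "monogenic_algebra R f" "power_basis R f" "monogenic_gen R f" s1 s2 s3 s4
    unfolding f_def by (rule cring.monogenic_quartic_closure[OF assms])
  have "resolvent_element R f = \<omega>"
    by (simp only: resolvent_element_def Let_def \<omega>_def prod13_def prod24_def \<xi>_def)
  moreover have "{y \<in> carrier R. eval R R id y (cubic_resolvent R s1 s2 s3 s4) = \<zero>} = {y. resolvent_root y}"
    by (simp add: R.eval_cubic_resolvent resolvent_root_def R.cubic_transpose cong: conj_cong)
  ultimately show ?thesis
    using closure_data_bij by (simp only: Let_def f_def)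
qed

end
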